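(* Let $\gamma_1,\dots,\gamma_n$ be pairwise disjoint cycles in $\mathfrak S_N$ of lengths $L_1,\dots,L_n\ge1$, and $L=\sum_iL_i$. Then, as formal power series in the weights, $$\kappa_n\big(\mathcal P_{\gamma_1}(M),\dots,\mathcal P_{\gamma_n}(M)\big)=\sum_{g\ge0}N^{2-2g-n-L}\,H^{[g]}_{L_1,\dots,L_n},$$ $$\kappa_n\big(\mathcal P_{\gamma_1}(M),\dots,\mathcal P_{\gamma_n}(M)\big)_S=\sum_{g\ge0}N^{2-2g-n-L}\,\widehat H^{[g]}_{L_1,\dots,L_n},$$ where the first cumulant is with respect to the formal measure of usual maps and the second with respect to the formal measure of stuffed maps, and $H^{[g]}_{L_1,\dots,L_n}$ (resp. $\widehat H^{[g]}_{L_1,\dots,L_n}$) is the generating series of connected fully simple usual (resp. stuffed) maps of genus $g$ with $n$ boundaries of lengths $L_1,\dots,L_n$.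
   Context: Matrix side. For a cycle $\gamma=(c_1\,c_2\dots c_\ell)$ in $\mathfrak S_N$, $\mathcal P_\gamma(M)=\prod_{m=1}^\ell M_{c_m,\gamma(c_m)}$. On the space of $N\times N$ hermitian matrices, the formal measure of stuffed maps is (up to normalization) $$dM\,e^{-N\,\mathrm{Tr}\frac{M^2}{2}}\exp\Big(\sum_{h\ge0,k\ge1}\frac{N^{2-2h-k}}{k!}\sum_{m_1,\dots,m_k\ge1}t^h_{m_1,\dots,m_k}\prod_{i=1}^k\frac{\mathrm{Tr}\,M^{m_i}}{m_i}\Big),$$ with formal variables $t^h_{m_1,\dots,m_k}$ symmetric in the $m_i$; the formal measure of usual maps is the case where only $t_m:=t^0_m$ (with $h=0,k=1$) are nonzero. Normalized expectation values of polynomials in the entries of $M$ are formal power series in the $t$'s, obtained by expanding the exponential around the Gaussian measure, and $\kappa_n$, $\kappa_n(\cdot)_S$ are the corresponding joint cumulants. Map side. A stuffed map with $n\ge1$ boundaries of lengths $\ell_1,\dots,\ell_n\ge 1$ is given by: a finite set $H$ of half-edges; permutations $\sigma,\alpha,\varphi$ of $H$ with $\sigma\circ\alpha\circ\varphi=\mathrm{id}$ and $\alpha$ a fixed-point-free involution (cycles of $\sigma$ are vertices, cycles of $\alpha$ are edges); a choice of $n$ cycles of $\varphi$, labelled $1,\dots,n$ and called boundaries, the $i$-th of length $\ell_i$ and equipped with a distinguished half-edge (root); a partition of the set of remaining cycles of $\varphi$ into nonempty blocks $f_1,\dots,f_F$ (the inner cells); and integers $h_1,\dots,h_F\ge0$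 (genera of the cells). $H^\partial\subset H$ is the set of half-edges in boundaries. It is connected if the equivalence relation generated by $h\sim\sigma(h)$, $h\sim\alpha(h)$, and $h\sim h'$ whenever $h,h'$ lie in cycles belonging to the same block $f_p$, has a single class. The genus $g$ of a connected stuffed map is defined by $2-2g=|\mathcal C(\sigma)|-|\mathcal C(\alpha)|+n+\sum_p(2-2h_p-|f_p|)$, where $\mathcal C(\cdot)$ denotes the set of cycles. Isomorphisms are bijections of half-edges transporting all the data (including labels of boundaries and roots); automorphisms fix $H^\partial$ pointwise. Generating series are sums over isomorphism classes of connected objects of $\frac{1}{|\mathrm{Aut}|}\prod_pt^{h_p}_{(\text{lengths of the cycles in }f_p)}$. Usual maps are those with all $h_p=0$ and $|f_p|=1$. A (stuffed) map is fully simple if the half-edges of $H^\partial$ belong to pairwise distinct cycles of $\sigma$. *)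

theory Defs
  imports
    "HOL-Probability.Probability"
    "HOL-Combinatorics.Cycles"
    "HOL-Combinatorics.Orbits"
    "HOL-Combinatorics.Multiset_Permutations"
    "Jordan_Normal_Form.Matrix"
begin

section \<open>Formal power series in arbitrarily many variables\<close>

text \<open>Monomials in variables of type \<open>'v\<close> are finite multisets of variables. A power series is an
  arbitrary family of complex coefficients indexed by monomials.\<close>

typedef 'v mseries = "UNIV :: ('v multiset \<Rightarrow> complex) set"
  morphisms coeff MSeries by simp

setup_lifting type_definition_mseries

lemma coeff_MSeries [simp]: "coeff (MSeries f) = f"
  by (simp add: MSeries_inverse)

lemma mseries_eqI: "(\<And>m. coeff f m = coeff g m) \<Longrightarrow> f = g"
  by transfer (rule ext)

lemma finite_mset_splits [simp]: "finite {(a, b). a + b = (m :: 'v multiset)}"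
proof (induction m)
  case empty
  have "{(a, b). a + b = ({#} :: 'v multiset)} = {({#}, {#})}" by auto
  then show ?case by (simp only: finite.intros)
next
  case (add x m)
  let ?D = "{(a, b). a + b = m}"
  have "{(a, b). a + b = add_mset x m} \<subseteq>
      (\<lambda>(a, b). (add_mset x a, b)) ` ?D \<union> (\<lambda>(a, b). (a, add_mset x b)) ` ?D"
  proof safe
    fix a b assume ab: "a + b = add_mset x m"
      and n: "(a, b) \<notin> (\<lambda>(a, b). (a, add_mset x b)) ` ?D"
    show "(a, b) \<in> (\<lambda>(a, b). (add_mset x a, b)) ` ?D"
    proof (cases "x \<in># a")
      case True
      then obtain a' where "a = add_mset x a'" by (meson multi_member_split)
      then show ?thesis using ab by force
    next
      case False
      then have "x \<in># b" using ab by (metis union_iff union_single_eq_member add_mset_add_single)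
      then obtain b' where "b = add_mset x b'" by (meson multi_member_split)
      then show ?thesis using ab n by force
    qed
  qed
  then show ?case using add.IH by (meson finite_UnI finite_imageI finite_subset)
qed

instantiation mseries :: (type) comm_ring_1
begin

lift_definition zero_mseries :: "'v mseries" is "\<lambda>_. 0" .
lift_definition one_mseries :: "'v mseries" is "\<lambda>m. if m = {#} then 1 else 0" .
lift_definition plus_mseries :: "'v mseries \<Rightarrow> 'v mseries \<Rightarrow> 'v mseries"
  is "\<lambda>f g m. f m + g m" .
lift_definition minus_mseries :: "'v mseries \<Rightarrow> 'v mseries \<Rightarrow> 'v mseries"
  is "\<lambda>f g m. f m - g m" .
lift_definition uminus_mseries :: "'v mseries \<Rightarrow> 'v mseries"
  is "\<lambda>f m. - f m" .
lift_definition times_mseries :: "'v mseries \<Rightarrow> 'v mseries \<Rightarrow> 'v mseries"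
  is "\<lambda>f g m. \<Sum>(a, b) | a + b = m. f a * g b" .

instance
proof
  fix f g h :: "'v mseries"
  show "f + g + h = f + (g + h)" by transfer (simp add: algebra_simps)
  show "f + g = g + f" by transfer (simp add: algebra_simps)
  show "0 + f = f" by transfer simp
  show "- f + f = 0" by transfer simp
  show "f - g = f + - g" by transfer simp
  show "f * g = g * f"
    by transfer (rule ext, rule sum.reindex_bij_witness[of _ prod.swap prod.swap],
      auto simp: add.commute mult.commute)
  show "(f + g) * h = f * h + g * h"
    by transfer (simp add: algebra_simps sum.distrib case_prod_unfold)
  show "1 * f = f"
  proof transfer
    fix f :: "'v multiset \<Rightarrow> complex"
    have "(\<Sum>(a, b) | a + b = m. (if a = {#} then 1 else 0) * f b) = f m" for m
    proof -
      have "(\<Sum>(a, b) | a + b = m. (if a = {#} then 1 else 0) * f b)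
          = (\<Sum>(a, b) \<in> {({#} :: 'v multiset, m)}. (if a = {#} then 1 else 0) * f b)"
        by (rule sum.mono_neutral_right) (auto split: if_splits)
      then show ?thesis by simp
    qed
    then show "(\<lambda>m. \<Sum>(a, b) | a + b = m. (if a = {#} then 1 else 0) * f b) = f" by blast
  qed
  show "(0 :: 'v mseries) \<noteq> 1" by transfer (metis zero_neq_one)
  show "f * g * h = f * (g * h)"
  proof transfer
    fix f g h :: "'v multiset \<Rightarrow> complex"
    have "(\<Sum>(a, b) | a + b = m. (\<Sum>(c, d) | c + d = a. f c * g d) * h b)
        = (\<Sum>(a, b) | a + b = m. f a * (\<Sum>(c, d) | c + d = b. g c * h d))" for m
    proof -
      have "(\<Sum>(a, b) | a + b = m. (\<Sum>(c, d) | c + d = a. f c * g d) * h b)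
          = (\<Sum>p \<in> {(a, b). a + b = m}. \<Sum>q \<in> {(c, d). c + d = fst p}. f (fst q) * g (snd q) * h (snd p))"
        by (simp add: sum_distrib_right case_prod_unfold)
      also have "\<dots> = (\<Sum>(p, q) \<in> (SIGMA p : {(a, b). a + b = m}. {(c, d). c + d = fst p}).
          f (fst q) * g (snd q) * h (snd p))"
        by (rule sum.Sigma) auto
      also have "\<dots> = (\<Sum>(p, q) \<in> (SIGMA p : {(a, b). a + b = m}. {(c, d). c + d = snd p}).
          f (fst p) * (g (fst q) * h (snd q)))"
        by (rule sum.reindex_bij_witness[of _ "\<lambda>((a, b), (c, d)). ((a + c, d), (a, c))"
              "\<lambda>((a, b), (c, d)). ((c, d + b), (d, b))"])
          (auto simp: add.assoc mult.assoc)
      also have "\<dots> = (\<Sum>p \<in> {(a, b). a + b = m}. \<Sum>q \<in> {(c, d). c + d = snd p}.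
          f (fst p) * (g (fst q) * h (snd q)))"
        by (rule sum.Sigma[symmetric]) auto
      also have "\<dots> = (\<Sum>(a, b) | a + b = m. f a * (\<Sum>(c, d) | c + d = b. g c * h d))"
        by (simp add: sum_distrib_left case_prod_unfold)
      finally show ?thesis .
    qed
    then show "(\<lambda>m. \<Sum>(a, b) | a + b = m. (\<Sum>(c, d) | c + d = a. f c * g d) * h b)
        = (\<lambda>m. \<Sum>(a, b) | a + b = m. f a * (\<Sum>(c, d) | c + d = b. g c * h d))" by blast
  qed
qed

end

definition mconst :: "complex \<Rightarrow> 'v mseries" where
  "mconst c = MSeries (\<lambda>m. if m = {#} then c else 0)"

definition mvar :: "'v \<Rightarrow> 'v mseries" where
  "mvar v = MSeries (\<lambda>m. if m = {#v#} then 1 else 0)"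

text \<open>Infinite sums of power series, in the topology where each coefficient is eventually constant:
  every monomial occurs in finitely many summands.\<close>

definition formally_summable :: "('i \<Rightarrow> 'v mseries) \<Rightarrow> 'i set \<Rightarrow> bool" where
  "formally_summable F I \<longleftrightarrow> (\<forall>m. finite {i \<in> I. coeff (F i) m \<noteq> 0})"

definition formal_sum :: "('i \<Rightarrow> 'v mseries) \<Rightarrow> 'i set \<Rightarrow> 'v mseries" where
  "formal_sum F I = MSeries (\<lambda>m. \<Sum>i | i \<in> I \<and> coeff (F i) m \<noteq> 0. coeff (F i) m)"

definition has_formal_sum :: "('i \<Rightarrow> 'v mseries) \<Rightarrow> 'v mseries \<Rightarrow> 'i set \<Rightarrow> bool" where
  "has_formal_sum F s I \<longleftrightarrow> formally_summable F I \<and> formal_sum F I = s"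

text \<open>To be used for series with constant coefficient \<open>0\<close>, respectively \<open>1\<close>; then the sums are
  formally summable, by \<open>formally_summable_powers\<close> below.\<close>

definition mexp :: "'v mseries \<Rightarrow> 'v mseries" where
  "mexp f = formal_sum (\<lambda>j. mconst (1 / fact j) * f ^ j) UNIV"

definition minverse :: "'v mseries \<Rightarrow> 'v mseries" where
  "minverse f = formal_sum (\<lambda>j. (1 - f) ^ j) UNIV"

lemma coeff_mult: "coeff (f * g) m = (\<Sum>(a, b) | a + b = m. coeff f a * coeff g b)"
  by transfer simp

lemma coeff_diff [simp]: "coeff (f - g) m = coeff f m - coeff g m"
  by transfer simp

lemma coeff_one: "coeff 1 m = (if m = {#} then 1 else 0)"
  by transfer simp

lemma coeff_mconst_mult [simp]: "coeff (mconst c * f) m = c * coeff f m"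
  for f :: "'v mseries"
proof -
  have "coeff (mconst c * f) m = (\<Sum>(a, b) \<in> {({#} :: 'v multiset, m)}. (if a = {#} then c else 0) * coeff f b)"
    unfolding coeff_mult mconst_def coeff_MSeries by (rule sum.mono_neutral_right) (auto split: if_splits)
  then show ?thesis by simp
qed

lemma coeff_power_eq_0:
  assumes "coeff f {#} = 0" "size m < j"
  shows "coeff (f ^ j) m = 0"
  using assms(2)
proof (induction j arbitrary: m)
  case (Suc j)
  have "coeff f a * coeff (f ^ j) b = 0" if "a + b = m" for a b
  proof (cases "a = {#}")
    case False
    then have "size a > 0" by (simp add: nonempty_has_size)
    then have "size b < j" using that Suc.prems by auto
    then show ?thesis using Suc.IH by simp
  qed (simp add: assms(1))
  then have "(\<Sum>(a, b) | a + b = m. coeff f a * coeff (f ^ j) b) = 0"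
    by (intro sum.neutral) auto
  then show ?case by (simp add: coeff_mult)
qed simp

lemma formally_summable_powers:
  assumes "coeff f {#} = 0"
  shows "formally_summable (\<lambda>j. mconst (c j) * f ^ j) UNIV"
  unfolding formally_summable_def
proof
  fix m
  have "{j \<in> UNIV. coeff (mconst (c j) * f ^ j) m \<noteq> 0} \<subseteq> {..size m}"
    proof
    fix j assume "j \<in> {j \<in> UNIV. coeff (mconst (c j) * f ^ j) m \<noteq> 0}"
    then have "coeff (f ^ j) m \<noteq> 0" by simp
    then show "j \<in> {..size m}" using coeff_power_eq_0[OF assms] by (metis atMost_iff not_le)
  qed
  then show "finite {j \<in> UNIV. coeff (mconst (c j) * f ^ j) m \<noteq> 0}"
    by (rule finite_subset) simp
qed

lemma coeff_0 [simp]: "coeff 0 m = 0"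
  by transfer simp

lemma coeff_add [simp]: "coeff (f + g) m = coeff f m + coeff g m"
  by transfer simp

lemma coeff_sum: "coeff (sum F A) m = (\<Sum>i\<in>A. coeff (F i) m)"
  by (induction A rule: infinite_finite_induct) auto

lemma minverse_right:
  fixes f :: "'v mseries"
  assumes "coeff f {#} = 1"
  shows "f * minverse f = 1"
proof (rule mseries_eqI)
  fix m :: "'v multiset"
  let ?u = "1 - f"
  have u: "coeff ?u {#} = 0" using assms by (simp add: coeff_one)
  have inv: "coeff (minverse f) b = coeff (\<Sum>j\<le>size m. ?u ^ j) b" if "size b \<le> size m" for b
  proof -
    have "(\<Sum>j | j \<in> UNIV \<and> coeff (?u ^ j) b \<noteq> 0. coeff (?u ^ j) b)
        = (\<Sum>j\<le>size m. coeff (?u ^ j) b)"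
    proof (rule sum.mono_neutral_left)
      show "{j. j \<in> UNIV \<and> coeff (?u ^ j) b \<noteq> 0} \<subseteq> {..size m}"
        proof
        fix j assume "j \<in> {j. j \<in> UNIV \<and> coeff (?u ^ j) b \<noteq> 0}"
        then have "coeff (?u ^ j) b \<noteq> 0" by simp
        then have "j \<le> size b" using coeff_power_eq_0[OF u] by (metis not_le)
        then show "j \<in> {..size m}" using that by simp
      qed
    qed auto
    then show ?thesis by (simp only: minverse_def formal_sum_def coeff_MSeries coeff_sum)
  qed
  have "coeff (f * minverse f) m = coeff (f * (\<Sum>j\<le>size m. ?u ^ j)) m"
    unfolding coeff_mult by (intro sum.cong refl) (auto simp: inv)
  also have "f * (\<Sum>j\<le>size m. ?u ^ j) = 1 - ?u ^ Suc (size m)"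
    using sum_gp_basic[of ?u "size m"] by simp
  also have "coeff \<dots> m = coeff 1 m"
    unfolding coeff_diff using coeff_power_eq_0[OF u, of m "Suc (size m)"] by simp
  finally show "coeff (f * minverse f) m = coeff 1 m" .
qed


section \<open>The formal matrix measures\<close>

definition mtrace :: "complex mat \<Rightarrow> complex" where
  "mtrace M = (\<Sum>i<dim_row M. M $$ (i, i))"

text \<open>The real coordinates of a hermitian matrix: diagonal entries, and real and imaginary parts of
  the entries above the diagonal. The measure \<open>dM\<close> is Lebesgue measure in these coordinates.\<close>

definition hermitian_of :: "nat \<Rightarrow> (nat \<times> nat \<Rightarrow> real) \<Rightarrow> complex mat" where
  "hermitian_of N x = mat N N (\<lambda>(i, j).
     if i = j then of_real (x (i, i))
     else if i < j then Complex (x (i, j)) (x (j, i))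
     else cnj (Complex (x (j, i)) (x (i, j))))"

definition lebesgue_hermitian :: "nat \<Rightarrow> (nat \<times> nat \<Rightarrow> real) measure" where
  "lebesgue_hermitian N = (\<Pi>\<^sub>M e \<in> {..<N} \<times> {..<N}. lborel)"

definition gauss_density :: "nat \<Rightarrow> complex mat \<Rightarrow> complex" where
  "gauss_density N M = exp (- of_nat N * mtrace (M ^\<^sub>m 2) / 2)"

definition gauss_expectation :: "nat \<Rightarrow> (complex mat \<Rightarrow> complex) \<Rightarrow> complex" where
  "gauss_expectation N f =
     (\<integral>x. gauss_density N (hermitian_of N x) * f (hermitian_of N x) \<partial>lebesgue_hermitian N) /
     (\<integral>x. gauss_density N (hermitian_of N x) \<partial>lebesgue_hermitian N)"

text \<open>The variable \<open>(h, {#m\<^sub>1, \<dots>, m\<^sub>k#})\<close> stands for the weight \<open>t\<^sup>h\<^bsub>m\<^sub>1,\<dots>,m\<^sub>k\<^esub>\<close>, which is symmetric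
  in the \<open>m\<^sub>i\<close>. A set \<open>T\<close> of weights selects those not set to zero.\<close>

type_synonym weight = "nat \<times> nat multiset"

definition stuffed_weights :: "weight set" where
  "stuffed_weights = {(h, \<mu>). \<mu> \<noteq> {#} \<and> (\<forall>m \<in># \<mu>. m \<ge> 1)}"

definition usual_weights :: "weight set" where
  "usual_weights = {(0, {#m#}) | m. m \<ge> 1}"

text \<open>The sum over \<open>h\<close>, \<open>k\<close> and ordered tuples \<open>ms = [m\<^sub>1, \<dots>, m\<^sub>k]\<close>.\<close>

definition potential :: "weight set \<Rightarrow> nat \<Rightarrow> complex mat \<Rightarrow> weight mseries" where
  "potential T N M = formal_sum
     (\<lambda>(h, ms). mconst (of_nat N powi (2 - 2 * int h - int (length ms)) / fact (length ms)
                        * (\<Prod>m\<leftarrow>ms. mtrace (M ^\<^sub>m m) / of_nat m))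
                * mvar (h, mset ms))
     {(h, ms). (h, mset ms) \<in> T}"

definition formal_integral :: "weight set \<Rightarrow> nat \<Rightarrow> (complex mat \<Rightarrow> complex) \<Rightarrow> weight mseries" where
  "formal_integral T N f = MSeries (\<lambda>w.
     gauss_expectation N (\<lambda>M. coeff (mconst (f M) * mexp (potential T N M)) w))"

definition formal_expectation :: "weight set \<Rightarrow> nat \<Rightarrow> (complex mat \<Rightarrow> complex) \<Rightarrow> weight mseries" where
  "formal_expectation T N f = formal_integral T N f * minverse (formal_integral T N (\<lambda>_. 1))"

definition joint_cumulant ::
    "(('m \<Rightarrow> 'c) \<Rightarrow> 'a) \<Rightarrow> ('m \<Rightarrow> 'c :: comm_monoid_mult) list \<Rightarrow> 'a :: comm_ring_1" where
  "joint_cumulant E Xs = (\<Sum>\<pi> | partition_on {..<length Xs} \<pi>.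
     (- 1) ^ (card \<pi> - 1) * of_nat (fact (card \<pi> - 1)) * (\<Prod>B\<in>\<pi>. E (\<lambda>M. \<Prod>i\<in>B. (Xs ! i) M)))"

text \<open>The cycle \<open>(c\<^sub>1 c\<^sub>2 \<dots> c\<^sub>l)\<close> is represented by the list of the \<open>c\<^sub>i\<close>, so that cycles of length 1
  carry their support. Matrix indices are \<open>0, \<dots>, N - 1\<close>.\<close>

definition cycle_product :: "nat list \<Rightarrow> complex mat \<Rightarrow> complex" where
  "cycle_product c M = (\<Prod>k<length c. M $$ (c ! k, cycle_of_list c (c ! k)))"


section \<open>Stuffed maps\<close>

text \<open>The \<open>i\<close>-th boundary is the cycle of \<open>face_perm\<close> through the \<open>i\<close>-th element of \<open>roots\<close>. Cycles
  are represented by their sets of half-edges, and cells by sets of cycles. The values of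
  \<open>cell_genus\<close> outside \<open>cells\<close> are irrelevant.\<close>

record 'h stuffed_map =
  half_edges :: "'h set"
  vertex_perm :: "'h \<Rightarrow> 'h"
  edge_perm :: "'h \<Rightarrow> 'h"
  face_perm :: "'h \<Rightarrow> 'h"
  roots :: "'h list"
  cells :: "'h set set set"
  cell_genus :: "'h set set \<Rightarrow> nat"

definition cycles_on :: "'h set \<Rightarrow> ('h \<Rightarrow> 'h) \<Rightarrow> 'h set set" where
  "cycles_on H p = orbit p ` H"

definition boundaries :: "'h stuffed_map \<Rightarrow> 'h set list" where
  "boundaries S = map (orbit (face_perm S)) (roots S)"

definition boundary_half_edges :: "'h stuffed_map \<Rightarrow> 'h set" where
  "boundary_half_edges S = \<Union> (set (boundaries S))"

definition is_stuffed_map :: "'h stuffed_map \<Rightarrow> bool" where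
  "is_stuffed_map S \<longleftrightarrow>
     finite (half_edges S) \<and>
     vertex_perm S permutes half_edges S \<and>
     edge_perm S permutes half_edges S \<and>
     face_perm S permutes half_edges S \<and>
     vertex_perm S \<circ> edge_perm S \<circ> face_perm S = id \<and>
     (\<forall>x \<in> half_edges S. edge_perm S x \<noteq> x \<and> edge_perm S (edge_perm S x) = x) \<and>
     roots S \<noteq> [] \<and> set (roots S) \<subseteq> half_edges S \<and> distinct (boundaries S) \<and>
     partition_on (cycles_on (half_edges S) (face_perm S) - set (boundaries S)) (cells S)"

definition is_usual_map :: "'h stuffed_map \<Rightarrow> bool" where
  "is_usual_map S \<longleftrightarrow>
     is_stuffed_map S \<and> (\<forall>f \<in> cells S. cell_genus S f = 0 \<and> card f = 1)"

definition connected_map :: "'h stuffed_map \<Rightarrow> bool" where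
  "connected_map S \<longleftrightarrow> half_edges S \<noteq> {} \<and>
     (\<forall>x \<in> half_edges S. \<forall>y \<in> half_edges S.
        equivclp (\<lambda>u v. u \<in> half_edges S \<and>
          (v = vertex_perm S u \<or> v = edge_perm S u \<or> (\<exists>f \<in> cells S. u \<in> \<Union> f \<and> v \<in> \<Union> f))) x y)"

definition euler_char :: "'h stuffed_map \<Rightarrow> int" where
  "euler_char S =
     int (card (cycles_on (half_edges S) (vertex_perm S)))
     - int (card (cycles_on (half_edges S) (edge_perm S)))
     + int (length (roots S))
     + (\<Sum>f \<in> cells S. 2 - 2 * int (cell_genus S f) - int (card f))"

definition has_genus :: "'h stuffed_map \<Rightarrow> nat \<Rightarrow> bool" where
  "has_genus S g \<longleftrightarrow> 2 - 2 * int g = euler_char S"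

definition fully_simple :: "'h stuffed_map \<Rightarrow> bool" where
  "fully_simple S \<longleftrightarrow> inj_on (orbit (vertex_perm S)) (boundary_half_edges S)"

definition is_map_iso :: "('h \<Rightarrow> 'k) \<Rightarrow> 'h stuffed_map \<Rightarrow> 'k stuffed_map \<Rightarrow> bool" where
  "is_map_iso b S S' \<longleftrightarrow>
     bij_betw b (half_edges S) (half_edges S') \<and>
     (\<forall>x \<in> half_edges S. b (vertex_perm S x) = vertex_perm S' (b x) \<and>
        b (edge_perm S x) = edge_perm S' (b x) \<and> b (face_perm S x) = face_perm S' (b x)) \<and>
     map b (roots S) = roots S' \<and>
     image (image (image b)) (cells S) = cells S' \<and>
     (\<forall>f \<in> cells S. cell_genus S' (image (image b) f) = cell_genus S f)"

definition automorphisms :: "'h stuffed_map \<Rightarrow> ('h \<Rightarrow> 'h) set" where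
  "automorphisms S = {b. b permutes half_edges S \<and> is_map_iso b S S \<and>
     (\<forall>x \<in> boundary_half_edges S. b x = x)}"

definition iso_on :: "'h stuffed_map set \<Rightarrow> ('h stuffed_map \<times> 'h stuffed_map) set" where
  "iso_on \<M> = {(S, S'). S \<in> \<M> \<and> S' \<in> \<M> \<and> (\<exists>b. is_map_iso b S S')}"

text \<open>The monomial \<open>\<Prod>\<^sub>p t\<^bsup>h\<^sub>p\<^esup>\<close> indexed by the lengths of the cycles in \<open>f\<^sub>p\<close>.\<close>

definition map_monomial :: "'h stuffed_map \<Rightarrow> weight multiset" where
  "map_monomial S =
     image_mset (\<lambda>f. (cell_genus S f, image_mset card (mset_set f))) (mset_set (cells S))"

text \<open>Sum over isomorphism classes. Since half-edge sets are finite, it suffices to consider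
  half-edges in \<open>nat\<close>. For a given monomial and given boundary lengths, the number of half-edges is
  determined, hence there are finitely many classes.\<close>

definition generating_series :: "nat stuffed_map set \<Rightarrow> weight mseries" where
  "generating_series \<M> = MSeries (\<lambda>w.
     \<Sum>K \<in> {S \<in> \<M>. map_monomial S = w} // iso_on {S \<in> \<M>. map_monomial S = w}.
       1 / of_nat (card (automorphisms (SOME S. S \<in> K))))"

definition fully_simple_maps :: "nat \<Rightarrow> nat list \<Rightarrow> nat stuffed_map set" where
  "fully_simple_maps g Ls = {S. is_stuffed_map S \<and> connected_map S \<and> has_genus S g \<and>
     fully_simple S \<and> map card (boundaries S) = Ls}"

definition usual_series :: "nat \<Rightarrow> nat list \<Rightarrow> weight mseries" where
  "usual_series g Ls = generating_series {S \<in> fully_simple_maps g Ls. is_usual_map S}"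

definition stuffed_series :: "nat \<Rightarrow> nat list \<Rightarrow> weight mseries" where
  "stuffed_series g Ls = generating_series (fully_simple_maps g Ls)"

end

theory Submission
  imports Defs
begin

text \<open>By Wick's theorem, the Gaussian expectation of a product of \<open>\<P>\<^sub>\<gamma>\<close>'s and traces is a sum over
  pairings \<open>\<alpha>\<close> of the factors and over index assignments which are constant on the cycles of
  \<open>\<phi> \<circ> \<alpha>\<close>, where \<open>\<phi>\<close> is the permutation whose cycles are the boundaries and the traces. The indices
  of the boundary half-edges are prescribed and pairwise distinct, so that the maps which contribute are
  the fully simple ones, and each of the remaining cycles of \<open>\<phi> \<circ> \<alpha>\<close> contributes a free index.

  Multiplying the coefficient of a monomial by \<open>d!\<close> turns it into a count of maps with half-edges
  \<open>0, \<dots>, d - 1\<close>. Splitting off the component of one boundary gives a recursion for the expectations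
  that characterizes the cumulants: they count the connected maps. (Components without boundary are
  removed by the normalization.) Finally the symmetric group acts on the labelled maps by relabelling;
  the stabilizers are the automorphism groups, and these fix the boundary pointwise because boundaries
  are rooted.\<close>

section \<open>Gaussian moments\<close>

text \<open>The coefficient of a monomial \<open>w\<close> in the exponentiated potential carries
  \<open>1 / weight_factor w\<close>. One configuration of \<open>d\<close> half-edges has
  \<open>weight_factor w\<close> ways to order and root its inner cells, and \<open>d\<close>
  half-edges fill the resulting slots in \<open>d!\<close> ways, so this fraction is the number of
  configurations divided by \<open>d!\<close>. Hence all series are exponential generating series in
  the half-edges: a product distributes the labels between two maps, and automorphisms appear only
  at the very end.

  Each labelled map has a definite power of \<open>N\<close>: a factor \<open>N\<close> for every
  vertex off the boundary, \<open>1 / N\<close> for every edge, and exponent 2 - 2h - k for every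
  cell. For a connected map the exponent is 2 - 2g - n - L, provided that a natural number
  \<open>g\<close> exists. This has to be proved, namely that the Euler characteristic is even and
  at most 2; otherwise the sum over \<open>g\<close> would miss terms of the cumulant.

  Wick's rule produces the vertex permutation \<open>\<phi> \<circ> \<alpha>\<close>, whereas
  \<open>\<sigma> \<circ> \<alpha> \<circ> \<phi> = id\<close> gives
  \<open>\<phi>\<inverse> \<circ> \<alpha>\<close>. Inverting the face permutation reconciles the
  orientations and keeps its cycles as sets.\<close>

definition herm_scale :: "nat \<times> nat \<Rightarrow> real" where
  "herm_scale e = (if fst e = snd e then 1 else 2)"

text \<open>The coefficient of the real coordinate \<open>e\<close> in the entry
  \<open>(i, j)\<close>. Entries as linear forms in independent Gaussian coordinates reduce Wick's
  theorem to one-dimensional moments.\<close>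

definition herm_coeff :: "nat \<Rightarrow> nat \<Rightarrow> nat \<times> nat \<Rightarrow> complex" where
  "herm_coeff i j e =
     (if i = j then (if e = (i, i) then 1 else 0)
      else if i < j then (if e = (i, j) then 1 else if e = (j, i) then \<i> else 0)
      else (if e = (j, i) then 1 else if e = (i, j) then - \<i> else 0))"

lemma hermitian_of_entry:
  assumes "i < N" "j < N"
  shows "hermitian_of N x $$ (i, j) = (\<Sum>e\<in>{..<N} \<times> {..<N}. herm_coeff i j e * of_real (x e))"
proof -
  have "(\<Sum>e\<in>{..<N} \<times> {..<N}. herm_coeff i j e * of_real (x e))
      = (\<Sum>e\<in>{(i, j), (j, i)}. herm_coeff i j e * of_real (x e))"
    by (rule sum.mono_neutral_right) (use assms in \<open>auto simp: herm_coeff_def split: if_splits\<close>)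
  also have "\<dots> = hermitian_of N x $$ (i, j)"
    using assms by (auto simp: hermitian_of_def herm_coeff_def complex_eq_iff)
  finally show ?thesis by simp
qed

lemma herm_coeff_eq_0: "e \<noteq> (i, j) \<Longrightarrow> e \<noteq> (j, i) \<Longrightarrow> herm_coeff i j e = 0"
  by (auto simp: herm_coeff_def)

text \<open>Real and imaginary parts have equal variance. Off the diagonal their contributions to
  the product of an entry with itself cancel, while against the transposed entry the two halves add
  up to 1. The sum is \<open>N\<close> times the covariance of two entries.\<close>

lemma herm_coeff_covariance:
  assumes "i < N" "j < N" "k < N" "l < N"
  shows "(\<Sum>e\<in>{..<N} \<times> {..<N}. herm_coeff i j e * herm_coeff k l e / of_real (herm_scale e))
    = (if j = k \<and> i = l then 1 else 0)"
proof -
  have "(\<Sum>e\<in>{..<N} \<times> {..<N}. herm_coeff i j e * herm_coeff k l e / of_real (herm_scale e))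
     = (\<Sum>e\<in>{(i, j), (j, i)}. herm_coeff i j e * herm_coeff k l e / of_real (herm_scale e))"
    by (rule sum.mono_neutral_right) (use assms in \<open>auto simp: herm_coeff_eq_0\<close>)
  also have "\<dots> = (if j = k \<and> i = l then 1 else 0)"
  proof -
    consider "i = j" | "i < j" | "j < i" by linarith
    then show ?thesis
    proof cases
      case 1
      then show ?thesis by (simp add: herm_coeff_def herm_scale_def)
    next
      case 2
      then have "(\<Sum>e\<in>{(i, j), (j, i)}. herm_coeff i j e * herm_coeff k l e / of_real (herm_scale e))
          = (herm_coeff k l (i, j) + \<i> * herm_coeff k l (j, i)) / 2"
        by (simp add: herm_coeff_def herm_scale_def add_divide_distrib)
      also have "\<dots> = (if j = k \<and> i = l then 1 else 0)"
        using 2 by (cases k l rule: linorder_cases) (simp_all add: herm_coeff_def)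
      finally show ?thesis .
    next
      case 3
      then have "(\<Sum>e\<in>{(i, j), (j, i)}. herm_coeff i j e * herm_coeff k l e / of_real (herm_scale e))
          = (herm_coeff k l (j, i) - \<i> * herm_coeff k l (i, j)) / 2"
        by (simp add: herm_coeff_def herm_scale_def diff_divide_distrib)
      also have "\<dots> = (if j = k \<and> i = l then 1 else 0)"
        using 3 by (cases k l rule: linorder_cases) (auto simp: herm_coeff_def)
      finally show ?thesis .
    qed
  qed
  finally show ?thesis .
qed

lemma mtrace_square_hermitian:
  "mtrace (hermitian_of N x ^\<^sub>m 2) = (\<Sum>e\<in>{..<N} \<times> {..<N}. of_real (herm_scale e * (x e)\<^sup>2))"
proof -
  let ?M = "hermitian_of N x"
  have dim: "dim_row ?M = N" "dim_col ?M = N" by (auto simp: hermitian_of_def)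
  have "mtrace (?M ^\<^sub>m 2) = (\<Sum>i<N. \<Sum>j<N. ?M $$ (i, j) * ?M $$ (j, i))"
    using dim by (simp add: mtrace_def numeral_2_eq_2 scalar_prod_def lessThan_atLeast0)
  also have "\<dots> = (\<Sum>e\<in>{..<N} \<times> {..<N}. ?M $$ e * ?M $$ prod.swap e)"
    by (simp add: sum.cartesian_product case_prod_unfold prod.swap_def)
  \<comment> \<open>Off the diagonal the product is a squared modulus, hence the sum of the squares
    of both coordinates of the pair. The second square is then moved to its own index by
    \<open>prod.swap\<close>.\<close>
  also have "\<dots> = (\<Sum>e\<in>{..<N} \<times> {..<N}. of_real ((x e)\<^sup>2 + (if fst e = snd e then 0 else (x (prod.swap e))\<^sup>2)))"
    by (rule sum.cong) (auto simp: hermitian_of_def complex_eq_iff power2_eq_square)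
  also have "\<dots> = of_real ((\<Sum>e\<in>{..<N} \<times> {..<N}. (x e)\<^sup>2)
      + (\<Sum>e\<in>{..<N} \<times> {..<N}. if fst e = snd e then 0 else (x (prod.swap e))\<^sup>2))"
    by (simp add: sum.distrib)
  also have "(\<Sum>e\<in>{..<N} \<times> {..<N}. if fst e = snd e then 0 else (x (prod.swap e))\<^sup>2)
      = (\<Sum>e\<in>{..<N} \<times> {..<N}. if fst e = snd e then 0 else (x e)\<^sup>2)"
    by (rule sum.reindex_bij_witness[of _ prod.swap prod.swap]) auto
  also have "(\<Sum>e\<in>{..<N} \<times> {..<N}. (x e)\<^sup>2) + \<dots> = (\<Sum>e\<in>{..<N} \<times> {..<N}. herm_scale e * (x e)\<^sup>2)"
    unfolding sum.distrib[symmetric] by (rule sum.cong) (auto simp: herm_scale_def)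
  finally show ?thesis by simp
qed

text \<open>The factor of the coordinate \<open>e\<close> in the Gaussian density: up to
  normalization, a centred normal density of variance \<open>1 / (N * herm_scale e)\<close>.\<close>

definition coord_density :: "nat \<Rightarrow> nat \<times> nat \<Rightarrow> real \<Rightarrow> real" where
  "coord_density N e t = exp (- (real N * herm_scale e / 2) * t\<^sup>2)"

lemma gauss_density_hermitian:
  "gauss_density N (hermitian_of N x) = of_real (\<Prod>e\<in>{..<N} \<times> {..<N}. coord_density N e (x e))"
proof -
  have "gauss_density N (hermitian_of N x)
      = exp (of_real (\<Sum>e\<in>{..<N} \<times> {..<N}. - (real N * herm_scale e / 2) * (x e)\<^sup>2))"
    unfolding gauss_density_def mtrace_square_hermitian
    by (rule arg_cong[where f = exp]) (simp add: sum_distrib_left sum_divide_distrib sum_negf mult_ac)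
  also have "\<dots> = of_real (exp (\<Sum>e\<in>{..<N} \<times> {..<N}. - (real N * herm_scale e / 2) * (x e)\<^sup>2))"
    by (simp only: exp_of_real)
  finally show ?thesis
    unfolding coord_density_def by (subst (asm) exp_sum) auto
qed

text \<open>The \<open>p\<close>-th moment of a centred normal law of variance \<open>v\<close>; for
  even \<open>p\<close> the quotient of factorials and powers of 2 is the double factorial of
  \<open>p - 1\<close>.\<close>

definition gauss_moment :: "real \<Rightarrow> nat \<Rightarrow> real" where
  "gauss_moment v p = (if even p then fact p * v ^ (p div 2) / (2 ^ (p div 2) * fact (p div 2)) else 0)"

text \<open>Integration by parts for a normal law. At \<open>p = 0\<close> the truncated
  \<open>p - 1\<close> is harmless because the factor \<open>p\<close> vanishes, as does the first
  moment.\<close>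

lemma gauss_moment_rec: "gauss_moment v (Suc p) = v * real p * gauss_moment v (p - 1)"
proof (cases "even p")
  case False
  then obtain k where p: "p = 2 * k + 1" by (elim oddE)
  have "gauss_moment v (Suc p)
      = (real (2 * k + 2) * (real (2 * k + 1) * fact (2 * k))) * (v * v ^ k) / ((2 * 2 ^ k) * (real (k + 1) * fact k))"
    by (simp add: gauss_moment_def p)
  also have "\<dots> = v * real (2 * k + 1) * (fact (2 * k) * v ^ k / (2 ^ k * fact k))"
    by (simp add: divide_simps)
  finally show ?thesis by (simp add: gauss_moment_def p)
next
  case True
  then show ?thesis by (cases "p = 0") (auto simp: gauss_moment_def)
qed

text \<open>\<open>coord_density\<close> is a normal density times \<open>sqrt (2 * pi * v)\<close>.
  This constant stays explicit, since it cancels only in the quotient that defines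
  \<open>gauss_expectation\<close>.\<close>

lemma coord_density_moment:
  fixes e :: "nat \<times> nat"
  assumes "N > 0"
  defines "v \<equiv> 1 / (real N * herm_scale e)"
  shows "has_bochner_integral lborel (\<lambda>t. coord_density N e t * t ^ p)
           (sqrt (2 * pi * v) * gauss_moment v p)"
proof -
  have pos: "v > 0" using assms by (auto simp: herm_scale_def)
  define s where "s = sqrt v"
  have s: "s > 0" "s\<^sup>2 = v" using pos by (auto simp: s_def)
  have dens: "coord_density N e t = sqrt (2 * pi * v) * normal_density 0 s t" for t
  proof -
    have "- (real N * herm_scale e / 2) * t\<^sup>2 = - t\<^sup>2 / (2 * v)"
      using assms by (simp add: v_def herm_scale_def)
    then show ?thesis using pos by (simp add: coord_density_def normal_density_def s)
  qed
  have "has_bochner_integral lborel (\<lambda>t. normal_density 0 s t * t ^ p) (gauss_moment v p)"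
  proof (cases "even p")
    case True
    then obtain k where p: "p = 2 * k" by (elim evenE)
    have "fact p / ((2 / v) ^ k * fact k) = gauss_moment v p"
      using pos p by (simp add: gauss_moment_def power_divide)
    then show ?thesis using normal_moment_even[OF s(1), of 0 k] p s by simp
  next
    case False
    then obtain k where p: "p = 2 * k + 1" by (elim oddE)
    then show ?thesis using normal_moment_odd[OF s(1), of 0 k] by (simp add: gauss_moment_def)
  qed
  then show ?thesis
    unfolding dens mult.assoc by (rule has_bochner_integral_mult_right)
qed

text \<open>The monomial is indexed by a set of factors, so that the Wick recursion can remove
  factors one at a time.\<close>

definition coord_moment :: "nat \<Rightarrow> 'k set \<Rightarrow> ('k \<Rightarrow> nat \<times> nat) \<Rightarrow> real" where
  "coord_moment N K c =
     (\<Prod>e\<in>{..<N} \<times> {..<N}. gauss_moment (1 / (real N * herm_scale e)) (card {k\<in>K. c k = e}))"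

text \<open>Integration by parts in the coordinate of \<open>k0\<close>. The factor \<open>p\<close>
  of \<open>gauss_moment_rec\<close> is the number of partners \<open>k\<close> at this coordinate,
  and the other coordinates do not change.\<close>

lemma coord_moment_rec:
  assumes "finite K" "k0 \<notin> K" "c k0 \<in> {..<N} \<times> {..<N}"
  shows "coord_moment N (insert k0 K) c =
    (\<Sum>k\<in>K. if c k = c k0 then coord_moment N (K - {k}) c / (real N * herm_scale (c k0)) else 0)"
proof -
  let ?I = "{..<N} \<times> {..<N}" and ?e = "c k0"
  let ?g = "\<lambda>e. gauss_moment (1 / (real N * herm_scale e))"
  let ?n = "\<lambda>K e. card {k\<in>K. c k = e}"
  have split: "coord_moment N K' c = ?g ?e (?n K' ?e) * (\<Prod>e\<in>?I - {?e}. ?g e (?n K' e))" for K'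
    unfolding coord_moment_def using assms(3) by (intro prod.remove) auto
  have n0: "?n (insert k0 K) ?e = Suc (?n K ?e)"
  proof -
    have "{k\<in>insert k0 K. c k = ?e} = insert k0 {k\<in>K. c k = ?e}" by auto
    then show ?thesis using assms(1,2) by simp
  qed
  have n1: "?n (insert k0 K) e = ?n K e" if "e \<noteq> ?e" for e
    using that by (intro arg_cong[where f = card]) auto
  have n2: "coord_moment N (K - {k}) c = ?g ?e (?n K ?e - 1) * (\<Prod>e\<in>?I - {?e}. ?g e (?n K e))"
    if "k \<in> K" "c k = ?e" for k
  proof -
    have "{k'\<in>K - {k}. c k' = ?e} = {k\<in>K. c k = ?e} - {k}" by auto
    then have 1: "?n (K - {k}) ?e = ?n K ?e - 1" using that assms(1) by (simp add: card_Diff_singleton)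
    have "?n (K - {k}) e = ?n K e" if "e \<noteq> ?e" for e
      using that \<open>c k = ?e\<close> by (intro arg_cong[where f = card]) auto
    then have "(\<Prod>e\<in>?I - {?e}. ?g e (?n (K - {k}) e)) = (\<Prod>e\<in>?I - {?e}. ?g e (?n K e))"
      by (intro prod.cong refl arg_cong2[where f = gauss_moment]) auto
    then show ?thesis unfolding split 1 by simp
  qed
  have "coord_moment N (insert k0 K) c
      = real (?n K ?e) * (?g ?e (?n K ?e - 1) * (\<Prod>e\<in>?I - {?e}. ?g e (?n K e))) / (real N * herm_scale ?e)"
  proof -
    have "(\<Prod>e\<in>?I - {?e}. ?g e (?n (insert k0 K) e)) = (\<Prod>e\<in>?I - {?e}. ?g e (?n K e))"
      by (intro prod.cong refl arg_cong2[where f = gauss_moment] n1) auto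
    then show ?thesis unfolding split[of "insert k0 K"] n0 gauss_moment_rec by simp
  qed
  also have "\<dots> = (\<Sum>k\<in>{k\<in>K. c k = ?e}. coord_moment N (K - {k}) c / (real N * herm_scale ?e))"
    using n2 by simp
  also have "\<dots> = (\<Sum>k\<in>K. if c k = ?e then coord_moment N (K - {k}) c / (real N * herm_scale ?e) else 0)"
    using assms(1) by (simp add: sum.If_cases Int_def)
  finally show ?thesis .
qed

text \<open>Density and monomial factorize over the coordinates, so the integral is a product of
  one-dimensional ones. \<open>Z\<close> is the total mass, \<open>coord_moment\<close> the
  normalized moment.\<close>

lemma coord_moment_integral:
  assumes "N > 0" "finite K" "\<And>k. k \<in> K \<Longrightarrow> c k \<in> {..<N} \<times> {..<N}"
  defines "Z \<equiv> \<Prod>e\<in>{..<N} \<times> {..<N}. sqrt (2 * pi * (1 / (real N * herm_scale e)))"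
  shows "has_bochner_integral (lebesgue_hermitian N)
     (\<lambda>x. gauss_density N (hermitian_of N x) * (\<Prod>k\<in>K. of_real (x (c k))))
     (of_real (Z * coord_moment N K c))"
proof -
  let ?I = "{..<N} \<times> {..<N}"
  let ?n = "\<lambda>e. card {k\<in>K. c k = e}"
  interpret product_sigma_finite "\<lambda>_ :: nat \<times> nat. lborel :: real measure" by standard
  have 1: "(\<Prod>k\<in>K. x (c k)) = (\<Prod>e\<in>?I. x e ^ ?n e)" for x :: "nat \<times> nat \<Rightarrow> real"
  proof -
    have "(\<Prod>e\<in>?I. x e ^ ?n e) = (\<Prod>e\<in>?I. \<Prod>k\<in>{k\<in>K. c k = e}. x (c k))"
      by (intro prod.cong) auto
    also have "\<dots> = (\<Prod>k\<in>K. x (c k))"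
      by (rule prod.group) (use assms(2,3) in blast)+
    finally show ?thesis by simp
  qed
  have 2: "gauss_density N (hermitian_of N x) * (\<Prod>k\<in>K. of_real (x (c k)))
     = of_real (\<Prod>e\<in>?I. coord_density N e (x e) * x e ^ ?n e)" for x
    unfolding gauss_density_hermitian of_real_prod[symmetric] of_real_mult[symmetric] 1
    by (simp only: prod.distrib)
  have int: "integrable lborel (\<lambda>t. coord_density N e t * t ^ p)" for e p
    using coord_density_moment[OF assms(1)] by (rule integrable.intros)
  have "has_bochner_integral (lebesgue_hermitian N) (\<lambda>x. \<Prod>e\<in>?I. coord_density N e (x e) * x e ^ ?n e)
      (Z * coord_moment N K c)"
    unfolding has_bochner_integral_iff
  proof
    show "integrable (lebesgue_hermitian N) (\<lambda>x. \<Prod>e\<in>?I. coord_density N e (x e) * x e ^ ?n e)"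
      unfolding lebesgue_hermitian_def by (rule product_integrable_prod) (auto intro: int)
    have "(\<integral>x. (\<Prod>e\<in>?I. coord_density N e (x e) * x e ^ ?n e) \<partial>lebesgue_hermitian N)
        = (\<Prod>e\<in>?I. \<integral>t. coord_density N e t * t ^ ?n e \<partial>lborel)"
      unfolding lebesgue_hermitian_def by (rule product_integral_prod) (auto intro: int)
    also have "\<dots> = Z * coord_moment N K c"
      unfolding Z_def coord_moment_def prod.distrib[symmetric]
      by (intro prod.cong refl has_bochner_integral_integral_eq coord_density_moment assms)
    finally show "(\<integral>x. (\<Prod>e\<in>?I. coord_density N e (x e) * x e ^ ?n e) \<partial>lebesgue_hermitian N)
      = Z * coord_moment N K c" .
  qed
  then show ?thesis unfolding 2 by (rule has_bochner_integral_of_real)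
qed

lemma coord_moment_empty: "coord_moment N {} c = 1"
  by (simp add: coord_moment_def gauss_moment_def)

lemma coord_moment_cong: "(\<And>k. k \<in> K \<Longrightarrow> c k = c' k) \<Longrightarrow> coord_moment N K c = coord_moment N K c'"
  unfolding coord_moment_def
  by (intro prod.cong refl arg_cong2[where f = gauss_moment] arg_cong[where f = card]) auto

text \<open>The normalized Gaussian expectation of the product of the entries
  \<open>(a k, b k)\<close>: multiplying out the linear forms, \<open>c\<close> selects one real
  coordinate for each factor.\<close>

definition entry_moment :: "nat \<Rightarrow> 'k set \<Rightarrow> ('k \<Rightarrow> nat) \<Rightarrow> ('k \<Rightarrow> nat) \<Rightarrow> complex" where
  "entry_moment N K a b = (\<Sum>c\<in>K \<rightarrow>\<^sub>E {..<N} \<times> {..<N}.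
     (\<Prod>k\<in>K. herm_coeff (a k) (b k) (c k)) * of_real (coord_moment N K c))"

lemma entry_moment_integral:
  assumes "N > 0" "finite K" "\<And>k. k \<in> K \<Longrightarrow> a k < N" "\<And>k. k \<in> K \<Longrightarrow> b k < N"
  defines "Z \<equiv> \<Prod>e\<in>{..<N} \<times> {..<N}. sqrt (2 * pi * (1 / (real N * herm_scale e)))"
  shows "has_bochner_integral (lebesgue_hermitian N)
     (\<lambda>x. gauss_density N (hermitian_of N x) * (\<Prod>k\<in>K. hermitian_of N x $$ (a k, b k)))
     (of_real Z * entry_moment N K a b)"
proof -
  let ?C = "K \<rightarrow>\<^sub>E {..<N} \<times> {..<N}"
  have "has_bochner_integral (lebesgue_hermitian N)
     (\<lambda>x. \<Sum>c\<in>?C. (\<Prod>k\<in>K. herm_coeff (a k) (b k) (c k)) *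
        (gauss_density N (hermitian_of N x) * (\<Prod>k\<in>K. of_real (x (c k)))))
     (\<Sum>c\<in>?C. (\<Prod>k\<in>K. herm_coeff (a k) (b k) (c k)) * of_real (Z * coord_moment N K c))"
    unfolding Z_def
    by (intro has_bochner_integral_sum has_bochner_integral_mult_right coord_moment_integral assms) auto
  also have "(\<lambda>x. \<Sum>c\<in>?C. (\<Prod>k\<in>K. herm_coeff (a k) (b k) (c k)) *
        (gauss_density N (hermitian_of N x) * (\<Prod>k\<in>K. of_real (x (c k)))))
    = (\<lambda>x. gauss_density N (hermitian_of N x) * (\<Prod>k\<in>K. hermitian_of N x $$ (a k, b k)))"
  proof
    fix x
    have "(\<Prod>k\<in>K. hermitian_of N x $$ (a k, b k))
        = (\<Prod>k\<in>K. \<Sum>e\<in>{..<N} \<times> {..<N}. herm_coeff (a k) (b k) e * of_real (x e))"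
      using assms by (intro prod.cong refl hermitian_of_entry) auto
    also have "\<dots> = (\<Sum>c\<in>?C. \<Prod>k\<in>K. herm_coeff (a k) (b k) (c k) * of_real (x (c k)))"
      using assms(2) by (intro prod_sum_PiE) auto
    finally show "(\<Sum>c\<in>?C. (\<Prod>k\<in>K. herm_coeff (a k) (b k) (c k)) *
        (gauss_density N (hermitian_of N x) * (\<Prod>k\<in>K. of_real (x (c k)))))
      = gauss_density N (hermitian_of N x) * (\<Prod>k\<in>K. hermitian_of N x $$ (a k, b k))"
      by (simp add: sum_distrib_left prod.distrib mult_ac)
  qed
  also have "(\<Sum>c\<in>?C. (\<Prod>k\<in>K. herm_coeff (a k) (b k) (c k)) * of_real (Z * coord_moment N K c))
     = of_real Z * entry_moment N K a b"
    by (simp add: entry_moment_def sum_distrib_left mult_ac)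
  finally show ?thesis .
qed

lemma sum_PiE_insert:
  assumes "k \<notin> K"
  shows "(\<Sum>c\<in>insert k K \<rightarrow>\<^sub>E A. f c) = (\<Sum>e\<in>A. \<Sum>c\<in>K \<rightarrow>\<^sub>E A. f (c(k := e)))"
proof -
  have "(\<Sum>c\<in>insert k K \<rightarrow>\<^sub>E A. f c) = (\<Sum>p\<in>A \<times> (K \<rightarrow>\<^sub>E A). f ((snd p)(k := fst p)))"
    unfolding PiE_insert_eq
    by (subst sum.reindex) (use inj_combinator[OF assms, of "\<lambda>_. A"] in \<open>auto simp: case_prod_unfold\<close>)
  then show ?thesis by (simp add: sum.cartesian_product case_prod_unfold)
qed

text \<open>Wick's recursion: \<open>k0\<close> is paired with each other factor and contributes the
  covariance of the two entries. It is inherited from the recursion for coordinates.\<close>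

lemma entry_moment_rec:
  assumes "finite K" "k0 \<notin> K"
    and ab: "\<And>k. k \<in> insert k0 K \<Longrightarrow> a k < N" "\<And>k. k \<in> insert k0 K \<Longrightarrow> b k < N"
  shows "entry_moment N (insert k0 K) a b =
    (\<Sum>k\<in>K. if b k0 = a k \<and> a k0 = b k then entry_moment N (K - {k}) a b / of_nat N else 0)"
proof -
  let ?I = "{..<N} \<times> {..<N}"
  let ?h = "\<lambda>k. herm_coeff (a k) (b k)"
  let ?P = "\<lambda>K c. (\<Prod>k\<in>K. ?h k (c k))"
  let ?s = "\<lambda>e. of_real (real N * herm_scale e) :: complex"
  have upd: "?P K (c(k0 := e)) = ?P K c" for c e
    using assms(2) by (intro prod.cong) auto
  have "entry_moment N (insert k0 K) a b
     = (\<Sum>e\<in>?I. \<Sum>c\<in>K \<rightarrow>\<^sub>E ?I. ?h k0 e * ?P K c * of_real (coord_moment N (insert k0 K) (c(k0 := e))))"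
    unfolding entry_moment_def sum_PiE_insert[OF assms(2)] using assms(1,2) upd by simp
  also have "\<dots> = (\<Sum>e\<in>?I. \<Sum>c\<in>K \<rightarrow>\<^sub>E ?I. \<Sum>k\<in>K.
      if c k = e then ?h k0 e * ?P K c * of_real (coord_moment N (K - {k}) c) / ?s e else 0)"
  proof (intro sum.cong refl)
    fix e c assume e: "e \<in> ?I" and c: "c \<in> K \<rightarrow>\<^sub>E ?I"
    have "coord_moment N (insert k0 K) (c(k0 := e)) =
       (\<Sum>k\<in>K. if c k = e then coord_moment N (K - {k}) c / (real N * herm_scale e) else 0)"
    proof -
      have "coord_moment N (K - {k}) (c(k0 := e)) = coord_moment N (K - {k}) c" for k
        using assms(2) by (intro coord_moment_cong) auto
      then show ?thesis
        using assms(2) e by (subst coord_moment_rec[OF assms(1,2)]) (auto intro!: sum.cong)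
    qed
    then show "?h k0 e * ?P K c * of_real (coord_moment N (insert k0 K) (c(k0 := e))) = (\<Sum>k\<in>K.
      if c k = e then ?h k0 e * ?P K c * of_real (coord_moment N (K - {k}) c) / ?s e else 0)"
      by (simp add: sum_distrib_left if_distrib[of of_real] if_distrib[of "(*) _"] cong: if_cong)
  qed
  \<comment> \<open>With \<open>e\<close> innermost, the sum over \<open>e\<close> collapses to
    \<open>e = c k\<close>: the two paired factors use the same real coordinate.\<close>
  also have "\<dots> = (\<Sum>k\<in>K. \<Sum>c\<in>K \<rightarrow>\<^sub>E ?I. \<Sum>e\<in>?I.
      if c k = e then ?h k0 e * ?P K c * of_real (coord_moment N (K - {k}) c) / ?s e else 0)"
  proof -
    have "(\<Sum>e\<in>?I. \<Sum>c\<in>K \<rightarrow>\<^sub>E ?I. \<Sum>k\<in>K. f e c k) = (\<Sum>k\<in>K. \<Sum>c\<in>K \<rightarrow>\<^sub>E ?I. \<Sum>e\<in>?I. f e c k)"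
      for f :: "nat \<times> nat \<Rightarrow> ('a \<Rightarrow> nat \<times> nat) \<Rightarrow> 'a \<Rightarrow> complex"
    proof -
      have "(\<Sum>e\<in>?I. \<Sum>c\<in>K \<rightarrow>\<^sub>E ?I. \<Sum>k\<in>K. f e c k) = (\<Sum>e\<in>?I. \<Sum>k\<in>K. \<Sum>c\<in>K \<rightarrow>\<^sub>E ?I. f e c k)"
        by (intro sum.cong refl sum.swap)
      also have "\<dots> = (\<Sum>k\<in>K. \<Sum>e\<in>?I. \<Sum>c\<in>K \<rightarrow>\<^sub>E ?I. f e c k)" by (rule sum.swap)
      also have "\<dots> = (\<Sum>k\<in>K. \<Sum>c\<in>K \<rightarrow>\<^sub>E ?I. \<Sum>e\<in>?I. f e c k)"
        by (intro sum.cong refl sum.swap)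
      finally show ?thesis .
    qed
    then show ?thesis .
  qed
  also have "\<dots> = (\<Sum>k\<in>K. \<Sum>c\<in>K \<rightarrow>\<^sub>E ?I.
      ?h k0 (c k) * ?P K c * of_real (coord_moment N (K - {k}) c) / ?s (c k))"
  proof (intro sum.cong refl)
    fix k c assume "k \<in> K" "c \<in> K \<rightarrow>\<^sub>E ?I"
    then have "c k \<in> ?I" by blast
    then show "(\<Sum>e\<in>?I. if c k = e then ?h k0 e * ?P K c * of_real (coord_moment N (K - {k}) c) / ?s e else 0)
      = ?h k0 (c k) * ?P K c * of_real (coord_moment N (K - {k}) c) / ?s (c k)"
      by (subst sum.delta') auto
  qed
  also have "\<dots> = (\<Sum>k\<in>K. if b k0 = a k \<and> a k0 = b k then entry_moment N (K - {k}) a b / of_nat N else 0)"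
  proof (intro sum.cong refl)
    fix k assume k: "k \<in> K"
    define K' where "K' = K - {k}"
    have K': "K = insert k K'" "k \<notin> K'" "finite K'" using k assms(1) by (auto simp: K'_def)
    have upd: "?P K' (c(k := e)) = ?P K' c" "coord_moment N K' (c(k := e)) = coord_moment N K' c" for c e
      using K'(2) by (auto intro!: prod.cong coord_moment_cong)
    \<comment> \<open>Separating the coordinate \<open>e\<close> of \<open>k\<close> from the
      coordinates of \<open>K'\<close> turns the sum over \<open>e\<close> into the covariance of
      the entries of \<open>k0\<close> and \<open>k\<close>.\<close>
    have "(\<Sum>c\<in>K \<rightarrow>\<^sub>E ?I. ?h k0 (c k) * ?P K c * of_real (coord_moment N K' c) / ?s (c k))
       = (\<Sum>e\<in>?I. \<Sum>c\<in>K' \<rightarrow>\<^sub>E ?I. ?h k0 e * ?h k e / ?s e * (?P K' c * of_real (coord_moment N K' c)))"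
      unfolding K'(1) sum_PiE_insert[OF K'(2)] using K'(2,3) upd by (simp add: mult_ac)
    also have "\<dots> = (\<Sum>e\<in>?I. ?h k0 e * ?h k e / of_real (herm_scale e)) / of_nat N * entry_moment N K' a b"
      unfolding entry_moment_def sum_divide_distrib sum_product
      by (intro sum.cong refl) (simp add: mult_ac)
    also have "(\<Sum>e\<in>?I. ?h k0 e * ?h k e / of_real (herm_scale e)) = (if b k0 = a k \<and> a k0 = b k then 1 else 0)"
      using k ab by (intro herm_coeff_covariance) auto
    finally show "(\<Sum>c\<in>K \<rightarrow>\<^sub>E ?I. ?h k0 (c k) * ?P K c * of_real (coord_moment N (K - {k}) c) / ?s (c k))
       = (if b k0 = a k \<and> a k0 = b k then entry_moment N (K - {k}) a b / of_nat N else 0)"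
      by (simp add: K'_def)
  qed
  finally show ?thesis .
qed

section \<open>Fixed-point-free involutions and Wick's formula\<close>

definition pairings :: "'h set \<Rightarrow> ('h \<Rightarrow> 'h) set" where
  "pairings H = {\<alpha>. \<alpha> permutes H \<and> (\<forall>x\<in>H. \<alpha> x \<noteq> x \<and> \<alpha> (\<alpha> x) = x)}"

lemma finite_pairings: "finite H \<Longrightarrow> finite (pairings H)"
  by (rule finite_subset[OF _ finite_permutations[of H]]) (auto simp: pairings_def)

lemma pairings_empty [simp]: "pairings {} = {id}"
  by (auto simp: pairings_def permutes_empty)

text \<open>Deleting \<open>h0\<close> and its partner \<open>h\<close> leaves a pairing of the
  rest. That pairing fixes both points, so composition with the transposition restores the pair, and
  a second composition removes it again.\<close>

lemma pairings_split:
  assumes "h0 \<notin> H"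
  shows "bij_betw (\<lambda>(h, \<alpha>). \<alpha> \<circ> Transposition.transpose h0 h) (SIGMA h:H. pairings (H - {h})) (pairings (insert h0 H))"
proof (rule bij_betwI[where g = "\<lambda>\<alpha>. (\<alpha> h0, \<alpha> \<circ> Transposition.transpose h0 (\<alpha> h0))"])
  have fix_out: "\<alpha> h0 = h0" "\<alpha> h = h" if "\<alpha> \<in> pairings (H - {h})" for \<alpha> h
    using that assms by (auto simp: pairings_def permutes_def)
  have into: "\<alpha> x \<in> H \<and> \<alpha> x \<noteq> h" if "\<alpha> \<in> pairings (H - {h})" "x \<in> H" "x \<noteq> h" for \<alpha> h x
    using that permutes_in_image[of \<alpha> "H - {h}" x] by (auto simp: pairings_def)
  show "(\<lambda>(h, \<alpha>). \<alpha> \<circ> Transposition.transpose h0 h) \<in> (SIGMA h:H. pairings (H - {h})) \<rightarrow> pairings (insert h0 H)"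
  proof safe
    fix h \<alpha> assume h: "h \<in> H" and \<alpha>: "\<alpha> \<in> pairings (H - {h})"
    have p: "\<alpha> \<circ> Transposition.transpose h0 h permutes insert h0 H"
    proof (rule permutes_compose)
      show "Transposition.transpose h0 h permutes insert h0 H" using h by (intro permutes_swap_id) auto
      show "\<alpha> permutes insert h0 H" using \<alpha> by (auto simp: pairings_def intro: permutes_subset)
    qed
    have "(\<alpha> \<circ> Transposition.transpose h0 h) x \<noteq> x \<and> (\<alpha> \<circ> Transposition.transpose h0 h) ((\<alpha> \<circ> Transposition.transpose h0 h) x) = x"
      if x: "x \<in> insert h0 H" for x
    proof -
      consider "x = h0" | "x = h" | "x \<in> H" "x \<noteq> h" using x by blast
      then show ?thesis
      proof cases
        case 3
        then have "x \<noteq> h0" "\<alpha> x \<noteq> h0" "\<alpha> x \<noteq> h" using assms into[OF \<alpha>, of x] by auto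
        moreover have "\<alpha> x \<noteq> x" "\<alpha> (\<alpha> x) = x" using 3 \<alpha> by (auto simp: pairings_def)
        ultimately show ?thesis using 3 by simp
      next
        case 1
        have "h \<noteq> h0" using h assms by blast
        then show ?thesis using 1 fix_out[OF \<alpha>] by simp
      next
        case 2
        have "h \<noteq> h0" using h assms by blast
        then show ?thesis using 2 fix_out[OF \<alpha>] by simp
      qed
    qed
    then show "\<alpha> \<circ> Transposition.transpose h0 h \<in> pairings (insert h0 H)" using p unfolding pairings_def by blast
  qed
  show "(\<lambda>\<alpha>. (\<alpha> h0, \<alpha> \<circ> Transposition.transpose h0 (\<alpha> h0))) \<in> pairings (insert h0 H) \<rightarrow> (SIGMA h:H. pairings (H - {h}))"
  proof
    fix \<alpha> assume \<alpha>: "\<alpha> \<in> pairings (insert h0 H)"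
    then have p: "\<alpha> permutes insert h0 H" and i: "\<And>x. x \<in> insert h0 H \<Longrightarrow> \<alpha> x \<noteq> x \<and> \<alpha> (\<alpha> x) = x"
      by (auto simp: pairings_def)
    let ?h = "\<alpha> h0"
    have h: "?h \<in> H" using permutes_in_image[OF p, of h0] i[of h0] by auto
    have inj: "\<alpha> x = \<alpha> y \<longleftrightarrow> x = y" for x y by (rule inj_eq[OF permutes_inj[OF p]])
    have p': "\<alpha> \<circ> Transposition.transpose h0 ?h permutes (H - {?h})"
    proof (rule permutes_superset[where S = "insert h0 H"])
      show "\<alpha> \<circ> Transposition.transpose h0 ?h permutes insert h0 H"
        using h by (intro permutes_compose[OF permutes_swap_id p]) auto
      show "(\<alpha> \<circ> Transposition.transpose h0 ?h) x = x" if "x \<in> insert h0 H - (H - {?h})" for x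
      proof -
        have "x = h0 \<or> x = ?h" using that by blast
        then show ?thesis using i[of h0] by (elim disjE) simp_all
      qed
    qed
    have "(\<alpha> \<circ> Transposition.transpose h0 ?h) x \<noteq> x \<and> (\<alpha> \<circ> Transposition.transpose h0 ?h) ((\<alpha> \<circ> Transposition.transpose h0 ?h) x) = x"
      if "x \<in> H - {?h}" for x
    proof -
      have x: "x \<noteq> h0" "x \<noteq> ?h" "x \<in> insert h0 H" using that assms by blast+
      have "\<alpha> x \<noteq> h0" using i[OF x(3)] x(2) by metis
      moreover have "\<alpha> x \<noteq> ?h" using inj x(1) by blast
      ultimately show ?thesis using i[OF x(3)] x by simp
    qed
    then show "(?h, \<alpha> \<circ> Transposition.transpose h0 ?h) \<in> (SIGMA h:H. pairings (H - {h}))"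
      using h p' by (auto simp: pairings_def)
  qed
  show "(\<lambda>\<alpha>. (\<alpha> h0, \<alpha> \<circ> Transposition.transpose h0 (\<alpha> h0))) ((\<lambda>(h, \<alpha>). \<alpha> \<circ> Transposition.transpose h0 h) p) = p"
    if p: "p \<in> (SIGMA h:H. pairings (H - {h}))" for p
  proof -
    obtain h \<alpha> where h: "p = (h, \<alpha>)" "h \<in> H" "\<alpha> \<in> pairings (H - {h})" using p by blast
    then show ?thesis using fix_out[OF h(3)] by (simp add: comp_assoc)
  qed
  show "(\<lambda>(h, \<alpha>). \<alpha> \<circ> Transposition.transpose h0 h) (\<alpha> h0, \<alpha> \<circ> Transposition.transpose h0 (\<alpha> h0)) = \<alpha>"
    if "\<alpha> \<in> pairings (insert h0 H)" for \<alpha>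
    by (simp add: comp_assoc)
qed

text \<open>The recursion chooses a partner for one factor at a time, contributing
  \<open>1 / N\<close> and matching the indices of both; \<open>pairings_split\<close> collects
  these choices into pairings. For an odd number of factors there is no pairing and both sides
  vanish.\<close>

lemma entry_moment_wick:
  assumes "finite H" "\<And>h. h \<in> H \<Longrightarrow> a h < N" "\<And>h. h \<in> H \<Longrightarrow> b h < N"
  shows "entry_moment N H a b
    = (\<Sum>\<alpha>\<in>pairings H. if \<forall>h\<in>H. b h = a (\<alpha> h) then 1 / of_nat N ^ (card H div 2) else 0)"
  using assms
proof (induction "card H" arbitrary: H rule: less_induct)
  case less
  show ?case
  proof (cases "H = {}")
    case True
    then show ?thesis by (simp add: entry_moment_def coord_moment_empty)
  next
    case False
    then obtain h0 where h0: "h0 \<in> H" by blast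
    define K where "K = H - {h0}"
    have K: "H = insert h0 K" "h0 \<notin> K" "finite K" using h0 less.prems by (auto simp: K_def)
    let ?f = "\<lambda>H \<alpha>. if \<forall>h\<in>H. b h = a (\<alpha> h) then 1 / of_nat N ^ (card H div 2) else 0 :: complex"
    have step: "(if b h0 = a h \<and> a h0 = b h then entry_moment N (K - {h}) a b / of_nat N else 0)
       = (\<Sum>\<alpha>\<in>pairings (K - {h}). ?f H (\<alpha> \<circ> Transposition.transpose h0 h))" if h: "h \<in> K" for h
    proof -
      have IH: "entry_moment N (K - {h}) a b = (\<Sum>\<alpha>\<in>pairings (K - {h}). ?f (K - {h}) \<alpha>)"
        using K h less.prems by (intro less.hyps) (auto simp: card_gt_0_iff intro: le_less_trans[OF card_Diff1_le])
      have c: "card H div 2 = Suc (card (K - {h}) div 2)"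
      proof -
        have "card H = card (K - {h}) + 2" using K h card_Suc_Diff1[of K h] by simp
        then show ?thesis by simp
      qed
      have "?f H (\<alpha> \<circ> Transposition.transpose h0 h) = (if b h0 = a h \<and> a h0 = b h then ?f (K - {h}) \<alpha> / of_nat N else 0)"
        if \<alpha>: "\<alpha> \<in> pairings (K - {h})" for \<alpha>
      proof -
        have fx: "\<alpha> h0 = h0" "\<alpha> h = h" using \<alpha> K by (auto simp: pairings_def permutes_def)
        have "(\<forall>h'\<in>H. b h' = a ((\<alpha> \<circ> Transposition.transpose h0 h) h'))
          \<longleftrightarrow> b h0 = a h \<and> b h = a h0 \<and> (\<forall>h'\<in>K - {h}. b h' = a (\<alpha> h'))"
        proof -
          have H: "H = insert h0 (insert h (K - {h}))" using K(1) h by blast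
          have "(\<alpha> \<circ> Transposition.transpose h0 h) h' = \<alpha> h'" if "h' \<in> K - {h}" for h'
          proof -
            have "h' \<noteq> h0" "h' \<noteq> h" using that K(2) by blast+
            then show ?thesis by simp
          qed
          then have "(\<forall>h'\<in>K - {h}. b h' = a ((\<alpha> \<circ> Transposition.transpose h0 h) h')) \<longleftrightarrow> (\<forall>h'\<in>K - {h}. b h' = a (\<alpha> h'))"
            by simp
          moreover have "(\<forall>h'\<in>H. P h') \<longleftrightarrow> P h0 \<and> P h \<and> (\<forall>h'\<in>K - {h}. P h')" for P
            by (subst H) blast
          ultimately show ?thesis using fx by simp
        qed
        then show ?thesis unfolding c by simp
      qed
      then have "(\<Sum>\<alpha>\<in>pairings (K - {h}). ?f H (\<alpha> \<circ> Transposition.transpose h0 h))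
         = (\<Sum>\<alpha>\<in>pairings (K - {h}). if b h0 = a h \<and> a h0 = b h then ?f (K - {h}) \<alpha> / of_nat N else 0)"
        by (intro sum.cong) auto
      then show ?thesis
        unfolding IH by (cases "b h0 = a h \<and> a h0 = b h") (simp_all only: sum_divide_distrib simp_thms if_True if_False sum.neutral_const)
    qed
    have "entry_moment N H a b = (\<Sum>h\<in>K. \<Sum>\<alpha>\<in>pairings (K - {h}). ?f H (\<alpha> \<circ> Transposition.transpose h0 h))"
      using K less.prems step by (subst K(1), subst entry_moment_rec) (auto intro!: sum.cong)
    also have "\<dots> = (\<Sum>p\<in>(SIGMA h:K. pairings (K - {h})). ?f H (case p of (h, \<alpha>) \<Rightarrow> \<alpha> \<circ> Transposition.transpose h0 h))"
      using K(3) by (subst sum.Sigma) (auto simp: finite_pairings case_prod_unfold)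
    also have "\<dots> = (\<Sum>\<alpha>\<in>pairings H. ?f H \<alpha>)"
      unfolding K(1) by (rule sum.reindex_bij_betw[OF pairings_split[OF K(2)]])
    finally show ?thesis .
  qed
qed

text \<open>Stated for finite linear combinations of monomials: \<open>gauss_expectation\<close> is
  a quotient of integrals, and its linearity rests on the integrability of each term.\<close>

lemma gauss_expectation_wick:
  assumes "N > 0" "finite H" "finite I"
    and "\<And>i h. i \<in> I \<Longrightarrow> h \<in> H \<Longrightarrow> a i h < N" "\<And>i h. i \<in> I \<Longrightarrow> h \<in> H \<Longrightarrow> b i h < N"
  shows "gauss_expectation N (\<lambda>M. \<Sum>i\<in>I. c i * (\<Prod>h\<in>H. M $$ (a i h, b i h)))
    = (\<Sum>i\<in>I. c i * (\<Sum>\<alpha>\<in>pairings H. if \<forall>h\<in>H. b i h = a i (\<alpha> h) then 1 / of_nat N ^ (card H div 2) else 0))"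
proof -
  define Z where "Z = (\<Prod>e\<in>{..<N} \<times> {..<N}. sqrt (2 * pi * (1 / (real N * herm_scale e))))"
  have Z: "Z > 0" unfolding Z_def using assms(1) by (intro prod_pos) (auto simp: herm_scale_def)
  have "has_bochner_integral (lebesgue_hermitian N)
     (\<lambda>x. \<Sum>i\<in>I. c i * (gauss_density N (hermitian_of N x) * (\<Prod>h\<in>H. hermitian_of N x $$ (a i h, b i h))))
     (\<Sum>i\<in>I. c i * (of_real Z * entry_moment N H (a i) (b i)))"
    unfolding Z_def using assms
    by (intro has_bochner_integral_sum has_bochner_integral_mult_right entry_moment_integral) auto
  moreover have "(\<lambda>x. \<Sum>i\<in>I. c i * (gauss_density N (hermitian_of N x) * (\<Prod>h\<in>H. hermitian_of N x $$ (a i h, b i h))))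
     = (\<lambda>x. gauss_density N (hermitian_of N x) * (\<Sum>i\<in>I. c i * (\<Prod>h\<in>H. hermitian_of N x $$ (a i h, b i h))))"
    by (simp add: sum_distrib_left mult_ac)
  moreover have "has_bochner_integral (lebesgue_hermitian N)
     (\<lambda>x. gauss_density N (hermitian_of N x)) (of_real Z)"
    using entry_moment_integral[OF assms(1), of "{}", folded Z_def]
    by (simp add: entry_moment_def coord_moment_empty)
  ultimately have "gauss_expectation N (\<lambda>M. \<Sum>i\<in>I. c i * (\<Prod>h\<in>H. M $$ (a i h, b i h)))
     = (\<Sum>i\<in>I. c i * (of_real Z * entry_moment N H (a i) (b i))) / of_real Z"
    unfolding gauss_expectation_def by (simp add: has_bochner_integral_integral_eq)
  also have "\<dots> = (\<Sum>i\<in>I. c i * entry_moment N H (a i) (b i))"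
    using Z by (simp add: sum_divide_distrib)
  also have "\<dots> = (\<Sum>i\<in>I. c i * (\<Sum>\<alpha>\<in>pairings H. if \<forall>h\<in>H. b i h = a i (\<alpha> h) then 1 / of_nat N ^ (card H div 2) else 0))"
    using assms by (intro sum.cong refl arg_cong2[where f = "(*)"] entry_moment_wick) auto
  finally show ?thesis .
qed

section \<open>Cycles of permutations\<close>

lemma orbit_subset_closed:
  assumes "\<And>y. y \<in> X \<Longrightarrow> p y \<in> X" "x \<in> X"
  shows "orbit p x \<subseteq> X"
proof
  fix y assume "y \<in> orbit p x"
  then show "y \<in> X" by induction (use assms in auto)
qed

lemma orbit_eq_iff:
  assumes "permutation p"
  shows "orbit p x = orbit p y \<longleftrightarrow> y \<in> orbit p x"
  using orbit_cyclic_eq3[OF cyclic_on_orbit'[OF assms, of x], of y] permutation_self_in_orbit[OF assms, of y]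
  by auto

lemma orbit_disjoint:
  assumes "permutation p" "y \<notin> orbit p x"
  shows "orbit p x \<inter> orbit p y = {}"
proof (rule ccontr)
  assume "orbit p x \<inter> orbit p y \<noteq> {}"
  then obtain z where "z \<in> orbit p x" "z \<in> orbit p y" by blast
  then have "orbit p x = orbit p y" using orbit_eq_iff[OF assms(1)] by metis
  then show False using assms orbit_eq_iff[OF assms(1)] by metis
qed

lemma permutes_permutation: "p permutes H \<Longrightarrow> finite H \<Longrightarrow> permutation p"
  by (auto simp: permutation_permutes)

lemma partition_on_cycles:
  assumes "p permutes H" "finite H"
  shows "partition_on H (cycles_on H p)"
proof (rule partition_onI)
  note perm = permutes_permutation[OF assms]
  show "\<Union> (cycles_on H p) = H"
    using permutes_orbit_subset[OF assms(1)] permutation_self_in_orbit[OF perm]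
    by (auto simp: cycles_on_def)
  show "{} \<notin> cycles_on H p"
    using permutation_self_in_orbit[OF perm] by (auto simp: cycles_on_def)
  show "disjnt c d" if "c \<in> cycles_on H p" "d \<in> cycles_on H p" "c \<noteq> d" for c d
  proof -
    obtain x y where "c = orbit p x" "d = orbit p y" using \<open>c \<in> _\<close> \<open>d \<in> _\<close> by (auto simp: cycles_on_def)
    then show ?thesis using \<open>c \<noteq> d\<close> orbit_disjoint[OF perm] orbit_eq_iff[OF perm] by (metis disjnt_def)
  qed
qed

lemma in_cycles_onD: "p permutes H \<Longrightarrow> finite H \<Longrightarrow> c \<in> cycles_on H p \<Longrightarrow> x \<in> c \<Longrightarrow> c = orbit p x"
  unfolding cycles_on_def using orbit_eq_iff[OF permutes_permutation] by (metis imageE)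

lemma orbit_cong_on_closed:
  assumes "\<And>y. y \<in> X \<Longrightarrow> p y \<in> X" "\<And>y. y \<in> X \<Longrightarrow> q y = p y" "x \<in> X"
  shows "orbit q x = orbit p x"
  using assms by (intro orbit_cong0[symmetric, of x X p q]) auto

context
  fixes p q :: "'a \<Rightarrow> 'a" and x y :: 'a
  assumes perm: "permutation p" and xy: "x \<noteq> y" and q: "q = p \<circ> Transposition.transpose x y"
begin

private lemma perm_q: "permutation q"
  unfolding q using perm by (intro permutation_compose permutation_swap_id)

private lemma q_other: "z \<noteq> x \<Longrightarrow> z \<noteq> y \<Longrightarrow> q z = p z"
  by (simp add: q)

private lemma q_x: "q x = p y" and q_y: "q y = p x"
  by (simp_all add: q)

text \<open>The cycle of \<open>y\<close> under \<open>p\<close> avoids \<open>x\<close>. Starting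
  from \<open>q x = p y\<close>, the map \<open>q\<close> follows that cycle as far as
  \<open>y\<close>.\<close>

lemma orbit_transpose_merge:
  assumes "y \<notin> orbit p x"
  shows "y \<in> orbit q x"
proof (rule ccontr)
  assume y: "y \<notin> orbit q x"
  have x: "x \<notin> orbit p y" using assms orbit_eq_iff[OF perm] permutation_self_in_orbit[OF perm] by metis
  have "orbit p (p y) \<subseteq> orbit p y \<inter> orbit q x"
  proof (rule orbit_subset_closed)
    show "p y \<in> orbit p y \<inter> orbit q x" using orbit.base[of q x] q_x by (auto intro: orbit.base)
    fix z assume z: "z \<in> orbit p y \<inter> orbit q x"
    then have "q z = p z" using x y by (intro q_other) auto
    then show "p z \<in> orbit p y \<inter> orbit q x" using z orbit.step[of z q x] by (auto intro: orbit.step)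
  qed
  moreover have "y \<in> orbit p (p y)"
    using orbit_eq_iff[OF perm, of y "p y"] permutation_self_in_orbit[OF perm, of y] orbit.base[of p y] by simp
  ultimately show False using y by blast
qed

text \<open>The stretch of the \<open>p\<close>-cycle from \<open>p x\<close> to the first visit of
  \<open>y\<close> is closed under \<open>q\<close>, because \<open>q y = p x\<close>. It contains
  \<open>y\<close> but not \<open>x\<close>.\<close>

lemma orbit_transpose_split:
  assumes "y \<in> orbit p x"
  shows "y \<notin> orbit q x"
proof
  assume yq: "y \<in> orbit q x"
  define j where "j = (LEAST j. j > 0 \<and> (p ^^ j) x = y)"
  have j: "j > 0" "(p ^^ j) x = y" and least: "\<And>i. i > 0 \<Longrightarrow> (p ^^ i) x = y \<Longrightarrow> j \<le> i"
  proof -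
    obtain i where "i > 0 \<and> (p ^^ i) x = y" using assms by (auto simp: orbit_altdef)
    then have "j > 0 \<and> (p ^^ j) x = y" unfolding j_def by (rule LeastI)
    then show "j > 0" "(p ^^ j) x = y" by simp_all
  next
    fix i assume "i > 0" "(p ^^ i) x = y" then show "j \<le> i" unfolding j_def by (auto intro: Least_le)
  qed
  define S where "S = (\<lambda>i. (p ^^ i) x) ` {1..j}"
  \<comment> \<open>A return to \<open>x\<close> at time \<open>i\<close> would mean that
    \<open>y\<close> is reached already at time \<open>j - i\<close>.\<close>
  have xS: "x \<notin> S"
  proof
    assume "x \<in> S"
    then obtain i where i: "1 \<le> i" "i \<le> j" "(p ^^ i) x = x" by (auto simp: S_def)
    then have "i < j" using j xy by (cases "i = j") auto
    moreover have "(p ^^ (j - i)) x = y"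
      using j(2) i \<open>i < j\<close> funpow_add[of "j - i" i p] by (simp add: fun_eq_iff)
    ultimately show False using least[of "j - i"] i by simp
  qed
  have "orbit q y \<subseteq> S"
  proof (rule orbit_subset_closed)
    show "y \<in> S" using j by (auto simp: S_def)
    fix z assume "z \<in> S"
    then obtain i where i: "1 \<le> i" "i \<le> j" "z = (p ^^ i) x" by (auto simp: S_def)
    show "q z \<in> S"
    proof (cases "i = j")
      case True
      then have "q z = (p ^^ 1) x" using i j q_y by simp
      then show ?thesis using j(1) unfolding S_def by (intro image_eqI[where x = 1]) auto
    next
      case False
      then have "z \<noteq> y" using least[of i] i by auto
      moreover have "z \<noteq> x" using xS \<open>z \<in> S\<close> by blast
      ultimately have "q z = (p ^^ Suc i) x" using i q_other by simp
      then show ?thesis using i False unfolding S_def by (intro image_eqI[where x = "Suc i"]) auto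
    qed
  qed
  moreover have "x \<in> orbit q y" using yq orbit_eq_iff[OF perm_q] permutation_self_in_orbit[OF perm_q] by metis
  ultimately show False using xS by blast
qed

text \<open>The cycles through neither \<open>x\<close> nor \<open>y\<close> are common to
  \<open>p\<close> and \<open>q\<close>. All other points form one cycle or two, and the
  transposition exchanges these two situations.\<close>

lemma card_cycles_transpose:
  assumes "p permutes H" "finite H" "x \<in> H" "y \<in> H"
  shows "int (card (cycles_on H q)) = int (card (cycles_on H p)) + (if y \<in> orbit p x then 1 else - 1)"
proof -
  have qH: "q permutes H" unfolding q using assms by (intro permutes_compose[OF permutes_swap_id]) auto
  define A where "A = (\<lambda>p. {c \<in> cycles_on H p. x \<notin> c \<and> y \<notin> c})"
  have split: "card (cycles_on H r) = card (A r) + (if y \<in> orbit r x then 1 else 2)"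
    if r: "r permutes H" for r
  proof -
    note perm_r = permutes_permutation[OF r assms(2)]
    note self = permutation_self_in_orbit[OF perm_r]
    have "cycles_on H r = A r \<union> {orbit r x, orbit r y}"
    proof (intro equalityI subsetI)
      fix c assume "c \<in> cycles_on H r"
      then show "c \<in> A r \<union> {orbit r x, orbit r y}"
        using in_cycles_onD[OF r assms(2), of c] unfolding A_def by blast
    next
      fix c assume "c \<in> A r \<union> {orbit r x, orbit r y}"
      then show "c \<in> cycles_on H r" using assms(3,4) unfolding A_def cycles_on_def by blast
    qed
    moreover have "A r \<inter> {orbit r x, orbit r y} = {}" using self by (auto simp: A_def)
    moreover have "finite (A r)" using assms(2) by (auto simp: A_def cycles_on_def)
    ultimately have "card (cycles_on H r) = card (A r) + card {orbit r x, orbit r y}"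
      by (simp only: card_Un_disjoint finite.intros)
    then show ?thesis using orbit_eq_iff[OF perm_r, of x y] by auto
  qed
  have "A q = A p"
  proof -
    have qp: "orbit q z = orbit p z" if "x \<notin> orbit p z" "y \<notin> orbit p z" for z
    proof (rule orbit_cong_on_closed[where X = "orbit p z"])
      fix v assume "v \<in> orbit p z"
      then have "v \<noteq> x" "v \<noteq> y" using that by auto
      then show "q v = p v" by (rule q_other)
    qed (auto intro: orbit.step permutation_self_in_orbit[OF perm])
    have pq: "orbit p z = orbit q z" if "x \<notin> orbit q z" "y \<notin> orbit q z" for z
    proof (rule orbit_cong_on_closed[where X = "orbit q z"])
      fix v assume "v \<in> orbit q z"
      then have "v \<noteq> x" "v \<noteq> y" using that by auto
      then show "p v = q v" by (simp add: q_other)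
    qed (auto intro: orbit.step permutation_self_in_orbit[OF perm_q])
    show ?thesis
    proof (intro equalityI subsetI)
      fix c assume "c \<in> A q"
      then obtain z where z: "z \<in> H" "c = orbit q z" "x \<notin> c" "y \<notin> c" unfolding A_def cycles_on_def by blast
      then have "c = orbit p z" using pq[of z] by simp
      then show "c \<in> A p" using z unfolding A_def cycles_on_def by blast
    next
      fix c assume "c \<in> A p"
      then obtain z where z: "z \<in> H" "c = orbit p z" "x \<notin> c" "y \<notin> c" unfolding A_def cycles_on_def by blast
      then have "c = orbit q z" using qp[of z] by simp
      then show "c \<in> A q" using z unfolding A_def cycles_on_def by blast
    qed
  qed
  moreover have "y \<in> orbit q x \<longleftrightarrow> y \<notin> orbit p x"
    using orbit_transpose_merge orbit_transpose_split by blast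
  ultimately show ?thesis using split[OF assms(1)] split[OF qH] by auto
qed

end

text \<open>Starting from \<open>\<phi>\<close>, the transpositions of \<open>\<alpha>\<close> are multiplied on one at a time, while
  \<open>P\<close> keeps track of the blocks connected so far. A transposition joining two blocks of \<open>P\<close>
  necessarily merges two cycles.\<close>

lemma cycles_compose_involution:
  fixes H :: "'a set"
  assumes "finite H" "\<phi> permutes H" "partition_on H P0" "\<And>B z. B \<in> P0 \<Longrightarrow> z \<in> B \<Longrightarrow> \<phi> z \<in> B"
    and "\<alpha> permutes H" "\<And>z. \<alpha> (\<alpha> z) = z"
  shows "\<exists>P. partition_on H P \<and> (\<forall>B\<in>P0. \<exists>B'\<in>P. B \<subseteq> B') \<and> (\<forall>B\<in>P. \<forall>z\<in>B. \<alpha> z \<in> B) \<and>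
    card (cycles_on H (\<phi> \<circ> \<alpha>)) + 2 * card P0 \<le> card (cycles_on H \<phi>) + card {z. \<alpha> z \<noteq> z} div 2 + 2 * card P \<and>
    even (card (cycles_on H (\<phi> \<circ> \<alpha>)) + card (cycles_on H \<phi>) + card {z. \<alpha> z \<noteq> z} div 2)"
  using assms(5,6)
proof (induction "card {z. \<alpha> z \<noteq> z}" arbitrary: \<alpha> rule: less_induct)
  case less
  have fin: "finite {z. \<alpha> z \<noteq> z}"
    using assms(1) by (rule finite_subset[rotated]) (use less.prems in \<open>auto simp: permutes_def\<close>)
  show ?case
  proof (cases "\<exists>x. \<alpha> x \<noteq> x")
    case False
    then have "\<alpha> = id" by auto
    then show ?thesis using assms(3) by (intro exI[of _ P0]) auto
  next
    case True
    then obtain x y where x: "\<alpha> x = y" "x \<noteq> y" by metis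
    have y: "\<alpha> y = x" using less.prems(2)[of x] x by simp
    have xH: "x \<in> H" "y \<in> H"
      using x y less.prems(1) by (metis permutes_not_in)+
    define \<alpha>' where "\<alpha>' = \<alpha> \<circ> Transposition.transpose x y"
    have \<alpha>'x: "\<alpha>' x = x" "\<alpha>' y = y" using x y by (simp_all add: \<alpha>'_def)
    have \<alpha>'z: "\<alpha>' z = \<alpha> z" if "z \<noteq> x" "z \<noteq> y" for z using that by (simp add: \<alpha>'_def)
    have \<alpha>: "\<alpha> = \<alpha>' \<circ> Transposition.transpose x y" by (simp add: \<alpha>'_def comp_assoc)
    have perm': "\<alpha>' permutes H"
      unfolding \<alpha>'_def using xH less.prems(1) by (intro permutes_compose[OF permutes_swap_id])
    have inv': "\<alpha>' (\<alpha>' z) = z" for z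
    proof -
      consider "z = x" | "z = y" | "z \<noteq> x" "z \<noteq> y" by blast
      then show ?thesis
      proof cases
        case 3
        then have "\<alpha> z \<noteq> x" "\<alpha> z \<noteq> y" using less.prems(2)[of z] x y by metis+
        then show ?thesis using 3 less.prems(2)[of z] by (simp add: \<alpha>'z)
      qed (simp_all add: \<alpha>'x)
    qed
    have supp: "{z. \<alpha> z \<noteq> z} = insert x (insert y {z. \<alpha>' z \<noteq> z})"
    proof (rule Set.set_eqI)
      fix z show "z \<in> {z. \<alpha> z \<noteq> z} \<longleftrightarrow> z \<in> insert x (insert y {z. \<alpha>' z \<noteq> z})"
        using x y \<alpha>'z[of z] by (cases "z = x \<or> z = y") auto
    qed
    have c: "card {z. \<alpha> z \<noteq> z} = card {z. \<alpha>' z \<noteq> z} + 2"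
    proof -
      have "finite {z. \<alpha>' z \<noteq> z}" using fin supp by (metis finite_insert)
      then show ?thesis using supp \<alpha>'x x(2) by simp
    qed
    obtain P where P: "partition_on H P" "\<forall>B\<in>P0. \<exists>B'\<in>P. B \<subseteq> B'" "\<forall>B\<in>P. \<forall>z\<in>B. \<alpha>' z \<in> B"
      "card (cycles_on H (\<phi> \<circ> \<alpha>')) + 2 * card P0 \<le> card (cycles_on H \<phi>) + card {z. \<alpha>' z \<noteq> z} div 2 + 2 * card P"
      "even (card (cycles_on H (\<phi> \<circ> \<alpha>')) + card (cycles_on H \<phi>) + card {z. \<alpha>' z \<noteq> z} div 2)"
      using less.hyps[OF _ perm' inv'] c by auto
    have finP: "finite P" using P(1) assms(1) by (rule finite_elements[rotated])
    have disj: "B = B'" if "B \<in> P" "B' \<in> P" "z \<in> B" "z \<in> B'" for B B' z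
      using that partition_onD2[OF P(1)] by (auto dest: disjointD)
    have \<phi>P: "\<phi> z \<in> B" if "B \<in> P" "z \<in> B" for B z
    proof -
      have "z \<in> H" using that P(1) by (auto simp: partition_on_def)
      then obtain B0 where B0: "B0 \<in> P0" "z \<in> B0" using assms(3) by (auto simp: partition_on_def)
      then obtain B' where "B' \<in> P" "B0 \<subseteq> B'" using P(2) by blast
      then show ?thesis using B0 disj[of B B' z] that assms(4)[of B0 z] by blast
    qed
    have perm_p: "\<phi> \<circ> \<alpha>' permutes H" by (rule permutes_compose[OF perm' assms(2)])
    have count: "int (card (cycles_on H (\<phi> \<circ> \<alpha>))) =
        int (card (cycles_on H (\<phi> \<circ> \<alpha>'))) + (if y \<in> orbit (\<phi> \<circ> \<alpha>') x then 1 else - 1)"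
      by (rule card_cycles_transpose[OF permutes_permutation[OF perm_p assms(1)] x(2) _ perm_p assms(1) xH])
        (simp only: \<alpha> comp_assoc)
    \<comment> \<open>Each transposition changes the number of cycles by exactly one and adds one
      pair to the involution, so the parity of the sum is invariant.\<close>
    have even': "even (card (cycles_on H (\<phi> \<circ> \<alpha>)) + card (cycles_on H \<phi>) + card {z. \<alpha> z \<noteq> z} div 2)"
    proof -
      have "\<bar>int (card (cycles_on H (\<phi> \<circ> \<alpha>))) - int (card (cycles_on H (\<phi> \<circ> \<alpha>')))\<bar> = 1" using count by auto
      then have "card (cycles_on H (\<phi> \<circ> \<alpha>)) = card (cycles_on H (\<phi> \<circ> \<alpha>')) + 1 \<or>
        card (cycles_on H (\<phi> \<circ> \<alpha>')) = card (cycles_on H (\<phi> \<circ> \<alpha>)) + 1" by linarith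
      then show ?thesis using P(5) unfolding c by auto
    qed
    obtain Bx By where Bx: "Bx \<in> P" "x \<in> Bx" and By: "By \<in> P" "y \<in> By"
      using xH P(1) by (auto simp: partition_on_def)
    show ?thesis
    \<comment> \<open>Inside one block, a possible additional cycle is paid for by the new pair.
      Between two blocks one cycle is lost on the left, and on the right the new pair offsets half
      of the loss of 2 from \<open>2 * card P\<close>, so the inequality is preserved.\<close>
    proof (cases "Bx = By")
      case True
      have "\<alpha> z \<in> B" if "B \<in> P" "z \<in> B" for B z
      proof -
        consider "z = x" | "z = y" | "z \<noteq> x" "z \<noteq> y" by blast
        then show ?thesis
          by cases (use that disj Bx By True x y \<alpha>'z P(3) in \<open>metis+\<close>)
      qed
      moreover have "card (cycles_on H (\<phi> \<circ> \<alpha>)) + 2 * card P0 \<le> card (cycles_on H \<phi>) + card {z. \<alpha> z \<noteq> z} div 2 + 2 * card P"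
        using P(4) count unfolding c by (auto split: if_splits)
      ultimately show ?thesis using P even' by blast
    next
      case False
      define Q where "Q = insert (Bx \<union> By) (P - {Bx, By})"
      have notin: "Bx \<union> By \<notin> P - {Bx, By}" using disj Bx By by blast
      \<comment> \<open>\<open>\<phi>\<close> and \<open>\<alpha>'\<close> both preserve the block
        \<open>Bx\<close>, so the cycle of \<open>x\<close> cannot reach \<open>y\<close>.\<close>
      have "y \<notin> orbit (\<phi> \<circ> \<alpha>') x"
      proof -
        have "orbit (\<phi> \<circ> \<alpha>') x \<subseteq> Bx"
          using \<phi>P P(3) Bx by (intro orbit_subset_closed) auto
        then show ?thesis using disj[OF Bx(1) By(1) _ By(2)] False by blast
      qed
      then have "int (card (cycles_on H (\<phi> \<circ> \<alpha>))) = int (card (cycles_on H (\<phi> \<circ> \<alpha>'))) - 1" using count by simp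
      moreover have "card P = card Q + 1"
      proof -
        have "card Q = Suc (card (P - {Bx, By}))" unfolding Q_def using finP notin by simp
        moreover have "card P = card (P - {Bx, By}) + 2"
          using finP Bx By False card_Diff_subset[of "{Bx, By}" P] card_mono[of P "{Bx, By}"] by simp
        ultimately show ?thesis by simp
      qed
      ultimately have "card (cycles_on H (\<phi> \<circ> \<alpha>)) + 2 * card P0 \<le> card (cycles_on H \<phi>) + card {z. \<alpha> z \<noteq> z} div 2 + 2 * card Q"
        using P(4) unfolding c by simp
      moreover have "partition_on H Q"
      proof (rule partition_onI)
        show "\<Union> Q = H" using P(1) Bx By by (auto simp: Q_def partition_on_def)
        show "{} \<notin> Q" using P(1) Bx by (auto simp: Q_def partition_on_def)
        show "disjnt B B'" if "B \<in> Q" "B' \<in> Q" "B \<noteq> B'" for B B'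
          using that disj Bx By unfolding Q_def disjnt_def by blast
      qed
      moreover have "\<forall>B\<in>P0. \<exists>B'\<in>Q. B \<subseteq> B'"
      proof
        fix B assume "B \<in> P0"
        then obtain B' where "B' \<in> P" "B \<subseteq> B'" using P(2) by blast
        then show "\<exists>B'\<in>Q. B \<subseteq> B'" unfolding Q_def by (cases "B' \<in> {Bx, By}") auto
      qed
      moreover have "\<forall>B\<in>Q. \<forall>z\<in>B. \<alpha> z \<in> B"
      proof (intro ballI)
        fix B z assume B: "B \<in> Q" "z \<in> B"
        consider "z = x" | "z = y" | "z \<noteq> x" "z \<noteq> y" by blast
        then show "\<alpha> z \<in> B"
        proof cases
          case 3
          then have "\<alpha> z = \<alpha>' z" by (simp add: \<alpha>'z)
          then show ?thesis using B P(3) Bx By unfolding Q_def by auto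
        next
          case 1
          then have "B = Bx \<union> By" using B disj[of B Bx x] Bx unfolding Q_def by blast
          then show ?thesis using 1 x By by simp
        next
          case 2
          then have "B = Bx \<union> By" using B disj[of B By y] By unfolding Q_def by blast
          then show ?thesis using 2 y Bx by simp
        qed
      qed
      ultimately show ?thesis using even' by blast
    qed
  qed
qed

section \<open>Exponential of the potential and cumulants\<close>

definition sym_factor :: "'a multiset \<Rightarrow> nat" where
  "sym_factor A = (\<Prod>x\<in>set_mset A. fact (count A x))"

lemma sym_factor_pos [simp]: "sym_factor A > 0"
  by (simp add: sym_factor_def)

lemma card_permutations_eq:
  "of_nat (card (permutations_of_multiset A)) / fact (size A) = 1 / (of_nat (sym_factor A) :: complex)"
proof -
  have "of_nat (card (permutations_of_multiset A)) * (of_nat (sym_factor A) :: complex) = fact (size A)"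
    unfolding sym_factor_def of_nat_mult[symmetric] card_permutations_of_multiset_aux by simp
  moreover have "(of_nat (sym_factor A) :: complex) \<noteq> 0"
    using sym_factor_pos[of A] by (simp del: sym_factor_pos)
  ultimately show ?thesis by (simp add: field_simps)
qed

lemma card_permutations_of_multiset_remove_sum:
  assumes "A \<noteq> {#}"
  shows "card (permutations_of_multiset A) = (\<Sum>x\<in>set_mset A. card (permutations_of_multiset (A - {#x#})))"
proof -
  have "card (permutations_of_multiset A)
      = card (\<Union>x\<in>set_mset A. (\<lambda>xs. x # xs) ` permutations_of_multiset (A - {#x#}))"
    using permutations_of_multiset_nonempty[OF assms] by simp
  also have "\<dots> = (\<Sum>x\<in>set_mset A. card ((\<lambda>xs. x # xs) ` permutations_of_multiset (A - {#x#})))"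
    by (rule card_UN_disjoint) auto
  also have "\<dots> = (\<Sum>x\<in>set_mset A. card (permutations_of_multiset (A - {#x#})))"
    by (intro sum.cong refl card_image) (auto simp: inj_on_def)
  finally show ?thesis .
qed

text \<open>A linear series is a sum over letters, so its \<open>j\<close>-th power is a sum over
  words of length \<open>j\<close>. The words with content \<open>w\<close> are the orderings of
  \<open>w\<close>.\<close>

lemma coeff_power_linear:
  fixes f :: "'v mseries"
  assumes lin: "\<And>w. size w \<noteq> 1 \<Longrightarrow> coeff f w = 0"
  shows "coeff (f ^ j) w =
    (if size w = j then of_nat (card (permutations_of_multiset w)) * (\<Prod>v\<in>#w. coeff f {#v#}) else 0)"
proof (induction j arbitrary: w)
  case 0
  then show ?case by (auto simp: coeff_one)
next
  case (Suc j)
  have "coeff (f ^ Suc j) w = (\<Sum>(a, b) | a + b = w. coeff f a * coeff (f ^ j) b)"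
    by (simp add: coeff_mult)
  also have "\<dots> = (\<Sum>(a, b) \<in> (\<lambda>v. ({#v#}, w - {#v#})) ` set_mset w. coeff f a * coeff (f ^ j) b)"
  proof (rule sum.mono_neutral_right)
    show "\<forall>p\<in>{(a, b). a + b = w} - (\<lambda>v. ({#v#}, w - {#v#})) ` set_mset w.
        (case p of (a, b) \<Rightarrow> coeff f a * coeff (f ^ j) b) = 0"
    proof safe
      fix a b assume n: "(a, b) \<notin> (\<lambda>v. ({#v#}, a + b - {#v#})) ` set_mset (a + b)" and "w = a + b"
      have "size a \<noteq> 1"
      proof
        assume "size a = 1"
        then obtain v where "a = {#v#}" using size_1_singleton_mset by blast
        then show False using n by auto
      qed
      then show "coeff f a * coeff (f ^ j) b = 0" using lin by simp
    qed
  qed auto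
  also have "\<dots> = (\<Sum>v\<in>set_mset w. coeff f {#v#} * coeff (f ^ j) (w - {#v#}))"
    by (subst sum.reindex) (auto simp: inj_on_def)
  also have "\<dots> = (\<Sum>v\<in>set_mset w. if size w = Suc j then
      of_nat (card (permutations_of_multiset (w - {#v#}))) * (\<Prod>v\<in>#w. coeff f {#v#}) else 0)"
  proof (rule sum.cong[OF refl])
    fix v assume "v \<in># w"
    then obtain w' where w: "w = add_mset v w'" by (meson multi_member_split)
    then show "coeff f {#v#} * coeff (f ^ j) (w - {#v#}) = (if size w = Suc j then
      of_nat (card (permutations_of_multiset (w - {#v#}))) * (\<Prod>v\<in>#w. coeff f {#v#}) else 0)"
      using Suc.IH[of w'] by simp
  qed
  also have "\<dots> = (if size w = Suc j then
      of_nat (card (permutations_of_multiset w)) * (\<Prod>v\<in>#w. coeff f {#v#}) else 0)"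
  proof (cases "size w = Suc j")
    case True
    then have "w \<noteq> {#}" by auto
    then show ?thesis using True
      by (simp add: card_permutations_of_multiset_remove_sum sum_distrib_right)
  qed simp
  finally show ?case .
qed

text \<open>Only the power \<open>size w\<close> contributes. Dividing the number of orderings by
  the factorial of \<open>size w\<close> leaves the inverse multiplicity factorials.\<close>

lemma coeff_mexp_linear:
  fixes f :: "'v mseries"
  assumes lin: "\<And>w. size w \<noteq> 1 \<Longrightarrow> coeff f w = 0"
  shows "coeff (mexp f) w = (\<Prod>v\<in>#w. coeff f {#v#}) / of_nat (sym_factor w)"
proof -
  have "coeff (mexp f) w = (\<Sum>j | j \<in> UNIV \<and> coeff (mconst (1 / fact j) * f ^ j) w \<noteq> 0.
      coeff (mconst (1 / fact j) * f ^ j) w)"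
    by (simp add: mexp_def formal_sum_def)
  also have "\<dots> = (\<Sum>j\<in>{size w}. coeff (mconst (1 / fact j) * f ^ j) w)"
    by (rule sum.mono_neutral_left) (auto simp: coeff_power_linear[OF lin] split: if_splits)
  also have "\<dots> = of_nat (card (permutations_of_multiset w)) / fact (size w) * (\<Prod>v\<in>#w. coeff f {#v#})"
    by (simp add: coeff_power_linear[OF lin])
  finally show ?thesis unfolding card_permutations_eq by simp
qed

definition cell_factor :: "nat \<Rightarrow> weight \<Rightarrow> complex" where
  "cell_factor N v = of_nat N powi (2 - 2 * int (fst v) - int (size (snd v)))"

text \<open>Ordered tuples with the same multiset give the same term, and their number divided by
  \<open>k!\<close> is the inverse of \<open>sym_factor\<close>. In particular the potential is
  linear in the variables, which is what \<open>coeff_mexp_linear\<close> requires.\<close>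

lemma coeff_potential:
  "coeff (potential T N M) w = (if \<exists>v\<in>T. w = {#v#} then
     cell_factor N (the_elem (set_mset w)) / of_nat (sym_factor (snd (the_elem (set_mset w)))) *
       (\<Prod>m\<in>#snd (the_elem (set_mset w)). mtrace (M ^\<^sub>m m) / of_nat m) else 0)"
proof -
  define F where "F = (\<lambda>(h, ms). mconst (of_nat N powi (2 - 2 * int h - int (length ms)) / fact (length ms)
                        * (\<Prod>m\<leftarrow>ms. mtrace (M ^\<^sub>m m) / of_nat m)) * mvar (h, mset ms))"
  have F: "coeff (F (h, ms)) w = (if w = {#(h, mset ms)#} then
      cell_factor N (h, mset ms) / fact (size (mset ms)) * (\<Prod>m\<in>#mset ms. mtrace (M ^\<^sub>m m) / of_nat m) else 0)"
    for h ms w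
    unfolding F_def case_prod_conv coeff_mconst_mult
    by (simp add: mvar_def cell_factor_def prod_mset_prod_list[symmetric])
  have "coeff (potential T N M) w
      = (\<Sum>p | p \<in> {(h, ms). (h, mset ms) \<in> T} \<and> coeff (F p) w \<noteq> 0. coeff (F p) w)"
    unfolding potential_def formal_sum_def coeff_MSeries F_def ..
  also have "\<dots> = (if \<exists>v\<in>T. w = {#v#} then
     cell_factor N (the_elem (set_mset w)) / of_nat (sym_factor (snd (the_elem (set_mset w)))) *
       (\<Prod>m\<in>#snd (the_elem (set_mset w)). mtrace (M ^\<^sub>m m) / of_nat m) else 0)"
  proof (cases "\<exists>v\<in>T. w = {#v#}")
    case False
    then have "coeff (F p) w = 0" if "p \<in> {(h, ms). (h, mset ms) \<in> T}" for p
      using F that by (cases p) auto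
    then show ?thesis using False by (intro trans[OF sum.neutral]) auto
  next
    case True
    then obtain h \<mu> where v: "(h, \<mu>) \<in> T" "w = {#(h, \<mu>)#}" by auto
    have "(\<Sum>p | p \<in> {(h, ms). (h, mset ms) \<in> T} \<and> coeff (F p) w \<noteq> 0. coeff (F p) w)
        = (\<Sum>p\<in>Pair h ` permutations_of_multiset \<mu>. coeff (F p) w)"
      by (rule sum.mono_neutral_left)
        (use v in \<open>auto simp: F image_iff dest: permutations_of_multisetD intro: permutations_of_multisetI split: if_splits\<close>)
    also have "\<dots> = (\<Sum>ms\<in>permutations_of_multiset \<mu>. coeff (F (h, ms)) w)"
      by (subst sum.reindex) (auto simp: inj_on_def)
    also have "\<dots> = (\<Sum>ms\<in>permutations_of_multiset \<mu>.
        cell_factor N (h, \<mu>) / fact (size \<mu>) * (\<Prod>m\<in>#\<mu>. mtrace (M ^\<^sub>m m) / of_nat m))"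
      by (intro sum.cong refl) (simp add: F v(2) permutations_of_multisetD)
    also have "\<dots> = of_nat (card (permutations_of_multiset \<mu>)) / fact (size \<mu>) *
        (cell_factor N (h, \<mu>) * (\<Prod>m\<in>#\<mu>. mtrace (M ^\<^sub>m m) / of_nat m))"
      by simp
    finally show ?thesis unfolding card_permutations_eq using v by auto
  qed
  finally show ?thesis .
qed

text \<open>The order of the symmetry group of a family of rooted, ordered cells with weights \<open>w\<close>.\<close>

definition weight_factor :: "weight multiset \<Rightarrow> nat" where
  "weight_factor w = sym_factor w * (\<Prod>v\<in>#w. sym_factor (snd v) * (\<Prod>m\<in>#snd v. m))"

lemma coeff_mexp_potential:
  assumes "set_mset w \<subseteq> T"
  shows "coeff (mexp (potential T N M)) w =
    (\<Prod>v\<in>#w. cell_factor N v) * (\<Prod>v\<in>#w. \<Prod>m\<in>#snd v. mtrace (M ^\<^sub>m m)) / of_nat (weight_factor w)"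
proof -
  have "coeff (mexp (potential T N M)) w = (\<Prod>v\<in>#w. coeff (potential T N M) {#v#}) / of_nat (sym_factor w)"
    by (rule coeff_mexp_linear) (auto simp: coeff_potential)
  also have "image_mset (\<lambda>v. coeff (potential T N M) {#v#}) w = image_mset (\<lambda>v. cell_factor N v *
      (\<Prod>m\<in>#snd v. mtrace (M ^\<^sub>m m)) / of_nat (sym_factor (snd v) * (\<Prod>m\<in>#snd v. m))) w"
  proof (rule image_mset_cong)
    fix v assume "v \<in># w"
    then have v: "v \<in> T" using assms by blast
    have "(\<Prod>m\<in>#A. mtrace (M ^\<^sub>m m) / of_nat m) = (\<Prod>m\<in>#A. mtrace (M ^\<^sub>m m)) / of_nat (\<Prod>m\<in>#A. m)" for A
      by (induction A) auto
    then show "coeff (potential T N M) {#v#} = cell_factor N v *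
      (\<Prod>m\<in>#snd v. mtrace (M ^\<^sub>m m)) / of_nat (sym_factor (snd v) * (\<Prod>m\<in>#snd v. m))"
      using v by (simp add: coeff_potential)
  qed
  also have "prod_mset \<dots> = (\<Prod>v\<in>#w. cell_factor N v) * (\<Prod>v\<in>#w. \<Prod>m\<in>#snd v. mtrace (M ^\<^sub>m m)) /
      of_nat (\<Prod>v\<in>#w. sym_factor (snd v) * (\<Prod>m\<in>#snd v. m))"
    by (induction w) auto
  finally show ?thesis by (simp add: weight_factor_def mult.commute)
qed

lemma coeff_mexp_potential_eq_0:
  assumes "\<not> set_mset w \<subseteq> T"
  shows "coeff (mexp (potential T N M)) w = 0"
proof -
  obtain v where v: "v \<in># w" "v \<notin> T" using assms by blast
  then have "coeff (potential T N M) {#v#} = 0" by (auto simp: coeff_potential)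
  then have "(\<Prod>v\<in>#w. coeff (potential T N M) {#v#}) = 0"
    using v(1) by (auto simp: prod_mset_zero_iff image_iff)
  moreover have "coeff (mexp (potential T N M)) w = (\<Prod>v\<in>#w. coeff (potential T N M) {#v#}) / of_nat (sym_factor w)"
    by (rule coeff_mexp_linear) (auto simp: coeff_potential)
  ultimately show ?thesis by simp
qed

section \<open>Cumulants of a set function in the role of the moments\<close>

definition set_cumulant :: "(nat set \<Rightarrow> 'a :: comm_ring_1) \<Rightarrow> nat set \<Rightarrow> 'a" where
  "set_cumulant e B = (\<Sum>\<pi> | partition_on B \<pi>.
     (- 1) ^ (card \<pi> - 1) * of_nat (fact (card \<pi> - 1)) * (\<Prod>b\<in>\<pi>. e b))"

lemma finite_partitions_on: "finite B \<Longrightarrow> finite {\<pi>. partition_on B \<pi>}"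
  by (rule finite_subset[of _ "Pow (Pow B)"]) (auto simp: partition_on_def)

text \<open>A partition \<open>\<rho>\<close> of \<open>B\<close> with \<open>k\<close> blocks arises once with \<open>S = B\<close> and \<open>k - 1\<close> times with
  \<open>B - S\<close> a block avoiding \<open>b\<close>. The coefficients cancel unless \<open>k = 1\<close>.\<close>

lemma set_cumulant_recursion:
  fixes e :: "nat set \<Rightarrow> 'a :: comm_ring_1"
  assumes "finite B" "b \<in> B" "e {} = 1"
  shows "(\<Sum>S | b \<in> S \<and> S \<subseteq> B. set_cumulant e S * e (B - S)) = e B"
proof -
  define g where "g = (\<lambda>k. (- 1) ^ (k - 1) * of_nat (fact (k - 1)) :: 'a)"
  let ?Q = "{S. b \<in> S \<and> S \<subseteq> B \<and> S \<noteq> B}"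
  have finQ: "finite ?Q" by (rule finite_subset[of _ "Pow B"]) (use assms(1) in auto)
  have "{S. b \<in> S \<and> S \<subseteq> B} = insert B ?Q" using assms(2) by auto
  then have "(\<Sum>S | b \<in> S \<and> S \<subseteq> B. set_cumulant e S * e (B - S))
     = set_cumulant e B + (\<Sum>S\<in>?Q. set_cumulant e S * e (B - S))"
    using finQ assms(3) by simp
  also have "(\<Sum>S\<in>?Q. set_cumulant e S * e (B - S))
     = (\<Sum>S\<in>?Q. \<Sum>\<pi> | partition_on S \<pi>. g (card \<pi>) * (\<Prod>c\<in>\<pi>. e c) * e (B - S))"
    by (simp add: set_cumulant_def g_def sum_distrib_right)
  also have "\<dots> = (\<Sum>(S, \<pi>) \<in> (SIGMA S:?Q. {\<pi>. partition_on S \<pi>}). g (card \<pi>) * (\<Prod>c\<in>\<pi>. e c) * e (B - S))"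
    using finQ by (intro sum.Sigma) (auto intro: finite_partitions_on finite_subset[OF _ assms(1)])
  \<comment> \<open>A partition of \<open>S\<close> is completed by the block \<open>B - S\<close>.
    Conversely, a partition of \<open>B\<close> with a marked block avoiding \<open>b\<close>
    returns \<open>S\<close> as the complement of that block.\<close>
  also have "\<dots> = (\<Sum>(\<rho>, A) \<in> (SIGMA \<rho>:{\<rho>. partition_on B \<rho>}. {A\<in>\<rho>. b \<notin> A}).
      g (card \<rho> - 1) * (\<Prod>c\<in>\<rho>. e c))"
  proof (rule sum.reindex_bij_witness[of _ "\<lambda>(\<rho>, A). (B - A, \<rho> - {A})" "\<lambda>(S, \<pi>). (insert (B - S) \<pi>, B - S)"])
    fix p assume p: "p \<in> (SIGMA S:?Q. {\<pi>. partition_on S \<pi>})"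
    obtain S \<pi> where S: "p = (S, \<pi>)" "b \<in> S" "S \<subseteq> B" "S \<noteq> B" "partition_on S \<pi>" using p by auto
    have U: "\<Union> \<pi> = S" using S by (auto simp: partition_on_def)
    have notin: "B - S \<notin> \<pi>"
    proof
      assume "B - S \<in> \<pi>"
      then have "B - S \<subseteq> S" using U by blast
      then show False using S by blast
    qed
    have fin: "finite \<pi>" using S assms(1) by (metis finite_elements finite_subset)
    show "(case case p of (S, \<pi>) \<Rightarrow> (insert (B - S) \<pi>, B - S) of (\<rho>, A) \<Rightarrow> (B - A, \<rho> - {A})) = p"
      using S notin by auto
    have "disjnt (B - S) (\<Union> \<pi>)" using U by (auto simp: disjnt_def)
    then have "partition_on B (insert (B - S) \<pi>)"
      using S by (subst partition_on_insert) (auto simp: double_diff)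
    then show "(case p of (S, \<pi>) \<Rightarrow> (insert (B - S) \<pi>, B - S)) \<in> (SIGMA \<rho>:{\<rho>. partition_on B \<rho>}. {A\<in>\<rho>. b \<notin> A})"
      using S by auto
    show "(case case p of (S, \<pi>) \<Rightarrow> (insert (B - S) \<pi>, B - S) of (\<rho>, A) \<Rightarrow> g (card \<rho> - 1) * (\<Prod>c\<in>\<rho>. e c))
      = (case p of (S, \<pi>) \<Rightarrow> g (card \<pi>) * (\<Prod>c\<in>\<pi>. e c) * e (B - S))"
      using S notin fin by (simp add: mult_ac)
  next
    fix p assume p: "p \<in> (SIGMA \<rho>:{\<rho>. partition_on B \<rho>}. {A\<in>\<rho>. b \<notin> A})"
    obtain \<rho> A where \<rho>: "p = (\<rho>, A)" "partition_on B \<rho>" "A \<in> \<rho>" "b \<notin> A" using p by auto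
    have AB: "A \<subseteq> B" "A \<noteq> {}" using \<rho> by (auto simp: partition_on_def)
    then have "B - (B - A) = A" by auto
    then show "(case case p of (\<rho>, A) \<Rightarrow> (B - A, \<rho> - {A}) of (S, \<pi>) \<Rightarrow> (insert (B - S) \<pi>, B - S)) = p"
      using \<rho> by auto
    have "disjnt A (\<Union> (\<rho> - {A}))" using \<rho> by (auto simp: partition_on_def disjnt_def dest: disjointD)
    then have "partition_on (B - A) (\<rho> - {A})"
      using \<rho> partition_on_insert[of A "\<rho> - {A}" B] by (simp add: insert_absorb)
    then show "(case p of (\<rho>, A) \<Rightarrow> (B - A, \<rho> - {A})) \<in> (SIGMA S:?Q. {\<pi>. partition_on S \<pi>})"
      using \<rho> AB assms(2) by auto
  qed
  also have "\<dots> = (\<Sum>\<rho> | partition_on B \<rho>. \<Sum>A | A \<in> \<rho> \<and> b \<notin> A. g (card \<rho> - 1) * (\<Prod>c\<in>\<rho>. e c))"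
    by (rule sum.Sigma[symmetric])
      (use finite_partitions_on[OF assms(1)] finite_elements[OF assms(1)] in auto)
  also have "\<dots> = (\<Sum>\<rho> | partition_on B \<rho>. of_nat (card \<rho> - 1) * (g (card \<rho> - 1) * (\<Prod>c\<in>\<rho>. e c)))"
  proof (rule sum.cong[OF refl])
    fix \<rho> assume "\<rho> \<in> {\<rho>. partition_on B \<rho>}"
    then have \<rho>: "partition_on B \<rho>" by simp
    obtain A where A: "A \<in> \<rho>" "b \<in> A" using \<rho> assms(2) by (auto simp: partition_on_def)
    have "{A. A \<in> \<rho> \<and> b \<notin> A} = \<rho> - {A}"
      using A \<rho> by (auto simp: partition_on_def dest: disjointD)
    then show "(\<Sum>A | A \<in> \<rho> \<and> b \<notin> A. g (card \<rho> - 1) * (\<Prod>c\<in>\<rho>. e c))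
      = of_nat (card \<rho> - 1) * (g (card \<rho> - 1) * (\<Prod>c\<in>\<rho>. e c))"
      using A(1) by (simp add: card_Diff_singleton)
  qed
  also have "set_cumulant e B + \<dots>
    = (\<Sum>\<rho> | partition_on B \<rho>. (g (card \<rho>) + of_nat (card \<rho> - 1) * g (card \<rho> - 1)) * (\<Prod>c\<in>\<rho>. e c))"
    by (simp add: set_cumulant_def g_def sum.distrib[symmetric] algebra_simps)
  also have "\<dots> = (\<Sum>\<rho>\<in>{{B}}. (g (card \<rho>) + of_nat (card \<rho> - 1) * g (card \<rho> - 1)) * (\<Prod>c\<in>\<rho>. e c))"
  proof (rule sum.mono_neutral_right)
    show "{{B}} \<subseteq> {\<rho>. partition_on B \<rho>}" using assms(2) by (auto intro: partition_on_space)
    show "\<forall>\<rho>\<in>{\<rho>. partition_on B \<rho>} - {{B}}. (g (card \<rho>) + of_nat (card \<rho> - 1) * g (card \<rho> - 1)) * (\<Prod>c\<in>\<rho>. e c) = 0"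
    proof
      fix \<rho> assume "\<rho> \<in> {\<rho>. partition_on B \<rho>} - {{B}}"
      then have \<rho>: "partition_on B \<rho>" "\<rho> \<noteq> {B}" by auto
      have fin: "finite \<rho>" using \<rho>(1) assms(1) by (rule finite_elements[rotated])
      have "card \<rho> \<noteq> 0" using fin \<rho>(1) assms(2) by (auto simp: partition_on_def)
      moreover have "card \<rho> \<noteq> 1" using \<rho> by (auto simp: card_1_singleton_iff partition_on_def)
      ultimately obtain k where "card \<rho> = Suc (Suc k)" by (metis One_nat_def not0_implies_Suc)
      then have "g (card \<rho>) + of_nat (card \<rho> - 1) * g (card \<rho> - 1) = 0" by (simp add: g_def algebra_simps)
      then show "(g (card \<rho>) + of_nat (card \<rho> - 1) * g (card \<rho> - 1)) * (\<Prod>c\<in>\<rho>. e c) = 0" by simp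
    qed
  qed (use assms(1) in \<open>simp add: finite_partitions_on\<close>)
  also have "\<dots> = e B" by (simp add: g_def)
  finally show ?thesis .
qed

text \<open>The term \<open>S = B\<close> isolates \<open>C B\<close> because
  \<open>e {} = 1\<close>, and all other terms concern smaller sets. So the recursion determines
  \<open>C\<close>, whichever \<open>b\<close> is taken in each \<open>B\<close>.\<close>

lemma set_cumulant_unique:
  fixes e C :: "nat set \<Rightarrow> 'a :: comm_ring_1"
  assumes "finite U" "e {} = 1"
    and rec: "\<And>B. B \<subseteq> U \<Longrightarrow> B \<noteq> {} \<Longrightarrow> \<exists>b\<in>B. (\<Sum>S | b \<in> S \<and> S \<subseteq> B. C S * e (B - S)) = e B"
  shows "B \<subseteq> U \<Longrightarrow> B \<noteq> {} \<Longrightarrow> C B = set_cumulant e B"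
proof (induction "card B" arbitrary: B rule: less_induct)
  case less
  have fin: "finite B" using less.prems assms(1) finite_subset by blast
  obtain b where b: "b \<in> B" "(\<Sum>S | b \<in> S \<and> S \<subseteq> B. C S * e (B - S)) = e B"
    using rec less.prems by blast
  let ?Q = "{S. b \<in> S \<and> S \<subseteq> B \<and> S \<noteq> B}"
  have finQ: "finite ?Q" by (rule finite_subset[of _ "Pow B"]) (use fin in auto)
  have Q: "{S. b \<in> S \<and> S \<subseteq> B} = insert B ?Q" using b by auto
  have "C B + (\<Sum>S\<in>?Q. C S * e (B - S)) = e B"
    using b(2) finQ assms(2) unfolding Q by simp
  moreover have "set_cumulant e B + (\<Sum>S\<in>?Q. set_cumulant e S * e (B - S)) = e B"
    using set_cumulant_recursion[of B b e] b(1) fin finQ assms(2) unfolding Q by simp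
  moreover have "(\<Sum>S\<in>?Q. C S * e (B - S)) = (\<Sum>S\<in>?Q. set_cumulant e S * e (B - S))"
  proof (rule sum.cong[OF refl])
    fix S assume S: "S \<in> ?Q"
    have "C S = set_cumulant e S"
      using S less.prems fin by (intro less.hyps psubset_card_mono) auto
    then show "C S * e (B - S) = set_cumulant e S * e (B - S)" by simp
  qed
  ultimately have "C B + (\<Sum>S\<in>?Q. C S * e (B - S)) = set_cumulant e B + (\<Sum>S\<in>?Q. C S * e (B - S))"
    by simp
  then show ?case by (rule add_right_imp_eq)
qed

lemma joint_cumulant_eq_set_cumulant:
  "joint_cumulant E Xs = set_cumulant (\<lambda>B. E (\<lambda>M. \<Prod>i\<in>B. (Xs ! i) M)) {..<length Xs}"
  by (simp add: joint_cumulant_def set_cumulant_def)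

section \<open>Counting permutations with roots and cells\<close>

definition cells_weight :: "(nat \<times> 'h set set) set \<Rightarrow> weight multiset" where
  "cells_weight K = image_mset (\<lambda>(h, f). (h, image_mset card (mset_set f))) (mset_set K)"

text \<open>Here \<open>B\<close> is the set of labels of the boundaries, \<open>r\<close> maps each label to the root of its boundary,
  and \<open>K\<close> is the set of inner cells, paired with their genera.\<close>

definition premaps :: "'h set \<Rightarrow> (nat \<Rightarrow> nat) \<Rightarrow> nat set \<Rightarrow> weight multiset \<Rightarrow>
    (('h \<Rightarrow> 'h) \<times> (nat \<rightharpoonup> 'h) \<times> (nat \<times> 'h set set) set) set" where
  "premaps H L B w = {(\<phi>, r, K). \<phi> permutes H \<and> dom r = B \<and> ran r \<subseteq> H \<and>
     inj_on (\<lambda>i. orbit \<phi> (the (r i))) B \<and> (\<forall>i\<in>B. card (orbit \<phi> (the (r i))) = L i) \<and>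
     inj_on snd K \<and> partition_on (cycles_on H \<phi> - orbit \<phi> ` ran r) (snd ` K) \<and> cells_weight K = w}"

text \<open>A list in \<open>cyc_lists \<phi>\<close> is a cycle of \<open>\<phi>\<close> with a root, its head.\<close>

definition cyc_lists :: "('h \<Rightarrow> 'h) \<Rightarrow> 'h list set" where
  "cyc_lists \<phi> = {x. x \<noteq> [] \<and> distinct x \<and> map \<phi> x = rotate1 x}"

lemma cyc_lists_funpow:
  assumes "x \<in> cyc_lists \<phi>"
  shows "(\<phi> ^^ k) (hd x) = x ! (k mod length x)"
proof (induction k)
  case 0
  then show ?case using assms by (simp add: cyc_lists_def hd_conv_nth)
next
  case (Suc k)
  have l: "k mod length x < length x" using assms by (simp add: cyc_lists_def)
  have "(\<phi> ^^ Suc k) (hd x) = \<phi> (x ! (k mod length x))" using Suc by simp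
  also have "\<dots> = map \<phi> x ! (k mod length x)" using l by simp
  also have "\<dots> = rotate1 x ! (k mod length x)" using assms by (simp add: cyc_lists_def)
  also have "\<dots> = x ! (Suc k mod length x)" using l by (simp add: nth_rotate1 mod_Suc_eq)
  finally show ?case .
qed

lemma cyc_lists_set:
  assumes "x \<in> cyc_lists \<phi>"
  shows "set x = orbit \<phi> (hd x)"
proof -
  have ne: "length x > 0" using assms by (simp add: cyc_lists_def)
  have "set x = {(\<phi> ^^ k) (hd x) | k. 0 < k}"
  proof (intro equalityI subsetI)
    fix y assume "y \<in> set x"
    then obtain k where k: "k < length x" "y = x ! k" by (auto simp: in_set_conv_nth)
    then have "y = (\<phi> ^^ (k + length x)) (hd x)" using cyc_lists_funpow[OF assms] by simp
    then show "y \<in> {(\<phi> ^^ k) (hd x) | k. 0 < k}" using ne by (intro CollectI exI[of _ "k + length x"]) simp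
  next
    fix y assume "y \<in> {(\<phi> ^^ k) (hd x) | k. 0 < k}"
    then show "y \<in> set x" using cyc_lists_funpow[OF assms] ne by auto
  qed
  then show ?thesis by (simp add: orbit_altdef)
qed

lemma cyc_lists_length: "x \<in> cyc_lists \<phi> \<Longrightarrow> length x = card (orbit \<phi> (hd x))"
  using cyc_lists_set[of x \<phi>] distinct_card[of x] by (simp add: cyc_lists_def)

lemma cyc_lists_unique:
  assumes "x \<in> cyc_lists \<phi>" "y \<in> cyc_lists \<phi>" "hd x = hd y"
  shows "x = y"
proof (rule nth_equalityI)
  show "length x = length y" using assms cyc_lists_length by metis
  then show "x ! i = y ! i" if "i < length x" for i
    using that cyc_lists_funpow[OF assms(1), of i] cyc_lists_funpow[OF assms(2), of i] assms(3) by simp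
qed

lemma cyc_lists_ex:
  assumes "permutation \<phi>"
  shows "\<exists>x\<in>cyc_lists \<phi>. hd x = h"
proof
  let ?x = "support \<phi> h"
  have pos: "least_power \<phi> h > 0" and per: "(\<phi> ^^ least_power \<phi> h) h = h"
    using least_power_of_permutation[OF assms] by auto
  show "hd ?x = h" using pos by (simp add: hd_map upt_conv_Cons)
  have "map \<phi> ?x = rotate1 ?x"
  proof (rule nth_equalityI)
    fix i assume "i < length (map \<phi> ?x)"
    then have i: "i < least_power \<phi> h" by simp
    have "\<phi> ((\<phi> ^^ i) h) = (\<phi> ^^ (Suc i mod least_power \<phi> h)) h"
    proof (cases "Suc i = least_power \<phi> h")
      case True
      then have "\<phi> ((\<phi> ^^ i) h) = (\<phi> ^^ least_power \<phi> h) h" by (metis funpow.simps(2) comp_apply)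
      then show ?thesis using True per by simp
    qed (use i in auto)
    then show "map \<phi> ?x ! i = rotate1 ?x ! i" using i pos by (simp add: nth_rotate1)
  qed simp
  then show "?x \<in> cyc_lists \<phi>"
    using pos cycle_of_permutation[OF assms, of h] by (simp add: cyc_lists_def)
qed

text \<open>A rooting of a cycle is determined by its head, and every element of the cycle may be
  the head. The resulting factor \<open>m\<close> matches the \<open>1 / m\<close> that accompanies
  each trace in the potential.\<close>

lemma card_cyc_lists:
  assumes "permutation \<phi>" "c = orbit \<phi> y"
  shows "card {x \<in> cyc_lists \<phi>. length x = m \<and> set x = c} = (if card c = m then m else 0)"
proof (cases "card c = m")
  case True
  have "bij_betw hd {x \<in> cyc_lists \<phi>. length x = m \<and> set x = c} c"
  proof (rule bij_betwI')
    show "hd x = hd z \<longleftrightarrow> x = z" if "x \<in> {x \<in> cyc_lists \<phi>. length x = m \<and> set x = c}"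
      "z \<in> {x \<in> cyc_lists \<phi>. length x = m \<and> set x = c}" for x z
      using that cyc_lists_unique by blast
    show "hd x \<in> c" if "x \<in> {x \<in> cyc_lists \<phi>. length x = m \<and> set x = c}" for x
      using that by (auto simp: cyc_lists_def)
    fix h assume "h \<in> c"
    then have c: "orbit \<phi> h = c" using assms(2) orbit_eq_iff[OF assms(1), of y h] by simp
    obtain x where x: "x \<in> cyc_lists \<phi>" "hd x = h" using cyc_lists_ex[OF assms(1)] by blast
    then show "\<exists>x\<in>{x \<in> cyc_lists \<phi>. length x = m \<and> set x = c}. h = hd x"
      using cyc_lists_set[OF x(1)] cyc_lists_length[OF x(1)] c True by auto
  qed
  then show ?thesis using True bij_betw_same_card by auto
next
  case False
  then have e: "{x \<in> cyc_lists \<phi>. length x = m \<and> set x = c} = {}"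
    using distinct_card by (auto simp: cyc_lists_def)
  show ?thesis unfolding e using False by simp
qed

text \<open>The product of the cycles \<open>cycle_of_list x\<close>; disjointness of the lists
  keeps each of them a cycle of the product.\<close>

lemma cyc_lists_exists_perm:
  assumes "distinct (concat xss)"
  shows "\<exists>\<phi>. \<phi> permutes set (concat xss) \<and> (\<forall>x\<in>set xss. x \<noteq> [] \<longrightarrow> x \<in> cyc_lists \<phi>)"
  using assms
proof (induction xss)
  case Nil
  then show ?case by (auto intro: permutes_id)
next
  case (Cons x xss)
  then obtain \<phi> where \<phi>: "\<phi> permutes set (concat xss)" "\<forall>x\<in>set xss. x \<noteq> [] \<longrightarrow> x \<in> cyc_lists \<phi>" by auto
  have dis: "set x \<inter> set (concat xss) = {}" "distinct x" using Cons.prems by auto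
  let ?\<psi> = "cycle_of_list x \<circ> \<phi>"
  have "?\<psi> permutes set (concat (x # xss))"
    using \<phi>(1) cycle_permutes[of x] by (intro permutes_compose) (auto intro: permutes_subset)
  moreover have "x \<in> cyc_lists ?\<psi>" if "x \<noteq> []"
  proof -
    have "map ?\<psi> x = map (cycle_of_list x) x"
    proof (intro map_cong refl)
      fix z assume "z \<in> set x"
      then have "z \<notin> set (concat xss)" using dis(1) by blast
      then show "?\<psi> z = cycle_of_list x z" using permutes_not_in[OF \<phi>(1)] by simp
    qed
    also have "\<dots> = rotate1 x" using cyclic_rotation[OF dis(2), of 1] by simp
    finally show ?thesis using that dis unfolding cyc_lists_def by blast
  qed
  moreover have "y \<in> cyc_lists ?\<psi>" if "y \<in> set xss" "y \<noteq> []" for y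
  proof -
    have y: "y \<in> cyc_lists \<phi>" using \<phi> that by blast
    have "?\<psi> z = \<phi> z" if "z \<in> set y" for z
    proof -
      have "z \<in> set (concat xss)" using that \<open>y \<in> set xss\<close> by auto
      then have "\<phi> z \<in> set (concat xss)" using permutes_in_image[OF \<phi>(1)] by blast
      then have "\<phi> z \<notin> set x" using dis by blast
      then show ?thesis by (simp add: id_outside_supp)
    qed
    then have "map ?\<psi> y = map \<phi> y" by (intro map_cong refl)
    then show ?thesis using y unfolding cyc_lists_def by (metis (no_types, lifting) mem_Collect_eq)
  qed
  ultimately have "\<forall>y\<in>set (x # xss). y \<noteq> [] \<longrightarrow> y \<in> cyc_lists ?\<psi>"
    by (metis set_ConsD)
  then show ?case using \<open>?\<psi> permutes _\<close> by blast
qed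

section \<open>Orderings with prescribed keys\<close>

lemma sym_factor_add: "sym_factor (add_mset v w) = Suc (count w v) * sym_factor w"
proof (cases "v \<in># w")
  case True
  then have "insert v (set_mset w) = insert v (set_mset w - {v})" by auto
  moreover have "(\<Prod>x\<in>set_mset w - {v}. fact (count (add_mset v w) x)) = (\<Prod>x\<in>set_mset w - {v}. fact (count w x) :: nat)"
    by (intro prod.cong) auto
  moreover have "(\<Prod>x\<in>set_mset w. fact (count w x)) = fact (count w v) * (\<Prod>x\<in>set_mset w - {v}. fact (count w x) :: nat)"
    using True by (intro prod.remove) auto
  moreover have "(\<Prod>x\<in>set_mset (add_mset v w). fact (count (add_mset v w) x))
      = fact (count (add_mset v w) v) * (\<Prod>x\<in>set_mset (add_mset v w) - {v}. fact (count (add_mset v w) x) :: nat)"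
    by (intro prod.remove) auto
  ultimately show ?thesis by (simp add: sym_factor_def algebra_simps)
next
  case False
  then have "(\<Prod>x\<in>set_mset w. fact (count (add_mset v w) x)) = (\<Prod>x\<in>set_mset w. fact (count w x) :: nat)"
    by (intro prod.cong) auto
  then show ?thesis using False by (simp add: sym_factor_def not_in_iff)
qed

text \<open>Orderings of \<open>A\<close> compatible with a list of prescribed keys \<open>l s\<close>, each element \<open>a\<close> being
  replaced by one of the structures above it.\<close>

lemma card_lists_over:
  fixes X :: "'s \<Rightarrow> 'c set" and g :: "'s \<Rightarrow> 'c \<Rightarrow> 'a" and k :: "'a \<Rightarrow> 'k"
  assumes "finite A" "mset (map l sh) = image_mset k (mset_set A)"
    and "\<And>s a. s \<in> set sh \<Longrightarrow> a \<in> A \<Longrightarrow> finite {c \<in> X s. g s c = a}"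
    and "\<And>s a. s \<in> set sh \<Longrightarrow> a \<in> A \<Longrightarrow> card {c \<in> X s. g s c = a} = (if k a = l s then n (l s) else 0)"
  defines "Cl \<equiv> \<lambda>sh A. {cl. list_all2 (\<lambda>s c. c \<in> X s) sh cl \<and> distinct (map2 g sh cl) \<and> set (map2 g sh cl) = A}"
  shows "finite (Cl sh A) \<and> card (Cl sh A) = sym_factor (mset (map l sh)) * (\<Prod>v\<in>#mset (map l sh). n v)"
  using assms(1-4)
proof (induction sh arbitrary: A)
  case Nil
  then have "A = {}" by (simp add: mset_set_empty_iff)
  then have "Cl [] A = {[]}" by (auto simp: Cl_def)
  then show ?case by (simp add: sym_factor_def)
next
  case (Cons s sh)
  let ?F = "\<lambda>a. {c \<in> X s. g s c = a}"
  have step: "Cl (s # sh) A = (\<Union>a\<in>A. (\<lambda>(c, cl). c # cl) ` (?F a \<times> Cl sh (A - {a})))"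
  proof (intro equalityI subsetI)
    fix xs assume xs: "xs \<in> Cl (s # sh) A"
    then obtain c cl where c: "xs = c # cl" "c \<in> X s" "list_all2 (\<lambda>s c. c \<in> X s) sh cl"
      by (auto simp: Cl_def list_all2_Cons1)
    have d: "g s c \<notin> set (map2 g sh cl)" "distinct (map2 g sh cl)" "insert (g s c) (set (map2 g sh cl)) = A"
      using xs c(1) by (simp_all add: Cl_def)
    then have "set (map2 g sh cl) = A - {g s c}" by blast
    then have "cl \<in> Cl sh (A - {g s c})" using c(3) d(2) unfolding Cl_def by blast
    moreover have "g s c \<in> A" using d(3) by blast
    ultimately show "xs \<in> (\<Union>a\<in>A. (\<lambda>(c, cl). c # cl) ` (?F a \<times> Cl sh (A - {a})))"
      using c by auto
  next
    fix xs assume "xs \<in> (\<Union>a\<in>A. (\<lambda>(c, cl). c # cl) ` (?F a \<times> Cl sh (A - {a})))"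
    then obtain c cl where c: "xs = c # cl" "c \<in> X s" "g s c \<in> A" and cl: "cl \<in> Cl sh (A - {g s c})"
      by auto
    have d: "list_all2 (\<lambda>s c. c \<in> X s) sh cl" "distinct (map2 g sh cl)" "set (map2 g sh cl) = A - {g s c}"
      using cl unfolding Cl_def by blast+
    have "map2 g (s # sh) xs = g s c # map2 g sh cl" "list_all2 (\<lambda>s c. c \<in> X s) (s # sh) xs"
      using c d by simp_all
    moreover have "set (g s c # map2 g sh cl) = A" "distinct (g s c # map2 g sh cl)"
      using c d by (simp_all only: distinct.simps list.simps insert_Diff Diff_iff singletonI) blast+
    ultimately show "xs \<in> Cl (s # sh) A" unfolding Cl_def by (simp only: mem_Collect_eq simp_thms)
  qed
  have IH: "finite (Cl sh (A - {a})) \<and> card (Cl sh (A - {a})) = sym_factor (mset (map l sh)) * (\<Prod>v\<in>#mset (map l sh). n v)"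
    if a: "a \<in> A" "k a = l s" for a
  proof (rule Cons.IH)
    have "mset_set A = add_mset a (mset_set (A - {a}))"
      using a Cons.prems(1) by (metis mset_set.remove)
    then show "mset (map l sh) = image_mset k (mset_set (A - {a}))" using Cons.prems(2) a by simp
  qed (use Cons.prems in auto)
  have fin: "finite (?F a \<times> Cl sh (A - {a}))" if "a \<in> A" for a
  proof (cases "k a = l s")
    case False
    then have e: "?F a = {}" using Cons.prems(3)[of s a] Cons.prems(4)[of s a] that by (metis card_0_eq list.set_intros(1))
    show ?thesis unfolding e by simp
  qed (use IH that Cons.prems(3) in auto)
  have "card (Cl (s # sh) A) = (\<Sum>a\<in>A. card ((\<lambda>(c, cl). c # cl) ` (?F a \<times> Cl sh (A - {a}))))"
    unfolding step using Cons.prems(1) fin by (intro card_UN_disjoint) auto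
  also have "\<dots> = (\<Sum>a\<in>A. card (?F a) * card (Cl sh (A - {a})))"
    by (intro sum.cong refl) (auto simp: card_image inj_on_def card_cartesian_product)
  also have "\<dots> = (\<Sum>a\<in>A. if k a = l s then n (l s) * (sym_factor (mset (map l sh)) * (\<Prod>v\<in>#mset (map l sh). n v)) else 0)"
    using IH Cons.prems(4) by (intro sum.cong refl) auto
  also have "\<dots> = card {a\<in>A. k a = l s} * (n (l s) * (sym_factor (mset (map l sh)) * (\<Prod>v\<in>#mset (map l sh). n v)))"
    using Cons.prems(1) by (simp add: sum.If_cases Int_def)
  \<comment> \<open>The candidates for the first place are as many as the multiplicity of its key,
    which is the factor that \<open>sym_factor\<close> gains in
    \<open>sym_factor_add\<close>.\<close>
  also have "card {a\<in>A. k a = l s} = count (mset (map l (s # sh))) (l s)"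
  proof -
    have "count (image_mset k (mset_set A)) (l s) = card {a\<in>A. k a = l s}"
      using Cons.prems(1) by (simp add: count_image_mset_eq_card_vimage)
    then show ?thesis using Cons.prems(2) by simp
  qed
  finally have "card (Cl (s # sh) A) = sym_factor (mset (map l (s # sh))) * (\<Prod>v\<in>#mset (map l (s # sh)). n v)"
    by (simp add: sym_factor_add algebra_simps)
  moreover have "finite (Cl (s # sh) A)" unfolding step using Cons.prems(1) fin by auto
  ultimately show ?case by blast
qed

section \<open>Cutting lists into pieces of prescribed lengths\<close>

lemma lists_chop:
  "sum_list ls = length xs \<Longrightarrow> \<exists>yss. map length yss = ls \<and> concat yss = xs"
proof (induction ls arbitrary: xs)
  case (Cons l ls)
  then have "sum_list ls = length (drop l xs)" by simp
  then obtain yss where "map length yss = ls" "concat yss = drop l xs" using Cons.IH by blast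
  then show ?case using Cons.prems by (intro exI[of _ "take l xs # yss"]) auto
qed auto

lemma lists_chop_unique:
  "map length yss = map length zss \<Longrightarrow> concat yss = concat zss \<Longrightarrow> yss = zss"
proof (induction yss arbitrary: zss)
  case (Cons y yss)
  then obtain z zss' where "zss = z # zss'" "length y = length z" by (cases zss) auto
  then show ?case using Cons by simp
qed simp

text \<open>Concatenation identifies the nested lists with the orderings of \<open>H\<close>, since
  the prescribed lengths determine where an ordering has to be cut.\<close>

lemma card_nested_lists:
  assumes "finite H" "sum_list ls + sum_list (concat lss) = card H"
  shows "card {(bl, cl). map length bl = ls \<and> map (map length) cl = lss \<and>
      distinct (concat (bl @ concat cl)) \<and> set (concat (bl @ concat cl)) = H} = fact (card H)"
    (is "card ?O = _")
proof -
  have "bij_betw (\<lambda>(bl, cl). concat (bl @ concat cl)) ?O (permutations_of_set H)"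
  proof (rule bij_betwI')
    fix p q assume "p \<in> ?O" "q \<in> ?O"
    then obtain bl cl bl' cl' where p: "p = (bl, cl)" "q = (bl', cl')"
      and l: "map length bl = ls" "map (map length) cl = lss" "map length bl' = ls" "map (map length) cl' = lss"
      by auto
    have "p = q" if e: "concat (bl @ concat cl) = concat (bl' @ concat cl')"
    proof -
      have lc: "map length (concat cl) = concat lss" "map length (concat cl') = concat lss"
        using l by (simp_all add: map_concat flip: l)
      have "bl @ concat cl = bl' @ concat cl'"
        using l lc by (intro lists_chop_unique[OF _ e]) simp
      then have "bl = bl' \<and> concat cl = concat cl'"
        using l by (metis append_eq_append_conv length_map)
      moreover have "map length cl = map length cl'"
      proof -
        have "map length cl = map length (map (map length) cl)" "map length cl' = map length (map (map length) cl')"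
          by (simp_all add: comp_def)
        then show ?thesis unfolding l by (rule trans[OF _ sym])
      qed
      ultimately show ?thesis using lists_chop_unique p by blast
    qed
    then show "((case p of (bl, cl) \<Rightarrow> concat (bl @ concat cl)) = (case q of (bl, cl) \<Rightarrow> concat (bl @ concat cl))) = (p = q)"
      using p by auto
  next
    fix p assume "p \<in> ?O"
    then obtain bl cl where "p = (bl, cl)" "distinct (concat (bl @ concat cl))" "set (concat (bl @ concat cl)) = H" by blast
    then show "(case p of (bl, cl) \<Rightarrow> concat (bl @ concat cl)) \<in> permutations_of_set H" by (simp only: prod.case permutations_of_setI)
  next
    fix xs assume "xs \<in> permutations_of_set H"
    then have xs: "distinct xs" "set xs = H" by (auto dest: permutations_of_setD)
    then have "sum_list (ls @ concat lss) = length xs" using assms(2) distinct_card by fastforce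
    then obtain yss where yss: "map length yss = ls @ concat lss" "concat yss = xs" using lists_chop by blast
    define bl where "bl = take (length ls) yss"
    define ds where "ds = drop (length ls) yss"
    have bl: "map length bl = ls" "map length ds = concat lss" using yss(1) by (simp_all add: bl_def ds_def take_map[symmetric] drop_map[symmetric])
    have "sum_list (map length lss) = length ds" using bl(2) by (metis length_concat length_map)
    then obtain cl where cl: "map length cl = map length lss" "concat cl = ds" using lists_chop by blast
    have "map (map length) cl = lss"
    proof (rule lists_chop_unique)
      show "map length (map (map length) cl) = map length lss" using cl(1) by (simp add: comp_def)
      show "concat (map (map length) cl) = concat lss" using cl(2) bl(2) by (simp add: map_concat[symmetric])
    qed
    moreover have "concat (bl @ concat cl) = xs" using yss(2) cl(2) by (simp add: bl_def ds_def flip: concat_append)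
    ultimately show "\<exists>p\<in>?O. xs = (case p of (bl, cl) \<Rightarrow> concat (bl @ concat cl))"
      using xs bl(1) by (intro bexI[of _ "(bl, cl)"]) (simp_all only: prod.case mem_Collect_eq simp_thms)
  qed
  then show ?thesis using bij_betw_same_card assms(1) by fastforce
qed

lemma distinct_concat_partition:
  assumes "distinct (concat yss)" "[] \<notin> set yss"
  shows "distinct (map set yss) \<and> partition_on (set (concat yss)) (set ` set yss)"
proof
  have "removeAll [] yss = yss" using assms(2) by (simp add: removeAll_id)
  then have d: "distinct yss" "\<And>ys zs. ys \<in> set yss \<Longrightarrow> zs \<in> set yss \<Longrightarrow> ys \<noteq> zs \<Longrightarrow> set ys \<inter> set zs = {}"
    using assms(1) unfolding distinct_concat_iff by auto
  have ne: "set ys \<noteq> {}" if "ys \<in> set yss" for ys using that assms(2) by auto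
  have "inj_on set (set yss)"
    using d(2) ne by (metis inf.idem inj_onI)
  then show "distinct (map set yss)" using d(1) by (simp add: distinct_map)
  show "partition_on (set (concat yss)) (set ` set yss)"
  proof (rule partition_onI)
    show "disjnt p q" if "p \<in> set ` set yss" "q \<in> set ` set yss" "p \<noteq> q" for p q
      using that d(2) by (auto simp: disjnt_def)
  qed (use ne in auto)
qed

lemma distinct_concat_of_partition:
  assumes "distinct (map set yss)" "disjoint (set ` set yss)" "\<And>ys. ys \<in> set yss \<Longrightarrow> distinct ys"
  shows "distinct (concat yss)"
proof (rule distinct_concat)
  show "distinct yss" using assms(1) by (simp add: distinct_map)
  show "set ys \<inter> set zs = {}" if "ys \<in> set yss" "zs \<in> set yss" "ys \<noteq> zs" for ys zs
  proof -
    have "set ys \<noteq> set zs" using that assms(1) by (auto simp: distinct_map dest: inj_onD)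
    then show ?thesis using that assms(2) by (auto dest: disjointD)
  qed
qed (use assms(3) in auto)

lemma map2_ignore_left: "length xs = length ys \<Longrightarrow> map2 (\<lambda>_ y. f y) xs ys = map f ys"
  by (induction xs ys rule: list_induct2) auto

section \<open>Ordered families of rooted cycles\<close>

definition rooted_cycle :: "('h \<Rightarrow> 'h) \<Rightarrow> 'h \<Rightarrow> 'h list" where
  "rooted_cycle \<phi> h = (THE x. x \<in> cyc_lists \<phi> \<and> hd x = h)"

lemma rooted_cycle:
  assumes "permutation \<phi>"
  shows "rooted_cycle \<phi> h \<in> cyc_lists \<phi>" "hd (rooted_cycle \<phi> h) = h"
proof -
  have "\<exists>!x. x \<in> cyc_lists \<phi> \<and> hd x = h"
    using cyc_lists_ex[OF assms, of h] cyc_lists_unique by metis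
  then have "rooted_cycle \<phi> h \<in> cyc_lists \<phi> \<and> hd (rooted_cycle \<phi> h) = h"
    unfolding rooted_cycle_def by (rule theI')
  then show "rooted_cycle \<phi> h \<in> cyc_lists \<phi>" "hd (rooted_cycle \<phi> h) = h" by auto
qed

lemma rooted_cycle_eq: "permutation \<phi> \<Longrightarrow> x \<in> cyc_lists \<phi> \<Longrightarrow> rooted_cycle \<phi> (hd x) = x"
  using rooted_cycle[of \<phi> "hd x"] cyc_lists_unique by blast

text \<open>A cell of given lengths whose cycles are put in order and rooted. Distinctness is
  imposed on the underlying sets because one cycle has several rootings.\<close>

definition ordered_cells :: "('h \<Rightarrow> 'h) \<Rightarrow> nat \<times> nat list \<Rightarrow> 'h list list set" where
  "ordered_cells \<phi> s = {fl. list_all2 (\<lambda>m x. x \<in> {x \<in> cyc_lists \<phi>. length x = m}) (snd s) fl \<and> distinct (map set fl)}"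

definition cell_of :: "nat \<times> nat list \<Rightarrow> 'h list list \<Rightarrow> nat \<times> 'h set set" where
  "cell_of s fl = (fst s, set ` set fl)"

text \<open>An instance of \<open>card_lists_over\<close>: the cycles of \<open>f\<close> have their
  lengths as keys and their rootings as structures. Ordering cycles of equal length yields
  \<open>sym_factor\<close>, rooting yields the product of the lengths.\<close>

lemma card_ordered_cells:
  assumes "\<phi> permutes H" "finite H" "f \<subseteq> cycles_on H \<phi>"
  shows "finite {fl \<in> ordered_cells \<phi> s. cell_of s fl = (h, f)} \<and>
    card {fl \<in> ordered_cells \<phi> s. cell_of s fl = (h, f)} =
      (if (h, image_mset card (mset_set f)) = (fst s, mset (snd s))
       then sym_factor (mset (snd s)) * (\<Prod>m\<in>#mset (snd s). m) else 0)"
proof (cases "(h, image_mset card (mset_set f)) = (fst s, mset (snd s))")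
  case True
  note perm = permutes_permutation[OF assms(1,2)]
  have fin: "finite f" using assms by (metis cycles_on_def finite_imageI finite_subset)
  let ?X = "\<lambda>m. {x \<in> cyc_lists \<phi>. length x = m}"
  have "{fl \<in> ordered_cells \<phi> s. cell_of s fl = (h, f)} =
     {cl. list_all2 (\<lambda>m x. x \<in> ?X m) (snd s) cl \<and> distinct (map2 (\<lambda>_. set) (snd s) cl) \<and>
        set (map2 (\<lambda>_. set) (snd s) cl) = f}" (is "?A = ?B")
  proof -
    have "list_all2 (\<lambda>m x. x \<in> ?X m) (snd s) cl \<Longrightarrow> map2 (\<lambda>_. set) (snd s) cl = map set cl" for cl
      by (intro map2_ignore_left) (auto dest: list_all2_lengthD)
    then show ?thesis using True unfolding ordered_cells_def cell_of_def by (auto simp del: set_map simp: set_map[symmetric])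
  qed
  moreover have "finite ?B \<and> card ?B = sym_factor (mset (map (\<lambda>m. m) (snd s))) * (\<Prod>v\<in>#mset (map (\<lambda>m. m) (snd s)). v)"
  proof (rule card_lists_over[OF fin, where k = card])
    show "mset (map (\<lambda>m. m) (snd s)) = image_mset card (mset_set f)" using True by simp
  next
    fix m c assume "m \<in> set (snd s)" "c \<in> f"
    then obtain y where c: "c = orbit \<phi> y" "c \<subseteq> H"
      using assms permutes_orbit_subset[OF assms(1)] unfolding cycles_on_def by blast
    have "{x \<in> ?X m. set x = c} \<subseteq> {xs. set xs \<subseteq> H \<and> length xs = m}" using c by auto
    then show "finite {x \<in> ?X m. set x = c}"
      using finite_lists_length_eq[OF assms(2)] by (rule finite_subset)
    have "{x \<in> ?X m. set x = c} = {x \<in> cyc_lists \<phi>. length x = m \<and> set x = c}" by blast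
    then show "card {x \<in> ?X m. set x = c} = (if card c = m then m else 0)"
      using card_cyc_lists[OF perm c(1)] by simp
  qed
  ultimately show ?thesis using True by simp
next
  case False
  \<comment> \<open>An ordered cell determines the genus and the lengths of the cell below it, so
    none lies above an incompatible one.\<close>
  have "False" if fl: "fl \<in> ordered_cells \<phi> s" "cell_of s fl = (h, f)" for fl
  proof -
    have "list_all2 (\<lambda>m x. x \<in> {x \<in> cyc_lists \<phi>. length x = m}) (snd s) fl" "distinct (map set fl)"
      using fl by (auto simp: ordered_cells_def)
    then have "map (\<lambda>x. card (set x)) fl = snd s"
      by (induction "snd s" fl arbitrary: s rule: list_all2_induct)
         (auto simp: cyc_lists_def distinct_card)
    then have "mset (snd s) = image_mset card (mset (map set fl))" by (simp flip: mset_map add: comp_def)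
    also have "\<dots> = image_mset card (mset_set (set (map set fl)))"
      using \<open>distinct (map set fl)\<close> by (simp only: mset_set_set)
    finally show False using False fl(2) by (simp add: cell_of_def)
  qed
  then have e: "{fl \<in> ordered_cells \<phi> s. cell_of s fl = (h, f)} = {}" by blast
  show ?thesis unfolding e using False by auto
qed

text \<open>A shape is a weight with orders chosen at both levels, that of the cells and that of the
  cycles in each cell; this map forgets the orders.\<close>

definition shape_weight :: "(nat \<times> nat list) list \<Rightarrow> weight multiset" where
  "shape_weight sh = mset (map (\<lambda>s. (fst s, mset (snd s))) sh)"

text \<open>The first factor is a singleton because boundaries are already labelled and rooted. Only
  the inner cells leave choices: an order of the cells, an order of the cycles in each, and a root
  on each cycle.\<close>

definition orderings ::
  "nat list \<Rightarrow> (nat \<times> nat list) list \<Rightarrow> ('h \<Rightarrow> 'h) \<times> (nat \<rightharpoonup> 'h) \<times> (nat \<times> 'h set set) set \<Rightarrow>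
     ('h list list \<times> 'h list list list) set" where
  "orderings bs sh p = (case p of (\<phi>, r, K) \<Rightarrow> {map (\<lambda>i. rooted_cycle \<phi> (the (r i))) bs} \<times>
     {cl. list_all2 (\<lambda>s c. c \<in> ordered_cells \<phi> s) sh cl \<and> distinct (map2 cell_of sh cl) \<and> set (map2 cell_of sh cl) = K})"

lemma premaps_finite_cells:
  assumes "finite H" "(\<phi>, r, K) \<in> premaps H L B w"
  shows "finite K"
proof -
  have "finite (snd ` K)"
    using assms by (intro finite_elements[of "cycles_on H \<phi> - orbit \<phi> ` ran r"]) (auto simp: premaps_def cycles_on_def)
  then show ?thesis using assms by (auto simp: premaps_def dest: finite_imageD)
qed

text \<open>\<open>card_lists_over\<close> one level up: the cells have genus and lengths as keys,
  and \<open>card_ordered_cells\<close> counts the structures above each cell. The two levels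
  multiply to \<open>weight_factor\<close>.\<close>

lemma card_orderings:
  assumes "finite H" "p \<in> premaps H L B w" "w = shape_weight sh"
  shows "finite (orderings bs sh p) \<and> card (orderings bs sh p) = weight_factor w"
proof -
  obtain \<phi> r K where p: "p = (\<phi>, r, K)" by (cases p)
  have K: "finite K" using premaps_finite_cells assms p by blast
  have \<phi>: "\<phi> permutes H" and part: "partition_on (cycles_on H \<phi> - orbit \<phi> ` ran r) (snd ` K)"
    and w: "cells_weight K = w" using assms p by (auto simp: premaps_def)
  let ?C = "{cl. list_all2 (\<lambda>s c. c \<in> ordered_cells \<phi> s) sh cl \<and> distinct (map2 cell_of sh cl) \<and> set (map2 cell_of sh cl) = K}"
  have "finite ?C \<and> card ?C = sym_factor (mset (map (\<lambda>s. (fst s, mset (snd s))) sh)) *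
      (\<Prod>v\<in>#mset (map (\<lambda>s. (fst s, mset (snd s))) sh). sym_factor (snd v) * (\<Prod>m\<in>#snd v. m))"
  proof (rule card_lists_over[OF K, where k = "\<lambda>(h, f). (h, image_mset card (mset_set f))"])
    show "mset (map (\<lambda>s. (fst s, mset (snd s))) sh) = image_mset (\<lambda>(h, f). (h, image_mset card (mset_set f))) (mset_set K)"
      using w assms(3) by (simp add: cells_weight_def shape_weight_def)
  next
    fix s a assume "a \<in> K"
    obtain h f where a: "a = (h, f)" by (cases a)
    have "f \<subseteq> cycles_on H \<phi>" using part \<open>a \<in> K\<close> a by (force simp: partition_on_def)
    then show "finite {c \<in> ordered_cells \<phi> s. cell_of s c = a}"
      "card {c \<in> ordered_cells \<phi> s. cell_of s c = a} =
         (if (case a of (h, f) \<Rightarrow> (h, image_mset card (mset_set f))) = (fst s, mset (snd s))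
          then sym_factor (snd (fst s, mset (snd s))) * (\<Prod>m\<in>#snd (fst s, mset (snd s)). m) else 0)"
      using card_ordered_cells[OF \<phi> assms(1), of f s h] a by simp_all
  qed
  then show ?thesis unfolding orderings_def p prod.case weight_factor_def
    using assms(3) by (simp add: shape_weight_def card_cartesian_product)
qed

lemma ordered_cells_list:
  assumes "list_all2 (\<lambda>s c. c \<in> ordered_cells \<phi> s) sh cl"
  shows "map (map length) cl = map snd sh" "set (concat cl) \<subseteq> cyc_lists \<phi>"
    "\<And>fl. fl \<in> set cl \<Longrightarrow> distinct (map set fl)"
    "map snd (map2 cell_of sh cl) = map (\<lambda>fl. set (map set fl)) cl"
proof -
  have 1: "map length fl = snd s \<and> set fl \<subseteq> cyc_lists \<phi> \<and> distinct (map set fl)" if "fl \<in> ordered_cells \<phi> s" for fl s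
  proof -
    have "list_all2 (\<lambda>m x. x \<in> {x \<in> cyc_lists \<phi>. length x = m}) (snd s) fl" using that by (simp add: ordered_cells_def)
    then have "map length fl = snd s \<and> set fl \<subseteq> cyc_lists \<phi>"
      by (induction "snd s" fl arbitrary: s rule: list_all2_induct) auto
    then show ?thesis using that by (simp add: ordered_cells_def)
  qed
  show "map (map length) cl = map snd sh" "set (concat cl) \<subseteq> cyc_lists \<phi>"
    "\<And>fl. fl \<in> set cl \<Longrightarrow> distinct (map set fl)"
    "map snd (map2 cell_of sh cl) = map (\<lambda>fl. set (map set fl)) cl"
    using assms by (induction rule: list_all2_induct) (use 1 in \<open>auto simp: cell_of_def\<close>)
qed

text \<open>The cycles of a permutation partition \<open>H\<close>, so an ordering writes every
  half-edge exactly once into a pattern of slots that depends only on the boundary lengths and the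
  shape.\<close>

lemma orderings_nested_lists:
  assumes "finite H" "finite B" "(\<phi>, r, K) \<in> premaps H L B w"
    and o: "(bl, cl) \<in> orderings (sorted_list_of_set B) sh (\<phi>, r, K)"
  shows "map length bl = map L (sorted_list_of_set B)" "map (map length) cl = map snd sh"
    "distinct (concat (bl @ concat cl))" "set (concat (bl @ concat cl)) = H"
    "set (bl @ concat cl) \<subseteq> cyc_lists \<phi>"
proof -
  let ?bs = "sorted_list_of_set B"
  have \<phi>: "\<phi> permutes H" and part: "partition_on (cycles_on H \<phi> - orbit \<phi> ` ran r) (snd ` K)"
    and r: "dom r = B" "ran r \<subseteq> H" "inj_on (\<lambda>i. orbit \<phi> (the (r i))) B" "\<forall>i\<in>B. card (orbit \<phi> (the (r i))) = L i"
    and K: "inj_on snd K" using assms(3) by (auto simp: premaps_def)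
  note perm = permutes_permutation[OF \<phi> assms(1)]
  have bl: "bl = map (\<lambda>i. rooted_cycle \<phi> (the (r i))) ?bs"
    and cl: "list_all2 (\<lambda>s c. c \<in> ordered_cells \<phi> s) sh cl" "distinct (map2 cell_of sh cl)" "set (map2 cell_of sh cl) = K"
    using o by (auto simp: orderings_def)
  note cl' = ordered_cells_list[OF cl(1)]
  show "map (map length) cl = map snd sh" by (rule cl'(1))
  show "map length bl = map L ?bs"
    using r(4) assms(2) cyc_lists_length[OF rooted_cycle(1)[OF perm]] rooted_cycle(2)[OF perm]
    by (simp add: bl)
  show cyc: "set (bl @ concat cl) \<subseteq> cyc_lists \<phi>"
    using cl'(2) rooted_cycle(1)[OF perm] by (auto simp: bl)
  have setbl: "map set bl = map (\<lambda>i. orbit \<phi> (the (r i))) ?bs"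
    using cyc_lists_set[OF rooted_cycle(1)[OF perm]] rooted_cycle(2)[OF perm] by (simp add: bl)
  have dbl: "distinct (map set bl)" unfolding setbl using r(3) assms(2) by (simp add: distinct_map)
  have ran: "ran r = (\<lambda>i. the (r i)) ` B" using r(1) by (force simp: ran_def dom_def)
  have sbl: "set (map set bl) = orbit \<phi> ` ran r"
    unfolding setbl ran using assms(2) by (simp add: image_image)
  let ?cs = "map (map set) cl"
  have "distinct (map set ?cs)"
  proof -
    have "distinct (map snd (map2 cell_of sh cl))" by (subst distinct_map) (simp only: cl K simp_thms)
    then show ?thesis unfolding cl'(4) by (simp add: comp_def)
  qed
  moreover have scs: "set ` set ?cs = snd ` K"
  proof -
    have "snd ` K = set (map snd (map2 cell_of sh cl))"
      unfolding cl(3)[symmetric] by (rule list.set_map[symmetric])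
    then show ?thesis unfolding cl'(4) by (simp add: image_image)
  qed
  ultimately have dcs: "distinct (concat ?cs)"
    using part cl'(3) by (intro distinct_concat_of_partition) (auto simp: partition_on_def)
  have sc: "set (concat ?cs) = cycles_on H \<phi> - orbit \<phi> ` ran r"
  proof -
    have "set (concat ?cs) = \<Union> (set ` set ?cs)" by simp
    then show ?thesis unfolding scs using part by (simp add: partition_on_def)
  qed
  have ms: "map set (bl @ concat cl) = map set bl @ concat ?cs" by (simp add: map_concat)
  have dxs: "distinct (map set (bl @ concat cl))"
    unfolding ms using dbl dcs sbl sc by auto
  have "orbit \<phi> ` ran r \<subseteq> cycles_on H \<phi>" using r(2) by (auto simp: cycles_on_def)
  then have sxs: "set (map set (bl @ concat cl)) = cycles_on H \<phi>"
    unfolding ms set_append sbl sc by blast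
  note pc = partition_on_cycles[OF \<phi> assms(1)]
  show "distinct (concat (bl @ concat cl))"
  proof (rule distinct_concat_of_partition[OF dxs])
    show "disjoint (set ` set (bl @ concat cl))" using pc unfolding partition_on_def sxs[symmetric] by (simp only: set_map)
    show "distinct ys" if "ys \<in> set (bl @ concat cl)" for ys using that cyc by (auto simp: cyc_lists_def)
  qed
  have "set (concat (bl @ concat cl)) = \<Union> (set (map set (bl @ concat cl)))" by auto
  then show "set (concat (bl @ concat cl)) = H" unfolding sxs using pc by (simp add: partition_on_def)
qed

text \<open>The lists prescribe the permutation on \<open>H\<close>, the heads of \<open>bl\<close>
  are the roots, and \<open>cl\<close> with the shape lists the cells.\<close>

lemma orderings_unique:
  assumes "finite H" "finite B" "p \<in> premaps H L B w" "p' \<in> premaps H L B w"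
    and "(bl, cl) \<in> orderings (sorted_list_of_set B) sh p" "(bl, cl) \<in> orderings (sorted_list_of_set B) sh p'"
  shows "p = p'"
proof -
  obtain \<phi> r K where p: "p = (\<phi>, r, K)" by (cases p)
  obtain \<phi>' r' K' where p': "p' = (\<phi>', r', K')" by (cases p')
  note n = orderings_nested_lists[OF assms(1,2) assms(3,5)[unfolded p]]
  note n' = orderings_nested_lists[OF assms(1,2) assms(4,6)[unfolded p']]
  have \<phi>: "\<phi> permutes H" "\<phi>' permutes H" and r: "dom r = B" "dom r' = B"
    using assms(3,4) by (auto simp: p p' premaps_def)
  have "\<phi> y = \<phi>' y" for y
  proof (cases "y \<in> H")
    case True
    then obtain x where x: "x \<in> set (bl @ concat cl)" "y \<in> set x" using n(4) by auto
    then have "x \<in> cyc_lists \<phi>" "x \<in> cyc_lists \<phi>'" using n(5) n'(5) by blast+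
    then have "map \<phi> x = map \<phi>' x" by (simp add: cyc_lists_def)
    then show ?thesis using x(2) by simp
  qed (use \<phi> in \<open>simp add: permutes_not_in\<close>)
  then have "\<phi> = \<phi>'" by blast
  moreover have "r i = r' i" for i
  proof (cases "i \<in> B")
    case True
    have "map (\<lambda>i. rooted_cycle \<phi> (the (r i))) (sorted_list_of_set B) = map (\<lambda>i. rooted_cycle \<phi>' (the (r' i))) (sorted_list_of_set B)"
      using assms(5,6) by (auto simp: p p' orderings_def)
    then have "rooted_cycle \<phi> (the (r i)) = rooted_cycle \<phi>' (the (r' i))"
      using True assms(2) by simp
    then have "the (r i) = the (r' i)"
      using rooted_cycle(2) permutes_permutation[OF _ assms(1)] \<phi> by metis
    moreover obtain a b where "r i = Some a" "r' i = Some b" using True r by (metis domD)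
    ultimately show ?thesis by simp
  qed (use r in \<open>auto simp: dom_def\<close>)
  then have "r = r'" by blast
  moreover have "K = K'" using assms(5,6) by (auto simp: p p' orderings_def)
  ultimately show ?thesis by (simp add: p p')
qed

text \<open>Every filling of the pattern is the cycle decomposition of some permutation. Positive
  lengths make all lists nonempty, so each has a head and different lists have different
  sets.\<close>

lemma orderings_exist:
  assumes "finite H" "finite B" "\<And>i. i \<in> B \<Longrightarrow> L i \<ge> 1" "set_mset (shape_weight sh) \<subseteq> stuffed_weights"
    and l: "map length bl = map L (sorted_list_of_set B)" "map (map length) cl = map snd sh"
    and d: "distinct (concat (bl @ concat cl))" "set (concat (bl @ concat cl)) = H"
  shows "\<exists>p\<in>premaps H L B (shape_weight sh). (bl, cl) \<in> orderings (sorted_list_of_set B) sh p"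
proof -
  let ?bs = "sorted_list_of_set B"
  have sh: "snd s \<noteq> [] \<and> (\<forall>m\<in>set (snd s). m \<ge> 1)" if "s \<in> set sh" for s
    using assms(4) that by (auto simp: shape_weight_def stuffed_weights_def)
  have cl_ne: "fl \<noteq> [] \<and> [] \<notin> set fl" if "fl \<in> set cl" for fl
  proof -
    have "map length fl \<in> set (map snd sh)" using that l(2) by (metis image_eqI list.set_map)
    then obtain s where s: "s \<in> set sh" "map length fl = snd s" by auto
    have "0 \<notin> set (map length fl)" "map length fl \<noteq> []" unfolding s(2) using sh[OF s(1)] by force+
    then show ?thesis by force
  qed
  have bl_ne: "[] \<notin> set bl"
  proof
    assume "[] \<in> set bl"
    then have "0 \<in> set (map L ?bs)" unfolding l(1)[symmetric] by force
    then show False using assms(2,3) by force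
  qed
  have ne: "[] \<notin> set (bl @ concat cl)" using cl_ne bl_ne by auto
  obtain \<phi> where \<phi>: "\<phi> permutes H" and cyc: "\<And>x. x \<in> set (bl @ concat cl) \<Longrightarrow> x \<in> cyc_lists \<phi>"
    using cyc_lists_exists_perm[OF d(1)] ne unfolding d(2) by metis
  note perm = permutes_permutation[OF \<phi> assms(1)]
  have dset: "distinct (map set (bl @ concat cl))" and part: "partition_on H (set ` set (bl @ concat cl))"
    using distinct_concat_partition[OF d(1) ne] unfolding d(2) by auto
  have orb: "orbit \<phi> y = set x" if "x \<in> set (bl @ concat cl)" "y \<in> set x" for x y
    using cyc_lists_set[OF cyc[OF that(1)]] that(2) orbit_eq_iff[OF perm] by metis
  have cycles: "cycles_on H \<phi> = set ` set (bl @ concat cl)"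
  proof (intro equalityI subsetI)
    fix c assume "c \<in> cycles_on H \<phi>"
    then obtain y where "y \<in> H" "c = orbit \<phi> y" by (auto simp: cycles_on_def)
    moreover obtain x where "x \<in> set (bl @ concat cl)" "y \<in> set x" using \<open>y \<in> H\<close> d(2) by auto
    ultimately show "c \<in> set ` set (bl @ concat cl)" using orb by blast
  next
    fix c assume "c \<in> set ` set (bl @ concat cl)"
    then obtain x where x: "x \<in> set (bl @ concat cl)" "c = set x" by blast
    then have "x \<noteq> []" using ne by metis
    then have "hd x \<in> set x" by simp
    moreover have "set x \<subseteq> H" using x(1) d(2) by auto
    ultimately show "c \<in> cycles_on H \<phi>" using orb[OF x(1)] x(2) unfolding cycles_on_def by blast
  qed
  have len: "length bl = length ?bs" using l(1) by (metis length_map)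
  define r where "r = map_of (zip ?bs (map hd bl))"
  have r_nth: "r (?bs ! j) = Some (hd (bl ! j))" if "j < length bl" for j
    using that len unfolding r_def by (subst map_of_zip_nth) auto
  have dom_r: "dom r = B" unfolding r_def using len assms(2) by simp
  have idx: "\<exists>j<length bl. i = ?bs ! j" if "i \<in> B" for i
    using that len assms(2) by (metis in_set_conv_nth set_sorted_list_of_set)
  have orb_r: "orbit \<phi> (the (r (?bs ! j))) = set (bl ! j)" if "j < length bl" for j
  proof -
    have "bl ! j \<in> set bl" using that by simp
    moreover have "bl ! j \<noteq> []" using calculation bl_ne by metis
    ultimately show ?thesis using orb[of "bl ! j" "hd (bl ! j)"] r_nth[OF that] by simp
  qed
  have ran_r: "orbit \<phi> ` ran r = set ` set bl"
  proof -
    have "ran r = (\<lambda>i. the (r i)) ` B" unfolding dom_r[symmetric] by (force simp: ran_def dom_def)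
    then have "orbit \<phi> ` ran r = (\<lambda>i. orbit \<phi> (the (r i))) ` B" by (simp add: image_image)
    also have "B = (\<lambda>j. ?bs ! j) ` {..<length bl}" using idx len assms(2) nth_mem[of _ ?bs] by fastforce
    also have "(\<lambda>i. orbit \<phi> (the (r i))) ` (\<lambda>j. ?bs ! j) ` {..<length bl} = (\<lambda>j. set (bl ! j)) ` {..<length bl}"
      unfolding image_image using orb_r by (intro image_cong) auto
    also have "\<dots> = set ` set bl" by (simp add: set_conv_nth image_Collect lessThan_def) blast
    finally show ?thesis .
  qed
  have lens: "length sh = length cl" using l(2) by (metis length_map)
  define K where "K = set (map2 cell_of sh cl)"
  let ?cs = "map (map set) cl"
  have all2: "list_all2 (\<lambda>s c. c \<in> ordered_cells \<phi> s) sh cl"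
    unfolding list_all2_conv_all_nth
  proof (intro conjI allI impI)
    fix j assume j: "j < length sh"
    then have clj: "cl ! j \<in> set cl" using lens by simp
    have "map length (cl ! j) = snd (sh ! j)" using arg_cong[OF l(2), of "\<lambda>xs. xs ! j"] j lens by simp
    moreover have "set (cl ! j) \<subseteq> cyc_lists \<phi>" using cyc clj by auto
    ultimately have "list_all2 (\<lambda>m x. x \<in> {x \<in> cyc_lists \<phi>. length x = m}) (snd (sh ! j)) (cl ! j)"
    proof -
      have "length (snd (sh ! j)) = length (cl ! j)" "\<And>i. i < length (cl ! j) \<Longrightarrow> length (cl ! j ! i) = snd (sh ! j) ! i"
        unfolding \<open>map length (cl ! j) = _\<close>[symmetric] by simp_all
      then show ?thesis using \<open>set (cl ! j) \<subseteq> cyc_lists \<phi>\<close> by (auto simp: list_all2_conv_all_nth)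
    qed
    moreover have "distinct (map set (cl ! j))"
    proof -
      have "distinct (map set (concat cl))" using dset by simp
      then have "distinct (concat ?cs)" by (simp only: map_concat)
      then show ?thesis using clj unfolding distinct_concat_iff by auto
    qed
    ultimately show "cl ! j \<in> ordered_cells \<phi> (sh ! j)" by (simp add: ordered_cells_def)
  qed (rule lens)
  note cl' = ordered_cells_list[OF all2]
  have dcs: "distinct (concat ?cs)" "[] \<notin> set ?cs"
    using dset cl_ne by (auto simp flip: map_concat)
  note pcs = distinct_concat_partition[OF dcs]
  have dK: "distinct (map snd (map2 cell_of sh cl))" unfolding cl'(4) using pcs by (simp add: comp_def)
  have dK': "distinct (map2 cell_of sh cl)" using dK unfolding distinct_map by blast
  have injK: "inj_on snd K" using dK unfolding K_def distinct_map by blast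
  have "set (concat ?cs) = cycles_on H \<phi> - orbit \<phi> ` ran r"
  proof -
    have "set (map set (concat cl)) \<inter> set (map set bl) = {}" using dset by auto
    moreover have "set (concat ?cs) = set (map set (concat cl))" by (simp only: map_concat)
    moreover have "cycles_on H \<phi> = set (map set bl) \<union> set (map set (concat cl))" unfolding cycles by auto
    moreover have "orbit \<phi> ` ran r = set (map set bl)" unfolding ran_r by simp
    ultimately show ?thesis by blast
  qed
  moreover have "snd ` K = set ` set ?cs"
  proof -
    have "snd ` K = set (map snd (map2 cell_of sh cl))" unfolding K_def by (rule list.set_map[symmetric])
    then show ?thesis unfolding cl'(4) by (simp add: image_image)
  qed
  ultimately have partK: "partition_on (cycles_on H \<phi> - orbit \<phi> ` ran r) (snd ` K)" using pcs by simp
  have "cells_weight K = shape_weight sh"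
  proof -
    have "cells_weight K = mset (map (\<lambda>(h, f). (h, image_mset card (mset_set f))) (map2 cell_of sh cl))"
      unfolding cells_weight_def K_def mset_set_set[OF dK'] by (rule mset_map[symmetric])
    also have "map (\<lambda>(h, f). (h, image_mset card (mset_set f))) (map2 cell_of sh cl) = map (\<lambda>s. (fst s, mset (snd s))) sh"
    proof (rule nth_equalityI)
      fix j assume "j < length (map (\<lambda>(h, f). (h, image_mset card (mset_set f))) (map2 cell_of sh cl))"
      then have j: "j < length sh" "j < length cl" using lens by auto
      have clj: "cl ! j \<in> set cl" using j by simp
      have "image_mset card (mset_set (set (map set (cl ! j)))) = mset (map card (map set (cl ! j)))"
        using cl'(3)[OF clj] by (simp only: mset_set_set mset_map)
      also have "map card (map set (cl ! j)) = map length (cl ! j)"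
      proof -
        have "card (set x) = length x" if "x \<in> set (cl ! j)" for x
          using cyc[of x] that clj by (intro distinct_card) (auto simp: cyc_lists_def)
        then show ?thesis by simp
      qed
      also have "\<dots> = snd (sh ! j)" using arg_cong[OF l(2), of "\<lambda>xs. xs ! j"] j lens by simp
      finally show "map (\<lambda>(h, f). (h, image_mset card (mset_set f))) (map2 cell_of sh cl) ! j
          = map (\<lambda>s. (fst s, mset (snd s))) sh ! j"
        using j by (simp add: cell_of_def)
    qed (use lens in simp)
    finally show ?thesis by (simp add: shape_weight_def)
  qed
  moreover have "inj_on (\<lambda>i. orbit \<phi> (the (r i))) B"
  proof (rule inj_onI)
    fix i i' assume "i \<in> B" "i' \<in> B" and e: "orbit \<phi> (the (r i)) = orbit \<phi> (the (r i'))"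
    then obtain j j' where j: "j < length bl" "i = ?bs ! j" "j' < length bl" "i' = ?bs ! j'" using idx by metis
    have "set (bl ! j) = set (bl ! j')" using e j orb_r by simp
    moreover have "distinct (map set bl)" using dset by simp
    ultimately have "j = j'" using j by (simp add: distinct_conv_nth) metis
    then show "i = i'" using j by simp
  qed
  moreover have "\<forall>i\<in>B. card (orbit \<phi> (the (r i))) = L i"
  proof
    fix i assume "i \<in> B"
    then obtain j where j: "j < length bl" "i = ?bs ! j" using idx by metis
    have "distinct (bl ! j)" using cyc[of "bl ! j"] j by (simp add: cyc_lists_def)
    then have "card (orbit \<phi> (the (r i))) = length (bl ! j)" using orb_r j by (simp add: distinct_card)
    also have "\<dots> = L i" using arg_cong[OF l(1), of "\<lambda>xs. xs ! j"] j len by simp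
    finally show "card (orbit \<phi> (the (r i))) = L i" .
  qed
  moreover have "ran r \<subseteq> H"
  proof
    fix y assume "y \<in> ran r"
    then have "orbit \<phi> y \<in> set ` set bl" using ran_r by blast
    then have "orbit \<phi> y \<subseteq> H" using d(2) by auto
    then show "y \<in> H" using permutation_self_in_orbit[OF perm] by blast
  qed
  ultimately have "(\<phi>, r, K) \<in> premaps H L B (shape_weight sh)"
    using \<phi> dom_r injK partK by (simp add: premaps_def)
  moreover have "map (\<lambda>i. rooted_cycle \<phi> (the (r i))) ?bs = bl"
  proof (rule nth_equalityI)
    fix j assume "j < length (map (\<lambda>i. rooted_cycle \<phi> (the (r i))) ?bs)"
    then have j: "j < length ?bs" "j < length bl" using len by auto
    then show "map (\<lambda>i. rooted_cycle \<phi> (the (r i))) ?bs ! j = bl ! j"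
      using rooted_cycle_eq[OF perm cyc[of "bl ! j"]] r_nth by simp
  qed (use len in simp)
  then have "(bl, cl) \<in> orderings ?bs sh (\<phi>, r, K)"
    using all2 dK' by (simp add: orderings_def K_def)
  ultimately show ?thesis by blast
qed

section \<open>The number of premaps\<close>

definition map_size :: "(nat \<Rightarrow> nat) \<Rightarrow> nat set \<Rightarrow> weight multiset \<Rightarrow> nat" where
  "map_size L B w = (\<Sum>i\<in>B. L i) + (\<Sum>v\<in>#w. \<Sum>m\<in>#snd v. m)"

lemma shape_exists: "\<exists>sh. shape_weight sh = w"
proof -
  obtain ws where ws: "mset ws = w" by (metis ex_mset)
  define ord where "ord = (\<lambda>A :: nat multiset. SOME xs. mset xs = A)"
  have "mset (ord A) = A" for A unfolding ord_def by (rule someI_ex) (rule ex_mset)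
  then show ?thesis unfolding shape_weight_def using ws
    by (intro exI[of _ "map (\<lambda>v. (fst v, ord (snd v))) ws"]) (simp add: comp_def)
qed

lemma map_size_shape:
  assumes "finite B"
  shows "map_size L B (shape_weight sh) = sum_list (map L (sorted_list_of_set B)) + sum_list (concat (map snd sh))"
proof -
  have "sum_list (concat (map snd sh)) = (\<Sum>v\<in>#shape_weight sh. \<Sum>m\<in>#snd v. m)"
    unfolding shape_weight_def by (induction sh) (auto simp: sum_mset_sum_list)
  moreover have "sum_list (map L (sorted_list_of_set B)) = (\<Sum>i\<in>B. L i)"
    using assms by (simp add: sum_list_distinct_conv_sum_set)
  ultimately show ?thesis by (simp add: map_size_def)
qed

lemma weight_factor_pos:
  assumes "set_mset w \<subseteq> stuffed_weights"
  shows "weight_factor w > 0"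
proof -
  have nz: "sym_factor (snd v) * (\<Prod>m\<in>#snd v. m) \<noteq> 0" if "v \<in># w" for v
  proof -
    have "0 \<notin># snd v" using assms that by (force simp: stuffed_weights_def)
    then have "(\<Prod>m\<in>#snd v. m) \<noteq> 0" by (simp add: prod_mset_zero_iff)
    then show ?thesis using sym_factor_pos[of "snd v"] by simp
  qed
  have "(\<Prod>v\<in>#w. sym_factor (snd v) * (\<Prod>m\<in>#snd v. m)) \<noteq> 0"
  proof
    assume "(\<Prod>v\<in>#w. sym_factor (snd v) * (\<Prod>m\<in>#snd v. m)) = 0"
    then obtain v where "v \<in># w" "sym_factor (snd v) * (\<Prod>m\<in>#snd v. m) = 0"
      unfolding prod_mset_zero_iff by (metis (no_types, lifting) image_iff set_image_mset)
    then show False using nz by blast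
  qed
  then show ?thesis unfolding weight_factor_def neq0_conv by (rule mult_pos_pos[OF sym_factor_pos])
qed

lemma premaps_weights:
  assumes "finite H" "(\<phi>, r, K) \<in> premaps H L B w"
  shows "set_mset w \<subseteq> stuffed_weights"
proof
  fix v assume "v \<in># w"
  then obtain h f where hf: "(h, f) \<in> K" "v = (h, image_mset card (mset_set f))"
    using assms premaps_finite_cells[OF assms] by (auto simp: premaps_def cells_weight_def)
  have part: "partition_on (cycles_on H \<phi> - orbit \<phi> ` ran r) (snd ` K)" and \<phi>: "\<phi> permutes H"
    using assms by (auto simp: premaps_def)
  have "f \<in> snd ` K" using hf(1) by force
  then have f: "f \<noteq> {}" "f \<subseteq> cycles_on H \<phi>" using part unfolding partition_on_def by blast+
  then have fin: "finite f" using assms(1) by (metis cycles_on_def finite_imageI finite_subset)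
  have "card c \<ge> 1" if c: "c \<in> f" for c
  proof -
    have "c \<noteq> {}" "c \<subseteq> H" using c f(2) partition_on_cycles[OF \<phi> assms(1)] by (auto simp: partition_on_def)
    then show ?thesis using assms(1) by (metis One_nat_def Suc_leI card_gt_0_iff finite_subset)
  qed
  moreover have "image_mset card (mset_set f) \<noteq> {#}" using f(1) fin by (simp add: mset_set_empty_iff)
  ultimately show "v \<in> stuffed_weights" using hf(2) fin by (auto simp: stuffed_weights_def)
qed

text \<open>A single ordering suffices, since it writes all of \<open>H\<close> into the pattern;
  one exists because \<open>weight_factor w\<close> is positive.\<close>

lemma premaps_card:
  assumes "finite H" "finite B" "p \<in> premaps H L B w"
  shows "card H = map_size L B w"
proof -
  obtain \<phi> r K where p: "p = (\<phi>, r, K)" by (cases p)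
  obtain sh where sh: "w = shape_weight sh" using shape_exists by metis
  have "weight_factor w > 0" using premaps_weights assms p by (intro weight_factor_pos) blast
  then have "orderings (sorted_list_of_set B) sh p \<noteq> {}" using card_orderings[OF assms(1,3) sh] by (metis card.empty less_irrefl)
  then obtain bl cl where "(bl, cl) \<in> orderings (sorted_list_of_set B) sh p" by auto
  note n = orderings_nested_lists[OF assms(1,2) assms(3)[unfolded p] this[unfolded p]]
  have "card H = length (concat (bl @ concat cl))" using n(3,4) distinct_card by metis
  also have "\<dots> = sum_list (map length bl) + sum_list (concat (map (map length) cl))"
    by (simp add: length_concat map_concat)
  also have "\<dots> = map_size L B w" unfolding n(1,2) sh map_size_shape[OF assms(2)] ..
  finally show ?thesis .
qed

text \<open>Double counting: the \<open>(card H)!\<close> fillings of the pattern are distributed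
  over the premaps, \<open>weight_factor w\<close> to each.\<close>

lemma card_premaps:
  assumes "finite H" "finite B" "\<And>i. i \<in> B \<Longrightarrow> L i \<ge> 1" "set_mset w \<subseteq> stuffed_weights"
    "card H = map_size L B w"
  shows "finite (premaps H L B w) \<and> card (premaps H L B w) * weight_factor w = fact (card H)"
proof -
  obtain sh where sh: "w = shape_weight sh" using shape_exists by metis
  let ?bs = "sorted_list_of_set B"
  let ?P = "premaps H L B w"
  define Os where "Os = {(bl, cl). map length bl = map L ?bs \<and> map (map length) cl = map snd sh \<and>
      distinct (concat (bl @ concat cl)) \<and> set (concat (bl @ concat cl)) = H}"
  have cO: "card Os = fact (card H)"
    unfolding Os_def using assms(1,2,5) by (intro card_nested_lists) (simp_all add: sh map_size_shape)
  have Os: "Os = (\<Union>p\<in>?P. orderings ?bs sh p)"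
  proof (intro equalityI subsetI)
    fix q assume "q \<in> Os"
    then show "q \<in> (\<Union>p\<in>?P. orderings ?bs sh p)"
      using orderings_exist[OF assms(1,2,3) assms(4)[unfolded sh]] unfolding Os_def sh by fast
  next
    fix q assume "q \<in> (\<Union>p\<in>?P. orderings ?bs sh p)"
    then obtain \<phi> r K bl cl where "(\<phi>, r, K) \<in> ?P" "(bl, cl) \<in> orderings ?bs sh (\<phi>, r, K)" "q = (bl, cl)"
      by (metis (no_types, lifting) UN_iff surj_pair)
    then show "q \<in> Os" using orderings_nested_lists[OF assms(1,2)] unfolding Os_def by fast
  qed
  have disj: "orderings ?bs sh p \<inter> orderings ?bs sh q = {}" if "p \<in> ?P" "q \<in> ?P" "p \<noteq> q" for p q
    using orderings_unique[OF assms(1,2) that(1,2)] that(3) by force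
  have ne: "orderings ?bs sh p \<noteq> {}" if "p \<in> ?P" for p
    using card_orderings[OF assms(1) that sh] weight_factor_pos[OF assms(4)] by (metis card.empty less_irrefl)
  have finO: "finite Os" using cO by (metis card.infinite fact_nonzero)
  \<comment> \<open>Finiteness comes from the orderings: those of distinct premaps are disjoint
    nonempty subsets of the finite set \<open>Os\<close>.\<close>
  have finP: "finite ?P"
  proof (rule inj_on_finite[where f = "orderings ?bs sh" and B = "Pow Os"])
    show "inj_on (orderings ?bs sh) ?P"
    proof (rule inj_onI, rule ccontr)
      fix p q assume pq: "p \<in> ?P" "q \<in> ?P" "orderings ?bs sh p = orderings ?bs sh q" "p \<noteq> q"
      then have "orderings ?bs sh p \<inter> orderings ?bs sh p = {}" using disj[OF pq(1,2,4)] by simp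
      then show False using ne[OF pq(1)] by blast
    qed
  qed (use Os finO in auto)
  have "card Os = (\<Sum>p\<in>?P. card (orderings ?bs sh p))"
    unfolding Os using finP disj card_orderings[OF assms(1) _ sh] by (intro card_UN_disjoint) auto
  also have "\<dots> = (\<Sum>p\<in>?P. weight_factor w)"
    using card_orderings[OF assms(1) _ sh] by (intro sum.cong) auto
  finally show ?thesis using finP cO by simp
qed

section \<open>Expectations as sums over maps\<close>

text \<open>Entries of a power are sums over walks from \<open>i\<close> to \<open>j\<close>. The
  function \<open>a\<close> carries the intermediate indices and is completed by the endpoints at
  \<open>0\<close> and \<open>Suc k\<close>.\<close>

lemma pow_mat_Suc_entry:
  fixes M :: "complex mat"
  assumes M: "M \<in> carrier_mat N N" and "i < N" "j < N"
  shows "(M ^\<^sub>m Suc k) $$ (i, j) = (\<Sum>a\<in>{1..k} \<rightarrow>\<^sub>E {..<N}.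
    \<Prod>t\<le>k. M $$ ((a(0 := i, Suc k := j)) t, (a(0 := i, Suc k := j)) (Suc t)))"
  using assms(3)
proof (induction k arbitrary: j)
  case 0
  then show ?case using assms by simp
next
  case (Suc k)
  have P: "M ^\<^sub>m Suc k \<in> carrier_mat N N" using M by (rule pow_carrier_mat)
  have "(M ^\<^sub>m Suc (Suc k)) $$ (i, j) = (\<Sum>l<N. (M ^\<^sub>m Suc k) $$ (i, l) * M $$ (l, j))"
  proof -
    have "M ^\<^sub>m Suc (Suc k) = M ^\<^sub>m Suc k * M" by simp
    also have "\<dots> $$ (i, j) = (\<Sum>l<N. (M ^\<^sub>m Suc k) $$ (i, l) * M $$ (l, j))"
      using P M assms(2) Suc.prems
      by (subst index_mult_mat(1)) (auto simp: scalar_prod_def lessThan_atLeast0 simp del: pow_mat.simps intro!: sum.cong)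
    finally show ?thesis .
  qed
  also have "\<dots> = (\<Sum>l<N. \<Sum>a\<in>{1..k} \<rightarrow>\<^sub>E {..<N}.
     (\<Prod>t\<le>k. M $$ ((a(0 := i, Suc k := l)) t, (a(0 := i, Suc k := l)) (Suc t))) * M $$ (l, j))"
  proof (rule sum.cong[OF refl])
    fix l assume "l \<in> {..<N}"
    then show "(M ^\<^sub>m Suc k) $$ (i, l) * M $$ (l, j) = (\<Sum>a\<in>{1..k} \<rightarrow>\<^sub>E {..<N}.
     (\<Prod>t\<le>k. M $$ ((a(0 := i, Suc k := l)) t, (a(0 := i, Suc k := l)) (Suc t))) * M $$ (l, j))"
      unfolding sum_distrib_right[symmetric] by (intro arg_cong2[where f = "(*)"] Suc.IH refl) simp
  qed
  also have "\<dots> = (\<Sum>l<N. \<Sum>a\<in>{1..k} \<rightarrow>\<^sub>E {..<N}. \<Prod>t\<le>Suc k.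
     M $$ (((a(Suc k := l))(0 := i, Suc (Suc k) := j)) t, ((a(Suc k := l))(0 := i, Suc (Suc k) := j)) (Suc t)))"
  proof (intro sum.cong refl)
    fix l a
    have "(\<Prod>t\<le>k. M $$ ((a(0 := i, Suc k := l)) t, (a(0 := i, Suc k := l)) (Suc t)))
      = (\<Prod>t\<le>k. M $$ (((a(Suc k := l))(0 := i, Suc (Suc k) := j)) t, ((a(Suc k := l))(0 := i, Suc (Suc k) := j)) (Suc t)))"
      by (intro prod.cong refl) auto
    then show "(\<Prod>t\<le>k. M $$ ((a(0 := i, Suc k := l)) t, (a(0 := i, Suc k := l)) (Suc t))) * M $$ (l, j)
      = (\<Prod>t\<le>Suc k. M $$ (((a(Suc k := l))(0 := i, Suc (Suc k) := j)) t, ((a(Suc k := l))(0 := i, Suc (Suc k) := j)) (Suc t)))"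
      by simp
  qed
  also have "\<dots> = (\<Sum>a\<in>insert (Suc k) {1..k} \<rightarrow>\<^sub>E {..<N}. \<Prod>t\<le>Suc k.
     M $$ ((a(0 := i, Suc (Suc k) := j)) t, (a(0 := i, Suc (Suc k) := j)) (Suc t)))"
    by (rule sum_PiE_insert[symmetric]) simp
  also have "insert (Suc k) {1..k} = {1..Suc k}" by auto
  finally show ?case .
qed

text \<open>The trace closes the walks: the endpoint is the starting point, whence the index modulo
  \<open>Suc k\<close>.\<close>

lemma mtrace_pow_mat:
  fixes M :: "complex mat"
  assumes M: "M \<in> carrier_mat N N"
  shows "mtrace (M ^\<^sub>m Suc k) = (\<Sum>a\<in>{..<Suc k} \<rightarrow>\<^sub>E {..<N}. \<Prod>t<Suc k. M $$ (a t, a (Suc t mod Suc k)))"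
proof -
  have "M ^\<^sub>m Suc k \<in> carrier_mat N N" using M by (rule pow_carrier_mat)
  then have "mtrace (M ^\<^sub>m Suc k) = (\<Sum>i<N. (M ^\<^sub>m Suc k) $$ (i, i))"
    unfolding mtrace_def by (simp only: carrier_matD)
  also have "\<dots> = (\<Sum>i<N. \<Sum>a\<in>{1..k} \<rightarrow>\<^sub>E {..<N}. \<Prod>t<Suc k. M $$ ((a(0 := i)) t, (a(0 := i)) (Suc t mod Suc k)))"
  proof (rule sum.cong[OF refl])
    fix i assume "i \<in> {..<N}"
    then have "(M ^\<^sub>m Suc k) $$ (i, i) = (\<Sum>a\<in>{1..k} \<rightarrow>\<^sub>E {..<N}.
        \<Prod>t\<le>k. M $$ ((a(0 := i, Suc k := i)) t, (a(0 := i, Suc k := i)) (Suc t)))"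
      by (intro pow_mat_Suc_entry[OF M]) auto
    also have "\<dots> = (\<Sum>a\<in>{1..k} \<rightarrow>\<^sub>E {..<N}. \<Prod>t<Suc k. M $$ ((a(0 := i)) t, (a(0 := i)) (Suc t mod Suc k)))"
    proof (intro sum.cong refl prod.cong)
      fix a t assume "t \<in> {..<Suc k}"
      then consider "t < k" | "t = k" by (auto simp: less_Suc_eq)
      then show "M $$ ((a(0 := i, Suc k := i)) t, (a(0 := i, Suc k := i)) (Suc t)) = M $$ ((a(0 := i)) t, (a(0 := i)) (Suc t mod Suc k))"
      proof cases
        case 1
        then have "Suc t mod Suc k = Suc t" by simp
        then show ?thesis using 1 by simp
      qed simp
    qed auto
    finally show "(M ^\<^sub>m Suc k) $$ (i, i) = (\<Sum>a\<in>{1..k} \<rightarrow>\<^sub>E {..<N}. \<Prod>t<Suc k. M $$ ((a(0 := i)) t, (a(0 := i)) (Suc t mod Suc k)))" .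
  qed
  also have "\<dots> = (\<Sum>a\<in>insert 0 {1..k} \<rightarrow>\<^sub>E {..<N}. \<Prod>t<Suc k. M $$ (a t, a (Suc t mod Suc k)))"
    by (rule sum_PiE_insert[symmetric]) simp
  also have "insert 0 {1..k} = {..<Suc k}" by auto
  finally show ?thesis .
qed

lemma cyc_lists_nth:
  assumes "x \<in> cyc_lists \<phi>" "t < length x"
  shows "\<phi> (x ! t) = x ! (Suc t mod length x)"
proof -
  have "map \<phi> x ! t = rotate1 x ! t" using assms by (simp add: cyc_lists_def)
  then show ?thesis using assms(2) by (simp add: nth_rotate1)
qed

lemma prod_cyc_list:
  fixes F :: "'a \<Rightarrow> 'a \<Rightarrow> 'b::comm_monoid_mult"
  assumes "x \<in> cyc_lists \<phi>"
  shows "(\<Prod>h\<in>set x. F h (\<phi> h)) = (\<Prod>t<length x. F (x ! t) (x ! (Suc t mod length x)))"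
proof -
  have "bij_betw (\<lambda>t. x ! t) {..<length x} (set x)"
    using assms by (intro bij_betw_nth) (auto simp: cyc_lists_def)
  from prod.reindex_bij_betw[OF this, of "\<lambda>h. F h (\<phi> h)"]
  have "(\<Prod>h\<in>set x. F h (\<phi> h)) = (\<Prod>t<length x. F (x ! t) (\<phi> (x ! t)))" by simp
  also have "\<dots> = (\<Prod>t<length x. F (x ! t) (x ! (Suc t mod length x)))"
    using cyc_lists_nth[OF assms] by (intro prod.cong) auto
  finally show ?thesis .
qed

text \<open>The positions on a closed walk are renamed to the half-edges of a cycle, so that the
  successor modulo the length becomes \<open>\<phi>\<close>.\<close>

lemma mtrace_cycle:
  fixes M :: "complex mat"
  assumes M: "M \<in> carrier_mat N N" and "permutation \<phi>"
  shows "mtrace (M ^\<^sub>m card (orbit \<phi> y)) =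
    (\<Sum>a\<in>orbit \<phi> y \<rightarrow>\<^sub>E {..<N}. \<Prod>h\<in>orbit \<phi> y. M $$ (a h, a (\<phi> h)))"
proof -
  obtain x where x: "x \<in> cyc_lists \<phi>" "hd x = y" using cyc_lists_ex[OF assms(2)] by blast
  have set_x: "set x = orbit \<phi> y" using cyc_lists_set[OF x(1)] x(2) by simp
  obtain k where k: "length x = Suc k" using x by (cases x) (auto simp: cyc_lists_def)
  have dist: "distinct x" using x by (simp add: cyc_lists_def)
  have c: "card (orbit \<phi> y) = Suc k" using cyc_lists_length[OF x(1)] x(2) k by simp
  let ?g = "inv_into {..<Suc k} (\<lambda>t. x ! t)"
  have g: "?g (x ! t) = t" if "t < Suc k" for t
    using that dist k by (intro inv_into_f_f) (auto simp: inj_on_def nth_eq_iff_index_eq)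
  have g': "?g h < Suc k \<and> x ! ?g h = h" if "h \<in> set x" for h
    using that g k by (auto simp: in_set_conv_nth)
  have "(\<Sum>a\<in>{..<Suc k} \<rightarrow>\<^sub>E {..<N}. \<Prod>t<Suc k. M $$ (a t, a (Suc t mod Suc k)))
     = (\<Sum>a\<in>set x \<rightarrow>\<^sub>E {..<N}. \<Prod>t<Suc k. M $$ (a (x ! t), a (x ! (Suc t mod Suc k))))"
  proof (rule sum.reindex_bij_witness[of _ "\<lambda>a. \<lambda>t\<in>{..<Suc k}. a (x ! t)" "\<lambda>a. \<lambda>h\<in>set x. a (?g h)"])
    fix a assume a: "a \<in> {..<Suc k} \<rightarrow>\<^sub>E {..<N}"
    show "(\<lambda>t\<in>{..<Suc k}. (\<lambda>h\<in>set x. a (?g h)) (x ! t)) = a"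
      using a g k by (auto simp: fun_eq_iff restrict_def PiE_def extensional_def)
    show "(\<lambda>h\<in>set x. a (?g h)) \<in> set x \<rightarrow>\<^sub>E {..<N}" using a g' by (auto simp: PiE_def Pi_def)
    show "(\<Prod>t<Suc k. M $$ ((\<lambda>h\<in>set x. a (?g h)) (x ! t), (\<lambda>h\<in>set x. a (?g h)) (x ! (Suc t mod Suc k))))
      = (\<Prod>t<Suc k. M $$ (a t, a (Suc t mod Suc k)))"
      using g k by (intro prod.cong refl) auto
  next
    fix a assume a: "a \<in> set x \<rightarrow>\<^sub>E {..<N}"
    show "(\<lambda>h\<in>set x. (\<lambda>t\<in>{..<Suc k}. a (x ! t)) (?g h)) = a"
      using a g' by (auto simp: fun_eq_iff restrict_def PiE_def extensional_def)
    show "(\<lambda>t\<in>{..<Suc k}. a (x ! t)) \<in> {..<Suc k} \<rightarrow>\<^sub>E {..<N}" using a k by (auto simp: PiE_def Pi_def)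
  qed
  also have "\<dots> = (\<Sum>a\<in>set x \<rightarrow>\<^sub>E {..<N}. \<Prod>h\<in>set x. M $$ (a h, a (\<phi> h)))"
  proof (rule sum.cong[OF refl])
    fix a :: "'a \<Rightarrow> nat"
    show "(\<Prod>t<Suc k. M $$ (a (x ! t), a (x ! (Suc t mod Suc k)))) = (\<Prod>h\<in>set x. M $$ (a h, a (\<phi> h)))"
      using prod_cyc_list[OF x(1), of "\<lambda>h y. M $$ (a h, a y)"] k by simp
  qed
  finally show ?thesis unfolding c mtrace_pow_mat[OF M] set_x .
qed

text \<open>Each factor involves the indices of one cycle only, so families of labellings of the
  cycles amount to labellings of \<open>H\<close>. The range \<open>A h\<close> varies with
  \<open>h\<close> because boundary half-edges will have a prescribed index.\<close>

lemma prod_cycles_sum_PiE: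
  fixes F :: "nat \<Rightarrow> nat \<Rightarrow> 'b::comm_ring_1"
  assumes \<phi>: "\<phi> permutes H" and "finite H" and A: "\<And>h. h \<in> H \<Longrightarrow> finite (A h)"
  shows "(\<Prod>c\<in>cycles_on H \<phi>. \<Sum>a\<in>PiE c A. \<Prod>h\<in>c. F (a h) (a (\<phi> h)))
    = (\<Sum>a\<in>PiE H A. \<Prod>h\<in>H. F (a h) (a (\<phi> h)))"
proof -
  let ?C = "cycles_on H \<phi>"
  note perm = permutes_permutation[OF assms(1,2)]
  note part = partition_on_cycles[OF assms(1,2)]
  have self: "h \<in> orbit \<phi> h" for h by (rule permutation_self_in_orbit[OF perm])
  have cyc: "c = orbit \<phi> h \<and> h \<in> H" if "c \<in> ?C" "h \<in> c" for c h
    using that in_cycles_onD[OF assms(1,2)] part by (auto simp: partition_on_def)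
  have orb: "orbit \<phi> h \<in> ?C" if "h \<in> H" for h using that by (auto simp: cycles_on_def)
  have closed: "\<phi> h \<in> c" if "c \<in> ?C" "h \<in> c" for c h using cyc[OF that] by (auto intro: orbit.base)
  have finC: "finite ?C" using assms(2) by (simp add: cycles_on_def)
  have finc: "finite c" if "c \<in> ?C" for c using that assms(2) cyc by (meson finite_subset subsetI)
  have "(\<Prod>c\<in>?C. \<Sum>a\<in>PiE c A. \<Prod>h\<in>c. F (a h) (a (\<phi> h)))
      = (\<Sum>\<beta>\<in>PiE ?C (\<lambda>c. PiE c A). \<Prod>c\<in>?C. \<Prod>h\<in>c. F (\<beta> c h) (\<beta> c (\<phi> h)))"
    using finC finc A cyc by (intro prod_sum_PiE finite_PiE) auto
  also have "\<dots> = (\<Sum>a\<in>PiE H A. \<Prod>c\<in>?C. \<Prod>h\<in>c. F (a h) (a (\<phi> h)))"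
  proof (rule sum.reindex_bij_witness[of _ "\<lambda>a. \<lambda>c\<in>?C. restrict a c" "\<lambda>\<beta>. \<lambda>h\<in>H. \<beta> (orbit \<phi> h) h"])
    fix \<beta> assume \<beta>: "\<beta> \<in> PiE ?C (\<lambda>c. PiE c A)"
    show "(\<lambda>c\<in>?C. restrict (\<lambda>h\<in>H. \<beta> (orbit \<phi> h) h) c) = \<beta>"
    proof
      fix c show "(\<lambda>c\<in>?C. restrict (\<lambda>h\<in>H. \<beta> (orbit \<phi> h) h) c) c = \<beta> c"
      proof (cases "c \<in> ?C")
        case True
        then have "\<beta> c \<in> PiE c A" using \<beta> by blast
        moreover have "restrict (\<lambda>h\<in>H. \<beta> (orbit \<phi> h) h) c h = \<beta> c h" if "h \<in> c" for h
          using cyc[OF True that] that by auto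
        ultimately show ?thesis using True by (auto simp: fun_eq_iff restrict_def PiE_def extensional_def)
      qed (use \<beta> in \<open>auto simp: PiE_def extensional_def\<close>)
    qed
    show "(\<lambda>h\<in>H. \<beta> (orbit \<phi> h) h) \<in> PiE H A"
      using \<beta> orb self by (auto simp: PiE_def Pi_def)
    show "(\<Prod>c\<in>?C. \<Prod>h\<in>c. F ((\<lambda>h\<in>H. \<beta> (orbit \<phi> h) h) h) ((\<lambda>h\<in>H. \<beta> (orbit \<phi> h) h) (\<phi> h)))
       = (\<Prod>c\<in>?C. \<Prod>h\<in>c. F (\<beta> c h) (\<beta> c (\<phi> h)))"
    proof (intro prod.cong refl)
      fix c h assume ch: "c \<in> ?C" "h \<in> c"
      have "orbit \<phi> h = c" "h \<in> H" "orbit \<phi> (\<phi> h) = c" "\<phi> h \<in> H"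
        using cyc[OF ch] cyc[OF ch(1) closed[OF ch]] by auto
      then show "F ((\<lambda>h\<in>H. \<beta> (orbit \<phi> h) h) h) ((\<lambda>h\<in>H. \<beta> (orbit \<phi> h) h) (\<phi> h)) = F (\<beta> c h) (\<beta> c (\<phi> h))"
        by simp
    qed
  next
    fix a assume a: "a \<in> PiE H A"
    show "(\<lambda>h\<in>H. (\<lambda>c\<in>?C. restrict a c) (orbit \<phi> h) h) = a"
      using a orb self by (auto simp: fun_eq_iff restrict_def PiE_def extensional_def)
    show "(\<lambda>c\<in>?C. restrict a c) \<in> PiE ?C (\<lambda>c. PiE c A)"
      using a cyc by (auto simp: PiE_def Pi_def)
  qed
  also have "\<dots> = (\<Sum>a\<in>PiE H A. \<Prod>h\<in>H. F (a h) (a (\<phi> h)))"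
  proof (rule sum.cong[OF refl])
    fix a
    have "(\<Prod>h\<in>\<Union>?C. F (a h) (a (\<phi> h))) = (\<Prod>c\<in>?C. \<Prod>h\<in>c. F (a h) (a (\<phi> h)))"
      using part finc by (subst prod.Union_disjoint) (auto simp: partition_on_def disjoint_def)
    then show "(\<Prod>c\<in>?C. \<Prod>h\<in>c. F (a h) (a (\<phi> h))) = (\<Prod>h\<in>H. F (a h) (a (\<phi> h)))"
      using part by (simp add: partition_on_def)
  qed
  finally show ?thesis .
qed

text \<open>A labelling takes a single value on each cycle. Two elements of \<open>D\<close> on one
  cycle would contradict the injectivity of \<open>a0\<close>; otherwise the cycles that meet
  \<open>D\<close> are decided and each remaining cycle has \<open>N\<close> choices.\<close>

lemma card_constant_on_cycles:
  assumes \<nu>: "\<nu> permutes H" and "finite H" "D \<subseteq> H" "inj_on a0 D" "a0 ` D \<subseteq> {..<N :: nat}"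
  shows "card {a \<in> PiE H (\<lambda>h. if h \<in> D then {a0 h} else {..<N}). \<forall>h\<in>H. a (\<nu> h) = a h}
    = (if inj_on (orbit \<nu>) D then N ^ (card (cycles_on H \<nu>) - card D) else 0)" (is "card ?S = _")
proof -
  let ?C = "cycles_on H \<nu>"
  note perm = permutes_permutation[OF assms(1,2)]
  have self: "h \<in> orbit \<nu> h" for h by (rule permutation_self_in_orbit[OF perm])
  have cyc: "c = orbit \<nu> h \<and> h \<in> H" if "c \<in> ?C" "h \<in> c" for c h
    using that in_cycles_onD[OF assms(1,2)] partition_on_cycles[OF assms(1,2)] by (auto simp: partition_on_def)
  have const: "a y = a h" if "a \<in> ?S" "h \<in> H" "y \<in> orbit \<nu> h" for a h y
  proof -
    from that(3) have "a y = a h \<and> y \<in> H"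
    proof induction
      case base
      then show ?case using that permutes_in_image[OF \<nu>] by auto
    next
      case (step z)
      then show ?case using that permutes_in_image[OF \<nu>] by auto
    qed
    then show ?thesis ..
  qed
  show ?thesis
  proof (cases "inj_on (orbit \<nu>) D")
    case False
    then obtain h h' where h: "h \<in> D" "h' \<in> D" "h \<noteq> h'" "orbit \<nu> h = orbit \<nu> h'" by (auto simp: inj_on_def)
    have "False" if a: "a \<in> ?S" for a
    proof -
      have "a h' = a h" using const[OF a, of h h'] h assms(3) self[of h'] by auto
      moreover have "a h = a0 h" "a h' = a0 h'" using a h assms(3) by (force simp: PiE_def Pi_def)+
      ultimately show False using h assms(4) by (auto dest: inj_onD)
    qed
    then have e: "?S = {}" by blast
    show ?thesis unfolding e using False by simp
  next
    case True
    \<comment> \<open>\<open>inv_into\<close> selects the unique element of \<open>D\<close> on the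
      cycle.\<close>
    let ?E = "\<lambda>c. if c \<in> orbit \<nu> ` D then {a0 (inv_into D (orbit \<nu>) c)} else {..<N}"
    have inv: "inv_into D (orbit \<nu>) (orbit \<nu> h) = h" if "h \<in> D" for h
      using True that by (rule inv_into_f_f)
    have img: "?S = (\<lambda>g. \<lambda>h\<in>H. g (orbit \<nu> h)) ` PiE ?C ?E"
    proof (intro equalityI subsetI)
      fix a assume a: "a \<in> ?S"
      define g where "g = (\<lambda>c\<in>?C. a (SOME h. h \<in> c))"
      have g: "g (orbit \<nu> h) = a h" if "h \<in> H" for h
      proof -
        have "(SOME y. y \<in> orbit \<nu> h) \<in> orbit \<nu> h" using self by (rule someI)
        then show ?thesis using const[OF a that] that by (auto simp: g_def cycles_on_def)
      qed
      have aE: "a h = a0 h" if "h \<in> D" for h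
        using a that assms(3) by (force simp: PiE_def Pi_def)
      have "g \<in> PiE ?C ?E"
      proof
        fix c assume "c \<in> ?C"
        then obtain h where h: "h \<in> H" "c = orbit \<nu> h" by (auto simp: cycles_on_def)
        show "g c \<in> ?E c"
        proof (cases "c \<in> orbit \<nu> ` D")
          case True
          then obtain d where d: "d \<in> D" "c = orbit \<nu> d" by blast
          then show ?thesis using True g[of d] aE[of d] inv[of d] assms(3) by auto
        next
          case False
          then have "h \<notin> D" using h by blast
          then have "a h \<in> {..<N}" using a h(1) by (force simp: PiE_def Pi_def)
          then show ?thesis using False g[OF h(1)] h(2) by simp
        qed
      qed (simp add: g_def)
      moreover have "a = (\<lambda>h\<in>H. g (orbit \<nu> h))"
        using a g by (auto simp: fun_eq_iff restrict_def PiE_def extensional_def)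
      ultimately show "a \<in> (\<lambda>g. \<lambda>h\<in>H. g (orbit \<nu> h)) ` PiE ?C ?E" by blast
    next
      fix a assume "a \<in> (\<lambda>g. \<lambda>h\<in>H. g (orbit \<nu> h)) ` PiE ?C ?E"
      then obtain g where g: "g \<in> PiE ?C ?E" "a = (\<lambda>h\<in>H. g (orbit \<nu> h))" by blast
      have gE: "g (orbit \<nu> h) \<in> ?E (orbit \<nu> h)" if "h \<in> H" for h
        using g(1) that by (intro PiE_mem[OF g(1)]) (auto simp: cycles_on_def)
      have "a \<in> PiE H (\<lambda>h. if h \<in> D then {a0 h} else {..<N})"
      proof
        fix h assume h: "h \<in> H"
        show "a h \<in> (if h \<in> D then {a0 h} else {..<N})"
        proof (cases "h \<in> D")
          case True
          then show ?thesis using gE[OF h] inv[OF True] h g(2) by auto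
        next
          case False
          have "g (orbit \<nu> h) < N"
          proof (cases "orbit \<nu> h \<in> orbit \<nu> ` D")
            case True
            then obtain d where "d \<in> D" "orbit \<nu> h = orbit \<nu> d" by blast
            then show ?thesis using gE[OF h] inv[of d] assms(5) by auto
          qed (use gE[OF h] in auto)
          then show ?thesis using False h g(2) by auto
        qed
      qed (simp add: g(2))
      moreover have "a (\<nu> h) = a h" if "h \<in> H" for h
      proof -
        have "orbit \<nu> (\<nu> h) = orbit \<nu> h" using orbit_eq_iff[OF perm, of h "\<nu> h"] orbit.base[of \<nu> h] by simp
        then show ?thesis using that permutes_in_image[OF \<nu>] g(2) by simp
      qed
      ultimately show "a \<in> ?S" by blast
    qed
    have "inj_on (\<lambda>g. \<lambda>h\<in>H. g (orbit \<nu> h)) (PiE ?C ?E)"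
    proof (rule inj_onI)
      fix g g' assume g: "g \<in> PiE ?C ?E" "g' \<in> PiE ?C ?E" "(\<lambda>h\<in>H. g (orbit \<nu> h)) = (\<lambda>h\<in>H. g' (orbit \<nu> h))"
      show "g = g'"
      proof (rule PiE_ext[OF g(1,2)])
        fix c assume "c \<in> ?C"
        then obtain h where "h \<in> H" "c = orbit \<nu> h" by (auto simp: cycles_on_def)
        then show "g c = g' c" using fun_cong[OF g(3), of h] by simp
      qed
    qed
    then have "card ?S = card (PiE ?C ?E)" unfolding img by (rule card_image)
    also have "\<dots> = (\<Prod>c\<in>?C. card (?E c))" using assms(2) by (intro card_PiE) (simp add: cycles_on_def)
    also have "\<dots> = (\<Prod>c\<in>?C - orbit \<nu> ` D. N)"
      using assms(2) by (intro prod.mono_neutral_cong_right) (auto simp: cycles_on_def)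
    also have "\<dots> = N ^ (card ?C - card D)"
    proof -
      have "orbit \<nu> ` D \<subseteq> ?C" using assms(3) by (auto simp: cycles_on_def)
      moreover have "finite (orbit \<nu> ` D)" using assms(2,3) finite_subset by blast
      ultimately show ?thesis using True by (simp add: card_Diff_subset card_image)
    qed
    finally show ?thesis using True by simp
  qed
qed

text \<open>In this encoding \<open>\<phi> \<circ> \<alpha>\<close> is the vertex permutation; the
  injectivity on the union of the boundary cycles is full simplicity.\<close>

definition maps :: "'h set \<Rightarrow> (nat \<Rightarrow> nat) \<Rightarrow> nat set \<Rightarrow> weight multiset \<Rightarrow>
    (('h \<Rightarrow> 'h) \<times> ('h \<Rightarrow> 'h) \<times> (nat \<rightharpoonup> 'h) \<times> (nat \<times> 'h set set) set) set" where
  "maps H L B w = {(\<alpha>, \<phi>, r, K). \<alpha> \<in> pairings H \<and> (\<phi>, r, K) \<in> premaps H L B w \<and>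
     inj_on (orbit (\<phi> \<circ> \<alpha>)) (\<Union> (orbit \<phi> ` ran r))}"

text \<open>The exponent is vertices minus edges minus boundary half-edges: in a fully simple map
  each boundary half-edge fixes the index of its own vertex, the other vertices have
  \<open>N\<close> choices, and each pair in Wick's formula brings \<open>1 / N\<close>.\<close>

definition index_factor :: "nat \<Rightarrow> 'h set \<Rightarrow> (nat \<Rightarrow> nat) \<Rightarrow> nat set \<Rightarrow> ('h \<Rightarrow> 'h) \<Rightarrow> ('h \<Rightarrow> 'h) \<Rightarrow> complex" where
  "index_factor N H L B \<alpha> \<phi> =
     of_nat N powi (int (card (cycles_on H (\<phi> \<circ> \<alpha>))) - int (card H div 2) - int (\<Sum>i\<in>B. L i))"

lemma gauss_expectation_cong:
  "(\<And>M. M \<in> carrier_mat N N \<Longrightarrow> f M = g M) \<Longrightarrow> gauss_expectation N f = gauss_expectation N g"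
  by (simp add: gauss_expectation_def hermitian_of_def)

lemma finite_premap_boundary:
  assumes "finite H" "finite B" "(\<phi>, r, K) \<in> premaps H L B w"
  shows "card (\<Union> (orbit \<phi> ` ran r)) = (\<Sum>i\<in>B. L i)" "\<Union> (orbit \<phi> ` ran r) \<subseteq> H"
    "orbit \<phi> ` ran r = (\<lambda>i. orbit \<phi> (the (r i))) ` B"
proof -
  have \<phi>: "\<phi> permutes H" and r: "dom r = B" "ran r \<subseteq> H" "inj_on (\<lambda>i. orbit \<phi> (the (r i))) B"
    "\<forall>i\<in>B. card (orbit \<phi> (the (r i))) = L i" using assms(3) by (auto simp: premaps_def)
  have "ran r = (\<lambda>i. the (r i)) ` B" unfolding r(1)[symmetric] by (force simp: ran_def dom_def)
  then show 1: "orbit \<phi> ` ran r = (\<lambda>i. orbit \<phi> (the (r i))) ` B" by (simp add: image_image)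
  show 2: "\<Union> (orbit \<phi> ` ran r) \<subseteq> H" using r(2) permutes_orbit_subset[OF \<phi>] by blast
  have "disjoint (orbit \<phi> ` ran r)"
    using r(2) partition_on_cycles[OF \<phi> assms(1)] unfolding partition_on_def
    by (elim conjE, rule_tac pairwise_subset) (auto simp: cycles_on_def)
  then have "card (\<Union> (orbit \<phi> ` ran r)) = sum card (orbit \<phi> ` ran r)"
    using 2 assms(1) by (intro card_Union_disjoint) (auto intro: finite_subset)
  also have "\<dots> = (\<Sum>i\<in>B. L i)" unfolding 1 using r(3,4) by (simp add: sum.reindex)
  finally show "card (\<Union> (orbit \<phi> ` ran r)) = (\<Sum>i\<in>B. L i)" .
qed

section \<open>Gaussian expectation of products over cycles\<close>

context
  fixes N :: nat and \<gamma>s :: "nat list list" and L :: "nat \<Rightarrow> nat"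
  assumes N: "N > 0"
    and L: "\<And>i. i < length \<gamma>s \<Longrightarrow> L i = length (\<gamma>s ! i)"
    and \<gamma>s: "\<And>\<gamma>. \<gamma> \<in> set \<gamma>s \<Longrightarrow> cycle \<gamma> \<and> length \<gamma> \<ge> 1 \<and> set \<gamma> \<subseteq> {..<N}"
    and disj: "\<And>i j. i < length \<gamma>s \<Longrightarrow> j < length \<gamma>s \<Longrightarrow> i \<noteq> j \<Longrightarrow> set (\<gamma>s ! i) \<inter> set (\<gamma>s ! j) = {}"
begin

lemma cycle_product_eq:
  assumes "\<gamma> \<in> set \<gamma>s"
  shows "cycle_product \<gamma> M = (\<Prod>t<length \<gamma>. M $$ (\<gamma> ! t, \<gamma> ! (Suc t mod length \<gamma>)))"
proof -
  have "\<gamma> \<in> cyc_lists (cycle_of_list \<gamma>)"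
    using \<gamma>s[OF assms] cyclic_rotation[of \<gamma> 1] by (auto simp: cyc_lists_def)
  from cyc_lists_nth[OF this] show ?thesis unfolding cycle_product_def by (intro prod.cong) auto
qed

text \<open>The \<open>t\<close>-th half-edge of the boundary \<open>i\<close>, counted from its
  root, receives the index \<open>\<gamma>s ! i ! t\<close>. Injectivity reflects that the cycles
  are disjoint and free of repetitions.\<close>

lemma boundary_labelling:
  assumes "finite H" "B \<subseteq> {..<length \<gamma>s}" "(\<phi>, r, K) \<in> premaps H L B w"
  obtains a0 where "inj_on a0 (\<Union> (orbit \<phi> ` ran r))" "a0 ` (\<Union> (orbit \<phi> ` ran r)) \<subseteq> {..<N}"
    "\<And>i M. i \<in> B \<Longrightarrow> (\<Prod>h\<in>orbit \<phi> (the (r i)). M $$ (a0 h, a0 (\<phi> h))) = cycle_product (\<gamma>s ! i) M"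
proof -
  let ?x = "\<lambda>i. rooted_cycle \<phi> (the (r i))"
  have \<phi>: "\<phi> permutes H" and r: "inj_on (\<lambda>i. orbit \<phi> (the (r i))) B"
    "\<forall>i\<in>B. card (orbit \<phi> (the (r i))) = L i" using assms(3) by (auto simp: premaps_def)
  note perm = permutes_permutation[OF \<phi> assms(1)]
  note x = rooted_cycle[OF perm]
  have finB: "finite B" using assms(2) finite_subset by blast
  have len: "length (?x i) = length (\<gamma>s ! i)" if "i \<in> B" for i
    using cyc_lists_length[OF x(1)] x(2) r(2) that L assms(2) by auto
  have set_x: "set (?x i) = orbit \<phi> (the (r i))" for i using cyc_lists_set[OF x(1)] x(2) by simp
  have dist: "distinct (?x i)" for i using x(1) by (auto simp: cyc_lists_def)
  let ?I = "SIGMA i:B. {..<length (\<gamma>s ! i)}"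
  let ?e = "\<lambda>(i, t). ?x i ! t"
  have \<gamma>: "\<gamma>s ! i \<in> set \<gamma>s" "distinct (\<gamma>s ! i)" "set (\<gamma>s ! i) \<subseteq> {..<N}" if "i \<in> B" for i
  proof -
    show "\<gamma>s ! i \<in> set \<gamma>s" using that assms(2) by auto
    then show "distinct (\<gamma>s ! i)" "set (\<gamma>s ! i) \<subseteq> {..<N}" using \<gamma>s by auto
  qed
  have inj_e: "inj_on ?e ?I"
  proof (rule inj_onI, safe)
    fix i t i' t' assume a: "i \<in> B" "t < length (\<gamma>s ! i)" "i' \<in> B" "t' < length (\<gamma>s ! i')" "?x i ! t = ?x i' ! t'"
    then have "?x i ! t \<in> orbit \<phi> (the (r i))" "?x i ! t \<in> orbit \<phi> (the (r i'))"
      using len set_x nth_mem by metis+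
    then have "orbit \<phi> (the (r i)) = orbit \<phi> (the (r i'))" using orbit_eq_iff[OF perm] by metis
    then show i: "i = i'" using r(1) a by (auto dest: inj_onD)
    show "t = t'" using a len dist unfolding i by (metis nth_eq_iff_index_eq)
  qed
  have img_e: "?e ` ?I = \<Union> (orbit \<phi> ` ran r)"
  proof -
    have "?e ` ?I = (\<Union>i\<in>B. (\<lambda>t. ?x i ! t) ` {..<length (?x i)})" using len by force
    also have "\<dots> = (\<Union>i\<in>B. set (?x i))" by (simp add: set_conv_nth image_Collect lessThan_def)
    finally show ?thesis unfolding set_x finite_premap_boundary(3)[OF assms(1) finB assms(3)] by simp
  qed
  define a0 where "a0 = (\<lambda>(i, t). \<gamma>s ! i ! t) \<circ> inv_into ?I ?e"
  have a0: "a0 (?x i ! t) = \<gamma>s ! i ! t" if "i \<in> B" "t < length (\<gamma>s ! i)" for i t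
    using inv_into_f_f[OF inj_e, of "(i, t)"] that by (simp add: a0_def)
  show ?thesis
  proof
    show "a0 ` (\<Union> (orbit \<phi> ` ran r)) \<subseteq> {..<N}"
      unfolding img_e[symmetric] using a0 \<gamma>(3) nth_mem by fastforce
    show "inj_on a0 (\<Union> (orbit \<phi> ` ran r))"
      unfolding img_e[symmetric]
    proof (rule inj_onI)
      fix y z assume yz: "y \<in> ?e ` ?I" "z \<in> ?e ` ?I" "a0 y = a0 z"
      then obtain i t i' t' where i: "i \<in> B" "t < length (\<gamma>s ! i)" "y = ?x i ! t"
        and i': "i' \<in> B" "t' < length (\<gamma>s ! i')" "z = ?x i' ! t'" by auto
      have e: "\<gamma>s ! i ! t = \<gamma>s ! i' ! t'" using yz(3) a0 i i' by simp
      then have "i = i'" using disj[of i i'] i i' assms(2) nth_mem by (metis disjoint_iff lessThan_iff subsetD)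
      then show "y = z" using e i i' \<gamma>(2)[OF i(1)] by (metis nth_eq_iff_index_eq)
    qed
    fix i and M :: "complex mat" assume i: "i \<in> B"
    have "(\<Prod>h\<in>orbit \<phi> (the (r i)). M $$ (a0 h, a0 (\<phi> h)))
        = (\<Prod>t<length (?x i). M $$ (a0 (?x i ! t), a0 (?x i ! (Suc t mod length (?x i)))))"
      using prod_cyc_list[OF x(1)[of "the (r i)"], of "\<lambda>h y. M $$ (a0 h, a0 y)"] unfolding set_x .
    also have "\<dots> = (\<Prod>t<length (\<gamma>s ! i). M $$ (\<gamma>s ! i ! t, \<gamma>s ! i ! (Suc t mod length (\<gamma>s ! i))))"
    proof (rule prod.cong)
      fix t assume t: "t \<in> {..<length (\<gamma>s ! i)}"
      then have "Suc t mod length (\<gamma>s ! i) < length (\<gamma>s ! i)" by (intro mod_less_divisor) auto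
      then show "M $$ (a0 (?x i ! t), a0 (?x i ! (Suc t mod length (?x i))))
        = M $$ (\<gamma>s ! i ! t, \<gamma>s ! i ! (Suc t mod length (\<gamma>s ! i)))"
        using t a0[OF i] len[OF i] by simp
    qed (simp add: len[OF i])
    finally show "(\<Prod>h\<in>orbit \<phi> (the (r i)). M $$ (a0 h, a0 (\<phi> h))) = cycle_product (\<gamma>s ! i) M"
      using cycle_product_eq[OF \<gamma>(1)[OF i]] by simp
  qed
qed

text \<open>The sum over labellings factorizes over the cycles of \<open>\<phi>\<close>. A boundary
  cycle has one admissible labelling and yields a \<open>cycle_product\<close>; any other cycle is
  labelled freely and yields the trace of a power.\<close>

lemma premap_polynomial:
  assumes "finite H" "B \<subseteq> {..<length \<gamma>s}" and p: "(\<phi>, r, K) \<in> premaps H L B w"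
    and a0: "inj_on a0 (\<Union> (orbit \<phi> ` ran r))" "a0 ` (\<Union> (orbit \<phi> ` ran r)) \<subseteq> {..<N}"
    "\<And>i M. i \<in> B \<Longrightarrow> (\<Prod>h\<in>orbit \<phi> (the (r i)). M $$ (a0 h, a0 (\<phi> h))) = cycle_product (\<gamma>s ! i) M"
    and M: "M \<in> carrier_mat N N"
  shows "(\<Prod>i\<in>B. cycle_product (\<gamma>s ! i) M) * (\<Prod>v\<in>#w. \<Prod>m\<in>#snd v. mtrace (M ^\<^sub>m m)) =
    (\<Sum>a\<in>PiE H (\<lambda>h. if h \<in> \<Union> (orbit \<phi> ` ran r) then {a0 h} else {..<N}). \<Prod>h\<in>H. M $$ (a h, a (\<phi> h)))"
proof -
  let ?D = "\<Union> (orbit \<phi> ` ran r)"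
  let ?A = "\<lambda>h. if h \<in> ?D then {a0 h} else {..<N}"
  let ?C = "cycles_on H \<phi>"
  let ?S = "\<lambda>c. \<Sum>a\<in>PiE c ?A. \<Prod>h\<in>c. M $$ (a h, a (\<phi> h))"
  have \<phi>: "\<phi> permutes H" and ran: "ran r \<subseteq> H" and r: "inj_on (\<lambda>i. orbit \<phi> (the (r i))) B"
    and injK: "inj_on snd K" and partK: "partition_on (?C - orbit \<phi> ` ran r) (snd ` K)"
    and w: "cells_weight K = w" using p by (auto simp: premaps_def)
  have finB: "finite B" using assms(2) finite_subset by blast
  note perm = permutes_permutation[OF \<phi> assms(1)]
  note fK = premaps_finite_cells[OF assms(1) p]
  note bd = finite_premap_boundary[OF assms(1) finB p]
  have finC: "finite ?C" using assms(1) by (simp add: cycles_on_def)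
  have sub: "orbit \<phi> ` ran r \<subseteq> ?C" using ran by (auto simp: cycles_on_def)
  have S1: "?S c = (\<Prod>h\<in>c. M $$ (a0 h, a0 (\<phi> h)))" if c: "c \<in> orbit \<phi> ` ran r" for c
  proof -
    have cD: "c \<subseteq> ?D" using c by blast
    have cl: "\<phi> h \<in> c" if "h \<in> c" for h using c that by (auto intro: orbit.step)
    have "PiE c ?A = PiE c (\<lambda>h. {restrict a0 c h})" using cD by (intro PiE_cong) auto
    also have "\<dots> = {restrict a0 c}" by (rule PiE_singleton) (simp add: extensional_def)
    finally show ?thesis using cl by (simp cong: prod.cong)
  qed
  have S2: "?S c = mtrace (M ^\<^sub>m card c)" if c: "c \<in> ?C - orbit \<phi> ` ran r" for c
  proof -
    obtain y where y: "y \<in> H" "c = orbit \<phi> y" using c by (auto simp: cycles_on_def)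
    have "c \<inter> ?D = {}"
    proof (rule ccontr)
      assume "c \<inter> ?D \<noteq> {}"
      then obtain h z where "h \<in> c" "z \<in> ran r" "h \<in> orbit \<phi> z" by blast
      then have "c = orbit \<phi> z" using y(2) orbit_eq_iff[OF perm] by metis
      then show False using c \<open>z \<in> ran r\<close> by blast
    qed
    then have "PiE c ?A = PiE c (\<lambda>_. {..<N})" by (intro PiE_cong) auto
    then show ?thesis using mtrace_cycle[OF M perm, of y] y(2) by simp
  qed
  have "(\<Sum>a\<in>PiE H ?A. \<Prod>h\<in>H. M $$ (a h, a (\<phi> h))) = (\<Prod>c\<in>?C. ?S c)"
    using prod_cycles_sum_PiE[OF \<phi> assms(1), of ?A "\<lambda>i j. M $$ (i, j)"] by simp
  also have "\<dots> = (\<Prod>c\<in>orbit \<phi> ` ran r. ?S c) * (\<Prod>c\<in>?C - orbit \<phi> ` ran r. ?S c)"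
    using finC sub prod.subset_diff[OF sub finC] by (simp add: mult.commute)
  also have "(\<Prod>c\<in>orbit \<phi> ` ran r. ?S c) = (\<Prod>c\<in>orbit \<phi> ` ran r. \<Prod>h\<in>c. M $$ (a0 h, a0 (\<phi> h)))"
    using S1 by (intro prod.cong) auto
  also have "\<dots> = (\<Prod>i\<in>B. cycle_product (\<gamma>s ! i) M)"
    unfolding bd(3) using r a0(3) by (simp add: prod.reindex)
  also have "(\<Prod>c\<in>?C - orbit \<phi> ` ran r. ?S c) = (\<Prod>c\<in>?C - orbit \<phi> ` ran r. mtrace (M ^\<^sub>m card c))"
    using S2 by (intro prod.cong) auto
  also have "\<dots> = (\<Prod>f\<in>snd ` K. \<Prod>c\<in>f. mtrace (M ^\<^sub>m card c))"
  proof -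
    have "finite f" if "f \<in> snd ` K" for f using that partK finC by (auto simp: partition_on_def intro: finite_subset)
    then have "(\<Prod>c\<in>\<Union> (snd ` K). mtrace (M ^\<^sub>m card c)) = (\<Prod>f\<in>snd ` K. \<Prod>c\<in>f. mtrace (M ^\<^sub>m card c))"
      using partK by (subst prod.Union_disjoint) (auto simp: partition_on_def disjoint_def)
    then show ?thesis using partK by (simp add: partition_on_def)
  qed
  also have "\<dots> = (\<Prod>k\<in>K. \<Prod>c\<in>snd k. mtrace (M ^\<^sub>m card c))" using injK by (simp add: prod.reindex)
  also have "\<dots> = (\<Prod>v\<in>#w. \<Prod>m\<in>#snd v. mtrace (M ^\<^sub>m m))"
  proof -
    have "(\<Prod>c\<in>f. mtrace (M ^\<^sub>m card c)) = (\<Prod>m\<in>#image_mset card (mset_set f). mtrace (M ^\<^sub>m m))" for f :: "'a set set"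
      by (simp add: prod_unfold_prod_mset image_mset.compositionality comp_def)
    then show ?thesis
      unfolding w[symmetric] cells_weight_def
      by (simp add: prod_unfold_prod_mset image_mset.compositionality comp_def case_prod_unfold)
  qed
  finally show ?thesis by simp
qed

lemma premap_gauss_expectation:
  assumes "finite H" "B \<subseteq> {..<length \<gamma>s}" and p: "(\<phi>, r, K) \<in> premaps H L B w"
  shows "gauss_expectation N (\<lambda>M. q * ((\<Prod>i\<in>B. cycle_product (\<gamma>s ! i) M) * (\<Prod>v\<in>#w. \<Prod>m\<in>#snd v. mtrace (M ^\<^sub>m m))))
    = (\<Sum>\<alpha> | (\<alpha>, \<phi>, r, K) \<in> maps H L B w. q * index_factor N H L B \<alpha> \<phi>)"
proof -
  let ?D = "\<Union> (orbit \<phi> ` ran r)"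
  have \<phi>: "\<phi> permutes H" using p by (auto simp: premaps_def)
  have finB: "finite B" using assms(2) finite_subset by blast
  note bd = finite_premap_boundary[OF assms(1) finB p]
  obtain a0 where a0: "inj_on a0 ?D" "a0 ` ?D \<subseteq> {..<N}"
    "\<And>i M. i \<in> B \<Longrightarrow> (\<Prod>h\<in>orbit \<phi> (the (r i)). M $$ (a0 h, a0 (\<phi> h))) = cycle_product (\<gamma>s ! i) M"
    using boundary_labelling[OF assms] by blast
  let ?A = "\<lambda>h. if h \<in> ?D then {a0 h} else {..<N}"
  let ?I = "PiE H ?A"
  have finI: "finite ?I" using assms(1) by (intro finite_PiE) auto
  have aN: "a h < N" if "a \<in> ?I" "h \<in> H" for a h
  proof -
    have "a h \<in> ?A h" using that by blast
    then show ?thesis using a0(2) by (auto split: if_splits)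
  qed
  let ?e = "1 / of_nat N ^ (card H div 2) :: complex"
  have "gauss_expectation N (\<lambda>M. q * ((\<Prod>i\<in>B. cycle_product (\<gamma>s ! i) M) * (\<Prod>v\<in>#w. \<Prod>m\<in>#snd v. mtrace (M ^\<^sub>m m))))
     = gauss_expectation N (\<lambda>M. \<Sum>a\<in>?I. q * (\<Prod>h\<in>H. M $$ (a h, a (\<phi> h))))"
    by (rule gauss_expectation_cong) (simp only: premap_polynomial[OF assms a0] sum_distrib_left)
  also have "\<dots> = (\<Sum>a\<in>?I. q * (\<Sum>\<alpha>\<in>pairings H. if \<forall>h\<in>H. a (\<phi> h) = a (\<alpha> h) then ?e else 0))"
    using aN permutes_in_image[OF \<phi>] by (intro gauss_expectation_wick N assms(1) finI) auto
  also have "\<dots> = (\<Sum>a\<in>?I. \<Sum>\<alpha>\<in>pairings H. q * (if \<forall>h\<in>H. a (\<phi> h) = a (\<alpha> h) then ?e else 0))"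
    by (simp only: sum_distrib_left)
  also have "\<dots> = (\<Sum>\<alpha>\<in>pairings H. \<Sum>a\<in>?I. q * (if \<forall>h\<in>H. a (\<phi> h) = a (\<alpha> h) then ?e else 0))"
    by (rule sum.swap)
  also have "\<dots> = (\<Sum>\<alpha>\<in>pairings H. if inj_on (orbit (\<phi> \<circ> \<alpha>)) ?D then q * index_factor N H L B \<alpha> \<phi> else 0)"
  proof (rule sum.cong[OF refl])
    fix \<alpha> assume \<alpha>: "\<alpha> \<in> pairings H"
    then have pa: "\<alpha> permutes H" and inv: "\<And>x. x \<in> H \<Longrightarrow> \<alpha> (\<alpha> x) = x" by (auto simp: pairings_def)
    have \<nu>: "\<phi> \<circ> \<alpha> permutes H" by (rule permutes_compose[OF pa \<phi>])
    \<comment> \<open>Substituting \<open>\<alpha> h\<close> for \<open>h\<close> turns Wick's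
      condition into constancy along \<open>\<phi> \<circ> \<alpha>\<close>.\<close>
    have eq: "(\<forall>h\<in>H. a (\<phi> h) = a (\<alpha> h)) \<longleftrightarrow> (\<forall>h\<in>H. a ((\<phi> \<circ> \<alpha>) h) = a h)" for a :: "'a \<Rightarrow> nat"
    proof -
      have "(\<forall>h\<in>\<alpha> ` H. a (\<phi> h) = a (\<alpha> h)) \<longleftrightarrow> (\<forall>h\<in>H. a ((\<phi> \<circ> \<alpha>) h) = a h)" using inv by simp
      then show ?thesis using permutes_image[OF pa] by simp
    qed
    have "(\<Sum>a\<in>?I. q * (if \<forall>h\<in>H. a (\<phi> h) = a (\<alpha> h) then ?e else 0))
      = of_nat (card {a\<in>?I. \<forall>h\<in>H. a ((\<phi> \<circ> \<alpha>) h) = a h}) * (q * ?e)"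
      unfolding eq using finI by (simp add: if_distrib[of "(*) q"] sum.If_cases Int_def cong: if_cong)
    also have "card {a\<in>?I. \<forall>h\<in>H. a ((\<phi> \<circ> \<alpha>) h) = a h}
      = (if inj_on (orbit (\<phi> \<circ> \<alpha>)) ?D then N ^ (card (cycles_on H (\<phi> \<circ> \<alpha>)) - card ?D) else 0)"
      by (rule card_constant_on_cycles[OF \<nu> assms(1) bd(2) a0(1,2)])
    also have "of_nat \<dots> * (q * ?e) = (if inj_on (orbit (\<phi> \<circ> \<alpha>)) ?D then q * index_factor N H L B \<alpha> \<phi> else 0)"
    proof (cases "inj_on (orbit (\<phi> \<circ> \<alpha>)) ?D")
      case True
      let ?V = "card (cycles_on H (\<phi> \<circ> \<alpha>))"
      \<comment> \<open>Makes the truncated difference \<open>?V - card ?D\<close> the true one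
        before it becomes an integer exponent.\<close>
      have "card ?D \<le> ?V"
        using assms(1) bd(2) by (intro card_inj_on_le[OF True]) (auto simp: cycles_on_def)
      have "of_nat (N ^ a) * (1 / of_nat N ^ b) = (of_nat N :: complex) powi (int a - int b)" for a b
        using N by (simp add: power_int_diff)
      then have "of_nat (N ^ (?V - card ?D)) * ?e = of_nat N powi (int (?V - card ?D) - int (card H div 2))" .
      also have "int (?V - card ?D) - int (card H div 2) = int ?V - int (card H div 2) - int (\<Sum>i\<in>B. L i)"
        using \<open>card ?D \<le> ?V\<close> bd(1) by simp
      finally have "of_nat (N ^ (?V - card ?D)) * ?e = index_factor N H L B \<alpha> \<phi>" unfolding index_factor_def .
      then have "of_nat (N ^ (?V - card ?D)) * (q * ?e) = q * index_factor N H L B \<alpha> \<phi>"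
        by (simp only: mult.left_commute[of _ q])
      then show ?thesis using True by (simp only: if_True)
    qed simp
    finally show "(\<Sum>a\<in>?I. q * (if \<forall>h\<in>H. a (\<phi> h) = a (\<alpha> h) then ?e else 0))
      = (if inj_on (orbit (\<phi> \<circ> \<alpha>)) ?D then q * index_factor N H L B \<alpha> \<phi> else 0)" .
  qed
  also have "\<dots> = (\<Sum>\<alpha> | \<alpha> \<in> pairings H \<and> inj_on (orbit (\<phi> \<circ> \<alpha>)) ?D. q * index_factor N H L B \<alpha> \<phi>)"
    using finite_pairings[OF assms(1)] by (simp add: sum.If_cases Int_def)
  also have "{\<alpha>. \<alpha> \<in> pairings H \<and> inj_on (orbit (\<phi> \<circ> \<alpha>)) ?D} = {\<alpha>. (\<alpha>, \<phi>, r, K) \<in> maps H L B w}"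
    using p by (auto simp: maps_def)
  finally show ?thesis .
qed

text \<open>The polynomial depends only on \<open>B\<close> and \<open>w\<close>, so its expectation
  equals the average over all premaps, each evaluated through its own labelling. Since the number of
  premaps is the factorial divided by \<open>weight_factor w\<close>, the symmetry factor turns into
  \<open>1 / fact (card H)\<close>.\<close>

lemma coeff_formal_integral:
  assumes "finite H" "B \<subseteq> {..<length \<gamma>s}" "set_mset w \<subseteq> T" "T \<subseteq> stuffed_weights" "card H = map_size L B w"
  shows "coeff (formal_integral T N (\<lambda>M. \<Prod>i\<in>B. cycle_product (\<gamma>s ! i) M)) w =
    (\<Sum>(\<alpha>, \<phi>, r, K)\<in>maps H L B w. (\<Prod>v\<in>#w. cell_factor N v) * index_factor N H L B \<alpha> \<phi>) / fact (card H)"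
proof -
  let ?P = "premaps H L B w"
  define W where "W = (\<Prod>v\<in>#w. cell_factor N v)"
  define f where "f = (\<lambda>M. (\<Prod>i\<in>B. cycle_product (\<gamma>s ! i) M) * (\<Prod>v\<in>#w. \<Prod>m\<in>#snd v. mtrace (M ^\<^sub>m m)))"
  have finB: "finite B" using assms(2) finite_subset by blast
  have w: "set_mset w \<subseteq> stuffed_weights" using assms by blast
  have L1: "L i \<ge> 1" if "i \<in> B" for i
  proof -
    have "i < length \<gamma>s" using that assms(2) by auto
    then show ?thesis using L \<gamma>s nth_mem by metis
  qed
  note P = card_premaps[OF assms(1) finB L1 w assms(5)]
  have Pz: "of_nat (card ?P) * of_nat (weight_factor w) = (fact (card H) :: complex)"
    using P by (metis of_nat_fact of_nat_mult)
  have wf: "of_nat (weight_factor w) \<noteq> (0 :: complex)" using weight_factor_pos[OF w] by simp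
  let ?q = "W / of_nat (weight_factor w)"
  have "coeff (formal_integral T N (\<lambda>M. \<Prod>i\<in>B. cycle_product (\<gamma>s ! i) M)) w = gauss_expectation N (\<lambda>M. ?q * f M)"
    unfolding formal_integral_def coeff_MSeries coeff_mconst_mult coeff_mexp_potential[OF assms(3)]
    by (rule arg_cong[where f = "gauss_expectation N"]) (simp add: fun_eq_iff f_def W_def)
  also have "\<dots> = (\<Sum>p\<in>?P. gauss_expectation N (\<lambda>M. ?q * f M)) / of_nat (card ?P)"
  proof -
    have "of_nat (card ?P) \<noteq> (0 :: complex)" using Pz fact_nonzero by (metis mult_zero_left)
    then show ?thesis by simp
  qed
  also have "(\<Sum>p\<in>?P. gauss_expectation N (\<lambda>M. ?q * f M))
      = (\<Sum>p\<in>?P. \<Sum>\<alpha> | (\<alpha>, p) \<in> maps H L B w. ?q * index_factor N H L B \<alpha> (fst p))"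
  proof (rule sum.cong[OF refl])
    fix p assume p: "p \<in> ?P"
    obtain \<phi> r K where [simp]: "p = (\<phi>, r, K)" by (cases p)
    show "gauss_expectation N (\<lambda>M. ?q * f M) = (\<Sum>\<alpha> | (\<alpha>, p) \<in> maps H L B w. ?q * index_factor N H L B \<alpha> (fst p))"
      using premap_gauss_expectation[OF assms(1,2), of \<phi> r K w ?q] p by (simp add: f_def)
  qed
  also have "\<dots> = (\<Sum>(p, \<alpha>)\<in>(SIGMA p:?P. {\<alpha>. (\<alpha>, p) \<in> maps H L B w}). ?q * index_factor N H L B \<alpha> (fst p))"
    by (rule sum.Sigma)
      (use P finite_pairings[OF assms(1)] in \<open>auto simp: maps_def intro: finite_subset[of _ "pairings H"]\<close>)
  also have "\<dots> = (\<Sum>(\<alpha>, \<phi>, r, K)\<in>maps H L B w. ?q * index_factor N H L B \<alpha> \<phi>)"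
    by (rule sum.reindex_bij_witness[of _ "\<lambda>(\<alpha>, p). (p, \<alpha>)" "\<lambda>(p, \<alpha>). (\<alpha>, p)"]) (auto simp: maps_def)
  also have "\<dots> / of_nat (card ?P) = (\<Sum>(\<alpha>, \<phi>, r, K)\<in>maps H L B w. W * index_factor N H L B \<alpha> \<phi>) / fact (card H)"
    unfolding Pz[symmetric] by (simp add: case_prod_unfold sum_divide_distrib mult_ac)
  finally show ?thesis by (simp add: W_def)
qed

end

section \<open>Connected components\<close>

type_synonym 'h labelled_map = "('h \<Rightarrow> 'h) \<times> ('h \<Rightarrow> 'h) \<times> (nat \<rightharpoonup> 'h) \<times> (nat \<times> 'h set set) set"

text \<open>For a subset of the half-edges of a map: a union of connected components. Invariant sets
  replace the generated equivalence relation because maps are going to be cut along them.\<close>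

definition closed_under :: "'h labelled_map \<Rightarrow> 'h set \<Rightarrow> bool" where
  "closed_under t X = (case t of (\<alpha>, \<phi>, r, K) \<Rightarrow>
     (\<forall>x\<in>X. \<alpha> x \<in> X \<and> \<phi> x \<in> X) \<and> (\<forall>k\<in>K. \<Union> (snd k) \<subseteq> X \<or> \<Union> (snd k) \<inter> X = {}))"

definition conn :: "'h set \<Rightarrow> 'h labelled_map \<Rightarrow> bool" where
  "conn H t \<longleftrightarrow> H \<noteq> {} \<and> (\<forall>X\<subseteq>H. closed_under t X \<longrightarrow> X = {} \<or> X = H)"

definition restrict_to :: "'h set \<Rightarrow> 'h labelled_map \<Rightarrow> 'h labelled_map" where
  "restrict_to X t = (case t of (\<alpha>, \<phi>, r, K) \<Rightarrow>
     (perm_restrict \<alpha> X, perm_restrict \<phi> X, r |` {i. \<exists>h\<in>X. r i = Some h}, {k\<in>K. \<Union> (snd k) \<subseteq> X}))"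

text \<open>Intended for maps on disjoint sets of half-edges: their permutations are the identity
  elsewhere, so composition superimposes them.\<close>

definition join_maps :: "'h labelled_map \<Rightarrow> 'h labelled_map \<Rightarrow> 'h labelled_map" where
  "join_maps t1 t2 = (case t1 of (\<alpha>1, \<phi>1, r1, K1) \<Rightarrow> case t2 of (\<alpha>2, \<phi>2, r2, K2) \<Rightarrow>
     (\<alpha>1 \<circ> \<alpha>2, \<phi>1 \<circ> \<phi>2, r1 ++ r2, K1 \<union> K2))"

text \<open>Makes the number of edges \<open>card H div 2\<close> additive when maps are
  joined.\<close>

lemma even_card_pairings: "finite H \<Longrightarrow> \<alpha> \<in> pairings H \<Longrightarrow> even (card H)"
proof (induction "card H" arbitrary: H \<alpha> rule: less_induct)
  case less
  show ?case
  proof (cases "H = {}")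
    case False
    then obtain h0 K where H: "H = insert h0 K" "h0 \<notin> K" by (metis Set.set_insert ex_in_conv)
    obtain h \<alpha>' where h: "h \<in> K" "\<alpha>' \<in> pairings (K - {h})"
      using pairings_split[OF H(2)] less.prems(2) unfolding H(1) bij_betw_def by blast
    have "card H = card (K - {h}) + 2"
      using H h less.prems(1) card_Suc_Diff1[of K h] by simp
    then show ?thesis using less.hyps[of "K - {h}" \<alpha>'] h less.prems(1) H(1) by simp
  qed simp
qed

lemma partition_on_Un:
  assumes "partition_on A P" "partition_on B Q" "A \<inter> B = {}"
  shows "partition_on (A \<union> B) (P \<union> Q)"
proof (rule partition_onI)
  have PA: "p \<subseteq> A" if "p \<in> P" for p using that assms(1) by (auto simp: partition_on_def)
  have QB: "q \<subseteq> B" if "q \<in> Q" for q using that assms(2) by (auto simp: partition_on_def)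
  show "disjnt p q" if "p \<in> P \<union> Q" "q \<in> P \<union> Q" "p \<noteq> q" for p q
  proof -
    consider "p \<in> P" "q \<in> P" | "p \<in> Q" "q \<in> Q" | "p \<subseteq> A" "q \<subseteq> B" | "p \<subseteq> B" "q \<subseteq> A"
      using \<open>p \<in> _\<close> \<open>q \<in> _\<close> PA QB by blast
    then show ?thesis
    proof cases
      case 1
      then show ?thesis using \<open>p \<noteq> q\<close> partition_onD2[OF assms(1)] by (simp add: disjnt_def disjointD)
    next
      case 2
      then show ?thesis using \<open>p \<noteq> q\<close> partition_onD2[OF assms(2)] by (simp add: disjnt_def disjointD)
    next
      case 3
      then show ?thesis using assms(3) by (auto simp: disjnt_def)
    next
      case 4
      then show ?thesis using assms(3) by (auto simp: disjnt_def)
    qed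
  qed
qed (use assms in \<open>auto simp: partition_on_def\<close>)

lemma cells_weight_Un:
  "finite K1 \<Longrightarrow> finite K2 \<Longrightarrow> K1 \<inter> K2 = {} \<Longrightarrow> cells_weight (K1 \<union> K2) = cells_weight K1 + cells_weight K2"
  by (simp add: cells_weight_def mset_set_Union)

lemma premap_cell_subset:
  assumes "finite H" "(\<phi>, r, K) \<in> premaps H L B w" "k \<in> K"
  shows "\<Union> (snd k) \<subseteq> H" "\<Union> (snd k) \<noteq> {}" "snd k \<subseteq> cycles_on H \<phi>"
proof -
  have part: "partition_on (cycles_on H \<phi> - orbit \<phi> ` ran r) (snd ` K)" and \<phi>: "\<phi> permutes H"
    using assms by (auto simp: premaps_def)
  have k: "snd k \<in> snd ` K" using assms(3) by blast
  then show f: "snd k \<subseteq> cycles_on H \<phi>" using part unfolding partition_on_def by blast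
  have "snd k \<noteq> {}" using part k unfolding partition_on_def by metis
  moreover have "c \<noteq> {} \<and> c \<subseteq> H" if "c \<in> snd k" for c
    using that f partition_on_cycles[OF \<phi> assms(1)] unfolding partition_on_def by blast
  ultimately show "\<Union> (snd k) \<subseteq> H" "\<Union> (snd k) \<noteq> {}" by blast+
qed

lemma the_map_mem: "i \<in> dom r \<Longrightarrow> ran r \<subseteq> A \<Longrightarrow> the (r i) \<in> A"
  by (auto simp: ran_def)

lemma cycles_on_Un: "cycles_on (X \<union> Y) p = cycles_on X p \<union> cycles_on Y p"
  by (simp add: cycles_on_def image_Un)

text \<open>On each part the joined permutations agree with those of that part, which is closed
  under them. Hence vertices, boundaries and cells are disjoint unions, and the exponents of
  \<open>N\<close> add up.\<close>

lemma join_maps: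
  fixes t1 t2 :: "'h labelled_map"
  assumes fin: "finite X" "finite Y" and XY: "X \<inter> Y = {}" and S: "S1 \<inter> S2 = {}" "finite S1" "finite S2"
    and t1: "t1 \<in> maps X L S1 w1" and t2: "t2 \<in> maps Y L S2 w2"
  shows "join_maps t1 t2 \<in> maps (X \<union> Y) L (S1 \<union> S2) (w1 + w2)"
    and "closed_under (join_maps t1 t2) X"
    and "restrict_to X (join_maps t1 t2) = t1" and "restrict_to Y (join_maps t1 t2) = t2"
    and "N > 0 \<Longrightarrow> index_factor N (X \<union> Y) L (S1 \<union> S2) (fst (join_maps t1 t2)) (fst (snd (join_maps t1 t2)))
      = index_factor N X L S1 (fst t1) (fst (snd t1)) * index_factor N Y L S2 (fst t2) (fst (snd t2))"
proof -
  obtain \<alpha>1 \<phi>1 r1 K1 where t1': "t1 = (\<alpha>1, \<phi>1, r1, K1)" by (cases t1)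
  obtain \<alpha>2 \<phi>2 r2 K2 where t2': "t2 = (\<alpha>2, \<phi>2, r2, K2)" by (cases t2)
  have p1: "(\<phi>1, r1, K1) \<in> premaps X L S1 w1" and p2: "(\<phi>2, r2, K2) \<in> premaps Y L S2 w2"
    and a1: "\<alpha>1 \<in> pairings X" and a2: "\<alpha>2 \<in> pairings Y"
    and fs1: "inj_on (orbit (\<phi>1 \<circ> \<alpha>1)) (\<Union> (orbit \<phi>1 ` ran r1))"
    and fs2: "inj_on (orbit (\<phi>2 \<circ> \<alpha>2)) (\<Union> (orbit \<phi>2 ` ran r2))"
    using t1 t2 by (auto simp: maps_def t1' t2')
  have f1: "\<phi>1 permutes X" "dom r1 = S1" "ran r1 \<subseteq> X" "inj_on (\<lambda>i. orbit \<phi>1 (the (r1 i))) S1"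
    "\<forall>i\<in>S1. card (orbit \<phi>1 (the (r1 i))) = L i" "inj_on snd K1"
    "partition_on (cycles_on X \<phi>1 - orbit \<phi>1 ` ran r1) (snd ` K1)" "cells_weight K1 = w1"
    using p1 by (auto simp: premaps_def)
  have f2: "\<phi>2 permutes Y" "dom r2 = S2" "ran r2 \<subseteq> Y" "inj_on (\<lambda>i. orbit \<phi>2 (the (r2 i))) S2"
    "\<forall>i\<in>S2. card (orbit \<phi>2 (the (r2 i))) = L i" "inj_on snd K2"
    "partition_on (cycles_on Y \<phi>2 - orbit \<phi>2 ` ran r2) (snd ` K2)" "cells_weight K2 = w2"
    using p2 by (auto simp: premaps_def)
  have pa1: "\<alpha>1 permutes X" and pa2: "\<alpha>2 permutes Y" using a1 a2 by (auto simp: pairings_def)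
  note in1 = permutes_in_image[OF f1(1)] permutes_in_image[OF pa1]
  note in2 = permutes_in_image[OF f2(1)] permutes_in_image[OF pa2]
  define \<phi> where "\<phi> = \<phi>1 \<circ> \<phi>2"
  define \<alpha> where "\<alpha> = \<alpha>1 \<circ> \<alpha>2"
  define r where "r = r1 ++ r2"
  define K where "K = K1 \<union> K2"
  have j: "join_maps t1 t2 = (\<alpha>, \<phi>, r, K)" by (simp add: join_maps_def t1' t2' \<phi>_def \<alpha>_def r_def K_def)
  have \<phi>X: "\<phi> x = \<phi>1 x" if "x \<in> X" for x
  proof -
    have "x \<notin> Y" using that XY by blast
    then show ?thesis using permutes_not_in[OF f2(1), of x] by (simp add: \<phi>_def)
  qed
  have \<alpha>X: "\<alpha> x = \<alpha>1 x" if "x \<in> X" for x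
  proof -
    have "x \<notin> Y" using that XY by blast
    then show ?thesis using permutes_not_in[OF pa2, of x] by (simp add: \<alpha>_def)
  qed
  have \<phi>Y: "\<phi> x = \<phi>2 x" if "x \<in> Y" for x
  proof -
    have "\<phi>2 x \<notin> X" using that in2 XY by blast
    then show ?thesis using permutes_not_in[OF f1(1)] by (simp add: \<phi>_def)
  qed
  have \<alpha>Y: "\<alpha> x = \<alpha>2 x" if "x \<in> Y" for x
  proof -
    have "\<alpha>2 x \<notin> X" using that in2 XY by blast
    then show ?thesis using permutes_not_in[OF pa1] by (simp add: \<alpha>_def)
  qed
  have out: "\<phi> x = x" "\<alpha> x = x" if "x \<notin> X \<union> Y" for x
    using that permutes_not_in[OF f1(1)] permutes_not_in[OF f2(1)] permutes_not_in[OF pa1] permutes_not_in[OF pa2]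
    by (auto simp: \<phi>_def \<alpha>_def)
  have \<phi>: "\<phi> permutes X \<union> Y" unfolding \<phi>_def
    by (rule permutes_compose) (use f1(1) f2(1) in \<open>auto intro: permutes_subset\<close>)
  have pa: "\<alpha> permutes X \<union> Y" unfolding \<alpha>_def
    by (rule permutes_compose) (use pa1 pa2 in \<open>auto intro: permutes_subset\<close>)
  have orbX: "orbit \<phi> x = orbit \<phi>1 x" "orbit (\<phi> \<circ> \<alpha>) x = orbit (\<phi>1 \<circ> \<alpha>1) x" if "x \<in> X" for x
  proof -
    show "orbit \<phi> x = orbit \<phi>1 x"
      by (rule orbit_cong_on_closed[where X = X]) (use that in1 \<phi>X in auto)
    show "orbit (\<phi> \<circ> \<alpha>) x = orbit (\<phi>1 \<circ> \<alpha>1) x"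
      by (rule orbit_cong_on_closed[where X = X]) (use that in1 \<phi>X \<alpha>X in auto)
  qed
  have orbY: "orbit \<phi> x = orbit \<phi>2 x" "orbit (\<phi> \<circ> \<alpha>) x = orbit (\<phi>2 \<circ> \<alpha>2) x" if "x \<in> Y" for x
  proof -
    show "orbit \<phi> x = orbit \<phi>2 x"
      by (rule orbit_cong_on_closed[where X = Y]) (use that in2 \<phi>Y in auto)
    show "orbit (\<phi> \<circ> \<alpha>) x = orbit (\<phi>2 \<circ> \<alpha>2) x"
      by (rule orbit_cong_on_closed[where X = Y]) (use that in2 \<phi>Y \<alpha>Y in auto)
  qed
  have cyc: "cycles_on (X \<union> Y) \<phi> = cycles_on X \<phi>1 \<union> cycles_on Y \<phi>2"
    unfolding cycles_on_Un unfolding cycles_on_def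
    by (intro arg_cong2[where f = "(\<union>)"] image_cong refl orbX(1) orbY(1))
  have cyc\<nu>: "cycles_on (X \<union> Y) (\<phi> \<circ> \<alpha>) = cycles_on X (\<phi>1 \<circ> \<alpha>1) \<union> cycles_on Y (\<phi>2 \<circ> \<alpha>2)"
    unfolding cycles_on_Un unfolding cycles_on_def
    by (intro arg_cong2[where f = "(\<union>)"] image_cong refl orbX(2) orbY(2))
  have cyc_disj: "cycles_on X p \<inter> cycles_on Y q = {}" if "p permutes X" "q permutes Y" for p q
  proof (rule ccontr)
    note px = partition_on_cycles[OF that(1) fin(1)] and py = partition_on_cycles[OF that(2) fin(2)]
    assume "cycles_on X p \<inter> cycles_on Y q \<noteq> {}"
    then obtain c where c: "c \<in> cycles_on X p" "c \<in> cycles_on Y q" by blast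
    have "c \<noteq> {}" using c(1) partition_onD3[OF px] by metis
    moreover have "c \<subseteq> X" "c \<subseteq> Y" using c partition_onD1[OF px] partition_onD1[OF py] by blast+
    ultimately show False using XY by blast
  qed
  have dom12: "dom r1 \<inter> dom r2 = {}" using f1(2) f2(2) S by simp
  have rS1: "r i = r1 i" if "i \<in> S1" for i
  proof -
    have "i \<notin> dom r2" using that S(1) f2(2) by blast
    then show ?thesis unfolding r_def by (rule map_add_dom_app_simps(3))
  qed
  have rS2: "r i = r2 i" if "i \<in> S2" for i
    using that f2(2) unfolding r_def by (intro map_add_dom_app_simps(1)) simp
  have r1X: "the (r1 i) \<in> X" if "i \<in> S1" for i
    using that f1(2,3) by (intro the_map_mem) simp_all
  have r2Y: "the (r2 i) \<in> Y" if "i \<in> S2" for i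
    using that f2(2,3) by (intro the_map_mem) simp_all
  have ran: "ran r = ran r1 \<union> ran r2" unfolding r_def using dom12 by (rule ran_map_add)
  have orb_ran1: "orbit \<phi> ` ran r1 = orbit \<phi>1 ` ran r1" using orbX(1) f1(3) by (intro image_cong) auto
  have orb_ran2: "orbit \<phi> ` ran r2 = orbit \<phi>2 ` ran r2" using orbY(1) f2(3) by (intro image_cong) auto
  have orb_ran: "orbit \<phi> ` ran r = orbit \<phi>1 ` ran r1 \<union> orbit \<phi>2 ` ran r2"
    unfolding ran image_Un orb_ran1 orb_ran2 ..
  have sub1: "orbit \<phi>1 ` ran r1 \<subseteq> cycles_on X \<phi>1" using f1(3) by (auto simp: cycles_on_def)
  have sub2: "orbit \<phi>2 ` ran r2 \<subseteq> cycles_on Y \<phi>2" using f2(3) by (auto simp: cycles_on_def)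
  note finK = premaps_finite_cells[OF fin(1) p1] premaps_finite_cells[OF fin(2) p2]
  have snd_disj: "snd k1 \<noteq> snd k2" if "k1 \<in> K1" "k2 \<in> K2" for k1 k2
  proof
    assume e: "snd k1 = snd k2"
    have "\<Union> (snd k1) \<subseteq> X \<inter> Y"
      using premap_cell_subset(1)[OF fin(1) p1 that(1)] premap_cell_subset(1)[OF fin(2) p2 that(2)] e by simp
    then show False using premap_cell_subset(2)[OF fin(1) p1 that(1)] XY by simp
  qed
  have K12: "K1 \<inter> K2 = {}" using snd_disj by blast
  have pairs: "\<alpha> \<in> pairings (X \<union> Y)"
    unfolding pairings_def
  proof (intro CollectI conjI ballI)
    show "\<alpha> permutes X \<union> Y" by (rule pa)
    fix x assume "x \<in> X \<union> Y"
    then show "\<alpha> x \<noteq> x" "\<alpha> (\<alpha> x) = x"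
      using a1 a2 \<alpha>X \<alpha>Y in1 in2 by (auto simp: pairings_def)
  qed
  have bdX: "\<Union> (orbit \<phi>1 ` ran r1) \<subseteq> X" and bdY: "\<Union> (orbit \<phi>2 ` ran r2) \<subseteq> Y"
    using f1(3) permutes_orbit_subset[OF f1(1)] f2(3) permutes_orbit_subset[OF f2(1)] by blast+
  have \<nu>1: "\<phi>1 \<circ> \<alpha>1 permutes X" and \<nu>2: "\<phi>2 \<circ> \<alpha>2 permutes Y"
    using f1(1) f2(1) pa1 pa2 by (auto intro: permutes_compose)
  have orb\<nu>: "orbit (\<phi> \<circ> \<alpha>) x \<noteq> orbit (\<phi> \<circ> \<alpha>) y" if "x \<in> X" "y \<in> Y" for x y
  proof -
    have "orbit (\<phi> \<circ> \<alpha>) x \<in> cycles_on X (\<phi>1 \<circ> \<alpha>1)" "orbit (\<phi> \<circ> \<alpha>) y \<in> cycles_on Y (\<phi>2 \<circ> \<alpha>2)"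
      using that orbX(2) orbY(2) by (auto simp: cycles_on_def)
    then show ?thesis using cyc_disj[OF \<nu>1 \<nu>2] by auto
  qed
  have "inj_on (orbit (\<phi> \<circ> \<alpha>)) (\<Union> (orbit \<phi> ` ran r))"
  proof (rule inj_onI)
    fix x y assume xy: "x \<in> \<Union> (orbit \<phi> ` ran r)" "y \<in> \<Union> (orbit \<phi> ` ran r)"
      and e: "orbit (\<phi> \<circ> \<alpha>) x = orbit (\<phi> \<circ> \<alpha>) y"
    let ?D1 = "\<Union> (orbit \<phi>1 ` ran r1)" and ?D2 = "\<Union> (orbit \<phi>2 ` ran r2)"
    have "x \<in> ?D1 \<and> y \<in> ?D1 \<or> x \<in> ?D2 \<and> y \<in> ?D2"
    proof -
      have "x \<in> ?D1 \<or> x \<in> ?D2" "y \<in> ?D1 \<or> y \<in> ?D2" using xy unfolding orb_ran by blast+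
      moreover have "\<not> (x \<in> X \<and> y \<in> Y)" "\<not> (y \<in> X \<and> x \<in> Y)" using orb\<nu>[of x y] orb\<nu>[of y x] e by auto
      ultimately show ?thesis using bdX bdY by blast
    qed
    then show "x = y"
    proof
      assume d: "x \<in> ?D1 \<and> y \<in> ?D1"
      then have "orbit (\<phi>1 \<circ> \<alpha>1) x = orbit (\<phi>1 \<circ> \<alpha>1) y" using e orbX(2) bdX by auto
      then show ?thesis using d fs1 by (blast dest: inj_onD)
    next
      assume d: "x \<in> ?D2 \<and> y \<in> ?D2"
      then have "orbit (\<phi>2 \<circ> \<alpha>2) x = orbit (\<phi>2 \<circ> \<alpha>2) y" using e orbY(2) bdY by auto
      then show ?thesis using d fs2 by (blast dest: inj_onD)
    qed
  qed
  moreover have "inj_on (\<lambda>i. orbit \<phi> (the (r i))) (S1 \<union> S2)"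
  proof -
    have o1: "orbit \<phi> (the (r i)) = orbit \<phi>1 (the (r1 i))" if "i \<in> S1" for i using that rS1 orbX(1) r1X by simp
    have o2: "orbit \<phi> (the (r i)) = orbit \<phi>2 (the (r2 i))" if "i \<in> S2" for i using that rS2 orbY(1) r2Y by simp
    have x: "orbit \<phi> (the (r i)) \<noteq> orbit \<phi> (the (r i'))" if "i \<in> S1" "i' \<in> S2" for i i'
    proof -
      have "orbit \<phi> (the (r i)) \<in> cycles_on X \<phi>1" "orbit \<phi> (the (r i')) \<in> cycles_on Y \<phi>2"
        using that o1 o2 r1X r2Y by (auto simp: cycles_on_def)
      then show ?thesis using cyc_disj[OF f1(1) f2(1)] by auto
    qed
    show ?thesis
    proof (rule inj_onI)
      fix i i' assume i: "i \<in> S1 \<union> S2" "i' \<in> S1 \<union> S2" "orbit \<phi> (the (r i)) = orbit \<phi> (the (r i'))"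
      then have "i \<in> S1 \<and> i' \<in> S1 \<or> i \<in> S2 \<and> i' \<in> S2" using x[of i i'] x[of i' i] by auto
      then show "i = i'" using i(3) o1 o2 inj_onD[OF f1(4), of i i'] inj_onD[OF f2(4), of i i'] by auto
    qed
  qed
  moreover have "\<forall>i\<in>S1 \<union> S2. card (orbit \<phi> (the (r i))) = L i"
    using rS1 rS2 orbX(1) orbY(1) r1X r2Y f1(5) f2(5) by auto
  moreover have "inj_on snd K"
  proof (rule inj_onI)
    fix k k' assume k: "k \<in> K" "k' \<in> K" "snd k = snd k'"
    then have "k \<in> K1 \<and> k' \<in> K1 \<or> k \<in> K2 \<and> k' \<in> K2" using snd_disj[of k k'] snd_disj[of k' k] unfolding K_def by auto
    then show "k = k'" using k(3) inj_onD[OF f1(6)] inj_onD[OF f2(6)] by blast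
  qed
  moreover have "partition_on (cycles_on (X \<union> Y) \<phi> - orbit \<phi> ` ran r) (snd ` K)"
  proof -
    have "cycles_on (X \<union> Y) \<phi> - orbit \<phi> ` ran r
      = (cycles_on X \<phi>1 - orbit \<phi>1 ` ran r1) \<union> (cycles_on Y \<phi>2 - orbit \<phi>2 ` ran r2)"
      using cyc_disj[OF f1(1) f2(1)] sub1 sub2 unfolding cyc orb_ran by blast
    moreover have "(cycles_on X \<phi>1 - orbit \<phi>1 ` ran r1) \<inter> (cycles_on Y \<phi>2 - orbit \<phi>2 ` ran r2) = {}"
      using cyc_disj[OF f1(1) f2(1)] by blast
    ultimately show ?thesis unfolding K_def image_Un using partition_on_Un[OF f1(7) f2(7)] by simp
  qed
  moreover have "cells_weight K = w1 + w2"
    unfolding K_def using cells_weight_Un[OF finK K12] f1(8) f2(8) by simp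
  moreover have "dom r = S1 \<union> S2" using f1(2) f2(2) by (auto simp: r_def)
  moreover have "ran r \<subseteq> X \<union> Y" using f1(3) f2(3) ran by auto
  ultimately show "join_maps t1 t2 \<in> maps (X \<union> Y) L (S1 \<union> S2) (w1 + w2)"
    using \<phi> pairs by (simp add: j maps_def premaps_def)
  have KX: "\<Union> (snd k) \<subseteq> X" "\<not> \<Union> (snd k) \<subseteq> Y" if "k \<in> K1" for k
    using premap_cell_subset[OF fin(1) p1 that] XY by blast+
  have KY: "\<Union> (snd k) \<subseteq> Y" "\<not> \<Union> (snd k) \<subseteq> X" if "k \<in> K2" for k
    using premap_cell_subset[OF fin(2) p2 that] XY by blast+
  show "closed_under (join_maps t1 t2) X"
    unfolding j closed_under_def prod.case
  proof (intro conjI ballI)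
    fix x assume "x \<in> X"
    then show "\<alpha> x \<in> X" "\<phi> x \<in> X" using \<alpha>X \<phi>X in1 by auto
  next
    fix k assume "k \<in> K"
    then show "\<Union> (snd k) \<subseteq> X \<or> \<Union> (snd k) \<inter> X = {}" using KX KY XY unfolding K_def by blast
  qed
  show "restrict_to X (join_maps t1 t2) = t1"
  proof -
    have "perm_restrict \<alpha> X = \<alpha>1" "perm_restrict \<phi> X = \<phi>1"
      using \<alpha>X \<phi>X permutes_not_in[OF pa1] permutes_not_in[OF f1(1)] by (auto simp: perm_restrict_def fun_eq_iff)
    moreover have "{i. \<exists>h\<in>X. r i = Some h} = S1"
    proof (intro equalityI subsetI)
      fix i assume "i \<in> {i. \<exists>h\<in>X. r i = Some h}"
      then obtain h where h: "h \<in> X" "r i = Some h" by blast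
      have "i \<notin> S2"
      proof
        assume "i \<in> S2"
        then have "r2 i = Some h" "the (r2 i) \<in> Y" using h(2) rS2[of i] r2Y[of i] by simp_all
        then show False using h(1) XY by auto
      qed
      moreover have "i \<in> S1 \<union> S2" using \<open>dom r = S1 \<union> S2\<close> h(2) by blast
      ultimately show "i \<in> S1" by blast
    next
      fix i assume "i \<in> S1"
      then show "i \<in> {i. \<exists>h\<in>X. r i = Some h}" using rS1[of i] r1X[of i] f1(2) by force
    qed
    moreover have "r |` S1 = r1" using rS1 f1(2) by (auto simp: fun_eq_iff restrict_map_def domIff)
    moreover have "{k \<in> K. \<Union> (snd k) \<subseteq> X} = K1" using KX KY unfolding K_def by blast
    ultimately show ?thesis unfolding j restrict_to_def prod.case by (simp add: t1')
  qed
  show "restrict_to Y (join_maps t1 t2) = t2"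
  proof -
    have "perm_restrict \<alpha> Y = \<alpha>2" "perm_restrict \<phi> Y = \<phi>2"
      using \<alpha>Y \<phi>Y permutes_not_in[OF pa2] permutes_not_in[OF f2(1)] by (auto simp: perm_restrict_def fun_eq_iff)
    moreover have "{i. \<exists>h\<in>Y. r i = Some h} = S2"
    proof (intro equalityI subsetI)
      fix i assume "i \<in> {i. \<exists>h\<in>Y. r i = Some h}"
      then obtain h where h: "h \<in> Y" "r i = Some h" by blast
      have "i \<notin> S1"
      proof
        assume "i \<in> S1"
        then have "r1 i = Some h" "the (r1 i) \<in> X" using h(2) rS1[of i] r1X[of i] by simp_all
        then show False using h(1) XY by auto
      qed
      moreover have "i \<in> S1 \<union> S2" using \<open>dom r = S1 \<union> S2\<close> h(2) by blast
      ultimately show "i \<in> S2" by blast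
    next
      fix i assume "i \<in> S2"
      then show "i \<in> {i. \<exists>h\<in>Y. r i = Some h}" using rS2[of i] r2Y[of i] f2(2) by force
    qed
    moreover have "r |` S2 = r2" using rS2 f2(2) by (auto simp: fun_eq_iff restrict_map_def domIff)
    moreover have "{k \<in> K. \<Union> (snd k) \<subseteq> Y} = K2" using KX KY unfolding K_def by blast
    ultimately show ?thesis unfolding j restrict_to_def prod.case by (simp add: t2')
  qed
  assume N: "N > 0"
  have "card (cycles_on (X \<union> Y) (\<phi> \<circ> \<alpha>)) = card (cycles_on X (\<phi>1 \<circ> \<alpha>1)) + card (cycles_on Y (\<phi>2 \<circ> \<alpha>2))"
    unfolding cyc\<nu> using fin cyc_disj[OF \<nu>1 \<nu>2] by (intro card_Un_disjoint) (auto simp: cycles_on_def)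
  moreover have "card (X \<union> Y) div 2 = card X div 2 + card Y div 2"
    using even_card_pairings[OF fin(1) a1] even_card_pairings[OF fin(2) a2] fin XY
    by (simp add: card_Un_disjoint)
  moreover have "(\<Sum>i\<in>S1 \<union> S2. L i) = (\<Sum>i\<in>S1. L i) + (\<Sum>i\<in>S2. L i)"
    using S by (intro sum.union_disjoint) auto
  moreover have "of_nat N powi (a + b) = (of_nat N :: complex) powi a * of_nat N powi b" for a b
    using N by (intro power_int_add) simp
  ultimately show "index_factor N (X \<union> Y) L (S1 \<union> S2) (fst (join_maps t1 t2)) (fst (snd (join_maps t1 t2)))
      = index_factor N X L S1 (fst t1) (fst (snd t1)) * index_factor N Y L S2 (fst t2) (fst (snd t2))"
    unfolding j fst_conv snd_conv index_factor_def by (simp add: t1' t2' algebra_simps flip: \<open>\<And>a b. _ powi (a + b) = _\<close>)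
qed

text \<open>A closed set contains each cycle and each cell entirely or not at all, so every
  condition of \<open>maps\<close> passes to the restriction.\<close>

lemma restrict_to:
  assumes "finite H" "finite B" and t: "t \<in> maps H L B w" and X: "X \<subseteq> H" "closed_under t X"
  defines "S \<equiv> {i \<in> B. the (fst (snd (snd t)) i) \<in> X}"
  shows "\<exists>w1. restrict_to X t \<in> maps X L S w1 \<and> w1 = cells_weight {k \<in> snd (snd (snd t)). \<Union> (snd k) \<subseteq> X}"
proof -
  obtain \<alpha> \<phi> r K where t': "t = (\<alpha>, \<phi>, r, K)" by (cases t)
  have p: "(\<phi>, r, K) \<in> premaps H L B w" and a: "\<alpha> \<in> pairings H"
    and fs: "inj_on (orbit (\<phi> \<circ> \<alpha>)) (\<Union> (orbit \<phi> ` ran r))"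
    using t by (auto simp: maps_def t')
  have f: "\<phi> permutes H" "dom r = B" "ran r \<subseteq> H" "inj_on (\<lambda>i. orbit \<phi> (the (r i))) B"
    "\<forall>i\<in>B. card (orbit \<phi> (the (r i))) = L i" "inj_on snd K"
    "partition_on (cycles_on H \<phi> - orbit \<phi> ` ran r) (snd ` K)" "cells_weight K = w"
    using p by (auto simp: premaps_def)
  have pa: "\<alpha> permutes H" using a by (auto simp: pairings_def)
  have cl: "\<alpha> x \<in> X" "\<phi> x \<in> X" if "x \<in> X" for x using X(2) that by (auto simp: closed_under_def t')
  have clK: "\<Union> (snd k) \<subseteq> X \<or> \<Union> (snd k) \<inter> X = {}" if "k \<in> K" for k
    using X(2) that by (auto simp: closed_under_def t')
  have finX: "finite X" using X(1) assms(1) finite_subset by blast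
  note perm = permutes_permutation[OF f(1) assms(1)]
  \<comment> \<open>An injective map of the finite set \<open>X\<close> into itself is onto.\<close>
  have res: "perm_restrict p X permutes X" if "p permutes H" "\<And>x. x \<in> X \<Longrightarrow> p x \<in> X" for p
  proof (rule bij_imp_permutes)
    have "inj_on p X" using permutes_inj[OF that(1)] by (rule inj_on_subset) simp
    moreover have "p ` X \<subseteq> X" using that(2) by blast
    ultimately have "bij_betw p X X" using finX by (simp add: bij_betw_def endo_inj_surj)
    then show "bij_betw (perm_restrict p X) X X" by (rule bij_betw_cong[THEN iffD1, rotated]) (simp add: perm_restrict_def)
  qed (simp add: perm_restrict_def)
  let ?\<phi> = "perm_restrict \<phi> X" and ?\<alpha> = "perm_restrict \<alpha> X"
  have pX: "?\<phi> permutes X" "?\<alpha> permutes X" using res[OF f(1)] res[OF pa] cl by auto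
  have rX: "?\<phi> x = \<phi> x" "?\<alpha> x = \<alpha> x" if "x \<in> X" for x using that by (simp_all add: perm_restrict_def)
  have orb: "orbit ?\<phi> x = orbit \<phi> x" "orbit (?\<phi> \<circ> ?\<alpha>) x = orbit (\<phi> \<circ> \<alpha>) x" if "x \<in> X" for x
  proof -
    show "orbit ?\<phi> x = orbit \<phi> x"
      by (rule orbit_cong_on_closed[where X = X]) (use that cl rX in auto)
    show "orbit (?\<phi> \<circ> ?\<alpha>) x = orbit (\<phi> \<circ> \<alpha>) x"
      by (rule orbit_cong_on_closed[where X = X]) (use that cl rX in auto)
  qed
  have orbX: "orbit \<phi> x \<subseteq> X" if "x \<in> X" for x using that cl by (intro orbit_subset_closed) auto
  have orbX': "x \<in> X" if "orbit \<phi> x \<subseteq> X" for x using that permutation_self_in_orbit[OF perm] by blast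
  let ?r = "r |` {i. \<exists>h\<in>X. r i = Some h}"
  have S: "{i. \<exists>h\<in>X. r i = Some h} = S"
    unfolding S_def t' using f(2) by (auto simp: dom_def)
  have dom: "dom ?r = S" unfolding S unfolding S_def t' using f(2) by auto
  have ran: "ran ?r = ran r \<inter> X" unfolding ran_def by (auto simp: restrict_map_def split: if_splits)
  have cycX: "cycles_on X ?\<phi> = {c \<in> cycles_on H \<phi>. c \<subseteq> X}"
    unfolding cycles_on_def using orb(1) orbX orbX' X(1) by auto
  have bdX: "orbit ?\<phi> ` ran ?r = {c \<in> orbit \<phi> ` ran r. c \<subseteq> X}"
    unfolding ran using orb(1) orbX orbX' by auto
  let ?K = "{k \<in> K. \<Union> (snd k) \<subseteq> X}"
  have "partition_on (cycles_on X ?\<phi> - orbit ?\<phi> ` ran ?r) (snd ` ?K)"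
  proof (rule partition_onI)
    show "\<Union> (snd ` ?K) = cycles_on X ?\<phi> - orbit ?\<phi> ` ran ?r"
    proof (intro equalityI subsetI)
      fix c assume "c \<in> \<Union> (snd ` ?K)"
      then obtain k where k: "k \<in> K" "\<Union> (snd k) \<subseteq> X" "c \<in> snd k" by blast
      then have "c \<in> cycles_on H \<phi> - orbit \<phi> ` ran r" using f(7) unfolding partition_on_def by blast
      then show "c \<in> cycles_on X ?\<phi> - orbit ?\<phi> ` ran ?r" unfolding cycX bdX using k by blast
    next
      fix c assume c: "c \<in> cycles_on X ?\<phi> - orbit ?\<phi> ` ran ?r"
      then have c': "c \<in> cycles_on H \<phi> - orbit \<phi> ` ran r" "c \<subseteq> X" unfolding cycX bdX by blast+
      then obtain k where k: "k \<in> K" "c \<in> snd k" using f(7) unfolding partition_on_def by blast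
      have "c \<noteq> {}" using c'(1) partition_on_cycles[OF f(1) assms(1)] unfolding partition_on_def by blast
      then have "\<Union> (snd k) \<subseteq> X" using clK[OF k(1)] k(2) c'(2) by blast
      then show "c \<in> \<Union> (snd ` ?K)" using k by blast
    qed
    show "{} \<notin> snd ` ?K" using f(7) unfolding partition_on_def by blast
    show "disjnt p q" if "p \<in> snd ` ?K" "q \<in> snd ` ?K" "p \<noteq> q" for p q
    proof -
      have "p \<in> snd ` K" "q \<in> snd ` K" using that by blast+
      then show ?thesis using that(3) partition_onD2[OF f(7)] by (auto simp: disjnt_def dest: disjointD)
    qed
  qed
  moreover have "?\<alpha> \<in> pairings X"
    using a pX(2) rX(2) cl X(1) by (auto simp: pairings_def)
  moreover have "inj_on (orbit (?\<phi> \<circ> ?\<alpha>)) (\<Union> (orbit ?\<phi> ` ran ?r))"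
  proof -
    have "\<Union> (orbit ?\<phi> ` ran ?r) \<subseteq> \<Union> (orbit \<phi> ` ran r)" "\<Union> (orbit ?\<phi> ` ran ?r) \<subseteq> X"
      unfolding bdX by blast+
    then have "inj_on (orbit (\<phi> \<circ> \<alpha>)) (\<Union> (orbit ?\<phi> ` ran ?r))"
      "\<And>x. x \<in> \<Union> (orbit ?\<phi> ` ran ?r) \<Longrightarrow> orbit (?\<phi> \<circ> ?\<alpha>) x = orbit (\<phi> \<circ> \<alpha>) x"
      using fs orb(2) by (auto intro: inj_on_subset)
    then show ?thesis by (subst inj_on_cong) auto
  qed
  moreover have "inj_on (\<lambda>i. orbit ?\<phi> (the (?r i))) S \<and> (\<forall>i\<in>S. card (orbit ?\<phi> (the (?r i))) = L i)"
  proof -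
    have "orbit ?\<phi> (the (?r i)) = orbit \<phi> (the (r i))" if "i \<in> S" for i
      using that orb(1) unfolding S by (simp add: S_def t')
    moreover have "S \<subseteq> B" by (auto simp: S_def)
    moreover have "inj_on (\<lambda>i. orbit \<phi> (the (r i))) S" using f(4) \<open>S \<subseteq> B\<close> by (rule inj_on_subset)
    ultimately show ?thesis using f(5) by (auto cong: inj_on_cong)
  qed
  moreover have "inj_on snd ?K" using f(6) by (auto simp: inj_on_def)
  ultimately have "(?\<alpha>, ?\<phi>, ?r, ?K) \<in> maps X L S (cells_weight ?K)"
    using pX dom ran by (simp add: maps_def premaps_def)
  then show ?thesis by (simp add: restrict_to_def t')
qed

text \<open>Closure is a forward condition, but an injective map of a finite set into itself is
  onto, so no point outside \<open>X\<close> is mapped into \<open>X\<close>.\<close>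

lemma closed_under_complement:
  assumes "finite H" and t: "t \<in> maps H L B w" and X: "X \<subseteq> H" "closed_under t X"
  shows "closed_under t (H - X)"
proof -
  obtain \<alpha> \<phi> r K where t': "t = (\<alpha>, \<phi>, r, K)" by (cases t)
  have p: "(\<phi>, r, K) \<in> premaps H L B w" and a: "\<alpha> \<in> pairings H" using t by (auto simp: maps_def t')
  have \<phi>: "\<phi> permutes H" using p by (auto simp: premaps_def)
  have pa: "\<alpha> permutes H" using a by (auto simp: pairings_def)
  have finX: "finite X" using X(1) assms(1) finite_subset by blast
  have cl: "\<alpha> x \<in> X" "\<phi> x \<in> X" if "x \<in> X" for x using X(2) that by (auto simp: closed_under_def t')
  have preimage: "x \<in> X" if q: "q permutes H" "\<And>x. x \<in> X \<Longrightarrow> q x \<in> X" "q x \<in> X" for q x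
  proof -
    have inj: "inj q" by (rule permutes_inj[OF q(1)])
    then have "q ` X = X" using q(2) finX by (intro endo_inj_surj) (auto intro: inj_on_subset)
    then have "q x \<in> q ` X" using q(3) by simp
    then obtain y where "y \<in> X" "q y = q x" by (metis imageE)
    then show ?thesis using inj by (auto dest: injD)
  qed
  show ?thesis
    unfolding closed_under_def t' prod.case
  proof (intro conjI ballI)
    fix x assume x: "x \<in> H - X"
    show "\<alpha> x \<in> H - X" using x preimage[OF pa cl(1)] permutes_in_image[OF pa] by blast
    show "\<phi> x \<in> H - X" using x preimage[OF \<phi> cl(2)] permutes_in_image[OF \<phi>] by blast
  next
    fix k assume k: "k \<in> K"
    have "\<Union> (snd k) \<subseteq> X \<or> \<Union> (snd k) \<inter> X = {}" using X(2) k by (auto simp: closed_under_def t')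
    then show "\<Union> (snd k) \<subseteq> H - X \<or> \<Union> (snd k) \<inter> (H - X) = {}"
      using premap_cell_subset(1)[OF assms(1) p k] by blast
  qed
qed

text \<open>Together with the lemma \<open>join_maps\<close> this makes cutting along a closed set
  and joining inverse to each other.\<close>

lemma join_restrict:
  assumes "finite H" and t: "t \<in> maps H L B w" and X: "X \<subseteq> H" "closed_under t X"
  shows "join_maps (restrict_to X t) (restrict_to (H - X) t) = t"
    and "cells_weight {k \<in> snd (snd (snd t)). \<Union> (snd k) \<subseteq> X} + cells_weight {k \<in> snd (snd (snd t)). \<Union> (snd k) \<subseteq> H - X} = w"
    and "{i \<in> B. the (fst (snd (snd t)) i) \<in> H - X} = B - {i \<in> B. the (fst (snd (snd t)) i) \<in> X}"
proof -
  obtain \<alpha> \<phi> r K where t': "t = (\<alpha>, \<phi>, r, K)" by (cases t)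
  have p: "(\<phi>, r, K) \<in> premaps H L B w" and a: "\<alpha> \<in> pairings H" using t by (auto simp: maps_def t')
  have \<phi>: "\<phi> permutes H" and r: "dom r = B" "ran r \<subseteq> H" and w: "cells_weight K = w" using p by (auto simp: premaps_def)
  have pa: "\<alpha> permutes H" using a by (auto simp: pairings_def)
  have cX: "closed_under t (H - X)" by (rule closed_under_complement[OF assms])
  have split: "perm_restrict q X \<circ> perm_restrict q (H - X) = q"
    if q: "q permutes H" and qX: "\<And>x. x \<in> H - X \<Longrightarrow> q x \<in> H - X" for q
  proof
    fix x show "(perm_restrict q X \<circ> perm_restrict q (H - X)) x = q x"
      using permutes_not_in[OF q, of x] qX[of x] X(1) by (auto simp: perm_restrict_def)
  qed
  have "(r |` {i. \<exists>h\<in>X. r i = Some h}) ++ (r |` {i. \<exists>h\<in>H - X. r i = Some h}) = r"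
  proof
    fix i show "((r |` {i. \<exists>h\<in>X. r i = Some h}) ++ (r |` {i. \<exists>h\<in>H - X. r i = Some h})) i = r i"
      using r(2) by (cases "r i") (auto simp: map_add_def restrict_map_def ran_def split: option.splits)
  qed
  moreover have K: "K = {k \<in> K. \<Union> (snd k) \<subseteq> X} \<union> {k \<in> K. \<Union> (snd k) \<subseteq> H - X}"
  proof -
    have "\<Union> (snd k) \<subseteq> X \<or> \<Union> (snd k) \<subseteq> H - X" if "k \<in> K" for k
    proof -
      have "\<Union> (snd k) \<subseteq> X \<or> \<Union> (snd k) \<inter> X = {}" using X(2) that by (auto simp: closed_under_def t')
      then show ?thesis using premap_cell_subset(1)[OF assms(1) p that] by blast
    qed
    then show ?thesis by blast
  qed
  moreover have "perm_restrict \<alpha> X \<circ> perm_restrict \<alpha> (H - X) = \<alpha>" "perm_restrict \<phi> X \<circ> perm_restrict \<phi> (H - X) = \<phi>"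
    using cX by (auto simp: closed_under_def t' intro!: split pa \<phi>)
  ultimately show "join_maps (restrict_to X t) (restrict_to (H - X) t) = t"
    unfolding t' restrict_to_def join_maps_def prod.case by simp
  have "{k \<in> K. \<Union> (snd k) \<subseteq> X} \<inter> {k \<in> K. \<Union> (snd k) \<subseteq> H - X} = {}"
    using premap_cell_subset(2)[OF assms(1) p] by blast
  then show "cells_weight {k \<in> snd (snd (snd t)). \<Union> (snd k) \<subseteq> X} + cells_weight {k \<in> snd (snd (snd t)). \<Union> (snd k) \<subseteq> H - X} = w"
    using premaps_finite_cells[OF assms(1) p] w by (subst cells_weight_Un[symmetric]) (auto simp: t' K[symmetric])
  have "the (r i) \<in> H" if "i \<in> B" for i using that r by (intro the_map_mem) simp_all
  then show "{i \<in> B. the (fst (snd (snd t)) i) \<in> H - X} = B - {i \<in> B. the (fst (snd (snd t)) i) \<in> X}"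
    by (auto simp: t')
qed

lemma closed_under_restrict:
  assumes "closed_under t X" "Y \<subseteq> X"
  shows "closed_under (restrict_to X t) Y \<longleftrightarrow> closed_under t Y"
proof -
  obtain \<alpha> \<phi> r K where t: "t = (\<alpha>, \<phi>, r, K)" by (cases t)
  have 1: "perm_restrict q X x = q x" if "x \<in> Y" for q x using that assms(2) by (auto simp: perm_restrict_def)
  have 2: "\<Union> (snd k) \<subseteq> X \<or> \<Union> (snd k) \<inter> X = {}" if "k \<in> K" for k
    using assms(1) that by (auto simp: closed_under_def t)
  have "(\<forall>k\<in>{k \<in> K. \<Union> (snd k) \<subseteq> X}. \<Union> (snd k) \<subseteq> Y \<or> \<Union> (snd k) \<inter> Y = {})
     \<longleftrightarrow> (\<forall>k\<in>K. \<Union> (snd k) \<subseteq> Y \<or> \<Union> (snd k) \<inter> Y = {})"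
    using 2 assms(2) by blast
  then show ?thesis unfolding closed_under_def restrict_to_def t prod.case using 1 by simp
qed

section \<open>The component of a half-edge\<close>

definition component :: "'h set \<Rightarrow> 'h labelled_map \<Rightarrow> 'h \<Rightarrow> 'h set" where
  "component H t h = \<Inter> {X. X \<subseteq> H \<and> closed_under t X \<and> h \<in> X}"

lemma closed_under_whole:
  assumes "finite H" "t \<in> maps H L B w"
  shows "closed_under t H"
proof -
  obtain \<alpha> \<phi> r K where t: "t = (\<alpha>, \<phi>, r, K)" by (cases t)
  have p: "(\<phi>, r, K) \<in> premaps H L B w" and "\<alpha> permutes H" "\<phi> permutes H"
    using assms(2) by (auto simp: maps_def premaps_def pairings_def t)
  then show ?thesis using premap_cell_subset(1)[OF assms(1) p] permutes_in_image
    unfolding closed_under_def t prod.case by metis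
qed

text \<open>Connectedness comes from minimality: if a closed part of the component misses
  \<open>h\<close>, its complement is closed and contains \<open>h\<close>, hence contains the whole
  component.\<close>

lemma component:
  assumes "finite H" "t \<in> maps H L B w" "h \<in> H"
  shows "component H t h \<subseteq> H" "closed_under t (component H t h)" "h \<in> component H t h"
    "conn (component H t h) (restrict_to (component H t h) t)"
proof -
  let ?C = "component H t h"
  obtain \<alpha> \<phi> r K where t: "t = (\<alpha>, \<phi>, r, K)" by (cases t)
  show C: "?C \<subseteq> H" "h \<in> ?C"
    using closed_under_whole[OF assms(1,2)] assms(3) by (auto simp: component_def)
  show cl: "closed_under t ?C"
    unfolding closed_under_def t prod.case
  proof (intro conjI ballI)
    fix x assume "x \<in> component H (\<alpha>, \<phi>, r, K) h"
    then show "\<alpha> x \<in> component H (\<alpha>, \<phi>, r, K) h" "\<phi> x \<in> component H (\<alpha>, \<phi>, r, K) h"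
      unfolding component_def closed_under_def by auto
  next
    fix k assume k: "k \<in> K"
    show "\<Union> (snd k) \<subseteq> component H (\<alpha>, \<phi>, r, K) h \<or> \<Union> (snd k) \<inter> component H (\<alpha>, \<phi>, r, K) h = {}"
    proof (cases "\<forall>X. X \<subseteq> H \<and> closed_under t X \<and> h \<in> X \<longrightarrow> \<Union> (snd k) \<subseteq> X")
      case True
      then show ?thesis unfolding component_def t by blast
    next
      case False
      then obtain X where X: "X \<subseteq> H" "closed_under t X" "h \<in> X" "\<not> \<Union> (snd k) \<subseteq> X" by blast
      have "\<Union> (snd k) \<subseteq> X \<or> \<Union> (snd k) \<inter> X = {}" using X(2) k by (simp add: closed_under_def t)
      then have "\<Union> (snd k) \<inter> X = {}" using X(4) by blast
      moreover have "component H (\<alpha>, \<phi>, r, K) h \<subseteq> X" unfolding component_def using X t by blast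
      ultimately show ?thesis by blast
    qed
  qed
  show "conn ?C (restrict_to ?C t)"
    unfolding conn_def
  proof (intro conjI allI impI)
    show "?C \<noteq> {}" using C(2) by blast
    fix Y assume Y: "Y \<subseteq> ?C" "closed_under (restrict_to ?C t) Y"
    then have Y': "closed_under t Y" "Y \<subseteq> H" using closed_under_restrict[OF cl Y(1)] C(1) by auto
    show "Y = {} \<or> Y = ?C"
    proof (cases "h \<in> Y")
      case True
      then have "?C \<subseteq> Y" unfolding component_def using Y' by blast
      then show ?thesis using Y(1) by blast
    next
      case False
      then have "?C \<subseteq> H - Y"
        unfolding component_def using closed_under_complement[OF assms(1,2) Y'(2,1)] assms(3)
        by (intro Inter_lower) simp
      then show ?thesis using Y(1) by blast
    qed
  qed
qed

text \<open>Recovers the cut from the joined map: \<open>X\<close> is closed and contains the root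
  of \<open>b\<close>, and the connectedness of \<open>t1\<close> forbids a smaller
  component.\<close>

lemma component_join:
  assumes fin: "finite X" "finite Y" and XY: "X \<inter> Y = {}" and S: "S1 \<inter> S2 = {}" "finite S1" "finite S2"
    and t1: "t1 \<in> maps X L S1 w1" "conn X t1" and t2: "t2 \<in> maps Y L S2 w2" and b: "b \<in> S1"
  shows "component (X \<union> Y) (join_maps t1 t2) (the (fst (snd (snd (join_maps t1 t2))) b)) = X"
    and "{i \<in> S1 \<union> S2. the (fst (snd (snd (join_maps t1 t2))) i) \<in> X} = S1"
proof -
  let ?t = "join_maps t1 t2"
  note J = join_maps[OF fin XY S t1(1) t2]
  obtain \<alpha>1 \<phi>1 r1 K1 where t1': "t1 = (\<alpha>1, \<phi>1, r1, K1)" by (cases t1)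
  obtain \<alpha>2 \<phi>2 r2 K2 where t2': "t2 = (\<alpha>2, \<phi>2, r2, K2)" by (cases t2)
  have r: "dom r1 = S1" "dom r2 = S2" "ran r1 \<subseteq> X" "ran r2 \<subseteq> Y"
    using t1 t2 by (auto simp: t1' t2' maps_def premaps_def)
  have rt: "fst (snd (snd ?t)) = r1 ++ r2" by (simp add: t1' t2' join_maps_def)
  have in1: "the ((r1 ++ r2) i) \<in> X" if i: "i \<in> S1" for i
  proof -
    have "i \<notin> dom r2" using i S(1) r(2) by blast
    then have "(r1 ++ r2) i = r1 i" by (rule map_add_dom_app_simps(3))
    then show ?thesis using i r(1,3) by (simp add: the_map_mem)
  qed
  have in2: "the ((r1 ++ r2) i) \<in> Y" if i: "i \<in> S2" for i
  proof -
    have "(r1 ++ r2) i = r2 i" using i r(2) by (intro map_add_dom_app_simps(1)) simp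
    then show ?thesis using i r(2,4) by (simp add: the_map_mem)
  qed
  show "{i \<in> S1 \<union> S2. the (fst (snd (snd ?t)) i) \<in> X} = S1"
    unfolding rt using in1 in2 XY by blast
  let ?h = "the (fst (snd (snd ?t)) b)"
  have h: "?h \<in> X" unfolding rt using in1 b by blast
  let ?C = "component (X \<union> Y) ?t ?h"
  have CX: "?C \<subseteq> X" unfolding component_def using h J(2) by blast
  have "finite (X \<union> Y)" using fin by simp
  then have C: "closed_under ?t ?C" "?h \<in> ?C" using component[OF _ J(1)] h by blast+
  then have "closed_under t1 ?C" using closed_under_restrict[OF J(2) CX] J(3) by simp
  then show "?C = X" using t1(2) CX C(2) unfolding conn_def by blast
qed

lemma finite_maps:
  assumes "finite H" "finite B"
  shows "finite (maps H L B w)"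
proof (cases "premaps H L B w = {}")
  case True
  then have "maps H L B w = {}" by (auto simp: maps_def)
  then show ?thesis by simp
next
  case False
  then obtain \<phi> r K where p: "(\<phi>, r, K) \<in> premaps H L B w" by auto
  \<comment> \<open>The positivity of the lengths, which \<open>card_premaps\<close> asks for, is
    read off from any existing premap.\<close>
  have "L i \<ge> 1" if "i \<in> B" for i
  proof -
    have \<phi>: "\<phi> permutes H" and r: "dom r = B" "ran r \<subseteq> H" "card (orbit \<phi> (the (r i))) = L i"
      using p that by (auto simp: premaps_def)
    have "the (r i) \<in> H" using that r by (intro the_map_mem) simp_all
    then have "finite (orbit \<phi> (the (r i)))"
      using permutes_orbit_subset[OF \<phi>] assms(1) by (meson finite_subset)
    then show ?thesis using r(3) orbit_nonempty[of \<phi> "the (r i)"] by (simp add: card_gt_0_iff Suc_le_eq flip: r(3))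
  qed
  then have "finite (premaps H L B w)"
    using card_premaps[OF assms _ premaps_weights[OF assms(1) p] premaps_card[OF assms p]] by blast
  then have "finite (pairings H \<times> premaps H L B w)" using finite_pairings[OF assms(1)] by blast
  then show ?thesis by (rule finite_subset[rotated]) (auto simp: maps_def)
qed

text \<open>A map is cut into the component of the root of the boundary \<open>b\<close> and the rest.\<close>

lemma sum_maps_component:
  fixes F :: "'h labelled_map \<Rightarrow> 'c::comm_monoid_add"
  assumes H: "finite H" and B: "finite B" and b: "b \<in> B"
  shows "(\<Sum>t\<in>maps H L B w. F t) =
    (\<Sum>X\<in>Pow H. \<Sum>S | b \<in> S \<and> S \<subseteq> B. \<Sum>(w1, w2) | w1 + w2 = w.
      \<Sum>t1\<in>{t \<in> maps X L S w1. conn X t}. \<Sum>t2\<in>maps (H - X) L (B - S) w2. F (join_maps t1 t2))"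
proof -
  let ?J = "SIGMA X:Pow H. SIGMA S:{S. b \<in> S \<and> S \<subseteq> B}. SIGMA ww:{(w1, w2). w1 + w2 = w}.
     SIGMA t1:{t \<in> maps X L S (fst ww). conn X t}. maps (H - X) L (B - S) (snd ww)"
  have finS: "finite {S. b \<in> S \<and> S \<subseteq> B}" by (rule finite_subset[of _ "Pow B"]) (use B in auto)
  have fins: "finite X" "finite (H - X)" "finite S" "finite (B - S)" if "X \<subseteq> H" "S \<subseteq> B" for X S
    using that H B by (auto intro: finite_subset)
  define W where "W = {(w1, w2). w1 + w2 = w}"
  have finW: "finite W" unfolding W_def by (rule finite_mset_splits)
  let ?D = "\<lambda>X S ww. {t \<in> maps X L S (fst ww). conn X t}" and ?E = "\<lambda>X S ww. maps (H - X) L (B - S) (snd ww)"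
  have finD: "finite (?D X S ww)" "finite (?E X S ww)" if "X \<subseteq> H" "S \<subseteq> B" for X S ww
    using finite_maps[OF fins(1,3)[OF that]] finite_maps[OF fins(2,4)[OF that]] by simp_all
  have "(\<Sum>X\<in>Pow H. \<Sum>S | b \<in> S \<and> S \<subseteq> B. \<Sum>(w1, w2)\<in>W.
      \<Sum>t1\<in>{t \<in> maps X L S w1. conn X t}. \<Sum>t2\<in>maps (H - X) L (B - S) w2. F (join_maps t1 t2))
     = (\<Sum>X\<in>Pow H. \<Sum>S | b \<in> S \<and> S \<subseteq> B. \<Sum>ww\<in>W. \<Sum>t1\<in>?D X S ww. \<Sum>t2\<in>?E X S ww. F (join_maps t1 t2))"
    by (simp add: case_prod_unfold)
  also have "\<dots> = (\<Sum>X\<in>Pow H. \<Sum>S | b \<in> S \<and> S \<subseteq> B. \<Sum>ww\<in>W. \<Sum>(t1, t2)\<in>Sigma (?D X S ww) (\<lambda>_. ?E X S ww). F (join_maps t1 t2))"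
    using finD by (intro sum.cong refl sum.Sigma) auto
  also have "\<dots> = (\<Sum>X\<in>Pow H. \<Sum>S | b \<in> S \<and> S \<subseteq> B. \<Sum>(ww, t1, t2)\<in>Sigma W (\<lambda>ww. Sigma (?D X S ww) (\<lambda>_. ?E X S ww)). F (join_maps t1 t2))"
    using finD finW by (intro sum.cong refl sum.Sigma) auto
  also have "\<dots> = (\<Sum>X\<in>Pow H. \<Sum>(S, ww, t1, t2)\<in>Sigma {S. b \<in> S \<and> S \<subseteq> B} (\<lambda>S. Sigma W (\<lambda>ww. Sigma (?D X S ww) (\<lambda>_. ?E X S ww))). F (join_maps t1 t2))"
    using finD finW finS by (intro sum.cong refl sum.Sigma) auto
  also have "\<dots> = (\<Sum>(X, S, ww, t1, t2)\<in>?J. F (join_maps t1 t2))"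
    unfolding W_def[symmetric] using finD finW finS H by (intro sum.Sigma) auto
  also have "\<dots> = (\<Sum>t\<in>maps H L B w. F t)"
  \<comment> \<open>Only \<open>X\<close> has to be reconstructed from the joined map. Labels,
    weights and both pieces are then restrictions to \<open>X\<close> and to its complement.\<close>
  proof (rule sum.reindex_bij_witness[where j = "\<lambda>(X, S, ww, t1, t2). join_maps t1 t2"
      and i = "\<lambda>t. let X = component H t (the (fst (snd (snd t)) b)) in
        (X, {i \<in> B. the (fst (snd (snd t)) i) \<in> X},
         (cells_weight {k \<in> snd (snd (snd t)). \<Union> (snd k) \<subseteq> X}, cells_weight {k \<in> snd (snd (snd t)). \<Union> (snd k) \<subseteq> H - X}),
         restrict_to X t, restrict_to (H - X) t)"])
    fix q assume "q \<in> ?J"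
    then obtain X S w1 w2 t1 t2 where q: "q = (X, S, (w1, w2), t1, t2)" and XS: "X \<subseteq> H" "b \<in> S" "S \<subseteq> B" "w1 + w2 = w"
      and t1: "t1 \<in> maps X L S w1" "conn X t1" and t2: "t2 \<in> maps (H - X) L (B - S) w2" by auto
    have u: "X \<union> (H - X) = H" "S \<union> (B - S) = B" and d: "X \<inter> (H - X) = {}" "S \<inter> (B - S) = {}" using XS by auto
    note f = fins[OF XS(1,3)]
    note J = join_maps[OF f(1,2) d(1,2) f(3,4) t1(1) t2, unfolded u XS(4)]
    note C = component_join[OF f(1,2) d(1,2) f(3,4) t1 t2 XS(2), unfolded u]
    show "(case q of (X, S, ww, t1, t2) \<Rightarrow> join_maps t1 t2) \<in> maps H L B w" using J(1) by (simp add: q)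
    have w1: "cells_weight {k \<in> snd (snd (snd (join_maps t1 t2))). \<Union> (snd k) \<subseteq> X} = w1"
      using arg_cong[OF J(3), of "\<lambda>t. cells_weight (snd (snd (snd t)))"] t1(1)
      by (auto simp: restrict_to_def case_prod_unfold maps_def premaps_def)
    have w2: "cells_weight {k \<in> snd (snd (snd (join_maps t1 t2))). \<Union> (snd k) \<subseteq> H - X} = w2"
      using arg_cong[OF J(4), of "\<lambda>t. cells_weight (snd (snd (snd t)))"] t2
      by (auto simp: restrict_to_def case_prod_unfold maps_def premaps_def)
    show "(let X = component H (case q of (X, S, ww, t1, t2) \<Rightarrow> join_maps t1 t2) (the (fst (snd (snd (case q of (X, S, ww, t1, t2) \<Rightarrow> join_maps t1 t2))) b)) in
        (X, {i \<in> B. the (fst (snd (snd (case q of (X, S, ww, t1, t2) \<Rightarrow> join_maps t1 t2))) i) \<in> X},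
         (cells_weight {k \<in> snd (snd (snd (case q of (X, S, ww, t1, t2) \<Rightarrow> join_maps t1 t2))). \<Union> (snd k) \<subseteq> X},
          cells_weight {k \<in> snd (snd (snd (case q of (X, S, ww, t1, t2) \<Rightarrow> join_maps t1 t2))). \<Union> (snd k) \<subseteq> H - X}),
         restrict_to X (case q of (X, S, ww, t1, t2) \<Rightarrow> join_maps t1 t2), restrict_to (H - X) (case q of (X, S, ww, t1, t2) \<Rightarrow> join_maps t1 t2))) = q"
      unfolding q prod.case C(1) Let_def C(2) J(3,4) w1 w2 ..
    show "F (case q of (X, S, ww, t1, t2) \<Rightarrow> join_maps t1 t2) = (case q of (X, S, ww, t1, t2) \<Rightarrow> F (join_maps t1 t2))"
      by (simp add: q)
  next
    fix t assume t: "t \<in> maps H L B w"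
    obtain \<alpha> \<phi> r K where t': "t = (\<alpha>, \<phi>, r, K)" by (cases t)
    have "dom r = B" "ran r \<subseteq> H" using t by (auto simp: t' maps_def premaps_def)
    then have "the (r b) \<in> H" using b by (intro the_map_mem) simp_all
    then have h: "the (fst (snd (snd t)) b) \<in> H" by (simp add: t')
    define X where "X = component H t (the (fst (snd (snd t)) b))"
    note C = component[OF H t h, folded X_def]
    note R = join_restrict[OF H t C(1,2)]
    have c: "closed_under t (H - X)" by (rule closed_under_complement[OF H t C(1,2)])
    have R1: "restrict_to X t \<in> maps X L {i \<in> B. the (fst (snd (snd t)) i) \<in> X} (cells_weight {k \<in> snd (snd (snd t)). \<Union> (snd k) \<subseteq> X})"
      using restrict_to[OF H B t C(1,2)] by blast
    have R2: "restrict_to (H - X) t \<in> maps (H - X) L (B - {i \<in> B. the (fst (snd (snd t)) i) \<in> X}) (cells_weight {k \<in> snd (snd (snd t)). \<Union> (snd k) \<subseteq> H - X})"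
      using restrict_to[OF H B t Diff_subset c] unfolding R(3) by blast
    show "(case let X = component H t (the (fst (snd (snd t)) b)) in
        (X, {i \<in> B. the (fst (snd (snd t)) i) \<in> X},
         (cells_weight {k \<in> snd (snd (snd t)). \<Union> (snd k) \<subseteq> X}, cells_weight {k \<in> snd (snd (snd t)). \<Union> (snd k) \<subseteq> H - X}),
         restrict_to X t, restrict_to (H - X) t) of (X, S, ww, t1, t2) \<Rightarrow> join_maps t1 t2) = t"
      unfolding X_def[symmetric] Let_def prod.case by (rule R(1))
    show "(let X = component H t (the (fst (snd (snd t)) b)) in
        (X, {i \<in> B. the (fst (snd (snd t)) i) \<in> X},
         (cells_weight {k \<in> snd (snd (snd t)). \<Union> (snd k) \<subseteq> X}, cells_weight {k \<in> snd (snd (snd t)). \<Union> (snd k) \<subseteq> H - X}),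
         restrict_to X t, restrict_to (H - X) t)) \<in> ?J"
      unfolding X_def[symmetric] Let_def
      by (intro SigmaI) (use C b R R1 R2 in \<open>simp_all add: X_def[symmetric]\<close>)
  qed
  finally show ?thesis unfolding W_def by (rule sym)
qed

section \<open>Relabelling of half-edges\<close>

text \<open>Used with bijections of the whole type, so that conjugation by the inverse makes sense
  everywhere and images of sets of sets stay injective. Bijections between finite sets enter through
  \<open>bij_extend\<close>.\<close>

definition transport :: "('h \<Rightarrow> 'h) \<Rightarrow> 'h labelled_map \<Rightarrow> 'h labelled_map" where
  "transport f t = (case t of (\<alpha>, \<phi>, r, K) \<Rightarrow>
     (f \<circ> \<alpha> \<circ> inv_into UNIV f, f \<circ> \<phi> \<circ> inv_into UNIV f, map_option f \<circ> r, map_prod id (image (image f)) ` K))"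

lemma orbit_conjugate:
  assumes "bij f"
  shows "orbit (f \<circ> p \<circ> inv_into UNIV f) (f x) = f ` orbit p x"
proof -
  define q where "q = f \<circ> p \<circ> inv_into UNIV f"
  have q: "q (f y) = f (p y)" for y using assms by (simp add: q_def bij_is_inj)
  have "orbit q (f x) \<subseteq> f ` orbit p x"
  proof
    fix y assume "y \<in> orbit q (f x)"
    then show "y \<in> f ` orbit p x"
      by induction (auto simp: q intro: orbit.intros)
  qed
  moreover have "f z \<in> orbit q (f x)" if "z \<in> orbit p x" for z
    using that
  proof induction
    case base
    show ?case using orbit.base[of q "f x"] by (simp add: q)
  next
    case (step z)
    show ?case using orbit.step[OF step.IH] by (simp add: q)
  qed
  ultimately show ?thesis unfolding q_def by blast
qed

lemma cycles_on_conjugate: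
  "bij f \<Longrightarrow> cycles_on (f ` X) (f \<circ> p \<circ> inv_into UNIV f) = image f ` cycles_on X p"
  by (simp only: cycles_on_def image_image orbit_conjugate)

lemma permutes_conjugate:
  assumes "bij f" "p permutes X"
  shows "f \<circ> p \<circ> inv_into UNIV f permutes f ` X"
proof -
  have "bij (f \<circ> p \<circ> inv_into UNIV f)"
    by (rule bij_comp[OF bij_imp_bij_inv[OF assms(1)] bij_comp[OF permutes_bij[OF assms(2)] assms(1)]])
  moreover have "(f \<circ> p \<circ> inv_into UNIV f) x = x" if x: "x \<notin> f ` X" for x
  proof -
    obtain y where y: "x = f y" using assms(1) by (metis bij_pointE)
    then have "y \<notin> X" using x by blast
    then show ?thesis using permutes_not_in[OF assms(2)] assms(1) y by (simp add: bij_is_inj)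
  qed
  ultimately show ?thesis unfolding permutes_def bij_iff by blast
qed

lemma inj_image_image: "bij f \<Longrightarrow> inj (image (image f))"
  by (meson bij_is_inj inj_image_eq_iff injI)

text \<open>All conditions are phrased through orbits, images and cardinalities, which commute with
  a bijection.\<close>

lemma transport_maps:
  assumes f: "bij f" and "finite X" and t: "t \<in> maps X L S w"
  shows "transport f t \<in> maps (f ` X) L S w"
    and "conn X t \<Longrightarrow> conn (f ` X) (transport f t)"
    and "index_factor N (f ` X) L S (fst (transport f t)) (fst (snd (transport f t))) = index_factor N X L S (fst t) (fst (snd t))"
proof -
  obtain \<alpha> \<phi> r K where t': "t = (\<alpha>, \<phi>, r, K)" by (cases t)
  have p: "(\<phi>, r, K) \<in> premaps X L S w" and a: "\<alpha> \<in> pairings X"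
    and fs: "inj_on (orbit (\<phi> \<circ> \<alpha>)) (\<Union> (orbit \<phi> ` ran r))"
    using t by (auto simp: maps_def t')
  have q: "\<phi> permutes X" "dom r = S" "ran r \<subseteq> X" "inj_on (\<lambda>i. orbit \<phi> (the (r i))) S"
    "\<forall>i\<in>S. card (orbit \<phi> (the (r i))) = L i" "inj_on snd K"
    "partition_on (cycles_on X \<phi> - orbit \<phi> ` ran r) (snd ` K)" "cells_weight K = w"
    using p by (auto simp: premaps_def)
  have pa: "\<alpha> permutes X" using a by (auto simp: pairings_def)
  have inj: "inj f" using f by (rule bij_is_inj)
  have inv: "inv_into UNIV f (f y) = y" for y using inj by simp
  note ii = inj_image_image[OF f]
  let ?c = "\<lambda>p. f \<circ> p \<circ> inv_into UNIV f"
  let ?r = "map_option f \<circ> r" and ?K = "map_prod id (image (image f)) ` K"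
  have tr: "transport f t = (?c \<alpha>, ?c \<phi>, ?r, ?K)" by (simp add: transport_def t')
  have comp: "?c \<phi> \<circ> ?c \<alpha> = ?c (\<phi> \<circ> \<alpha>)" using inv by (auto simp: fun_eq_iff)
  have ran: "ran ?r = f ` ran r" by (auto simp: ran_def)
  have orb_ran: "orbit (?c \<phi>) ` ran ?r = image f ` orbit \<phi> ` ran r"
    unfolding ran image_image orbit_conjugate[OF f] ..
  have D: "\<Union> (orbit (?c \<phi>) ` ran ?r) = f ` \<Union> (orbit \<phi> ` ran r)" unfolding orb_ran by blast
  have r: "orbit (?c \<phi>) (the (?r i)) = f ` orbit \<phi> (the (r i))" if i: "i \<in> S" for i
  proof -
    obtain h where "r i = Some h" using i q(2) by blast
    then show ?thesis using orbit_conjugate[OF f, of \<phi> h] by simp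
  qed
  have injK: "inj_on (map_prod id (image (image f))) K"
    by (rule inj_on_subset[OF map_prod_inj_on[OF inj_on_id[of UNIV] ii]]) auto
  have pairs: "?c \<alpha> \<in> pairings (f ` X)"
    using a permutes_conjugate[OF f pa] inj inv by (auto simp: pairings_def inj_def)
  have fs': "inj_on (orbit (?c \<phi> \<circ> ?c \<alpha>)) (\<Union> (orbit (?c \<phi>) ` ran ?r))"
    unfolding comp D
  proof (rule inj_onI)
    fix x y assume "x \<in> f ` \<Union> (orbit \<phi> ` ran r)" "y \<in> f ` \<Union> (orbit \<phi> ` ran r)"
      and e: "orbit (?c (\<phi> \<circ> \<alpha>)) x = orbit (?c (\<phi> \<circ> \<alpha>)) y"
    then obtain x' y' where xy: "x = f x'" "y = f y'" "x' \<in> \<Union> (orbit \<phi> ` ran r)" "y' \<in> \<Union> (orbit \<phi> ` ran r)"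
      by blast
    then have "f ` orbit (\<phi> \<circ> \<alpha>) x' = f ` orbit (\<phi> \<circ> \<alpha>) y'" using e unfolding xy orbit_conjugate[OF f] by simp
    then have "orbit (\<phi> \<circ> \<alpha>) x' = orbit (\<phi> \<circ> \<alpha>) y'" using inj by (simp add: inj_image_eq_iff)
    then show "x = y" using inj_onD[OF fs] xy by blast
  qed
  have "inj_on (\<lambda>i. orbit (?c \<phi>) (the (?r i))) S"
  proof (rule inj_onI)
    fix i i' assume i: "i \<in> S" "i' \<in> S" "orbit (?c \<phi>) (the (?r i)) = orbit (?c \<phi>) (the (?r i'))"
    then have "orbit \<phi> (the (r i)) = orbit \<phi> (the (r i'))"
      unfolding r[OF i(1)] r[OF i(2)] using inj by (simp add: inj_image_eq_iff)
    then show "i = i'" using inj_onD[OF q(4)] i by blast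
  qed
  moreover have "\<forall>i\<in>S. card (orbit (?c \<phi>) (the (?r i))) = L i"
  proof
    fix i assume i: "i \<in> S"
    show "card (orbit (?c \<phi>) (the (?r i))) = L i"
      unfolding r[OF i] using q(5) i card_image[OF inj_on_subset[OF inj subset_UNIV]] by simp
  qed
  moreover have sndK: "snd ` ?K = image (image f) ` snd ` K" by (simp add: image_image)
  moreover have "inj_on snd ?K"
  proof (rule inj_onI)
    fix k k' assume k: "k \<in> ?K" "k' \<in> ?K" and e: "snd k = snd k'"
    obtain l where l: "k = map_prod id (image (image f)) l" "l \<in> K" using k(1) by (rule imageE)
    obtain l' where l': "k' = map_prod id (image (image f)) l'" "l' \<in> K" using k(2) by (rule imageE)
    have "snd l = snd l'" using e ii l(1) l'(1) by (simp add: inj_eq)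
    then have "l = l'" using inj_onD[OF q(6)] l(2) l'(2) by simp
    then show "k = k'" using l(1) l'(1) by simp
  qed
  moreover have "partition_on (cycles_on (f ` X) (?c \<phi>) - orbit (?c \<phi>) ` ran ?r) (snd ` ?K)"
  proof -
    have "inj (image f)" using inj by (simp add: inj_image_eq_iff inj_def)
    then have "partition_on (image f ` (cycles_on X \<phi> - orbit \<phi> ` ran r)) (image (image f) ` snd ` K - {{}})"
      using q(7) by (intro partition_on_inj_image) (auto intro: inj_on_subset)
    moreover have "image (image f) ` snd ` K - {{}} = image (image f) ` snd ` K"
      using partition_onD3[OF q(7)] by auto
    moreover have "image f ` (cycles_on X \<phi> - orbit \<phi> ` ran r) = cycles_on (f ` X) (?c \<phi>) - orbit (?c \<phi>) ` ran ?r"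
      unfolding cycles_on_conjugate[OF f] orb_ran using \<open>inj (image f)\<close> by (rule image_set_diff)
    ultimately show ?thesis unfolding sndK by simp
  qed
  moreover have "cells_weight ?K = w"
  proof -
    have "image_mset card (mset_set (image f ` F)) = image_mset card (mset_set F)" for F
    proof -
      have "inj_on (image f) F" using inj by (simp add: inj_image_eq_iff inj_on_def)
      then have "mset_set (image f ` F) = image_mset (image f) (mset_set F)" by (simp add: image_mset_mset_set)
      then show ?thesis by (simp add: image_mset.compositionality comp_def card_image[OF inj_on_subset[OF inj]])
    qed
    then show ?thesis
      unfolding cells_weight_def image_mset_mset_set[OF injK, symmetric] q(8)[symmetric]
      by (simp add: image_mset.compositionality comp_def case_prod_unfold)
  qed
  moreover have "dom ?r = S" "ran ?r \<subseteq> f ` X" using q(2,3) ran by (auto simp: dom_def)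
  ultimately show "transport f t \<in> maps (f ` X) L S w"
    using pairs fs' permutes_conjugate[OF f q(1)] by (simp add: tr maps_def premaps_def)
  show "index_factor N (f ` X) L S (fst (transport f t)) (fst (snd (transport f t))) = index_factor N X L S (fst t) (fst (snd t))"
  proof -
    have "card (cycles_on (f ` X) (?c \<phi> \<circ> ?c \<alpha>)) = card (cycles_on X (\<phi> \<circ> \<alpha>))"
      unfolding comp cycles_on_conjugate[OF f] using inj by (intro card_image) (simp add: inj_image_eq_iff inj_on_def)
    moreover have "card (f ` X) = card X" using inj by (intro card_image) (auto intro: inj_on_subset)
    ultimately show ?thesis unfolding index_factor_def tr fst_conv snd_conv by (simp add: t')
  qed
  assume c: "conn X t"
  show "conn (f ` X) (transport f t)"
    unfolding conn_def
  proof (intro conjI allI impI)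
    show "f ` X \<noteq> {}" using c by (simp add: conn_def)
    fix Y' assume Y': "Y' \<subseteq> f ` X" "closed_under (transport f t) Y'"
    then obtain Y where Y: "Y \<subseteq> X" "Y' = f ` Y" by (meson subset_imageE)
    have "closed_under t Y"
      unfolding closed_under_def t' prod.case
    proof (intro conjI ballI)
      fix x assume "x \<in> Y"
      then have "(?c \<alpha>) (f x) \<in> f ` Y" "(?c \<phi>) (f x) \<in> f ` Y"
        using Y'(2) unfolding tr closed_under_def Y(2) by auto
      then show "\<alpha> x \<in> Y" "\<phi> x \<in> Y" using inv inj by (auto dest: injD)
    next
      fix k assume k: "k \<in> K"
      then have "\<Union> (snd (map_prod id (image (image f)) k)) \<subseteq> f ` Y \<or> \<Union> (snd (map_prod id (image (image f)) k)) \<inter> f ` Y = {}"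
        using Y'(2) unfolding tr closed_under_def Y(2) by blast
      then have "f ` \<Union> (snd k) \<subseteq> f ` Y \<or> f ` \<Union> (snd k) \<inter> f ` Y = {}"
        by (simp add: image_Union)
      then show "\<Union> (snd k) \<subseteq> Y \<or> \<Union> (snd k) \<inter> Y = {}"
        using inj by (simp add: inj_image_subset_iff flip: image_Int)
    qed
    then have "Y = {} \<or> Y = X" using c Y(1) by (simp add: conn_def)
    then show "Y' = {} \<or> Y' = f ` X" using Y(2) by blast
  qed
qed

lemma transport_inv:
  assumes "bij f"
  shows "transport (inv_into UNIV f) (transport f t) = t"
proof -
  obtain \<alpha> \<phi> r K where t: "t = (\<alpha>, \<phi>, r, K)" by (cases t)
  have inv: "inv_into UNIV f (f y) = y" for y using assms by (simp add: bij_is_inj)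
  have inv': "inv_into UNIV (inv_into UNIV f) = f" using assms by (rule inv_inv_eq)
  have 1: "inv_into UNIV f \<circ> (f \<circ> p \<circ> inv_into UNIV f) \<circ> inv_into UNIV (inv_into UNIV f) = p" for p unfolding inv' using inv by (auto simp: fun_eq_iff)
  have 2: "map_option (inv_into UNIV f) \<circ> (map_option f \<circ> r) = r" using inv by (auto simp: fun_eq_iff option.map_comp comp_def option.map_ident)
  have 3: "map_prod id (image (image (inv_into UNIV f))) (map_prod id (image (image f)) k) = k" for k :: "nat \<times> 'a set set"
    using inv by (cases k) (simp add: image_image)
  show ?thesis unfolding t transport_def prod.case 1 2 image_image 3 by simp
qed

text \<open>Since \<open>X\<close> and \<open>Y\<close> have equal size, so do \<open>Y - X\<close>
  and \<open>X - Y\<close>; a bijection from the former to the latter completes \<open>g\<close>,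
  with the identity on the remaining points.\<close>

lemma bij_extend:
  assumes "finite X" "finite Y" "card X = card Y" "bij_betw g X Y"
  shows "\<exists>f :: 'a \<Rightarrow> 'a. bij f \<and> (\<forall>x\<in>X. f x = g x)"
proof -
  have "card (Y - X) = card (X - Y)"
    using assms by (simp add: card_Diff_subset_Int Int_commute)
  then obtain g' where g': "bij_betw g' (Y - X) (X - Y)"
    using assms by (metis finite_Diff finite_same_card_bij)
  define f where "f = (\<lambda>x. if x \<in> X then g x else if x \<in> Y then g' x else x)"
  have "bij_betw f X Y" by (rule bij_betw_cong[THEN iffD1, OF _ assms(4)]) (simp add: f_def)
  moreover have "bij_betw f (Y - X) (X - Y)" by (rule bij_betw_cong[THEN iffD1, OF _ g']) (simp add: f_def)
  moreover have "bij_betw f (- (X \<union> Y)) (- (X \<union> Y))"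
    by (rule bij_betw_cong[THEN iffD1, OF _ bij_betw_id]) (auto simp: f_def)
  ultimately have "bij_betw f (X \<union> (Y - X) \<union> - (X \<union> Y)) (Y \<union> (X - Y) \<union> - (X \<union> Y))"
    by (intro bij_betw_combine) auto
  moreover have "X \<union> (Y - X) \<union> - (X \<union> Y) = UNIV" "Y \<union> (X - Y) \<union> - (X \<union> Y) = UNIV" by auto
  ultimately have "bij f" by simp
  then show ?thesis by (intro exI[of _ f]) (simp add: f_def)
qed

section \<open>Labelled maps counted with their power of \<open>N\<close>\<close>

definition map_sum :: "nat \<Rightarrow> 'h set \<Rightarrow> (nat \<Rightarrow> nat) \<Rightarrow> nat set \<Rightarrow> weight multiset \<Rightarrow> complex" where
  "map_sum N H L B w = (\<Sum>t\<in>maps H L B w. (\<Prod>v\<in>#w. cell_factor N v) * index_factor N H L B (fst t) (fst (snd t)))"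

definition conn_sum :: "nat \<Rightarrow> 'h set \<Rightarrow> (nat \<Rightarrow> nat) \<Rightarrow> nat set \<Rightarrow> weight multiset \<Rightarrow> complex" where
  "conn_sum N H L B w = (\<Sum>t\<in>{t \<in> maps H L B w. conn H t}. (\<Prod>v\<in>#w. cell_factor N v) * index_factor N H L B (fst t) (fst (snd t)))"

lemma conn_sum_transport:
  fixes f :: "'h \<Rightarrow> 'h"
  assumes f: "bij f" and X: "finite X"
  shows "conn_sum N (f ` X) L S w = conn_sum N X L S w"
proof -
  have f': "bij (inv_into UNIV f)" using f by (rule bij_imp_bij_inv)
  have fX: "inv_into UNIV f ` f ` X = X" using f by (simp add: image_image bij_is_inj)
  have inv: "transport f (transport (inv_into UNIV f) t) = t" for t :: "'h labelled_map"
    using transport_inv[OF f', of t] f by (simp add: inv_inv_eq)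
  show ?thesis
    unfolding conn_sum_def
  proof (rule sum.reindex_bij_witness[of _ "transport f" "transport (inv_into UNIV f)"])
    fix t assume t: "t \<in> {t \<in> maps (f ` X) L S w. conn (f ` X) t}"
    then show "transport f (transport (inv_into UNIV f) t) = t" by (simp add: inv)
    show "transport (inv_into UNIV f) t \<in> {t \<in> maps X L S w. conn X t}"
      using t transport_maps(1,2)[OF f', of "f ` X" t L S w] X unfolding fX by simp
    show "(\<Prod>v\<in>#w. cell_factor N v) * index_factor N X L S (fst (transport (inv_into UNIV f) t)) (fst (snd (transport (inv_into UNIV f) t)))
      = (\<Prod>v\<in>#w. cell_factor N v) * index_factor N (f ` X) L S (fst t) (fst (snd t))"
      using t transport_maps(3)[OF f', of "f ` X" t L S w N] X unfolding fX by simp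
  next
    fix t assume t: "t \<in> {t \<in> maps X L S w. conn X t}"
    then show "transport (inv_into UNIV f) (transport f t) = t" by (simp add: transport_inv[OF f])
    show "transport f t \<in> {t \<in> maps (f ` X) L S w. conn (f ` X) t}"
      using t transport_maps(1,2)[OF f X, of t L S w] by simp
  qed
qed

text \<open>The weighted count depends on the number of half-edges only. This is why
  \<open>conn_series\<close> may use the single set \<open>{..<map_size L B w}\<close> for each
  monomial.\<close>

lemma conn_sum_card:
  fixes X :: "nat set"
  assumes "finite X"
  shows "conn_sum N X L S w = conn_sum N {..<card X} L S w"
proof -
  obtain g where g: "bij_betw g X {..<card X}"
    using assms by (metis ex_bij_betw_finite_nat atLeast0LessThan)
  obtain f :: "nat \<Rightarrow> nat" where f: "bij f" "\<forall>x\<in>X. f x = g x"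
    using bij_extend[OF assms _ _ g] by auto
  have "f ` X = {..<card X}" using f(2) g by (simp add: bij_betw_def cong: image_cong)
  then show ?thesis using conn_sum_transport[OF f(1) assms] by metis
qed

text \<open>The cut at the component of \<open>b\<close>; both factors of the weight, that of the
  cells and that of the indices, are multiplicative under it.\<close>

lemma map_sum_decomposition:
  fixes H :: "'h set"
  assumes "finite H" "finite B" "b \<in> B" "N > 0"
  shows "map_sum N H L B w = (\<Sum>X\<in>Pow H. \<Sum>S | b \<in> S \<and> S \<subseteq> B. \<Sum>(w1, w2) | w1 + w2 = w.
    conn_sum N X L S w1 * map_sum N (H - X) L (B - S) w2)"
proof -
  have "(\<Sum>t1\<in>{t \<in> maps X L S w1. conn X t}. \<Sum>t2\<in>maps (H - X) L (B - S) w2.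
      (\<Prod>v\<in>#w. cell_factor N v) * index_factor N H L B (fst (join_maps t1 t2)) (fst (snd (join_maps t1 t2))))
    = conn_sum N X L S w1 * map_sum N (H - X) L (B - S) w2"
    if XS: "X \<subseteq> H" "S \<subseteq> B" and w: "w1 + w2 = w" for X S w1 w2
  proof -
    have u: "X \<union> (H - X) = H" "S \<union> (B - S) = B" "X \<inter> (H - X) = {}" "S \<inter> (B - S) = {}" using XS by auto
    have fin: "finite X" "finite (H - X)" "finite S" "finite (B - S)"
      using XS assms by (auto intro: finite_subset)
    show ?thesis
      unfolding conn_sum_def map_sum_def sum_product
    proof (intro sum.cong refl)
      fix t1 t2 assume t: "t1 \<in> {t \<in> maps X L S w1. conn X t}" "t2 \<in> maps (H - X) L (B - S) w2"
      have "index_factor N H L B (fst (join_maps t1 t2)) (fst (snd (join_maps t1 t2)))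
         = index_factor N X L S (fst t1) (fst (snd t1)) * index_factor N (H - X) L (B - S) (fst t2) (fst (snd t2))"
        using join_maps(5)[OF fin(1,2) u(3,4) fin(3,4), of t1 L w1 t2 w2 N] t assms(4) unfolding u by simp
      then show "(\<Prod>v\<in>#w. cell_factor N v) * index_factor N H L B (fst (join_maps t1 t2)) (fst (snd (join_maps t1 t2)))
        = (\<Prod>v\<in>#w1. cell_factor N v) * index_factor N X L S (fst t1) (fst (snd t1)) *
          ((\<Prod>v\<in>#w2. cell_factor N v) * index_factor N (H - X) L (B - S) (fst t2) (fst (snd t2)))"
        by (simp add: mult_ac flip: w)
    qed
  qed
  then show ?thesis
    unfolding map_sum_def[of N H] sum_maps_component[OF assms(1-3)] by (intro sum.cong refl) auto
qed

lemma conn_sum_eq_0: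
  assumes "finite H" "finite B" "card H \<noteq> map_size L B w"
  shows "conn_sum N H L B w = 0"
proof -
  have "maps H L B w = {}" using premaps_card[OF assms(1,2)] assms(3) unfolding maps_def by blast
  then show ?thesis by (simp add: conn_sum_def)
qed

text \<open>The exponential generating series, in the half-edges, of connected labelled maps with
  weights from \<open>T\<close>.\<close>

definition conn_series :: "weight set \<Rightarrow> nat \<Rightarrow> (nat \<Rightarrow> nat) \<Rightarrow> nat set \<Rightarrow> weight mseries" where
  "conn_series T N L B = MSeries (\<lambda>w. if set_mset w \<subseteq> T
     then conn_sum N {..<map_size L B w} L B w / fact (map_size L B w) else 0)"

lemma map_size_split:
  assumes "finite B" "S \<subseteq> B"
  shows "map_size L B (w1 + w2) = map_size L S w1 + map_size L (B - S) w2"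
  using sum.subset_diff[OF assms(2,1), of L] by (simp add: map_size_def)

section \<open>The recursion for expectations and the cumulants\<close>

context
  fixes N :: nat and \<gamma>s :: "nat list list" and L :: "nat \<Rightarrow> nat" and T :: "weight set"
  assumes N: "N > 0"
    and L: "\<And>i. i < length \<gamma>s \<Longrightarrow> L i = length (\<gamma>s ! i)"
    and \<gamma>s: "\<And>\<gamma>. \<gamma> \<in> set \<gamma>s \<Longrightarrow> cycle \<gamma> \<and> length \<gamma> \<ge> 1 \<and> set \<gamma> \<subseteq> {..<N}"
    and disj: "\<And>i j. i < length \<gamma>s \<Longrightarrow> j < length \<gamma>s \<Longrightarrow> i \<noteq> j \<Longrightarrow> set (\<gamma>s ! i) \<inter> set (\<gamma>s ! j) = {}"
    and T: "T \<subseteq> stuffed_weights"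
begin

abbreviation (input) "cycle_products B \<equiv> (\<lambda>M. \<Prod>i\<in>B. cycle_product (\<gamma>s ! i) M)"

lemma map_sum_eq_integral:
  assumes "finite H" "B \<subseteq> {..<length \<gamma>s}" "set_mset w \<subseteq> T" "card H = map_size L B w"
  shows "map_sum N H L B w = fact (card H) * coeff (formal_integral T N (cycle_products B)) w"
  using coeff_formal_integral[OF N L \<gamma>s disj assms(1,2,3) T assms(4)]
  by (simp add: map_sum_def case_prod_unfold)

lemma coeff_formal_integral_eq_0:
  "\<not> set_mset w \<subseteq> T \<Longrightarrow> coeff (formal_integral T N f) w = 0"
  by (simp add: formal_integral_def coeff_mexp_potential_eq_0 gauss_expectation_def)

text \<open>A product of exponential generating series. The half-edges of the component of
  \<open>b\<close> form a subset of prescribed size, and the binomial coefficient counting these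
  subsets combines with both factorials to \<open>d!\<close>. Components without boundary stay in
  the second factor.\<close>

lemma formal_integral_recursion:
  assumes B: "B \<subseteq> {..<length \<gamma>s}" and b: "b \<in> B"
  shows "formal_integral T N (cycle_products B) =
    (\<Sum>S | b \<in> S \<and> S \<subseteq> B. conn_series T N L S * formal_integral T N (cycle_products (B - S)))"
proof (rule mseries_eqI)
  fix w
  have finB: "finite B" using B finite_subset by blast
  let ?I = "\<lambda>B w. coeff (formal_integral T N (cycle_products B)) w"
  let ?C = "\<lambda>S w. coeff (conn_series T N L S) w"
  have rhs: "coeff (\<Sum>S | b \<in> S \<and> S \<subseteq> B. conn_series T N L S * formal_integral T N (cycle_products (B - S))) w
    = (\<Sum>S | b \<in> S \<and> S \<subseteq> B. \<Sum>(w1, w2) | w1 + w2 = w. ?C S w1 * ?I (B - S) w2)"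
    by (simp add: coeff_sum coeff_mult)
  show "?I B w = coeff (\<Sum>S | b \<in> S \<and> S \<subseteq> B. conn_series T N L S * formal_integral T N (cycle_products (B - S))) w"
  proof (cases "set_mset w \<subseteq> T")
    case False
    have "?C S w1 * ?I (B - S) w2 = 0" if "w1 + w2 = w" for S w1 w2
    proof -
      have "\<not> set_mset w1 \<subseteq> T \<or> \<not> set_mset w2 \<subseteq> T" using that False by auto
      then show ?thesis using coeff_formal_integral_eq_0 by (auto simp: conn_series_def)
    qed
    then have "(\<Sum>S | b \<in> S \<and> S \<subseteq> B. \<Sum>(w1, w2) | w1 + w2 = w. ?C S w1 * ?I (B - S) w2) = 0"
      by (auto intro!: sum.neutral)
    then show ?thesis unfolding rhs using coeff_formal_integral_eq_0[OF False] by simp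
  next
    case True
    define d where "d = map_size L B w"
    define H where "H = {..<d}"
    have H: "finite H" "card H = d" by (simp_all add: H_def)
    have "fact d * ?I B w = map_sum N H L B w"
      using map_sum_eq_integral[OF H(1) B True] H(2) by (simp add: d_def)
    also have "\<dots> = (\<Sum>X\<in>Pow H. \<Sum>S | b \<in> S \<and> S \<subseteq> B. \<Sum>(w1, w2) | w1 + w2 = w.
        conn_sum N X L S w1 * map_sum N (H - X) L (B - S) w2)"
      by (rule map_sum_decomposition[OF H(1) finB b N])
    also have "\<dots> = (\<Sum>S | b \<in> S \<and> S \<subseteq> B. \<Sum>X\<in>Pow H. \<Sum>(w1, w2) | w1 + w2 = w.
        conn_sum N X L S w1 * map_sum N (H - X) L (B - S) w2)" by (rule sum.swap)
    also have "\<dots> = (\<Sum>S | b \<in> S \<and> S \<subseteq> B. \<Sum>ww\<in>{(w1, w2). w1 + w2 = w}. \<Sum>X\<in>Pow H.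
        conn_sum N X L S (fst ww) * map_sum N (H - X) L (B - S) (snd ww))"
      unfolding case_prod_unfold by (intro sum.cong refl sum.swap)
    also have "\<dots> = (\<Sum>S | b \<in> S \<and> S \<subseteq> B. \<Sum>ww\<in>{(w1, w2). w1 + w2 = w}. fact d * (?C S (fst ww) * ?I (B - S) (snd ww)))"
    proof (intro sum.cong refl)
      fix S ww assume S: "S \<in> {S. b \<in> S \<and> S \<subseteq> B}" and "ww \<in> {(w1, w2). w1 + w2 = w}"
      then obtain w1 w2 where ww: "ww = (w1, w2)" "w1 + w2 = w" by auto
      have w12: "set_mset w1 \<subseteq> T" "set_mset w2 \<subseteq> T" using True unfolding ww(2)[symmetric] by auto
      have finS: "finite S" and BS: "B - S \<subseteq> {..<length \<gamma>s}" using S B finB by (auto intro: finite_subset)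
      define d1 where "d1 = map_size L S w1"
      define d2 where "d2 = map_size L (B - S) w2"
      have d: "d = d1 + d2" using map_size_split[OF finB, of S L w1 w2] S by (simp add: d_def d1_def d2_def ww(2))
      \<comment> \<open>The labels \<open>S\<close> and the monomial \<open>w1\<close> determine the
        number of half-edges in the component, so only sets \<open>X\<close> of size
        \<open>d1\<close> contribute.\<close>
      have "conn_sum N X L S w1 * map_sum N (H - X) L (B - S) w2
        = (if card X = d1 then fact d1 * ?C S w1 * (fact d2 * ?I (B - S) w2) else 0)" if X: "X \<in> Pow H" for X
      proof (cases "card X = d1")
        case True
        have finX: "finite X" using X H(1) by (auto intro: finite_subset)
        have "conn_sum N X L S w1 = fact d1 * ?C S w1"
          using conn_sum_card[OF finX] True w12 by (simp add: conn_series_def d1_def)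
        moreover have cH: "card (H - X) = d2" using X H True d finX by (simp add: card_Diff_subset)
        moreover have "map_sum N (H - X) L (B - S) w2 = fact d2 * ?I (B - S) w2"
          using map_sum_eq_integral[of "H - X", OF _ BS w12(2)] H(1) cH by (simp add: d2_def)
        ultimately show ?thesis using True by simp
      next
        case False
        have "finite X" using X H(1) by (auto intro: finite_subset)
        then have "conn_sum N X L S w1 = 0" using finS False by (intro conn_sum_eq_0) (simp_all add: d1_def)
        then show ?thesis using False by simp
      qed
      then have "(\<Sum>X\<in>Pow H. conn_sum N X L S w1 * map_sum N (H - X) L (B - S) w2)
        = (\<Sum>X\<in>Pow H. if card X = d1 then fact d1 * ?C S w1 * (fact d2 * ?I (B - S) w2) else 0)"
        by (intro sum.cong) auto
      also have "\<dots> = of_nat (card {X. X \<subseteq> H \<and> card X = d1}) * (fact d1 * ?C S w1 * (fact d2 * ?I (B - S) w2))"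
        using H(1) by (simp add: sum.If_cases Int_def)
      also have "card {X. X \<subseteq> H \<and> card X = d1} = d choose d1" using n_subsets[OF H(1)] H(2) by simp
      also have "of_nat (d choose d1) * (fact d1 * ?C S w1 * (fact d2 * ?I (B - S) w2)) = fact d * (?C S w1 * ?I (B - S) w2)"
      proof -
        have "fact d1 * fact d2 * (d choose d1) = (fact d :: nat)"
          using binomial_fact_lemma[of d1 d] d by simp
        then have "fact d1 * fact d2 * of_nat (d choose d1) = (fact d :: complex)"
          by (metis of_nat_fact of_nat_mult)
        then show ?thesis by (simp add: mult_ac flip: \<open>_ = (fact d :: complex)\<close>)
      qed
      finally show "(\<Sum>X\<in>Pow H. conn_sum N X L S (fst ww) * map_sum N (H - X) L (B - S) (snd ww))
        = fact d * (?C S (fst ww) * ?I (B - S) (snd ww))" by (simp add: ww(1))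
    qed
    also have "\<dots> = fact d * (\<Sum>S | b \<in> S \<and> S \<subseteq> B. \<Sum>(w1, w2) | w1 + w2 = w. ?C S w1 * ?I (B - S) w2)"
      by (simp add: sum_distrib_left case_prod_unfold)
    finally show ?thesis unfolding rhs by simp
  qed
qed

text \<open>The constant coefficient 1 makes \<open>minverse\<close> a genuine inverse of the
  partition function.\<close>

lemma coeff_formal_integral_one: "coeff (formal_integral T N (\<lambda>_. 1)) {#} = 1"
proof -
  have "coeff (formal_integral T N (\<lambda>_. 1)) {#} = gauss_expectation N (\<lambda>M. \<Sum>i\<in>{()}. 1 * (\<Prod>h\<in>({} :: nat set). M $$ (h, h)))"
    by (simp add: formal_integral_def coeff_mexp_potential weight_factor_def sym_factor_def)
  also have "\<dots> = 1" by (subst gauss_expectation_wick[OF N]) auto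
  finally show ?thesis .
qed

text \<open>The recursion is linear in the integrals and survives division by the partition
  function. The connected series therefore satisfy the recursion that characterizes the cumulants of
  the normalized expectations.\<close>

lemma joint_cumulant_eq_conn_series:
  assumes "\<gamma>s \<noteq> []"
  shows "joint_cumulant (formal_expectation T N) (map cycle_product \<gamma>s) = conn_series T N L {..<length \<gamma>s}"
proof -
  let ?U = "{..<length \<gamma>s}"
  let ?Z = "formal_integral T N (\<lambda>_. 1)"
  define e where "e = (\<lambda>B. formal_expectation T N (\<lambda>M. \<Prod>i\<in>B. (map cycle_product \<gamma>s ! i) M))"
  have e: "e B = formal_integral T N (cycle_products B) * minverse ?Z" if "B \<subseteq> ?U" for B
  proof -
    have "(\<lambda>M. \<Prod>i\<in>B. (map cycle_product \<gamma>s ! i) M) = cycle_products B"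
      using that by (intro ext prod.cong) auto
    then show ?thesis by (simp add: e_def formal_expectation_def)
  qed
  \<comment> \<open>The empty product integrates to the partition function itself.\<close>
  have e0: "e {} = 1" using e[of "{}"] minverse_right[OF coeff_formal_integral_one] by simp
  have "conn_series T N L ?U = set_cumulant e ?U"
  proof (rule set_cumulant_unique[where U = ?U])
    fix B assume B: "B \<subseteq> ?U" "B \<noteq> {}"
    then obtain b where b: "b \<in> B" by blast
    have "(\<Sum>S | b \<in> S \<and> S \<subseteq> B. conn_series T N L S * e (B - S))
      = (\<Sum>S | b \<in> S \<and> S \<subseteq> B. conn_series T N L S * formal_integral T N (cycle_products (B - S))) * minverse ?Z"
      unfolding sum_distrib_right
    proof (rule sum.cong[OF refl])
      fix S
      have "B - S \<subseteq> ?U" using B(1) by blast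
      from e[OF this] show "conn_series T N L S * e (B - S)
        = conn_series T N L S * formal_integral T N (cycle_products (B - S)) * minverse ?Z"
        by (simp only: mult.assoc)
    qed
    also have "\<dots> = e B" unfolding formal_integral_recursion[OF B(1) b, symmetric] using e[OF B(1)] by simp
    finally show "\<exists>b\<in>B. (\<Sum>S | b \<in> S \<and> S \<subseteq> B. conn_series T N L S * e (B - S)) = e B" using b by blast
  qed (use e0 assms in auto)
  then show ?thesis unfolding joint_cumulant_eq_set_cumulant e_def by simp
qed

end

section \<open>Stuffed maps as labelled maps\<close>

definition rooting :: "'h list \<Rightarrow> nat \<rightharpoonup> 'h" where
  "rooting rs = (\<lambda>i. if i < length rs then Some (rs ! i) else None)"

lemma dom_rooting: "dom (rooting rs) = {..<length rs}"
  by (auto simp: rooting_def split: if_splits)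

lemma ran_rooting: "ran (rooting rs) = set rs"
  by (fastforce simp: rooting_def ran_def in_set_conv_nth split: if_splits)

text \<open>Since \<open>\<sigma> \<circ> \<alpha> \<circ> \<phi> = id\<close>, using the inverse of the face permutation makes the vertex
  permutation the composition \<open>\<phi>\<inverse> \<circ> \<alpha>\<close>; the cycles are the same.\<close>

definition to_labelled :: "'h stuffed_map \<Rightarrow> 'h labelled_map" where
  "to_labelled S = (edge_perm S, inv_into UNIV (face_perm S), rooting (roots S), (\<lambda>f. (cell_genus S f, f)) ` cells S)"

definition weight_euler :: "weight multiset \<Rightarrow> int" where
  "weight_euler w = (\<Sum>v\<in>#w. 2 - 2 * int (fst v) - int (size (snd v)))"

text \<open>\<open>euler_char\<close> in terms of the encoding: edges are half the half-edges,
  \<open>n\<close> counts the boundaries, and the cells enter through the monomial.\<close>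

definition labelled_euler :: "'h set \<Rightarrow> nat \<Rightarrow> 'h labelled_map \<Rightarrow> weight multiset \<Rightarrow> int" where
  "labelled_euler H n t w =
     int (card (cycles_on H (fst (snd t) \<circ> fst t))) - int (card H div 2) + int n + weight_euler w"

definition connected_maps :: "'h set \<Rightarrow> nat list \<Rightarrow> weight multiset \<Rightarrow> nat \<Rightarrow> 'h labelled_map set" where
  "connected_maps H Ls w g = {t \<in> maps H (\<lambda>i. Ls ! i) {..<length Ls} w.
     conn H t \<and> 2 - 2 * int g = labelled_euler H (length Ls) t w}"

lemma permutes_inv_compose:
  assumes "\<alpha> \<in> pairings H" "\<phi> permutes H"
  shows "inv_into UNIV \<phi> \<circ> \<alpha> permutes H" "inv_into UNIV \<phi> \<circ> \<alpha> \<circ> \<alpha> \<circ> \<phi> = id" "\<And>x. \<alpha> (\<alpha> x) = x"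
proof -
  show a: "\<alpha> (\<alpha> x) = x" for x
    using assms(1) unfolding pairings_def by (cases "x \<in> H") (auto simp: permutes_not_in)
  show "inv_into UNIV \<phi> \<circ> \<alpha> permutes H"
    using assms by (intro permutes_compose permutes_inv) (auto simp: pairings_def)
  show "inv_into UNIV \<phi> \<circ> \<alpha> \<circ> \<alpha> \<circ> \<phi> = id"
    using a permutes_inverses[OF assms(2)] by (simp add: fun_eq_iff)
qed

lemma card_cycles_pairing:
  assumes "finite H" "\<alpha> \<in> pairings H"
  shows "card (cycles_on H \<alpha>) = card H div 2"
proof -
  have \<alpha>: "\<alpha> permutes H" "\<And>x. x \<in> H \<Longrightarrow> \<alpha> x \<noteq> x \<and> \<alpha> (\<alpha> x) = x" using assms(2) by (auto simp: pairings_def)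
  have "card c = 2" if c: "c \<in> cycles_on H \<alpha>" for c
  proof -
    obtain x where x: "x \<in> H" "c = orbit \<alpha> x" using c by (auto simp: cycles_on_def)
    have "orbit \<alpha> x \<subseteq> {x, \<alpha> x}" by (rule orbit_subset_closed) (use \<alpha>(2)[OF x(1)] in auto)
    moreover have "x \<in> orbit \<alpha> x" "\<alpha> x \<in> orbit \<alpha> x"
      using permutation_self_in_orbit[OF permutes_permutation[OF \<alpha>(1) assms(1)]] orbit.base by metis+
    ultimately have "c = {x, \<alpha> x}" using x(2) by blast
    then show ?thesis using \<alpha>(2)[OF x(1)] by (auto simp: card_insert_if)
  qed
  moreover have part: "partition_on H (cycles_on H \<alpha>)" by (rule partition_on_cycles[OF \<alpha>(1) assms(1)])
  moreover have "finite c" if "c \<in> cycles_on H \<alpha>" for c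
    using that partition_onD1[OF part] assms(1) by (metis Union_upper finite_subset)
  ultimately have "card H = card (cycles_on H \<alpha>) * 2"
    using product_partition[OF part] by simp
  then show ?thesis by simp
qed

text \<open>As \<open>\<alpha>\<close> is an involution, closure under \<open>\<alpha>\<close> and
  the inverse face permutation \<open>\<psi>\<close> is closure under \<open>\<alpha>\<close> and
  \<open>\<sigma> = \<psi> \<circ> \<alpha>\<close>. A closed set is a union of classes of the
  generated relation, and the class of a point is closed.\<close>

lemma connected_map_iff:
  assumes S: "finite (half_edges S)" "edge_perm S \<in> pairings (half_edges S)" "face_perm S permutes half_edges S"
      "vertex_perm S = inv_into UNIV (face_perm S) \<circ> edge_perm S"
    and cells: "\<And>f. f \<in> cells S \<Longrightarrow> \<Union> f \<subseteq> half_edges S"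
  shows "connected_map S \<longleftrightarrow> conn (half_edges S) (to_labelled S)"
proof -
  define H where "H = half_edges S"
  define \<alpha> where "\<alpha> = edge_perm S"
  define \<sigma> where "\<sigma> = vertex_perm S"
  define \<psi> where "\<psi> = inv_into UNIV (face_perm S)"
  define R where "R = (\<lambda>u v. u \<in> H \<and> (v = \<sigma> u \<or> v = \<alpha> u \<or> (\<exists>f \<in> cells S. u \<in> \<Union> f \<and> v \<in> \<Union> f)))"
  have \<sigma>: "\<sigma> = \<psi> \<circ> \<alpha>" using S(4) by (simp add: \<sigma>_def \<psi>_def \<alpha>_def)
  have \<alpha>: "\<alpha> permutes H" "\<And>x. \<alpha> (\<alpha> x) = x"
    using S(2) permutes_inv_compose(3)[OF S(2,3)] by (auto simp: \<alpha>_def H_def pairings_def)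
  have \<sigma>p: "\<sigma> permutes H" using S permutes_inv_compose(1) unfolding \<sigma>_def H_def by metis
  have \<psi>: "\<psi> x = \<sigma> (\<alpha> x)" for x using \<alpha>(2) by (simp add: \<sigma>)
  have closed: "closed_under (to_labelled S) X \<longleftrightarrow>
    (\<forall>x\<in>X. \<alpha> x \<in> X \<and> \<sigma> x \<in> X) \<and> (\<forall>f\<in>cells S. \<Union> f \<subseteq> X \<or> \<Union> f \<inter> X = {})" for X
  proof -
    have "(\<forall>x\<in>X. \<alpha> x \<in> X \<and> \<psi> x \<in> X) \<longleftrightarrow> (\<forall>x\<in>X. \<alpha> x \<in> X \<and> \<sigma> x \<in> X)"
    proof (intro iffI ballI)
      fix x assume "\<forall>x\<in>X. \<alpha> x \<in> X \<and> \<psi> x \<in> X" "x \<in> X"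
      then show "\<alpha> x \<in> X \<and> \<sigma> x \<in> X" unfolding \<sigma> by simp
    next
      fix x assume "\<forall>x\<in>X. \<alpha> x \<in> X \<and> \<sigma> x \<in> X" "x \<in> X"
      then have "\<alpha> x \<in> X" "\<sigma> (\<alpha> x) \<in> X" by blast+
      then show "\<alpha> x \<in> X \<and> \<psi> x \<in> X" unfolding \<psi> by blast
    qed
    then show ?thesis
      unfolding closed_under_def to_labelled_def \<alpha>_def[symmetric] \<psi>_def[symmetric] by simp
  qed
  have conn: "connected_map S \<longleftrightarrow> H \<noteq> {} \<and> (\<forall>x\<in>H. \<forall>y\<in>H. equivclp R x y)"
    unfolding connected_map_def R_def H_def \<sigma>_def \<alpha>_def ..
  show ?thesis
    unfolding conn conn_def H_def[symmetric] closed
  proof (intro iffI conjI allI impI ballI; (elim conjE)?)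
    fix X assume a: "\<forall>x\<in>H. \<forall>y\<in>H. equivclp R x y" and X: "X \<subseteq> H" "\<forall>x\<in>X. \<alpha> x \<in> X \<and> \<sigma> x \<in> X"
      "\<forall>f\<in>cells S. \<Union> f \<subseteq> X \<or> \<Union> f \<inter> X = {}"
    have finX: "finite X" using X(1) S(1) finite_subset unfolding H_def by blast
    have "\<sigma> ` X = X" "\<alpha> ` X = X"
      using X(2) by (intro endo_inj_surj[OF finX] permutes_inj_on[OF \<sigma>p] permutes_inj_on[OF \<alpha>(1)]; blast)+
    then have st: "\<sigma> u \<in> X \<longleftrightarrow> u \<in> X" "\<alpha> u \<in> X \<longleftrightarrow> u \<in> X" for u
      using inj_image_mem_iff[OF permutes_inj[OF \<sigma>p], of u X] inj_image_mem_iff[OF permutes_inj[OF \<alpha>(1)], of u X] by simp_all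
    have R: "R u v \<Longrightarrow> u \<in> X \<longleftrightarrow> v \<in> X" for u v
    proof -
      assume "R u v"
      then consider "v = \<sigma> u" | "v = \<alpha> u" | f where "f \<in> cells S" "u \<in> \<Union> f" "v \<in> \<Union> f" unfolding R_def by blast
      then show ?thesis
      proof cases
        case 3
        then have "\<Union> f \<subseteq> X \<or> \<Union> f \<inter> X = {}" using X(3) by blast
        then show ?thesis using 3(2,3) by blast
      qed (simp_all add: st)
    qed
    have eq: "u \<in> X \<longleftrightarrow> v \<in> X" if "equivclp R u v" for u v
      using that by (induction rule: equivclp_induct) (use R in blast)+
    show "X = {} \<or> X = H"
    proof (cases "X = {}")
      case False
      then obtain x where "x \<in> X" by blast
      have "H \<subseteq> X"
      proof
        fix y assume "y \<in> H"
        then have "equivclp R x y" using a X(1) \<open>x \<in> X\<close> by blast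
        then show "y \<in> X" using eq \<open>x \<in> X\<close> by blast
      qed
      then show ?thesis using X(1) by blast
    qed simp
  next
    fix x y assume a: "\<forall>X\<subseteq>H. (\<forall>x\<in>X. \<alpha> x \<in> X \<and> \<sigma> x \<in> X) \<and> (\<forall>f\<in>cells S. \<Union> f \<subseteq> X \<or> \<Union> f \<inter> X = {}) \<longrightarrow> X = {} \<or> X = H"
      and xy: "x \<in> H" "y \<in> H"
    \<comment> \<open>The class of \<open>x\<close>, a nonempty closed set and therefore all of
      \<open>H\<close>.\<close>
    define X where "X = {z \<in> H. equivclp R x z}"
    have step: "v \<in> X" if "u \<in> X" "R u v" "v \<in> H" for u v
      using that equivclp_into_equivclp[of R x u v] unfolding X_def by blast
    have "X \<subseteq> H" by (auto simp: X_def)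
    moreover have "\<forall>u\<in>X. \<alpha> u \<in> X \<and> \<sigma> u \<in> X"
    proof
      fix u assume u: "u \<in> X"
      then have "R u (\<alpha> u)" "R u (\<sigma> u)" "\<alpha> u \<in> H" "\<sigma> u \<in> H"
        using subsetD[OF \<open>X \<subseteq> H\<close> u] permutes_in_image[OF \<sigma>p] permutes_in_image[OF \<alpha>(1)] by (simp_all add: R_def)
      then show "\<alpha> u \<in> X \<and> \<sigma> u \<in> X" using step u by blast
    qed
    moreover have "\<forall>f\<in>cells S. \<Union> f \<subseteq> X \<or> \<Union> f \<inter> X = {}"
    proof
      fix f assume f: "f \<in> cells S"
      have "\<Union> f \<subseteq> X" if "u \<in> \<Union> f" "u \<in> X" for u
      proof
        fix v assume v: "v \<in> \<Union> f"
        have "R u v" unfolding R_def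
          using that(1) v f subsetD[OF \<open>X \<subseteq> H\<close> that(2)] by (intro conjI disjI2 bexI[of _ f])

        moreover have "v \<in> H" using v cells[OF f] unfolding H_def by blast
        ultimately show "v \<in> X" by (rule step[OF that(2)])
      qed
      then show "\<Union> f \<subseteq> X \<or> \<Union> f \<inter> X = {}" by blast
    qed
    moreover have "x \<in> X" using xy by (simp add: X_def)
    ultimately have "X = {} \<or> X = H" using a[THEN spec, of X] by simp
    then have "X = H" using \<open>x \<in> X\<close> by blast
    then show "equivclp R x y" using xy unfolding X_def by blast
  qed assumption+
qed

text \<open>The premises on \<open>S\<close> concern the half-edges and permutations alone, so the
  lemma also recognizes as stuffed maps the records built from labelled maps. A permutation and its
  inverse have the same cycles as sets, hence the same boundaries and cells.\<close>

lemma fully_simple_maps_iff: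
  assumes S: "finite (half_edges S)" "edge_perm S \<in> pairings (half_edges S)" "face_perm S permutes half_edges S"
      "vertex_perm S = inv_into UNIV (face_perm S) \<circ> edge_perm S"
    and Ls: "Ls \<noteq> []"
  shows "S \<in> fully_simple_maps g Ls \<and> map_monomial S = w \<longleftrightarrow> to_labelled S \<in> connected_maps (half_edges S) Ls w g"
proof -
  define H where "H = half_edges S"
  define rs where "rs = roots S"
  define K where "K = (\<lambda>f. (cell_genus S f, f)) ` cells S"
  let ?\<phi> = "face_perm S"
  have \<phi>: "permutation ?\<phi>" using permutes_permutation[OF S(3,1)] .
  have orb: "orbit (inv_into UNIV ?\<phi>) = orbit ?\<phi>" using orbit_inv_eq[OF \<phi>] by (rule ext)
  have bd: "orbit ?\<phi> ` ran (rooting rs) = set (boundaries S)"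
    by (simp add: ran_rooting boundaries_def rs_def)
  have bD: "\<Union> (orbit ?\<phi> ` ran (rooting rs)) = boundary_half_edges S"
    by (simp only: bd boundary_half_edges_def)
  have dist: "distinct (boundaries S) \<longleftrightarrow> inj_on (\<lambda>i. orbit ?\<phi> (the (rooting rs i))) {..<length rs}"
    by (auto simp: boundaries_def distinct_conv_nth inj_on_def rooting_def rs_def)
  have len: "map card (boundaries S) = Ls \<longleftrightarrow> length rs = length Ls \<and>
      (\<forall>i\<in>{..<length Ls}. card (orbit ?\<phi> (the (rooting rs i))) = Ls ! i)"
    by (auto simp: boundaries_def list_eq_iff_nth_eq rooting_def rs_def)
  have sndK: "snd ` K = cells S" by (force simp: K_def)
  have injK: "inj_on snd K" by (auto simp: K_def inj_on_def)
  have Kw: "cells_weight K = map_monomial S"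
  proof -
    have "inj_on (\<lambda>f. (cell_genus S f, f)) (cells S)" by (auto simp: inj_on_def)
    then show ?thesis
      by (simp add: cells_weight_def map_monomial_def K_def image_mset.compositionality comp_def flip: image_mset_mset_set)
  qed
  have stuffed: "is_stuffed_map S \<longleftrightarrow> rs \<noteq> [] \<and> set rs \<subseteq> H \<and> distinct (boundaries S) \<and>
      partition_on (cycles_on H ?\<phi> - set (boundaries S)) (cells S)"
    using S permutes_inv_compose[OF S(2,3)] unfolding is_stuffed_map_def H_def rs_def pairings_def by auto
  have cyc: "cycles_on H (inv_into UNIV ?\<phi>) = cycles_on H ?\<phi>" by (simp add: cycles_on_def orb)
  have maps: "to_labelled S \<in> maps H (\<lambda>i. Ls ! i) {..<length Ls} w \<longleftrightarrow>
      is_stuffed_map S \<and> fully_simple S \<and> map card (boundaries S) = Ls \<and> map_monomial S = w"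
  proof -
    have "inv_into UNIV ?\<phi> permutes H" using permutes_inv[OF S(3)] by (simp add: H_def)
    then have m: "to_labelled S \<in> maps H (\<lambda>i. Ls ! i) {..<length Ls} w \<longleftrightarrow>
        length rs = length Ls \<and> set rs \<subseteq> H \<and> inj_on (\<lambda>i. orbit ?\<phi> (the (rooting rs i))) {..<length Ls} \<and>
        (\<forall>i\<in>{..<length Ls}. card (orbit ?\<phi> (the (rooting rs i))) = Ls ! i) \<and>
        partition_on (cycles_on H ?\<phi> - set (boundaries S)) (cells S) \<and> map_monomial S = w \<and> fully_simple S"
      using S(2) injK unfolding to_labelled_def maps_def premaps_def mem_Collect_eq prod.case dom_rooting rs_def[symmetric]
        K_def[symmetric] fully_simple_def S(4) orb cyc ran_rooting bd[unfolded ran_rooting] sndK Kw H_def[symmetric] lessThan_eq_iff boundary_half_edges_def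
      by simp
    show ?thesis
    proof (cases "length rs = length Ls")
      case True
      then have "rs \<noteq> []" using Ls by auto
      then show ?thesis unfolding m stuffed len dist using True by auto
    qed (use m len in blast)
  qed
  show ?thesis
  proof (cases "is_stuffed_map S \<and> map_monomial S = w \<and> length rs = length Ls")
    case False
    then show ?thesis using maps len
      unfolding connected_maps_def fully_simple_maps_def mem_Collect_eq H_def by blast
  next
    case True
    have part: "partition_on (cycles_on H ?\<phi> - set (boundaries S)) (cells S)" using True stuffed by blast
    have "\<Union> f \<subseteq> H" if "f \<in> cells S" for f
    proof -
      have "f \<subseteq> cycles_on H ?\<phi>" using that part unfolding partition_on_def by blast
      then show ?thesis using partition_on_cycles[OF S(3,1)] unfolding partition_on_def H_def by blast
    qed
    then have conn: "connected_map S \<longleftrightarrow> conn H (to_labelled S)"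
      using connected_map_iff[OF S] unfolding H_def by blast
    have "(\<Sum>f\<in>cells S. 2 - 2 * int (cell_genus S f) - int (card f)) = weight_euler w"
    proof -
      have "weight_euler (map_monomial S) = (\<Sum>f\<in>cells S. 2 - 2 * int (cell_genus S f) - int (card f))"
        by (simp add: weight_euler_def map_monomial_def image_mset.compositionality comp_def sum_unfold_sum_mset)
      then show ?thesis using True by simp
    qed
    then have eul: "euler_char S = labelled_euler H (length Ls) (to_labelled S) w"
      using True card_cycles_pairing[OF S(1,2)]
      unfolding euler_char_def labelled_euler_def H_def[symmetric] rs_def[symmetric] to_labelled_def fst_conv snd_conv S(4)
      by simp
    show ?thesis
      unfolding connected_maps_def fully_simple_maps_def mem_Collect_eq has_genus_def H_def[symmetric] maps eul conn
      using True by blast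
  qed
qed

lemma stuffed_map_perms:
  assumes "is_stuffed_map S"
  shows "finite (half_edges S)" "edge_perm S \<in> pairings (half_edges S)" "face_perm S permutes half_edges S"
    "vertex_perm S = inv_into UNIV (face_perm S) \<circ> edge_perm S"
proof -
  show 1: "finite (half_edges S)" "edge_perm S \<in> pairings (half_edges S)" "face_perm S permutes half_edges S"
    using assms by (auto simp: is_stuffed_map_def pairings_def)
  have "vertex_perm S \<circ> edge_perm S \<circ> face_perm S = id" using assms by (simp add: is_stuffed_map_def)
  then have "vertex_perm S (edge_perm S (face_perm S (inv_into UNIV (face_perm S) (edge_perm S x)))) = inv_into UNIV (face_perm S) (edge_perm S x)" for x
    by (metis comp_apply id_apply)
  then show "vertex_perm S = inv_into UNIV (face_perm S) \<circ> edge_perm S"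
    using permutes_inv_compose(3)[OF 1(2,3)] permutes_inverses[OF 1(3)] by (simp add: fun_eq_iff)
qed

lemma stuffed_map_cells:
  assumes "is_stuffed_map S" "f \<in> cells S" "c \<in> f"
  shows "c \<subseteq> half_edges S"
proof -
  have "partition_on (cycles_on (half_edges S) (face_perm S) - set (boundaries S)) (cells S)"
    using assms(1) by (simp add: is_stuffed_map_def)
  then have "c \<in> cycles_on (half_edges S) (face_perm S)" using assms(2,3) unfolding partition_on_def by blast
  then show ?thesis using permutes_orbit_subset stuffed_map_perms(3)[OF assms(1)] by (fastforce simp: cycles_on_def)
qed

section \<open>Isomorphisms as relabellings\<close>

lemma rooting_inject: "rooting rs = rooting rs' \<longleftrightarrow> rs = rs'"
proof
  assume e: "rooting rs = rooting rs'"
  then have "length rs = length rs'" using dom_rooting[of rs] dom_rooting[of rs'] by (metis card_lessThan)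
  then show "rs = rs'" using e by (auto simp: rooting_def fun_eq_iff list_eq_iff_nth_eq split: if_splits)
qed simp

lemma rooting_map: "map_option f \<circ> rooting rs = rooting (map f rs)"
  by (auto simp: rooting_def fun_eq_iff)

lemma conjugate_eq_iff:
  assumes "bij f" "p permutes H" "q permutes f ` H"
  shows "f \<circ> p \<circ> inv_into UNIV f = q \<longleftrightarrow> (\<forall>x\<in>H. f (p x) = q (f x))"
proof
  have inv: "inv_into UNIV f (f y) = y" for y using assms(1) by (simp add: bij_is_inj)
  show "\<forall>x\<in>H. f (p x) = q (f x)" if "f \<circ> p \<circ> inv_into UNIV f = q" using inv by (simp flip: that)
  assume h: "\<forall>x\<in>H. f (p x) = q (f x)"
  show "f \<circ> p \<circ> inv_into UNIV f = q"
  proof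
    fix y
    obtain x where x: "y = f x" using assms(1) by (metis bij_pointE)
    show "(f \<circ> p \<circ> inv_into UNIV f) y = q y"
    proof (cases "x \<in> H")
      case False
      then have "y \<notin> f ` H" using assms(1) x by (simp add: bij_is_inj inj_image_mem_iff)
      then show ?thesis using x False permutes_not_in[OF assms(2)] permutes_not_in[OF assms(3)] inv by simp
    qed (use h x inv in simp)
  qed
qed

lemma is_map_iso_iff_transport:
  assumes S: "is_stuffed_map S" "is_stuffed_map S'" and f: "bij f" "f ` half_edges S = half_edges S'"
  shows "is_map_iso f S S' \<longleftrightarrow> transport f (to_labelled S) = to_labelled S'"
proof -
  note p = stuffed_map_perms[OF S(1)] and p' = stuffed_map_perms[OF S(2)]
  let ?H = "half_edges S" and ?\<phi> = "face_perm S" and ?\<phi>' = "face_perm S'"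
  have pa: "edge_perm S permutes ?H" "edge_perm S' permutes f ` ?H"
    using p(2) p'(2) unfolding f(2) by (auto simp: pairings_def)
  have ph: "inv_into UNIV ?\<phi> permutes ?H" "inv_into UNIV ?\<phi>' permutes f ` ?H"
    using permutes_inv[OF p(3)] permutes_inv[OF p'(3)] unfolding f(2) by auto
  \<comment> \<open>The labelled map stores the inverse face permutation; commuting with a
    permutation and with its inverse is equivalent.\<close>
  have face: "(\<forall>x\<in>?H. f (?\<phi> x) = ?\<phi>' (f x)) \<longleftrightarrow> (\<forall>x\<in>?H. f (inv_into UNIV ?\<phi> x) = inv_into UNIV ?\<phi>' (f x))"
  proof safe
    fix x assume h: "\<forall>x\<in>?H. f (?\<phi> x) = ?\<phi>' (f x)" and x: "x \<in> ?H"
    have "inv_into UNIV ?\<phi> x \<in> ?H" using x permutes_in_image[OF ph(1)] by blast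
    then have "f x = ?\<phi>' (f (inv_into UNIV ?\<phi> x))" using h permutes_inverses[OF p(3)] by metis
    then show "f (inv_into UNIV ?\<phi> x) = inv_into UNIV ?\<phi>' (f x)" using permutes_inverses[OF p'(3)] by metis
  next
    fix x assume h: "\<forall>x\<in>?H. f (inv_into UNIV ?\<phi> x) = inv_into UNIV ?\<phi>' (f x)" and x: "x \<in> ?H"
    have "?\<phi> x \<in> ?H" using x permutes_in_image[OF p(3)] by blast
    then have "f x = inv_into UNIV ?\<phi>' (f (?\<phi> x))" using h permutes_inverses[OF p(3)] by metis
    then show "f (?\<phi> x) = ?\<phi>' (f x)" using permutes_inverses[OF p'(3)] by metis
  qed
  \<comment> \<open>The vertex permutation is composed of the other two, so compatibility with it
    follows.\<close>
  have vert: "\<forall>x\<in>?H. f (vertex_perm S x) = vertex_perm S' (f x)"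
    if "\<forall>x\<in>?H. f (edge_perm S x) = edge_perm S' (f x)" "\<forall>x\<in>?H. f (inv_into UNIV ?\<phi> x) = inv_into UNIV ?\<phi>' (f x)"
    using that p(4) p'(4) permutes_in_image[OF pa(1)] by simp
  have perms: "(\<forall>x \<in> ?H. f (vertex_perm S x) = vertex_perm S' (f x) \<and>
        f (edge_perm S x) = edge_perm S' (f x) \<and> f (?\<phi> x) = ?\<phi>' (f x)) \<longleftrightarrow>
      f \<circ> edge_perm S \<circ> inv_into UNIV f = edge_perm S' \<and>
      f \<circ> inv_into UNIV ?\<phi> \<circ> inv_into UNIV f = inv_into UNIV ?\<phi>'"
    unfolding conjugate_eq_iff[OF f(1) pa] conjugate_eq_iff[OF f(1) ph] using face vert by blast
  let ?I = "image (image f)"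
  \<comment> \<open>\<open>to_labelled\<close> stores the graph of \<open>cell_genus\<close> on the
    cells, so a single equation of images expresses both conditions on cells.\<close>
  have cells: "?I ` cells S = cells S' \<and> (\<forall>c\<in>cells S. cell_genus S' (?I c) = cell_genus S c) \<longleftrightarrow>
      map_prod id ?I ` (\<lambda>c. (cell_genus S c, c)) ` cells S = (\<lambda>c. (cell_genus S' c, c)) ` cells S'" (is "?A \<longleftrightarrow> ?B")
  proof
    assume A: ?A
    have "map_prod id ?I ` (\<lambda>c. (cell_genus S c, c)) ` cells S = (\<lambda>c. (cell_genus S' c, c)) ` ?I ` cells S"
      unfolding image_image using A by (intro image_cong) auto
    then show ?B using A by simp
  next
    assume B: ?B
    have "?I ` cells S = snd ` map_prod id ?I ` (\<lambda>c. (cell_genus S c, c)) ` cells S" by (simp add: image_image)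
    also have "\<dots> = cells S'" unfolding B by (simp add: image_image)
    finally have "?I ` cells S = cells S'" .
    moreover have "cell_genus S' (?I c) = cell_genus S c" if "c \<in> cells S" for c
    proof -
      have "(cell_genus S c, ?I c) \<in> map_prod id ?I ` (\<lambda>c. (cell_genus S c, c)) ` cells S"
        using that by force
      then show ?thesis unfolding B by auto
    qed
    ultimately show ?A by blast
  qed
  have "bij_betw f ?H (half_edges S')" using f by (metis bij_betw_imageI bij_is_inj inj_on_subset subset_UNIV)
  then show ?thesis
    unfolding is_map_iso_def perms cells to_labelled_def transport_def prod.case prod.inject rooting_map rooting_inject
    by blast
qed

text \<open>An isomorphism matters only through its values on the half-edges, so it may be replaced
  by a bijection of the whole type.\<close>

lemma is_map_iso_cong:
  assumes "is_stuffed_map S" "\<And>x. x \<in> half_edges S \<Longrightarrow> b x = f x"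
  shows "is_map_iso b S S' \<longleftrightarrow> is_map_iso f S S'"
proof -
  let ?H = "half_edges S"
  note p = stuffed_map_perms[OF assms(1)]
  have pe: "edge_perm S permutes ?H" using p(2) by (auto simp: pairings_def)
  have pv: "vertex_perm S permutes ?H" using assms(1) by (simp add: is_stuffed_map_def)
  have e1: "bij_betw b ?H (half_edges S') \<longleftrightarrow> bij_betw f ?H (half_edges S')" using assms(2) by (rule bij_betw_cong)
  have e2: "(\<forall>x \<in> ?H. b (vertex_perm S x) = vertex_perm S' (b x) \<and>
        b (edge_perm S x) = edge_perm S' (b x) \<and> b (face_perm S x) = face_perm S' (b x)) \<longleftrightarrow>
      (\<forall>x \<in> ?H. f (vertex_perm S x) = vertex_perm S' (f x) \<and>
        f (edge_perm S x) = edge_perm S' (f x) \<and> f (face_perm S x) = face_perm S' (f x))"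
    using assms(2) permutes_in_image[OF pe] permutes_in_image[OF pv] permutes_in_image[OF p(3)] by simp
  have e3: "map b (roots S) = map f (roots S)"
    using assms by (intro map_cong) (auto simp: is_stuffed_map_def)
  have I: "image (image b) c = image (image f) c" if "c \<in> cells S" for c
    using stuffed_map_cells[OF assms(1) that] assms(2) by (intro image_cong refl) blast
  have e4: "image (image (image b)) (cells S) = image (image (image f)) (cells S)"
    by (rule image_cong[OF refl I])
  have e5: "(\<forall>c \<in> cells S. cell_genus S' (image (image b) c) = cell_genus S c) \<longleftrightarrow>
      (\<forall>c \<in> cells S. cell_genus S' (image (image f) c) = cell_genus S c)"
    by (rule ball_cong[OF refl]) (simp only: I)
  show ?thesis unfolding is_map_iso_def e1 e2 e3 e4 e5 ..
qed

lemma transport_compose: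
  assumes "bij f" "bij g"
  shows "transport g (transport f t) = transport (g \<circ> f) t"
proof -
  have inv: "inv_into UNIV (g \<circ> f) = inv_into UNIV f \<circ> inv_into UNIV g" by (rule o_inv_distrib[OF assms(2,1)])
  have I: "map_prod id (image (image g)) ` map_prod id (image (image f)) ` K = map_prod id (image (image (g \<circ> f))) ` K" for K :: "(nat \<times> 'a set set) set"
    by (simp add: image_image map_prod_def case_prod_unfold)
  show ?thesis unfolding transport_def
    by (cases t) (simp add: inv I comp_assoc option.map_comp fun_eq_iff)
qed

lemma transport_id: "transport id t = t"
  by (cases t) (simp add: transport_def inv_id option.map_id0 prod.map_id0)

text \<open>A conjugated permutation of \<open>X\<close> acts on the image of \<open>X\<close> and
  fixes all other points, while roots and cells lie inside \<open>X\<close>; so the values on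
  \<open>X\<close> decide.\<close>

lemma transport_cong:
  assumes f: "bij f" "bij g" and eq: "\<And>x. x \<in> X \<Longrightarrow> f x = g x" and X: "finite X" and t: "t \<in> maps X L B w"
  shows "transport f t = transport g t"
proof -
  obtain \<alpha> \<phi> r K where t': "t = (\<alpha>, \<phi>, r, K)" by (cases t)
  have p: "(\<phi>, r, K) \<in> premaps X L B w" and a: "\<alpha> permutes X" using t by (auto simp: maps_def pairings_def t')
  have \<phi>: "\<phi> permutes X" and r: "ran r \<subseteq> X" using p by (auto simp: premaps_def)
  have im: "f ` X = g ` X" using eq by (intro image_cong) auto
  have "f \<circ> q \<circ> inv_into UNIV f = g \<circ> q \<circ> inv_into UNIV g" if q: "q permutes X" for q
  proof -
    have "g \<circ> q \<circ> inv_into UNIV g permutes f ` X" unfolding im by (rule permutes_conjugate[OF f(2) q])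
    then show ?thesis
      using conjugate_eq_iff[OF f(1) q, of "g \<circ> q \<circ> inv_into UNIV g"] eq f(2) permutes_in_image[OF q] by (simp add: bij_is_inj)
  qed
  moreover have "map_option f \<circ> r = map_option g \<circ> r"
  proof
    fix i show "(map_option f \<circ> r) i = (map_option g \<circ> r) i"
      using r eq by (cases "r i") (auto simp: ran_def)
  qed
  moreover have "map_prod id (image (image f)) ` K = map_prod id (image (image g)) ` K"
  proof (intro image_cong refl)
    fix k assume k: "k \<in> K"
    have "c \<subseteq> X" if "c \<in> snd k" for c using premap_cell_subset(1)[OF X p k] that by blast
    then have "image (image f) (snd k) = image (image g) (snd k)" using eq by (intro image_cong refl) blast
    then show "map_prod id (image (image f)) k = map_prod id (image (image g)) k" by (simp add: prod_eq_iff)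
  qed
  ultimately show ?thesis using a \<phi> by (simp add: transport_def t')
qed

lemma connected_maps_transport:
  assumes f: "bij f" and X: "finite X" and t: "t \<in> connected_maps X Ls w g"
  shows "transport f t \<in> connected_maps (f ` X) Ls w g"
proof -
  obtain \<alpha> \<phi> r K where t': "t = (\<alpha>, \<phi>, r, K)" by (cases t)
  let ?c = "\<lambda>p. f \<circ> p \<circ> inv_into UNIV f"
  have comp: "?c \<phi> \<circ> ?c \<alpha> = ?c (\<phi> \<circ> \<alpha>)" using f by (auto simp: fun_eq_iff bij_is_inj)
  have "card (cycles_on (f ` X) (?c (\<phi> \<circ> \<alpha>))) = card (cycles_on X (\<phi> \<circ> \<alpha>))"
    unfolding cycles_on_conjugate[OF f] using bij_is_inj[OF f] by (intro card_image) (simp add: inj_image_eq_iff inj_on_def)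
  moreover have "card (f ` X) = card X" using bij_is_inj[OF f] by (intro card_image) (auto intro: inj_on_subset)
  ultimately have "labelled_euler (f ` X) (length Ls) (transport f t) w = labelled_euler X (length Ls) t w"
    unfolding labelled_euler_def t' transport_def prod.case fst_conv snd_conv comp by simp
  then show ?thesis
    using t transport_maps(1,2)[OF f X, of t "\<lambda>i. Ls ! i" "{..<length Ls}" w] unfolding connected_maps_def by simp
qed

text \<open>The converse of the encoding. The genus of a cell is recovered by
  \<open>inv_into K snd\<close>, which is unambiguous because \<open>snd\<close> is injective on
  \<open>K\<close>.\<close>

lemma labelled_surj:
  assumes "finite H" "t \<in> connected_maps H Ls w g"
  shows "\<exists>S. half_edges S = H \<and> finite (half_edges S) \<and> edge_perm S \<in> pairings H \<and> face_perm S permutes H \<and>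
    vertex_perm S = inv_into UNIV (face_perm S) \<circ> edge_perm S \<and> to_labelled S = t"
proof -
  obtain \<alpha> \<phi> r K where t': "t = (\<alpha>, \<phi>, r, K)" by (cases t)
  have p: "(\<phi>, r, K) \<in> premaps H (\<lambda>i. Ls ! i) {..<length Ls} w" and a: "\<alpha> \<in> pairings H"
    using assms(2) by (auto simp: maps_def connected_maps_def t')
  have \<phi>: "\<phi> permutes H" and r: "dom r = {..<length Ls}" and K: "inj_on snd K" using p by (auto simp: premaps_def)
  define S where "S = \<lparr>half_edges = H, vertex_perm = \<phi> \<circ> \<alpha>, edge_perm = \<alpha>, face_perm = inv_into UNIV \<phi>,
    roots = map (\<lambda>i. the (r i)) [0..<length Ls], cells = snd ` K, cell_genus = fst \<circ> inv_into K snd\<rparr>"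
  have inv: "inv_into UNIV (inv_into UNIV \<phi>) = \<phi>" using \<phi> by (simp add: permutes_bij inv_inv_eq)
  have "rooting (roots S) i = r i" for i
  proof (cases "i < length Ls")
    case True
    then have "i \<in> dom r" using r by simp
    then show ?thesis using True by (auto simp: rooting_def S_def)
  next
    case False
    then have "r i = None" using r by auto
    then show ?thesis using False by (simp add: rooting_def S_def)
  qed
  moreover have "(\<lambda>f. (cell_genus S f, f)) ` cells S = K"
    using K by (force simp: S_def image_image)
  ultimately have "to_labelled S = t"
    unfolding to_labelled_def t' by (simp add: S_def inv fun_eq_iff)
  then show ?thesis
    using assms(1) a \<phi> permutes_inv[OF \<phi>] by (intro exI[of _ S]) (simp add: S_def inv)
qed

section \<open>Isomorphism classes\<close>

text \<open>The permutations that send \<open>t\<close> to \<open>act p t\<close> form the coset of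
  the stabilizer through \<open>p\<close>, so all fibres over the orbit have the same size.\<close>

lemma card_orbit_stabilizer:
  assumes "finite U" "\<And>p q. p permutes U \<Longrightarrow> q permutes U \<Longrightarrow> act p (act q t) = act (p \<circ> q) t" "act id t = t"
  shows "card ((\<lambda>p. act p t) ` {p. p permutes U}) * card {p. p permutes U \<and> act p t = t} = fact (card U)"
proof -
  let ?G = "{p. p permutes U}"
  let ?F = "\<lambda>y. {p \<in> ?G. act p t = y}"
  have fin: "finite ?G" using finite_permutations[OF assms(1)] .
  have "card (?F (act p t)) = card {p. p permutes U \<and> act p t = t}" if p: "p permutes U" for p
  proof (rule bij_betw_same_card[symmetric], rule bij_betwI')
    have p': "inv_into UNIV p permutes U" by (rule permutes_inv[OF p])
    fix q q' assume q: "q \<in> {p. p permutes U \<and> act p t = t}" "q' \<in> {p. p permutes U \<and> act p t = t}"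
    show "(p \<circ> q = p \<circ> q') = (q = q')" using permutes_inj[OF p] by (auto simp: fun_eq_iff inj_eq)
  next
    fix q assume q: "q \<in> {p. p permutes U \<and> act p t = t}"
    then show "p \<circ> q \<in> ?F (act p t)" using assms(2)[OF p, of q] permutes_compose[OF _ p] by auto
  next
    fix q assume q: "q \<in> ?F (act p t)"
    define q' where "q' = inv_into UNIV p \<circ> q"
    have p': "inv_into UNIV p permutes U" by (rule permutes_inv[OF p])
    have inv: "inv_into UNIV p \<circ> p = id" "p \<circ> inv_into UNIV p = id" using permutes_inv_o[OF p] by auto
    have "q' permutes U" using q permutes_compose[OF _ p'] unfolding q'_def by blast
    moreover have "act q' t = act (inv_into UNIV p) (act q t)" using assms(2)[OF p', of q] q unfolding q'_def by simp
    moreover have "\<dots> = act (inv_into UNIV p \<circ> p) t" using q assms(2)[OF p' p] by simp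
    ultimately have "q' \<in> {p. p permutes U \<and> act p t = t}" using inv(1) assms(3) by simp
    moreover have "p \<circ> q' = q" unfolding q'_def comp_assoc[symmetric] inv by simp
    ultimately show "\<exists>x\<in>{p. p permutes U \<and> act p t = t}. q = p \<circ> x" by (intro bexI[of _ q']) simp_all
  qed
  then have "(\<Sum>y\<in>(\<lambda>p. act p t) ` ?G. card (?F y)) = (\<Sum>y\<in>(\<lambda>p. act p t) ` ?G. card {p. p permutes U \<and> act p t = t})"
    by (intro sum.cong) auto
  moreover have "(\<Sum>y\<in>(\<lambda>p. act p t) ` ?G. card (?F y)) = card ?G"
    using sum.group[OF fin finite_imageI[OF fin] order_refl, of "\<lambda>_. 1::nat" "\<lambda>p. act p t"] by simp
  ultimately show ?thesis using card_permutations[OF refl assms(1)] by simp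
qed

lemma automorphisms_eq:
  assumes "is_stuffed_map S"
  shows "automorphisms S = {b. b permutes half_edges S \<and> transport b (to_labelled S) = to_labelled S}"
proof -
  have iso: "is_map_iso b S S \<longleftrightarrow> transport b (to_labelled S) = to_labelled S" if "b permutes half_edges S" for b
    using is_map_iso_iff_transport[OF assms assms permutes_bij[OF that] permutes_image[OF that]] .
  have fix_boundary: "b x = x" if b: "b permutes half_edges S" "is_map_iso b S S" and x: "x \<in> boundary_half_edges S" for b x
  proof -
    obtain h where h: "h \<in> set (roots S)" "x \<in> orbit (face_perm S) h"
      using x by (auto simp: boundary_half_edges_def boundaries_def)
    have H: "h \<in> half_edges S" using h(1) assms by (auto simp: is_stuffed_map_def)
    have "map b (roots S) = roots S" using b(2) by (simp add: is_map_iso_def)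
    then have bh: "b h = h" using h(1) map_eq_conv[of b "roots S" "\<lambda>x. x"] by simp
    have comm: "b (face_perm S y) = face_perm S (b y)" if "y \<in> half_edges S" for y
      using b(2) that by (simp add: is_map_iso_def)
    \<comment> \<open>The root is fixed and \<open>b\<close> commutes with the face permutation, so
      being fixed spreads along the boundary.\<close>
    have "x \<in> half_edges S \<and> b x = x"
      using h(2)
    proof induction
      case base
      then show ?case using comm[OF H] bh H permutes_in_image[OF stuffed_map_perms(3)[OF assms]] by simp
    next
      case (step y)
      then show ?case using comm[of y] permutes_in_image[OF stuffed_map_perms(3)[OF assms]] by simp
    qed
    then show ?thesis ..
  qed
  show ?thesis
    unfolding automorphisms_def
  proof (rule Collect_cong)
    fix b
    show "b permutes half_edges S \<and> is_map_iso b S S \<and> (\<forall>x\<in>boundary_half_edges S. b x = x) \<longleftrightarrow>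
      b permutes half_edges S \<and> transport b (to_labelled S) = to_labelled S"
      using iso[of b] fix_boundary[of b] by blast
  qed
qed

lemma isomorphic_iff_transport:
  fixes S S' :: "'h stuffed_map"
  assumes S: "is_stuffed_map S" "is_stuffed_map S'"
  shows "(\<exists>b. is_map_iso b S S') \<longleftrightarrow>
    (\<exists>f. bij f \<and> f ` half_edges S = half_edges S' \<and> transport f (to_labelled S) = to_labelled S')"
proof
  assume "\<exists>b. is_map_iso b S S'"
  then obtain b where b: "is_map_iso b S S'" by blast
  then have bij: "bij_betw b (half_edges S) (half_edges S')" by (simp add: is_map_iso_def)
  obtain f where f: "bij f" "\<forall>x\<in>half_edges S. f x = b x"
    using bij_extend[OF stuffed_map_perms(1)[OF S(1)] stuffed_map_perms(1)[OF S(2)] bij_betw_same_card[OF bij] bij] by blast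
  have "f ` half_edges S = half_edges S'" using bij f(2) by (simp add: bij_betw_def cong: image_cong)
  moreover have "is_map_iso f S S'" using is_map_iso_cong[OF S(1), of f b] f(2) b by blast
  ultimately show "\<exists>f. bij f \<and> f ` half_edges S = half_edges S' \<and> transport f (to_labelled S) = to_labelled S'"
    using f(1) is_map_iso_iff_transport[OF S f(1)] by blast
next
  assume "\<exists>f. bij f \<and> f ` half_edges S = half_edges S' \<and> transport f (to_labelled S) = to_labelled S'"
  then obtain f where "bij f" "f ` half_edges S = half_edges S'" "transport f (to_labelled S) = to_labelled S'" by blast
  then show "\<exists>b. is_map_iso b S S'" using is_map_iso_iff_transport[OF S] by blast
qed

text \<open>Expressed by bijections of the whole type, isomorphisms are inverted and composed by the
  laws of \<open>transport\<close>.\<close>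

lemma equiv_iso_on:
  fixes \<M> :: "'h stuffed_map set"
  assumes "\<And>S. S \<in> \<M> \<Longrightarrow> is_stuffed_map S"
  shows "equiv \<M> (iso_on \<M>)"
proof (rule equivI)
  let ?P = "\<lambda>f S S'. bij f \<and> f ` half_edges S = half_edges S' \<and> transport f (to_labelled S) = to_labelled S'"
  have iso: "(S, S') \<in> iso_on \<M> \<longleftrightarrow> S \<in> \<M> \<and> S' \<in> \<M> \<and> (\<exists>f. ?P f S S')" for S S'
  proof (cases "S \<in> \<M> \<and> S' \<in> \<M>")
    case True
    then show ?thesis using isomorphic_iff_transport[OF assms assms, of S S'] by (simp add: iso_on_def)
  qed (auto simp: iso_on_def)
  show "iso_on \<M> \<subseteq> \<M> \<times> \<M>" by (auto simp: iso_on_def)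
  have "?P id S S" for S :: "'h stuffed_map" by (simp add: transport_id)
  then show "refl_on \<M> (iso_on \<M>)" unfolding refl_on_def iso by blast
  have inv: "?P (inv_into UNIV f) S' S" if "?P f S S'" for f and S S' :: "'h stuffed_map"
  proof -
    have "bij f" and im: "half_edges S' = f ` half_edges S" and t: "to_labelled S' = transport f (to_labelled S)" using that by auto
    then show ?thesis unfolding im t transport_inv[OF \<open>bij f\<close>] by (simp add: bij_imp_bij_inv image_image bij_is_inj)
  qed
  show "sym (iso_on \<M>)"
  proof (rule symI)
    fix S S' assume "(S, S') \<in> iso_on \<M>"
    then obtain f where f: "S \<in> \<M>" "S' \<in> \<M>" "?P f S S'" unfolding iso by (elim conjE exE) simp
    then show "(S', S) \<in> iso_on \<M>" unfolding iso using inv[OF f(3)] by (intro conjI exI[of _ "inv_into UNIV f"]) simp_all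
  qed
  have comp: "?P (g \<circ> f) S S''" if "?P f S S'" "?P g S' S''" for f g and S S' S'' :: "'h stuffed_map"
  proof -
    have b: "bij f" "bij g" using that by auto
    have "(g \<circ> f) ` half_edges S = half_edges S''" using that by (simp only: image_comp[symmetric])
    moreover have "transport (g \<circ> f) (to_labelled S) = to_labelled S''"
      using that by (simp only: transport_compose[OF b, symmetric])
    ultimately show ?thesis using bij_comp[OF b] by blast
  qed
  show "trans (iso_on \<M>)"
  proof (rule transI)
    fix S S' S'' assume "(S, S') \<in> iso_on \<M>" "(S', S'') \<in> iso_on \<M>"
    then obtain f g where f: "S \<in> \<M>" "S'' \<in> \<M>" "?P f S S'" "?P g S' S''" unfolding iso by (elim conjE exE) simp
    then show "(S, S'') \<in> iso_on \<M>" unfolding iso using comp[OF f(3,4)] by (intro conjI exI[of _ "g \<circ> f"]) simp_all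
  qed
qed

text \<open>Conjugation by \<open>f\<close> carries the automorphisms onto the stabilizer of the
  relabelled map.\<close>

lemma card_automorphisms_transport:
  assumes S: "is_stuffed_map S" and f: "bij f"
  shows "card {p. p permutes f ` half_edges S \<and> transport p (transport f (to_labelled S)) = transport f (to_labelled S)}
    = card (automorphisms S)"
proof -
  have f': "bij (inv_into UNIV f)" using f by (rule bij_imp_bij_inv)
  have inv: "f \<circ> inv_into UNIV f = id" "inv_into UNIV f \<circ> f = id"
    using f by (auto simp: fun_eq_iff bij_is_inj bij_is_surj surj_f_inv_f)
  have inv': "inv_into UNIV (inv_into UNIV f) = f" using f by (rule inv_inv_eq)
  have im: "inv_into UNIV f ` f ` half_edges S = half_edges S" using f by (simp add: image_image bij_is_inj)
  have "bij_betw (\<lambda>b. f \<circ> b \<circ> inv_into UNIV f) (automorphisms S)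
    {p. p permutes f ` half_edges S \<and> transport p (transport f (to_labelled S)) = transport f (to_labelled S)}"
    unfolding automorphisms_eq[OF S]
  proof (rule bij_betw_byWitness[where f' = "\<lambda>p. inv_into UNIV f \<circ> p \<circ> f"])
    have "f \<circ> (inv_into UNIV f \<circ> p \<circ> f) \<circ> inv_into UNIV f = p" "inv_into UNIV f \<circ> (f \<circ> p \<circ> inv_into UNIV f) \<circ> f = p" for p
    proof -
      have "f \<circ> (inv_into UNIV f \<circ> p \<circ> f) \<circ> inv_into UNIV f = (f \<circ> inv_into UNIV f) \<circ> p \<circ> (f \<circ> inv_into UNIV f)" by (simp add: comp_assoc)
      then show "f \<circ> (inv_into UNIV f \<circ> p \<circ> f) \<circ> inv_into UNIV f = p" by (simp add: inv)
      have "inv_into UNIV f \<circ> (f \<circ> p \<circ> inv_into UNIV f) \<circ> f = (inv_into UNIV f \<circ> f) \<circ> p \<circ> (inv_into UNIV f \<circ> f)" by (simp add: comp_assoc)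
      then show "inv_into UNIV f \<circ> (f \<circ> p \<circ> inv_into UNIV f) \<circ> f = p" by (simp add: inv)
    qed
    then show "\<forall>a\<in>{b. b permutes half_edges S \<and> transport b (to_labelled S) = to_labelled S}.
        inv_into UNIV f \<circ> (f \<circ> a \<circ> inv_into UNIV f) \<circ> f = a"
      and "\<forall>a'\<in>{p. p permutes f ` half_edges S \<and> transport p (transport f (to_labelled S)) = transport f (to_labelled S)}.
        f \<circ> (inv_into UNIV f \<circ> a' \<circ> f) \<circ> inv_into UNIV f = a'" by blast+
    show "(\<lambda>b. f \<circ> b \<circ> inv_into UNIV f) ` {b. b permutes half_edges S \<and> transport b (to_labelled S) = to_labelled S}
      \<subseteq> {p. p permutes f ` half_edges S \<and> transport p (transport f (to_labelled S)) = transport f (to_labelled S)}"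
    proof (rule image_subsetI)
      fix b assume "b \<in> {b. b permutes half_edges S \<and> transport b (to_labelled S) = to_labelled S}"
      then have b: "b permutes half_edges S" "transport b (to_labelled S) = to_labelled S" by auto
      note bb = permutes_bij[OF b(1)]
      have "transport (f \<circ> b \<circ> inv_into UNIV f) (transport f (to_labelled S)) = transport (f \<circ> b \<circ> (inv_into UNIV f \<circ> f)) (to_labelled S)"
        by (subst transport_compose) (simp_all add: bij_comp f f' bb comp_assoc)
      also have "\<dots> = transport f (to_labelled S)" unfolding inv using transport_compose[OF bb f, of "to_labelled S"] b(2) by simp
      finally show "f \<circ> b \<circ> inv_into UNIV f \<in> {p. p permutes f ` half_edges S \<and> transport p (transport f (to_labelled S)) = transport f (to_labelled S)}"
        using permutes_conjugate[OF f b(1)] by simp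
    qed
    show "(\<lambda>p. inv_into UNIV f \<circ> p \<circ> f) ` {p. p permutes f ` half_edges S \<and> transport p (transport f (to_labelled S)) = transport f (to_labelled S)}
      \<subseteq> {b. b permutes half_edges S \<and> transport b (to_labelled S) = to_labelled S}"
    proof (rule image_subsetI)
      fix p assume "p \<in> {p. p permutes f ` half_edges S \<and> transport p (transport f (to_labelled S)) = transport f (to_labelled S)}"
      then have p: "p permutes f ` half_edges S" "transport p (transport f (to_labelled S)) = transport f (to_labelled S)" by auto
      note bp = permutes_bij[OF p(1)]
      have "transport (inv_into UNIV f \<circ> p \<circ> f) (to_labelled S) = transport (inv_into UNIV f) (transport p (transport f (to_labelled S)))"
        by (simp add: transport_compose bij_comp f f' bp comp_assoc)
      also have "\<dots> = to_labelled S" unfolding p(2) by (rule transport_inv[OF f])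
      finally show "inv_into UNIV f \<circ> p \<circ> f \<in> {b. b permutes half_edges S \<and> transport b (to_labelled S) = to_labelled S}"
        using permutes_conjugate[OF f' p(1)] unfolding inv' im by simp
    qed
  qed
  then show ?thesis by (rule bij_betw_same_card[symmetric])
qed

text \<open>An isomorphism class corresponds to an orbit of the symmetric group on labelled maps
  over \<open>{..<d}\<close>, of size \<open>d!\<close> divided by the number of automorphisms.
  Summing over the orbits counts all labelled maps.\<close>

lemma coeff_stuffed_series:
  fixes w :: "weight multiset"
  assumes Ls: "Ls \<noteq> []"
  defines "d \<equiv> map_size (\<lambda>i. Ls ! i) {..<length Ls} w"
  shows "coeff (stuffed_series g Ls) w = of_nat (card (connected_maps {..<d} Ls w g)) / fact d"
proof -
  define \<M> where "\<M> = {S \<in> fully_simple_maps g Ls. map_monomial S = w}"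
  define X where "X = connected_maps {..<d} Ls w g"
  let ?U = "{..<d}"
  have stuffed: "is_stuffed_map S" if "S \<in> \<M>" for S using that by (simp add: \<M>_def fully_simple_maps_def)
  have finX: "finite X" unfolding X_def connected_maps_def using finite_maps[of ?U "{..<length Ls}"] by simp
  have mem: "to_labelled S \<in> connected_maps (half_edges S) Ls w g" if "S \<in> \<M>" for S
    using fully_simple_maps_iff[OF stuffed_map_perms[OF stuffed[OF that]] Ls] that unfolding \<M>_def by blast
  have card_half: "card (half_edges S) = d" if S: "S \<in> \<M>" for S
  proof -
    obtain p where "p \<in> premaps (half_edges S) (\<lambda>i. Ls ! i) {..<length Ls} w"
      using mem[OF S] by (auto simp: connected_maps_def maps_def)
    then show ?thesis using premaps_card[OF stuffed_map_perms(1)[OF stuffed[OF S]]] unfolding d_def by blast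
  qed
  have ex_of: "\<exists>S\<in>\<M>. half_edges S = ?U \<and> to_labelled S = t" if t: "t \<in> X" for t
  proof -
    obtain S where S: "half_edges S = ?U" "finite (half_edges S)" "edge_perm S \<in> pairings (half_edges S)"
      "face_perm S permutes half_edges S" "vertex_perm S = inv_into UNIV (face_perm S) \<circ> edge_perm S" "to_labelled S = t"
      using labelled_surj[OF _ t[unfolded X_def]] by auto
    have "S \<in> \<M>" using fully_simple_maps_iff[OF S(2-5) Ls, of g w] t unfolding \<M>_def S(1,6) X_def by blast
    then show ?thesis using S by blast
  qed
  \<comment> \<open>A choice is made because \<open>t\<close> leaves the values of
    \<open>cell_genus\<close> outside the cells open. The isomorphism class does not depend on
    it.\<close>
  define of_lab where "of_lab = (\<lambda>t. SOME S. S \<in> \<M> \<and> half_edges S = ?U \<and> to_labelled S = t)"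
  have of_lab: "of_lab t \<in> \<M>" "half_edges (of_lab t) = ?U" "to_labelled (of_lab t) = t" if "t \<in> X" for t
    using someI_ex[of "\<lambda>S. S \<in> \<M> \<and> half_edges S = ?U \<and> to_labelled S = t"] ex_of[OF that] unfolding of_lab_def by blast+
  let ?R = "iso_on \<M>"
  have equiv: "equiv \<M> ?R" by (rule equiv_iso_on[OF stuffed])
  define cl where "cl = (\<lambda>t. ?R `` {of_lab t})"
  have cl_mem: "cl t \<in> \<M> // ?R" if "t \<in> X" for t unfolding cl_def using of_lab(1)[OF that] by (rule quotientI)
  have fibre: "cl t = ?R `` {S} \<longleftrightarrow> (\<exists>f. bij f \<and> f ` half_edges S = ?U \<and> transport f (to_labelled S) = t)"
    if "t \<in> X" "S \<in> \<M>" for t S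
  proof -
    have "cl t = ?R `` {S} \<longleftrightarrow> (S, of_lab t) \<in> ?R"
    proof -
      have "sym ?R" using equiv by (simp add: equiv_def)
      then have "(S, of_lab t) \<in> ?R \<longleftrightarrow> (of_lab t, S) \<in> ?R" by (blast dest: symD)
      then show ?thesis
        unfolding cl_def using eq_equiv_class_iff[OF equiv of_lab(1)[OF that(1)] that(2)] by blast
    qed
    also have "\<dots> \<longleftrightarrow> (\<exists>b. is_map_iso b S (of_lab t))"
      using of_lab(1)[OF that(1)] that(2) by (simp add: iso_on_def)
    finally show ?thesis
      using isomorphic_iff_transport[OF stuffed stuffed, OF that(2) of_lab(1)[OF that(1)]] of_lab(2,3)[OF that(1)] by simp
  qed
  have count: "card {t \<in> X. cl t = ?R `` {S}} * card (automorphisms S) = fact d" if S: "S \<in> \<M>" for S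
  proof -
    note fin = stuffed_map_perms(1)[OF stuffed[OF S]]
    obtain b where b: "bij_betw b (half_edges S) ?U"
      using ex_bij_betw_finite_nat[OF fin] card_half[OF S] by (auto simp: atLeast0LessThan)
    obtain f where f: "bij f" "\<forall>x\<in>half_edges S. f x = b x"
      using bij_extend[OF fin _ _ b] card_half[OF S] by auto
    have im: "f ` half_edges S = ?U" using b f(2) by (simp add: bij_betw_def cong: image_cong)
    define t0 where "t0 = transport f (to_labelled S)"
    have t0: "t0 \<in> X" using connected_maps_transport[OF f(1) fin mem[OF S]] unfolding t0_def X_def im .
    have "{t \<in> X. cl t = ?R `` {S}} = (\<lambda>p. transport p t0) ` {p. p permutes ?U}"
    proof (intro equalityI subsetI)
      fix t assume "t \<in> (\<lambda>p. transport p t0) ` {p. p permutes ?U}"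
      then obtain p where p: "p permutes ?U" "t = transport p t0" by blast
      note bp = permutes_bij[OF p(1)]
      have t: "t = transport (p \<circ> f) (to_labelled S)" unfolding p(2) t0_def by (rule transport_compose[OF f(1) bp])
      have "(p \<circ> f) ` half_edges S = ?U" unfolding image_comp[symmetric] im by (rule permutes_image[OF p(1)])
      moreover have "bij (p \<circ> f)" by (rule bij_comp[OF f(1) bp])
      moreover have "t \<in> X"
        using connected_maps_transport[OF bp _ t0[unfolded X_def]] permutes_image[OF p(1)] unfolding p(2) X_def by simp
      ultimately show "t \<in> {t \<in> X. cl t = ?R `` {S}}" using fibre[OF _ S, of t] t by blast
    next
      fix t assume "t \<in> {t \<in> X. cl t = ?R `` {S}}"
      then obtain h where h: "bij h" "h ` half_edges S = ?U" "transport h (to_labelled S) = t"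
        using fibre[OF _ S, of t] by blast
      have f': "bij (inv_into UNIV f)" using f(1) by (rule bij_imp_bij_inv)
      let ?k = "h \<circ> inv_into UNIV f"
      have k: "bij ?k" by (rule bij_comp[OF f' h(1)])
      have fU: "inv_into UNIV f ` ?U = half_edges S" unfolding im[symmetric] using f(1) by (simp add: image_image bij_is_inj)
      have kU: "?k ` ?U = ?U" unfolding image_comp[symmetric] fU by (rule h(2))
      \<comment> \<open>\<open>?k\<close> maps \<open>?U\<close> onto itself but may move other
        points; cutting it down to \<open>?U\<close> gives a permutation with the same effect on
        \<open>t0\<close>.\<close>
      define p where "p = (\<lambda>x. if x \<in> ?U then ?k x else x)"
      have "bij_betw ?k ?U ?U" using inj_on_subset[OF bij_is_inj[OF k] subset_UNIV] kU by (rule bij_betw_imageI)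
      then have "bij_betw p ?U ?U" by (rule bij_betw_cong[THEN iffD1, rotated]) (simp add: p_def)
      then have p: "p permutes ?U" by (rule bij_imp_permutes) (simp add: p_def)
      have tX: "t0 \<in> maps ?U (\<lambda>i. Ls ! i) {..<length Ls} w" using t0 by (simp add: X_def connected_maps_def)
      have "transport p t0 = transport ?k t0"
        by (rule transport_cong[OF permutes_bij[OF p] k _ _ tX]) (simp_all add: p_def)
      also have "\<dots> = transport h (transport (inv_into UNIV f) t0)" using transport_compose[OF f' h(1), of t0] by simp
      also have "\<dots> = t" unfolding t0_def transport_inv[OF f(1)] by (rule h(3))
      finally show "t \<in> (\<lambda>p. transport p t0) ` {p. p permutes ?U}" using p by blast
    qed
    moreover have "card {p. p permutes ?U \<and> transport p t0 = t0} = card (automorphisms S)"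
      using card_automorphisms_transport[OF stuffed[OF S] f(1)] unfolding im t0_def .
    moreover have "card ((\<lambda>p. transport p t0) ` {p. p permutes ?U}) * card {p. p permutes ?U \<and> transport p t0 = t0} = fact (card ?U)"
      by (rule card_orbit_stabilizer) (simp_all only: transport_compose[OF permutes_bij permutes_bij] transport_id finite_lessThan)
    ultimately show ?thesis by simp
  qed
  have surj: "\<M> // ?R = cl ` X"
  proof (intro equalityI subsetI)
    fix K assume "K \<in> \<M> // ?R"
    then obtain S where S: "S \<in> \<M>" "K = ?R `` {S}" by (rule quotientE)
    \<comment> \<open>The fibre over a class cannot be empty, as its size times the number of
      automorphisms is \<open>d!\<close>.\<close>
    have "{t \<in> X. cl t = ?R `` {S}} \<noteq> {}"
    proof
      assume "{t \<in> X. cl t = ?R `` {S}} = {}"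
      from count[OF S(1), unfolded this] show False by simp
    qed
    then show "K \<in> cl ` X" using S(2) by blast
  qed (use cl_mem in blast)
  have "coeff (stuffed_series g Ls) w = (\<Sum>K\<in>\<M> // ?R. 1 / of_nat (card (automorphisms (SOME S. S \<in> K))))"
    by (simp add: stuffed_series_def generating_series_def \<M>_def)
  also have "\<dots> = (\<Sum>K\<in>cl ` X. of_nat (card {t \<in> X. cl t = K}) / fact d)"
    unfolding surj[symmetric]
  proof (rule sum.cong[OF refl])
    fix K assume K: "K \<in> \<M> // ?R"
    then have ne: "K \<noteq> {}" by (rule in_quotient_imp_non_empty[OF equiv])
    define S where "S = (SOME S. S \<in> K)"
    have SK: "S \<in> K" unfolding S_def using ne by (simp add: some_in_eq)
    then have S: "S \<in> \<M>" using in_quotient_imp_subset[OF equiv K] by blast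
    obtain S' where S': "K = ?R `` {S'}" using K by (rule quotientE)
    then have "(S', S) \<in> ?R" using SK by blast
    then have "K = ?R `` {S}" unfolding S' by (rule equiv_class_eq[OF equiv])
    then have c: "card {t \<in> X. cl t = K} * card (automorphisms S) = fact d" using count[OF S] by simp
    then have "card (automorphisms S) \<noteq> 0" using fact_nonzero[of d, where 'a = nat] by (intro notI) simp
    moreover have "of_nat (card {t \<in> X. cl t = K}) * of_nat (card (automorphisms S)) = (fact d :: complex)"
      using arg_cong[OF c, of "of_nat :: nat \<Rightarrow> complex"] by (simp only: of_nat_mult of_nat_fact)
    ultimately show "1 / of_nat (card (automorphisms (SOME S. S \<in> K))) = of_nat (card {t \<in> X. cl t = K}) / (fact d :: complex)"
      unfolding S_def[symmetric] by (simp add: divide_simps)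
  qed
  also have "\<dots> = of_nat (\<Sum>K\<in>cl ` X. card {t \<in> X. cl t = K}) / fact d"
    by (simp add: sum_divide_distrib)
  also have "(\<Sum>K\<in>cl ` X. card {t \<in> X. cl t = K}) = card X"
    using sum.group[OF finX finite_imageI[OF finX] order_refl, of "\<lambda>_. 1::nat" cl] by simp
  finally show ?thesis by (simp add: X_def)
qed

section \<open>The genus expansion\<close>

text \<open>Blocks are nonempty and disjoint, so different groups of blocks have disjoint, hence
  different, unions.\<close>

lemma partition_on_coarsen:
  assumes A: "partition_on A P" and P: "partition_on P Q"
  shows "partition_on A (Union ` Q)" "inj_on Union Q"
proof -
  have meet: "F = F'" if F: "F \<in> Q" "F' \<in> Q" "z \<in> \<Union> F" "z \<in> \<Union> F'" for F F' z
  proof -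
    obtain c c' where c: "c \<in> F" "z \<in> c" "c' \<in> F'" "z \<in> c'" using F by blast
    then have "c \<in> P" "c' \<in> P" using F partition_onD1[OF P] by blast+
    then have "c = c'" using c partition_onD2[OF A] by (auto dest: disjointD)
    then show "F = F'" using c F partition_onD2[OF P] by (auto dest: disjointD)
  qed
  have ne: "\<Union> F \<noteq> {}" if F: "F \<in> Q" for F
  proof -
    have "F \<noteq> {}" using F partition_onD3[OF P] by blast
    then obtain c where "c \<in> F" by blast
    moreover from this have "c \<noteq> {}" using F partition_onD1[OF P] partition_onD3[OF A] by auto
    ultimately show ?thesis by blast
  qed
  show "partition_on A (Union ` Q)"
  proof (rule partition_onI)
    show "\<Union> (Union ` Q) = A" using partition_onD1[OF P] partition_onD1[OF A] by auto
    show "{} \<notin> Union ` Q" using ne by auto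
    show "disjnt p q" if pq: "p \<in> Union ` Q" "q \<in> Union ` Q" "p \<noteq> q" for p q
    proof (rule ccontr)
      assume n: "\<not> disjnt p q"
      obtain F F' where F: "F \<in> Q" "p = \<Union> F" "F' \<in> Q" "q = \<Union> F'" using pq by blast
      obtain z where "z \<in> p" "z \<in> q" using n by (auto simp: disjnt_def)
      then show False using meet[OF F(1,3), of z] F(2,4) pq(3) by blast
    qed
  qed
  show "inj_on Union Q"
  proof (rule inj_onI)
    fix F F' assume F: "F \<in> Q" "F' \<in> Q" "\<Union> F = \<Union> F'"
    obtain z where "z \<in> \<Union> F" using ne[OF F(1)] by blast
    then show "F = F'" using meet[OF F(1,2), of z] F(3) by simp
  qed
qed

text \<open>Start \<open>cycles_compose_involution\<close> from one block for each boundary and each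
  cell. Connectedness leaves at most one block at the end, so the inequality bounds the
  characteristic by 2 even before the genera of the cells are subtracted. Its parity statement gives
  evenness.\<close>

lemma genus_exists:
  fixes H :: "'h set"
  assumes H: "finite H" "finite B" and t: "t \<in> maps H L B w" and c: "conn H t"
  shows "\<exists>g. 2 - 2 * int g = labelled_euler H (card B) t w"
proof -
  obtain \<alpha> \<phi> r K where t': "t = (\<alpha>, \<phi>, r, K)" by (cases t)
  have p: "(\<phi>, r, K) \<in> premaps H L B w" and a: "\<alpha> \<in> pairings H" using t by (auto simp: maps_def t')
  have \<phi>: "\<phi> permutes H" and r: "inj_on (\<lambda>i. orbit \<phi> (the (r i))) B" "ran r \<subseteq> H" and inj: "inj_on snd K"
    and part: "partition_on (cycles_on H \<phi> - orbit \<phi> ` ran r) (snd ` K)" and w: "cells_weight K = w"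
    using p by (auto simp: premaps_def)
  have \<alpha>: "\<alpha> permutes H" using a by (auto simp: pairings_def)
  have \<alpha>\<alpha>: "\<alpha> (\<alpha> z) = z" for z by (rule permutes_inv_compose(3)[OF a \<phi>])
  define D where "D = orbit \<phi> ` ran r"
  \<comment> \<open>The faces grouped into blocks: each boundary cycle alone, each cell as it
    is.\<close>
  define Q where "Q = (\<lambda>c. {c}) ` D \<union> snd ` K"
  have D: "D \<subseteq> cycles_on H \<phi>" "finite D" "card D = card B"
  proof -
    show "D \<subseteq> cycles_on H \<phi>" using r(2) by (auto simp: D_def cycles_on_def)
    show "finite D" unfolding D_def using r(2) H(1) finite_subset by blast
    show "card D = card B" unfolding D_def finite_premap_boundary(3)[OF H p] using r(1) by (rule card_image)
  qed
  have finK: "finite K" by (rule premaps_finite_cells[OF H(1) p])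
  have finF: "finite (snd k)" if "k \<in> K" for k
    using premap_cell_subset(3)[OF H(1) p that] H(1) finite_subset by (fastforce simp: cycles_on_def)
  have Q: "partition_on (cycles_on H \<phi>) Q"
    using partition_on_Un[OF partition_on_singletons[of D] part] D(1) unfolding Q_def D_def by (simp add: Un_absorb1)
  have disjQ: "(\<lambda>c. {c}) ` D \<inter> snd ` K = {}"
  proof -
    have "c \<notin> F" if "c \<in> D" "F \<in> snd ` K" for c F
      using that part unfolding partition_on_def D_def by blast
    then show ?thesis by fastforce
  qed
  have cardQ: "card Q = card B + card K"
    unfolding Q_def using D finK inj disjQ by (subst card_Un_disjoint) (auto simp: card_image)
  have cyc: "int (card (cycles_on H \<phi>)) = int (card B) + (\<Sum>k\<in>K. int (card (snd k)))"
  proof -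
    have "card (cycles_on H \<phi>) = (\<Sum>F\<in>Q. card F)"
      by (rule product_partition[OF Q]) (use finF in \<open>auto simp: Q_def\<close>)
    also have "\<dots> = (\<Sum>F\<in>(\<lambda>c. {c}) ` D. card F) + (\<Sum>F\<in>snd ` K. card F)"
      unfolding Q_def using D(2) finK disjQ by (intro sum.union_disjoint) auto
    also have "(\<Sum>F\<in>(\<lambda>c. {c}) ` D. card F) = card B" using D(3) by (subst sum.reindex) auto
    also have "(\<Sum>F\<in>snd ` K. card F) = (\<Sum>k\<in>K. card (snd k))" using inj by (simp add: sum.reindex)
    finally show ?thesis by simp
  qed
  define P0 where "P0 = Union ` Q"
  note P0 = partition_on_coarsen[OF partition_on_cycles[OF \<phi> H(1)] Q, folded P0_def]
  have cardP0: "card P0 = card B + card K" unfolding P0_def using card_image[OF P0(2)] cardQ by simp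
  have P0\<phi>: "\<phi> z \<in> X" if X: "X \<in> P0" "z \<in> X" for X z
  proof -
    obtain F e where F: "F \<in> Q" "X = \<Union> F" "e \<in> F" "z \<in> e" using X unfolding P0_def by blast
    then have "e \<in> cycles_on H \<phi>" using partition_onD1[OF Q] by blast
    then have "e = orbit \<phi> z" using in_cycles_onD[OF \<phi> H(1)] F(4) by blast
    then have "\<phi> z \<in> e" using orbit.base by metis
    then show ?thesis using F by blast
  qed
  obtain P where P: "partition_on H P" "\<forall>X\<in>P0. \<exists>Y\<in>P. X \<subseteq> Y" "\<forall>X\<in>P. \<forall>z\<in>X. \<alpha> z \<in> X"
    and le: "card (cycles_on H (\<phi> \<circ> \<alpha>)) + 2 * card P0 \<le> card (cycles_on H \<phi>) + card {z. \<alpha> z \<noteq> z} div 2 + 2 * card P"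
    and ev: "even (card (cycles_on H (\<phi> \<circ> \<alpha>)) + card (cycles_on H \<phi>) + card {z. \<alpha> z \<noteq> z} div 2)"
  proof -
    have "\<exists>P. partition_on H P \<and> (\<forall>X\<in>P0. \<exists>Y\<in>P. X \<subseteq> Y) \<and> (\<forall>X\<in>P. \<forall>z\<in>X. \<alpha> z \<in> X) \<and>
      card (cycles_on H (\<phi> \<circ> \<alpha>)) + 2 * card P0 \<le> card (cycles_on H \<phi>) + card {z. \<alpha> z \<noteq> z} div 2 + 2 * card P \<and>
      even (card (cycles_on H (\<phi> \<circ> \<alpha>)) + card (cycles_on H \<phi>) + card {z. \<alpha> z \<noteq> z} div 2)"
      by (rule cycles_compose_involution[OF H(1) \<phi> P0(1) _ \<alpha> \<alpha>\<alpha>]) (rule P0\<phi>)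
    then show ?thesis using that by (elim exE conjE) simp
  qed
  have supp: "{z. \<alpha> z \<noteq> z} = H" using a \<alpha> by (auto simp: pairings_def permutes_def)
  have meet: "X = Y" if "X \<in> P" "Y \<in> P" "z \<in> X" "z \<in> Y" for X Y z
    using that partition_onD2[OF P(1)] by (auto dest: disjointD)
  have inside: "Y \<subseteq> X \<or> Y \<inter> X = {}" if XY: "X \<in> P" "Y \<in> P0" for X Y
  proof -
    obtain Z where Z: "Z \<in> P" "Y \<subseteq> Z" using P(2) XY(2) by blast
    show ?thesis
    proof (cases "Y \<inter> X = {}")
      case False
      then have "Z = X" using meet[OF Z(1) XY(1)] Z(2) by blast
      then show ?thesis using Z(2) by simp
    qed simp
  qed
  \<comment> \<open>A final block contains every initial block that it meets, so it is closed under
    \<open>\<phi>\<close> and compatible with all cells.\<close>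
  have "X = H" if X: "X \<in> P" for X
  proof -
    have XH: "X \<subseteq> H" "X \<noteq> {}" using X P(1) by (auto simp: partition_on_def)
    have "\<phi> z \<in> X" if z: "z \<in> X" for z
    proof -
      obtain Y where Y: "Y \<in> P0" "z \<in> Y" using z XH(1) partition_onD1[OF P0(1)] by blast
      then have "Y \<subseteq> X" using inside[OF X Y(1)] z by blast
      then show ?thesis using P0\<phi>[OF Y] by blast
    qed
    moreover have "\<Union> (snd k) \<subseteq> X \<or> \<Union> (snd k) \<inter> X = {}" if "k \<in> K" for k
      by (rule inside[OF X]) (use that in \<open>auto simp: P0_def Q_def\<close>)
    ultimately have "closed_under t X" using P(3) X by (simp add: closed_under_def t')
    then show ?thesis using c XH by (auto simp: conn_def)
  qed
  then have "P \<subseteq> {H}" by blast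
  then have "card P \<le> 1" using card_mono[of "{H}" P] by simp
  moreover have "weight_euler w = (\<Sum>k\<in>K. 2 - 2 * int (fst k) - int (card (snd k)))"
    unfolding w[symmetric] by (simp add: weight_euler_def cells_weight_def image_mset.compositionality comp_def sum_unfold_sum_mset case_prod_unfold)
  then have we: "weight_euler w = 2 * int (card K) - 2 * (\<Sum>k\<in>K. int (fst k)) - (\<Sum>k\<in>K. int (card (snd k)))"
    by (simp add: sum_subtractf sum_distrib_left)
  have eul: "labelled_euler H (card B) t w =
      int (card (cycles_on H (\<phi> \<circ> \<alpha>))) - int (card H div 2) + int (card B) + weight_euler w"
    by (simp add: labelled_euler_def t')
  have "(\<Sum>k\<in>K. int (fst k)) \<ge> 0" by (simp add: sum_nonneg)
  ultimately have "labelled_euler H (card B) t w \<le> 2"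
  proof -
    assume 1: "card P \<le> 1" and 2: "(\<Sum>k\<in>K. int (fst k)) \<ge> 0"
    have "int (card (cycles_on H (\<phi> \<circ> \<alpha>)) + 2 * card P0) \<le> int (card (cycles_on H \<phi>) + card {z. \<alpha> z \<noteq> z} div 2 + 2 * card P)"
      using le by (simp only: of_nat_le_iff)
    then have "int (card (cycles_on H (\<phi> \<circ> \<alpha>))) + 2 * (int (card B) + int (card K)) \<le>
      int (card (cycles_on H \<phi>)) + int (card H div 2) + 2 * int (card P)"
      unfolding cardP0 supp by (simp only: of_nat_add of_nat_mult of_nat_numeral)
    moreover have "v - h + b + (2 * k - 2 * s - c) \<le> 2"
      if "v + 2 * (b + k) \<le> b + c + h + 2 * p" "p \<le> 1" "s \<ge> 0" for v h b k s c p :: int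
      using that by presburger
    ultimately show ?thesis unfolding eul we using 1 2 unfolding cyc by simp
  qed
  \<comment> \<open>Up to an even number the characteristic is the number of vertices plus faces
    plus edges, which is even by \<open>ev\<close>.\<close>
  moreover have "even (labelled_euler H (card B) t w)"
  proof -
    have "labelled_euler H (card B) t w = int (card (cycles_on H (\<phi> \<circ> \<alpha>)) + card (cycles_on H \<phi>) + card H div 2)
        + 2 * (int (card K) + int (card B) - (\<Sum>k\<in>K. int (fst k)) - int (card (cycles_on H \<phi>)) - int (card H div 2))"
      unfolding eul we using cyc by (simp add: algebra_simps)
    then show ?thesis using ev unfolding supp by (simp only: even_add even_mult_iff even_of_nat) simp
  qed
  then obtain e where e: "labelled_euler H (card B) t w = 2 * e" by (rule evenE)
  ultimately have "2 - 2 * int (nat (1 - e)) = labelled_euler H (card B) t w" by simp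
  then show ?thesis by blast
qed

lemma powi_prod_mset:
  fixes x :: complex
  assumes "x \<noteq> 0"
  shows "(\<Prod>v\<in>#w. x powi (f v)) = x powi (\<Sum>v\<in>#w. f v)"
  by (induction w) (use assms in \<open>simp_all add: power_int_add\<close>)

text \<open>\<open>G\<close> stands for either generating series. Connected labelled maps are
  grouped by genus: each has exactly one, and it determines the power of \<open>N\<close>.\<close>

lemma conn_series_genus_expansion:
  assumes N: "N > 0" and G: "\<And>g w. coeff (G g) w = (if set_mset w \<subseteq> T
      then of_nat (card (connected_maps {..<map_size (\<lambda>i. Ls ! i) {..<length Ls} w} Ls w g))
        / fact (map_size (\<lambda>i. Ls ! i) {..<length Ls} w) else 0)"
  shows "has_formal_sum (\<lambda>g. mconst (of_nat N powi (2 - 2 * int g - int (length Ls) - int (sum_list Ls))) * G g)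
    (conn_series T N (\<lambda>i. Ls ! i) {..<length Ls}) UNIV"
proof -
  let ?L = "\<lambda>i. Ls ! i" and ?B = "{..<length Ls}"
  let ?p = "\<lambda>g. (of_nat N :: complex) powi (2 - 2 * int g - int (length Ls) - int (sum_list Ls))"
  let ?F = "\<lambda>g. mconst (?p g) * G g"
  have main: "finite {g. coeff (?F g) w \<noteq> 0} \<and>
    (\<Sum>g | g \<in> UNIV \<and> coeff (?F g) w \<noteq> 0. coeff (?F g) w) = coeff (conn_series T N ?L ?B) w" for w
  proof (cases "set_mset w \<subseteq> T")
    case False
    then show ?thesis by (simp add: G conn_series_def)
  next
    case True
    define d where "d = map_size ?L ?B w"
    define H where "H = {..<d}"
    define C where "C = {t \<in> maps H ?L ?B w. conn H t}"
    have finC: "finite C" unfolding C_def using finite_maps[of H ?B] by (simp add: H_def)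
    define gen where "gen = (\<lambda>t. SOME g. 2 - 2 * int g = labelled_euler H (length Ls) t w)"
    have gen: "2 - 2 * int (gen t) = labelled_euler H (length Ls) t w" if "t \<in> C" for t
      using someI_ex[OF genus_exists[of H ?B t ?L w]] that unfolding gen_def C_def by (simp add: H_def)
    have cm: "connected_maps H Ls w g = {t \<in> C. gen t = g}" for g
    proof -
      have "2 - 2 * int g = labelled_euler H (length Ls) t w \<longleftrightarrow> gen t = g" if "t \<in> C" for t
        using gen[OF that] by auto
      then show ?thesis unfolding connected_maps_def C_def by blast
    qed
    have cF: "coeff (?F g) w = of_nat (card {t \<in> C. gen t = g}) * ?p g / fact d" for g
      using True by (simp add: G cm[symmetric] H_def d_def)
    \<comment> \<open>A monomial determines the number of half-edges, so finitely many connected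
      maps, hence finitely many genera, contribute to its coefficient.\<close>
    have sub: "{g. coeff (?F g) w \<noteq> 0} \<subseteq> gen ` C"
    proof
      fix g assume "g \<in> {g. coeff (?F g) w \<noteq> 0}"
      then have "{t \<in> C. gen t = g} \<noteq> {}" unfolding cF by (intro notI) simp
      then show "g \<in> gen ` C" by blast
    qed
    have summand: "(\<Prod>v\<in>#w. cell_factor N v) * index_factor N H ?L ?B (fst t) (fst (snd t)) = ?p (gen t)" if t: "t \<in> C" for t
    proof -
      have N': "(of_nat N :: complex) \<noteq> 0" using N by simp
      have "(\<Prod>v\<in>#w. cell_factor N v) = of_nat N powi (weight_euler w)"
        unfolding cell_factor_def weight_euler_def by (rule powi_prod_mset[OF N'])
      moreover have "(\<Sum>i<length Ls. Ls ! i) = sum_list Ls" by (simp add: sum_list_sum_nth atLeast0LessThan)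
      ultimately have "(\<Prod>v\<in>#w. cell_factor N v) * index_factor N H ?L ?B (fst t) (fst (snd t))
        = of_nat N powi (weight_euler w + (int (card (cycles_on H (fst (snd t) \<circ> fst t))) - int (card H div 2) - int (sum_list Ls)))"
        unfolding index_factor_def using N' by (simp add: power_int_add)
      \<comment> \<open>Euler's relation: \<open>weight_euler w\<close> plus vertices minus edges
        equals 2 - 2g - n.\<close>
      also have "weight_euler w + (int (card (cycles_on H (fst (snd t) \<circ> fst t))) - int (card H div 2) - int (sum_list Ls))
        = 2 - 2 * int (gen t) - int (length Ls) - int (sum_list Ls)"
        using gen[OF t] unfolding labelled_euler_def by simp
      finally show ?thesis .
    qed
    have "coeff (conn_series T N ?L ?B) w = (\<Sum>t\<in>C. ?p (gen t)) / fact d"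
      using True summand by (simp add: conn_series_def conn_sum_def C_def[symmetric] H_def[symmetric] d_def[symmetric])
    also have "(\<Sum>t\<in>C. ?p (gen t)) = (\<Sum>g\<in>gen ` C. \<Sum>t\<in>{t \<in> C. gen t = g}. ?p (gen t))"
      by (rule sum.group[OF finC finite_imageI[OF finC] order_refl, symmetric])
    also have "\<dots> = (\<Sum>g\<in>gen ` C. of_nat (card {t \<in> C. gen t = g}) * ?p g)"
      by (intro sum.cong refl) simp
    also have "\<dots> / fact d = (\<Sum>g\<in>gen ` C. coeff (?F g) w)" by (simp only: cF sum_divide_distrib)
    also have "\<dots> = (\<Sum>g | g \<in> UNIV \<and> coeff (?F g) w \<noteq> 0. coeff (?F g) w)"
      using sub finC by (intro sum.mono_neutral_right) auto
    finally show ?thesis using finite_subset[OF sub finite_imageI[OF finC]] by simp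
  qed
  then show ?thesis
    unfolding has_formal_sum_def formally_summable_def formal_sum_def
    by (intro conjI allI mseries_eqI) (simp_all del: coeff_mconst_mult)
qed

section \<open>Usual maps as a selection of monomials\<close>

lemma finite_cells:
  assumes "is_stuffed_map S"
  shows "finite (cells S)" "f \<in> cells S \<Longrightarrow> finite f"
proof -
  have part: "partition_on (cycles_on (half_edges S) (face_perm S) - set (boundaries S)) (cells S)"
    using assms by (simp add: is_stuffed_map_def)
  have fin: "finite (cycles_on (half_edges S) (face_perm S) - set (boundaries S))"
    using stuffed_map_perms(1)[OF assms] by (simp add: cycles_on_def)
  show "finite (cells S)" by (rule finite_elements[OF fin part])
  show "finite f" if "f \<in> cells S"
    using that partition_onD1[OF part] finite_subset[OF _ fin, of f] by blast
qed

lemma map_monomial_stuffed: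
  assumes "is_stuffed_map S"
  shows "set_mset (map_monomial S) \<subseteq> stuffed_weights"
proof
  fix v assume "v \<in># map_monomial S"
  note p = stuffed_map_perms[OF assms]
  have part: "partition_on (cycles_on (half_edges S) (face_perm S) - set (boundaries S)) (cells S)"
    using assms by (simp add: is_stuffed_map_def)
  obtain f where f: "f \<in> cells S" "v = (cell_genus S f, image_mset card (mset_set f))"
    using \<open>v \<in># map_monomial S\<close> finite_cells(1)[OF assms] by (auto simp: map_monomial_def)
  have fc: "f \<subseteq> cycles_on (half_edges S) (face_perm S)" "f \<noteq> {}" using f(1) part unfolding partition_on_def by blast+
  have fin: "finite f" by (rule finite_cells(2)[OF assms f(1)])
  have "card c \<ge> 1" if "c \<in> f" for c
  proof -
    have "c \<noteq> {}" "c \<subseteq> half_edges S"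
      using that fc(1) partition_on_cycles[OF p(3,1)] unfolding partition_on_def by blast+
    then show ?thesis using finite_subset[OF _ p(1)] by (simp add: Suc_le_eq card_gt_0_iff)
  qed
  then show "v \<in> stuffed_weights" using f(2) fc(2) fin by (auto simp: stuffed_weights_def mset_set_empty_iff)
qed

text \<open>The genus and the number of cycles of a cell are visible in the monomial. So the usual
  series is the stuffed one with all coefficients outside the usual weights set to zero.\<close>

lemma is_usual_map_iff: "is_usual_map S \<longleftrightarrow> is_stuffed_map S \<and> set_mset (map_monomial S) \<subseteq> usual_weights"
proof (cases "is_stuffed_map S")
  case True
  note finC = finite_cells(1)[OF True]
  have "(cell_genus S f = 0 \<and> card f = 1) \<longleftrightarrow> (cell_genus S f, image_mset card (mset_set f)) \<in> usual_weights"
    if f: "f \<in> cells S" for f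
  proof
    assume "(cell_genus S f, image_mset card (mset_set f)) \<in> usual_weights"
    then obtain m where m: "cell_genus S f = 0" "image_mset card (mset_set f) = {#m#}" by (auto simp: usual_weights_def)
    then have "size (mset_set f) = 1" by (metis size_image_mset size_single)
    then show "cell_genus S f = 0 \<and> card f = 1" using m(1) by simp
  next
    assume a: "cell_genus S f = 0 \<and> card f = 1"
    then obtain c where c: "f = {c}" by (metis card_1_singletonE)
    have "(cell_genus S f, image_mset card (mset_set f)) \<in> set_mset (map_monomial S)"
      using f finC by (auto simp: map_monomial_def)
    then have "(cell_genus S f, image_mset card (mset_set f)) \<in> stuffed_weights" using map_monomial_stuffed[OF True] by blast
    then show "(cell_genus S f, image_mset card (mset_set f)) \<in> usual_weights"
      using a by (auto simp: stuffed_weights_def usual_weights_def c)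
  qed
  moreover have "set_mset (map_monomial S) = (\<lambda>f. (cell_genus S f, image_mset card (mset_set f))) ` cells S"
    using finC by (simp add: map_monomial_def)
  ultimately show ?thesis using True by (auto simp: is_usual_map_def)
qed (simp add: is_usual_map_def)

lemma coeff_stuffed_series_eq_0:
  assumes "\<not> set_mset w \<subseteq> stuffed_weights"
  shows "coeff (stuffed_series g Ls) w = 0"
proof -
  have empty: "{S \<in> fully_simple_maps g Ls. map_monomial S = w} = {}"
    using assms map_monomial_stuffed unfolding fully_simple_maps_def by blast
  show ?thesis
    unfolding stuffed_series_def generating_series_def coeff_MSeries by (simp only: empty quotient_empty sum.empty)
qed

lemma coeff_usual_series:
  "coeff (usual_series g Ls) w = (if set_mset w \<subseteq> usual_weights then coeff (stuffed_series g Ls) w else 0)"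
proof -
  have split: "{S \<in> {S \<in> fully_simple_maps g Ls. is_usual_map S}. map_monomial S = w} =
    (if set_mset w \<subseteq> usual_weights then {S \<in> fully_simple_maps g Ls. map_monomial S = w} else {})"
    unfolding is_usual_map_iff fully_simple_maps_def by auto
  show ?thesis
    unfolding usual_series_def stuffed_series_def generating_series_def coeff_MSeries split
    by (cases "set_mset w \<subseteq> usual_weights") (simp_all only: if_True if_False quotient_empty sum.empty)
qed

theorem proposition9p3:
  fixes N :: nat and \<gamma>s :: "nat list list"
  defines "n \<equiv> length \<gamma>s"
    and "Ls \<equiv> map length \<gamma>s"
    and "L \<equiv> sum_list (map length \<gamma>s)"
  assumes "n \<ge> 1"
    and "\<And>\<gamma>. \<gamma> \<in> set \<gamma>s \<Longrightarrow> cycle \<gamma> \<and> length \<gamma> \<ge> 1 \<and> set \<gamma> \<subseteq> {..<N}"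
    and "\<And>i j. i < n \<Longrightarrow> j < n \<Longrightarrow> i \<noteq> j \<Longrightarrow> set (\<gamma>s ! i) \<inter> set (\<gamma>s ! j) = {}"
  shows
    "has_formal_sum
       (\<lambda>g. mconst (of_nat N powi (2 - 2 * int g - int n - int L)) * usual_series g Ls)
       (joint_cumulant (formal_expectation usual_weights N) (map cycle_product \<gamma>s)) UNIV \<and>
     has_formal_sum
       (\<lambda>g. mconst (of_nat N powi (2 - 2 * int g - int n - int L)) * stuffed_series g Ls)
       (joint_cumulant (formal_expectation stuffed_weights N) (map cycle_product \<gamma>s)) UNIV"
proof -
  have ne: "\<gamma>s \<noteq> []" using assms(4) by (auto simp: n_def)
  then have Ls: "Ls \<noteq> []" by (simp add: Ls_def)
  \<comment> \<open>Read off from the first cycle, which is nonempty and has its support in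
    \<open>{..<N}\<close>.\<close>
  have N: "N > 0"
  proof -
    have "length (hd \<gamma>s) \<ge> 1" "set (hd \<gamma>s) \<subseteq> {..<N}" using assms(5)[of "hd \<gamma>s"] ne by auto
    then show ?thesis by (cases "hd \<gamma>s") auto
  qed
  have n: "n = length Ls" and L: "L = sum_list Ls" by (simp_all add: n_def Ls_def L_def)
  have usub: "usual_weights \<subseteq> stuffed_weights" by (auto simp: usual_weights_def stuffed_weights_def)
  have cumulant: "joint_cumulant (formal_expectation T N) (map cycle_product \<gamma>s) = conn_series T N (\<lambda>i. Ls ! i) {..<length Ls}"
    if "T \<subseteq> stuffed_weights" for T
  proof -
    have "joint_cumulant (formal_expectation T N) (map cycle_product \<gamma>s) = conn_series T N (\<lambda>i. Ls ! i) {..<length \<gamma>s}"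
      by (rule joint_cumulant_eq_conn_series[OF N _ assms(5) _ that ne]) (use assms(6) in \<open>simp_all add: Ls_def n_def\<close>)
    then show ?thesis by (simp add: Ls_def)
  qed
  show ?thesis
    unfolding cumulant[OF usub] cumulant[OF order_refl] n L
  proof (intro conjI conn_series_genus_expansion[OF N])
    fix g w
    show "coeff (stuffed_series g Ls) w = (if set_mset w \<subseteq> stuffed_weights
      then of_nat (card (connected_maps {..<map_size (\<lambda>i. Ls ! i) {..<length Ls} w} Ls w g))
        / fact (map_size (\<lambda>i. Ls ! i) {..<length Ls} w) else 0)"
      using coeff_stuffed_series[OF Ls, of g w] coeff_stuffed_series_eq_0[of w g Ls]
      by (cases "set_mset w \<subseteq> stuffed_weights") simp_all
    show "coeff (usual_series g Ls) w = (if set_mset w \<subseteq> usual_weights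
      then of_nat (card (connected_maps {..<map_size (\<lambda>i. Ls ! i) {..<length Ls} w} Ls w g))
        / fact (map_size (\<lambda>i. Ls ! i) {..<length Ls} w) else 0)"
      unfolding coeff_usual_series using coeff_stuffed_series[OF Ls] by simp
  qed
qed

end
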